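(* Let $n\ge 2$, $s>0$, let $A\in\mathbb{R}^{n\times n}$ be a symmetric positive definite matrix, and let $$E:=\{x\in\mathbb{R}^n : Ax\cdot x<1\}.$$ Then there is a constant $\kappa=\kappa(n,s,A)>0$ such that the function $u_s:\mathbb{R}^n\to\mathbb{R}$ given by $u_s(x):=(1-Ax\cdot x)^s_+$ satisfies pointwise $$(-\Delta)^s u_s=\kappa\quad\text{in }E,$$ and $u_s$ is the unique weak solution of this equation in $\mathcal{H}^s_0(E)$.
   Context: $f_+$ denotes the positive part of $f$. Here $\mathbb{N}=\{1,2,\dots\}$. Function space: $\mathcal{H}^s_0(\Omega):=\{u\in H^s(\mathbb{R}^n): u=0\text{ in }\mathbb{R}^n\setminus\Omega\}$, where $H^s(\mathbb{R}^n)$ is the usual (fractional) Sobolev space of order $s$. A weak solution of $(-\Delta)^su=f$ in $\mathcal{H}^s_0(\Omega)$ is a $u\in\mathcal{H}^s_0(\Omega)$ with $\int_{\mathbb{R}^n}|\xi|^{2s}\,\widehat u(\xi)\,\overline{\widehat\varphi(\xi)}\,d\xi=\int_\Omega f\varphi\,dx$ for all $\varphi\in\mathcal{H}^s_0(\Omega)$ (with $\widehat{\cdot}$ the unitary Fourier transform). Pointwise fractional Laplacian: for $s>0$, $$(-\Delta)^s u(x)=\frac{c_{n,m,s}}{2}\int_{\mathbb{R}^n}\frac{\delta_m u(x,y)}{|y|^{n+2s}}\,dy,\qquad \delta_m u(x,y):=\sum_{k=-m}^m(-1)^k\binom{2m}{m-k}u(x+ky),$$ where $m\in\mathbb{N}$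 is any integer with $m>s$ (the value does not depend on this choice), and $c_{n,m,s}$ is the positive constant $$c_{n,m,s}=\begin{cases}\dfrac{4^{s}\Gamma(\frac n2+s)}{\pi^{n/2}\Gamma(-s)}\Big(\sum_{k=1}^{m}(-1)^{k}\binom{2m}{m-k}k^{2s}\Big)^{-1}, & s\in(0,m)\setminus\mathbb{N},\\[2mm] \dfrac{4^{s}\Gamma(\frac n2+s)\,s!}{2\pi^{n/2}}\Big(\sum_{k=2}^m(-1)^{k-s+1}\binom{2m}{m-k}k^{2s}\ln k\Big)^{-1}, & s\in\{1,\dots,m-1\}.\end{cases}$$ *)

theory Defs
  imports "HOL-Analysis.Analysis"
begin

subsection \<open>Sobolev spaces and weak solutions\<close>

definition L2 :: "('a::euclidean_space \<Rightarrow> 'b::{banach, second_countable_topology}) set" where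
  "L2 = {f \<in> borel_measurable lebesgue. integrable lebesgue (\<lambda>x. (norm (f x))\<^sup>2)}"

text \<open>
  The Fourier transform on \<open>L\<^sup>2\<close> is the \<open>L\<^sup>2\<close>-limit, as \<open>R \<rightarrow> \<infinity>\<close>, of the Fourier integrals over
  the balls of radius \<open>R\<close>.  The normalisation is the unitary one for which \<open>-\<Delta>\<close> has
  symbol \<open>|\<xi>|\<^sup>2\<close>.
\<close>

definition fourier_ball :: "real \<Rightarrow> ('a::euclidean_space \<Rightarrow> real) \<Rightarrow> 'a \<Rightarrow> complex" where
  "fourier_ball R u \<xi> =
     of_real ((2 * pi) powr (- real DIM('a) / 2)) *
     (LINT x:ball 0 R|lebesgue. exp (- \<i> * of_real (x \<bullet> \<xi>)) * of_real (u x))"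

definition is_fourier_L2 :: "('a::euclidean_space \<Rightarrow> real) \<Rightarrow> ('a \<Rightarrow> complex) \<Rightarrow> bool" where
  "is_fourier_L2 u g \<longleftrightarrow> g \<in> L2 \<and>
     ((\<lambda>R. \<integral>\<^sup>+ \<xi>. ennreal ((norm (fourier_ball R u \<xi> - g \<xi>))\<^sup>2) \<partial>lebesgue) \<longlongrightarrow> 0) at_top"

text \<open>
  For \<open>u \<in> L2\<close> the limit exists by Plancherel's theorem and is unique up to null sets; the
  choice of representative is immaterial, as it is only used under integrals.
\<close>

definition fourier_L2 :: "('a::euclidean_space \<Rightarrow> real) \<Rightarrow> 'a \<Rightarrow> complex" where
  "fourier_L2 u = (SOME g. is_fourier_L2 u g)"

definition sobolev :: "real \<Rightarrow> ('a::euclidean_space \<Rightarrow> real) set" where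
  "sobolev s = {u \<in> L2.
     integrable lebesgue (\<lambda>\<xi>. (1 + (norm \<xi>)\<^sup>2) powr s * (norm (fourier_L2 u \<xi>))\<^sup>2)}"

text \<open>
  Elements of Sobolev spaces are represented by functions rather than by classes modulo
  null sets, hence the exterior condition is required almost everywhere only.
\<close>

definition sobolev0 :: "real \<Rightarrow> 'a::euclidean_space set \<Rightarrow> ('a \<Rightarrow> real) set" where
  "sobolev0 s \<Omega> = {u \<in> sobolev s. AE x in lebesgue. x \<notin> \<Omega> \<longrightarrow> u x = 0}"

definition weak_solution ::
  "real \<Rightarrow> 'a::euclidean_space set \<Rightarrow> ('a \<Rightarrow> real) \<Rightarrow> ('a \<Rightarrow> real) \<Rightarrow> bool" where
  "weak_solution s \<Omega> f u \<longleftrightarrow> u \<in> sobolev0 s \<Omega> \<and>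
     (\<forall>\<phi> \<in> sobolev0 s \<Omega>.
        set_integrable lebesgue \<Omega> (\<lambda>x. f x * \<phi> x) \<and>
        has_bochner_integral lebesgue
          (\<lambda>\<xi>. of_real (norm \<xi> powr (2 * s)) * fourier_L2 u \<xi> * cnj (fourier_L2 \<phi> \<xi>))
          (complex_of_real (LINT x:\<Omega>|lebesgue. f x * \<phi> x)))"

subsection \<open>The pointwise fractional Laplacian\<close>

definition central_diff :: "nat \<Rightarrow> ('a::real_vector \<Rightarrow> real) \<Rightarrow> 'a \<Rightarrow> 'a \<Rightarrow> real" where
  "central_diff m u x y =
     (\<Sum>k\<in>{- int m..int m}. (-1) powi k * real ((2 * m) choose nat (int m - k)) *
        u (x + of_int k *\<^sub>R y))"

definition frac_const :: "nat \<Rightarrow> nat \<Rightarrow> real \<Rightarrow> real" where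
  "frac_const n m s =
     (if s \<notin> \<nat> then
        4 powr s * Gamma (real n / 2 + s) / (pi powr (real n / 2) * Gamma (- s)) *
        inverse (\<Sum>k=1..m. (-1) ^ k * real ((2 * m) choose (m - k)) * real k powr (2 * s))
      else
        4 powr s * Gamma (real n / 2 + s) * fact (nat \<lfloor>s\<rfloor>) / (2 * pi powr (real n / 2)) *
        inverse (\<Sum>k=2..m. (-1) powi (int k - \<lfloor>s\<rfloor> + 1) * real ((2 * m) choose (m - k)) *
                   real k powr (2 * s) * ln (real k)))"

definition frac_laplacian_integrand ::
  "nat \<Rightarrow> real \<Rightarrow> ('a::euclidean_space \<Rightarrow> real) \<Rightarrow> 'a \<Rightarrow> 'a \<Rightarrow> real" where
  "frac_laplacian_integrand m s u x y =
     central_diff m u x y / norm y powr (real DIM('a) + 2 * s)"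

definition frac_laplacian ::
  "nat \<Rightarrow> real \<Rightarrow> ('a::euclidean_space \<Rightarrow> real) \<Rightarrow> 'a \<Rightarrow> real" where
  "frac_laplacian m s u x =
     frac_const DIM('a) m s / 2 * (LINT y|lebesgue. frac_laplacian_integrand m s u x y)"

text \<open>
  \<open>(-\<Delta>)\<^sup>s u(x)\<close> exists and equals \<open>L\<close>: the integral converges absolutely and gives \<open>L\<close> for
  every admissible order \<open>m > s\<close> of the difference.
\<close>

definition has_frac_laplacian ::
  "real \<Rightarrow> ('a::euclidean_space \<Rightarrow> real) \<Rightarrow> 'a \<Rightarrow> real \<Rightarrow> bool" where
  "has_frac_laplacian s u x L \<longleftrightarrow>
     (\<forall>m. real m > s \<longrightarrow>
        integrable lebesgue (frac_laplacian_integrand m s u x) \<and> frac_laplacian m s u x = L)"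

subsection \<open>Ellipsoids\<close>

definition symmetric_posdef :: "real^'n^'n \<Rightarrow> bool" where
  "symmetric_posdef A \<longleftrightarrow> transpose A = A \<and> (\<forall>x. x \<noteq> 0 \<longrightarrow> (A *v x) \<bullet> x > 0)"

definition ellipsoid :: "real^'n^'n \<Rightarrow> (real^'n) set" where
  "ellipsoid A = {x. (A *v x) \<bullet> x < 1}"

definition ellipsoid_fun :: "real \<Rightarrow> real^'n^'n \<Rightarrow> real^'n \<Rightarrow> real" where
  "ellipsoid_fun s A x = (max 0 (1 - (A *v x) \<bullet> x)) powr s"

end

theory Submission imports Defs "HOL-Probability.Probability" begin

text \<open>
  Write \<open>Q x = A x \<bullet> x\<close> and \<open>u = (1 - Q)\<^sup>s\<^sub>+\<close>. The proof rests on the fact that the difference integral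
  \<open>L x = \<integral> \<delta>\<^sub>m u (x, y) / \<bar>y\<bar> powr (n + 2 s) dy\<close> is constant in the ellipsoid. Everything else is Fourier analysis.

  Dimension one. For \<open>u = (1 - t\<^sup>2)\<^sup>s\<^sub>+\<close> the operator with multiplier \<open>\<bar>\<xi>\<bar> powr (2 s) * exp (- \<epsilon> \<bar>\<xi>\<bar>)\<close> maps \<open>u\<close> to a
  multiple of the real part of \<open>G (x + \<i> \<epsilon>)\<close>, where \<open>G z = \<integral> (1 - t\<^sup>2)\<^sup>s (- \<i> (z - t)) powr (- 2 s - 1) dt\<close> over \<open>(-1, 1)\<close>.
  The derivative of \<open>G\<close> solves a linear equation of first order and is therefore \<open>\<i> (2 s + 1) B (1 - z\<^sup>2) powr (- s - 1)\<close> with a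
  real constant \<open>B\<close> (\<open>half_plane_integral_closed_form\<close>). On the interval this is purely imaginary, so the real part of \<open>G\<close> becomes
  constant as \<open>\<epsilon> \<rightarrow> 0\<close>. Pairing with translated bumps and letting \<open>\<epsilon> \<rightarrow> 0\<close> shows that \<open>L\<close> has equal averages over
  them, and since \<open>L\<close> is continuous it is constant (\<open>difference_integral_unit_constant\<close>).

  Higher dimension. In polar coordinates around a point \<open>x\<close> of the ellipsoid, \<open>L x\<close> is an integral over directions \<open>z\<close> of difference
  integrals along the lines \<open>x + t z\<close>. On such a line \<open>1 - Q\<close> is a quadratic polynomial, so \<open>u\<close> is a scaled copy of
  the one-dimensional profile (\<open>profile_on_line\<close>), and its contribution scales by \<open>Q z powr s\<close>, whatever \<open>x\<close> is
  (\<open>difference_integral_power_profile\<close>).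

  Weak equation. The difference acts on the Fourier side as multiplication by \<open>(2 - 2 cos (\<xi> \<bullet> y)) ^ m\<close>, whose
  integral against the kernel is \<open>2 / c * \<bar>\<xi>\<bar> powr (2 s)\<close> with \<open>c\<close> the constant \<open>frac_const\<close> (\<open>fractional_symbol\<close>). Hence the profile has
  finite energy (\<open>power_profile_energy\<close>), and its energy pairing with a test function supported inside the ellipsoid is
  the integral of the test function times \<open>c / 2 * L\<close> (\<open>energy_pairing\<close>). All other test functions are reached by dilation
  (\<open>weak_equation\<close>).

  Conclusion. Testing with \<open>u\<close> itself shows that the constant is \<open>\<kappa> = energy / \<integral> u\<close>, which is positive and does not depend on \<open>m\<close>. Testing with the
  difference of two weak solutions shows that its energy is zero, and injectivity of the Fourier transform gives uniqueness.
\<close>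

section \<open>Moments and Fourier symbol of the difference coefficients\<close>

text \<open>
  The coefficients of the central difference, so that sums over them can be manipulated without
  carrying the binomial expression along.
\<close>

definition dcoef :: "nat \<Rightarrow> int \<Rightarrow> real" where
  "dcoef m k = (-1) powi k * real ((2 * m) choose nat (int m - k))"

lemma central_diff_eq: "central_diff m u x y = (\<Sum>k\<in>{- int m..int m}. dcoef m k * u (x + of_int k *\<^sub>R y))"
  by (simp add: central_diff_def dcoef_def)

text \<open>
  An \<open>n\<close>-th difference kills polynomials of degree less than \<open>n\<close>; the shift \<open>c\<close> serves to
  move the window to \<open>{-m..m}\<close>.
\<close>

lemma alternating_binomial_moment:
  fixes c :: real
  assumes "j < n"
  shows "(\<Sum>i\<le>n. (-1) ^ i * real (n choose i) * (real i + c) ^ j) = 0"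
  using assms
proof (induction n arbitrary: c j)
  case 0
  then show ?case by simp
next
  case (Suc n)
  define T where "T = (\<lambda>n f. \<Sum>i\<le>n. (-1) ^ i * real (n choose i) * f i)"
  have rec: "T (Suc n) f = T n f - T n (\<lambda>i. f (Suc i))" for f :: "nat \<Rightarrow> real"
  proof -
    have "T (Suc n) f = f 0 + (\<Sum>i\<le>n. (-1) ^ Suc i * real (Suc n choose Suc i) * f (Suc i))"
      unfolding T_def by (subst sum.atMost_Suc_shift) simp
    also have "\<dots> = f 0 + (\<Sum>i\<le>n. (-1) ^ Suc i * real (n choose Suc i) * f (Suc i)) - T n (\<lambda>i. f (Suc i))"
      by (simp add: T_def algebra_simps sum.distrib sum_negf sum_subtractf)
    also have "f 0 + (\<Sum>i\<le>n. (-1) ^ Suc i * real (n choose Suc i) * f (Suc i)) = (\<Sum>i\<le>Suc n. (-1) ^ i * real (n choose i) * f i)"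
      by (subst sum.atMost_Suc_shift) simp
    also have "\<dots> = T n f" by (simp add: T_def)
    finally show ?thesis .
  qed
  have diff: "(real (Suc i) + c) ^ j - (real i + c) ^ j = (\<Sum>l<j. real (j choose l) * (real i + c) ^ l)" for i
  proof -
    have "(real (Suc i) + c) ^ j = ((real i + c) + 1) ^ j" by (simp add: algebra_simps)
    also have "\<dots> = (\<Sum>l\<le>j. real (j choose l) * (real i + c) ^ l)"
      by (subst binomial_ring) simp
    also have "\<dots> = (\<Sum>l<j. real (j choose l) * (real i + c) ^ l) + (real i + c) ^ j"
      by (simp add: lessThan_Suc_atMost[symmetric])
    finally show ?thesis by simp
  qed
  have "T (Suc n) (\<lambda>i. (real i + c) ^ j) = - (T n (\<lambda>i. (real (Suc i) + c) ^ j - (real i + c) ^ j))"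
    by (subst rec) (simp add: T_def sum_subtractf algebra_simps)
  also have "T n (\<lambda>i. (real (Suc i) + c) ^ j - (real i + c) ^ j)
     = (\<Sum>l<j. real (j choose l) * T n (\<lambda>i. (real i + c) ^ l))"
    unfolding diff T_def sum_distrib_left by (subst sum.swap) (simp add: mult_ac)
  also have "\<dots> = 0"
    using Suc by (intro sum.neutral) (auto simp: T_def)
  finally show ?case by (simp add: T_def)
qed

lemma sum_dcoef_reindex:
  fixes f :: "int \<Rightarrow> 'b::real_vector"
  shows "(\<Sum>k\<in>{- int m..int m}. dcoef m k *\<^sub>R f k)
     = (\<Sum>i\<le>2*m. ((-1) ^ (m + i) * real ((2*m) choose i)) *\<^sub>R f (int i - int m))"
proof (rule sum.reindex_bij_witness[of _ "\<lambda>i. int i - int m" "\<lambda>k. nat (k + int m)"])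
  fix k assume k: "k \<in> {- int m..int m}"
  define i where "i = nat (k + int m)"
  have ki: "k = int i - int m" "i \<le> 2 * m" using k by (auto simp: i_def)
  have "(-1::real) powi k = (-1) ^ (m + i)"
    unfolding ki(1) by (simp add: power_int_diff power_add power_int_minus_one_minus field_simps)
  moreover have "(2 * m) choose nat (int m - k) = (2*m) choose i"
  proof -
    have "nat (int m - k) = 2 * m - i" using ki by auto
    then show ?thesis using ki(2) binomial_symmetric by metis
  qed
  ultimately show "((-1) ^ (m + nat (k + int m)) * real ((2*m) choose nat (k + int m))) *\<^sub>R f (int (nat (k + int m)) - int m) = dcoef m k *\<^sub>R f k"
    using k ki(1) by (simp add: dcoef_def flip: i_def)
qed auto

lemma dcoef_moment:
  assumes "j < 2 * m"
  shows "(\<Sum>k\<in>{- int m..int m}. dcoef m k * (of_int k) ^ j) = 0"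
proof -
  have "(\<Sum>k\<in>{- int m..int m}. dcoef m k * (of_int k) ^ j)
     = (\<Sum>i\<le>2*m. ((-1) ^ (m + i) * real ((2*m) choose i)) * (of_int (int i - int m)) ^ j)"
    using sum_dcoef_reindex[of m "\<lambda>k. of_int k ^ j :: real"] by simp
  also have "\<dots> = (-1) ^ m * (\<Sum>i\<le>2*m. (-1) ^ i * real ((2*m) choose i) * (real i + (- real m)) ^ j)"
    by (simp add: sum_distrib_left power_add mult_ac)
  finally show ?thesis using alternating_binomial_moment[OF assms, of "- real m"] by simp
qed

text \<open>
  The binomial theorem for \<open>(1 - exp (\<i> t)) ^ (2 m)\<close>: this is the Fourier symbol of the difference.
\<close>

lemma dcoef_fourier:
  "(\<Sum>k\<in>{- int m..int m}. of_real (dcoef m k) * exp (\<i> * of_real (of_int k * t))) = of_real ((2 - 2 * cos t) ^ m)"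
proof -
  define w where "w = exp (\<i> * of_real t)"
  have w0: "w \<noteq> 0" by (simp add: w_def)
  have "(\<Sum>k\<in>{- int m..int m}. of_real (dcoef m k) * exp (\<i> * of_real (of_int k * t)))
     = (\<Sum>i\<le>2*m. of_real ((-1) ^ (m + i) * real ((2*m) choose i)) * exp (\<i> * of_real (of_int (int i - int m) * t)))"
    using sum_dcoef_reindex[of m "\<lambda>k. exp (\<i> * of_real (of_int k * t))"] by (simp add: scaleR_conv_of_real)
  also have "\<dots> = (\<Sum>i\<le>2*m. (-1)^m / w ^ m * (of_nat ((2*m) choose i) * (-w) ^ i))"
  proof (rule sum.cong[OF refl])
    fix i
    have "exp (\<i> * of_real (of_int (int i - int m) * t)) = w ^ i / w ^ m"
      by (simp add: w_def exp_diff[symmetric] exp_of_nat_mult[symmetric] algebra_simps)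
    then show "of_real ((-1) ^ (m + i) * real ((2*m) choose i)) * exp (\<i> * of_real (of_int (int i - int m) * t))
      = (-1)^m / w ^ m * (of_nat ((2*m) choose i) * (-w) ^ i)"
      by (simp add: power_add power_minus[of w])
  qed
  also have "\<dots> = (-1)^m / w ^ m * (1 - w) ^ (2 * m)"
    using binomial_ring[of "-w" 1 "2*m"] by (simp add: sum_distrib_left)
  also have "\<dots> = (- ((1 - w)\<^sup>2 / w)) ^ m"
    by (simp add: power_mult power_divide power_minus[of "_ / _"])
  also have "- ((1 - w)\<^sup>2 / w) = 2 - (w + 1 / w)"
    using w0 by (simp add: field_simps power2_eq_square)
  also have "1 / w = exp (- (\<i> * of_real t))" by (simp add: w_def exp_minus inverse_eq_divide)
  also have "w + exp (- (\<i> * of_real t)) = 2 * of_real (cos t)"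
    by (simp add: w_def cos_of_real[symmetric] cos_exp_eq)
  finally show ?thesis by simp
qed

lemma one_minus_powr_taylor:
  fixes s :: real
  assumes "N > 0"
  shows "\<exists>c C. C \<ge> 0 \<and> (\<forall>w. \<bar>w\<bar> \<le> 1/2 \<longrightarrow> \<bar>(1 - w) powr s - (\<Sum>k<N. c k * w ^ k)\<bar> \<le> C * \<bar>w\<bar> ^ N)"
proof -
  define p where "p = (\<lambda>k. \<Prod>i<k. - (s - real i))"
  define df where "df = (\<lambda>k w. p k * (1 - w) powr (s - real k))"
  have deriv: "DERIV (df k) w :> df (Suc k) w" if "w \<le> 1/2" for k w
    unfolding df_def p_def using that
    by (auto intro!: derivative_eq_intros simp: algebra_simps)
  have "continuous_on {-1/2..1/2} (df N)"
    unfolding df_def by (intro continuous_intros) auto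
  then have "bounded (df N ` {-1/2..1/2})"
    by (intro compact_imp_bounded compact_continuous_image) auto
  then obtain C where C: "\<And>t. t \<in> {-1/2..1/2} \<Longrightarrow> \<bar>df N t\<bar> \<le> C"
    unfolding bounded_iff by fastforce
  have C0: "C \<ge> 0" using C[of 0] by auto
  have "\<bar>(1 - w) powr s - (\<Sum>k<N. (df k 0 / fact k) * w ^ k)\<bar> \<le> C * \<bar>w\<bar> ^ N" if w: "\<bar>w\<bar> \<le> 1/2" for w
  proof (cases "w = 0")
    case True
    then show ?thesis using \<open>N > 0\<close> by (cases N) (auto simp: df_def p_def sum.lessThan_Suc_shift simp del: sum.lessThan_Suc)
  next
    case False
    have "\<exists>t. (if w < 0 then w < t \<and> t < 0 else 0 < t \<and> t < w) \<and>
      df 0 w = (\<Sum>m<N. (df m 0 / fact m) * (w - 0)^m) + (df N t / fact N) * (w - 0)^N"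
      using False w \<open>N > 0\<close> deriv by (intro Taylor[of N df "df 0" "-1/2" "1/2"]) auto
    then obtain t where t: "(if w < 0 then w < t \<and> t < 0 else 0 < t \<and> t < w)"
      "df 0 w = (\<Sum>m<N. (df m 0 / fact m) * w^m) + (df N t / fact N) * w^N" by auto
    have "\<bar>df N t\<bar> \<le> C" using t(1) w by (intro C) (auto split: if_splits)
    moreover have "\<bar>df N t\<bar> / fact N \<le> \<bar>df N t\<bar> / 1"
      by (intro divide_left_mono) (auto simp: fact_ge_1)
    ultimately have "\<bar>df N t\<bar> / fact N \<le> C" by simp
    then have "\<bar>df N t\<bar> / fact N * \<bar>w\<bar>^N \<le> C * \<bar>w\<bar>^N" by (intro mult_right_mono) auto
    then show ?thesis using t(2) by (simp add: df_def p_def abs_mult power_abs)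
  qed
  then show ?thesis using C0 by (intro exI[of _ "\<lambda>k. df k 0 / fact k"] exI[of _ C]) simp
qed

text \<open>
  Expanding the power in \<open>w = 2 t b + t\<^sup>2 g\<close> gives monomials \<open>t\<^sup>i\<close> with coefficients of size \<open>h\<^sup>i\<close>,
  and the difference kills all of those with \<open>i < 2 m\<close>. Here \<open>w\<close> is the form in which a quadratic
  polynomial enters along a line.
\<close>

lemma difference_of_quadratic_powr_bound:
  fixes s B :: real
  assumes m: "m > 0" and B: "B > 0"
  shows "\<exists>c C. 0 < c \<and> c \<le> 1 \<and> C \<ge> 0 \<and> (\<forall>h b g. 0 \<le> h \<longrightarrow> h \<le> c \<longrightarrow> \<bar>b\<bar> \<le> B * h \<longrightarrow> \<bar>g\<bar> \<le> B * h\<^sup>2 \<longrightarrow>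
     \<bar>\<Sum>k\<in>{- int m..int m}. dcoef m k * (1 - (2 * of_int k * b + (of_int k)\<^sup>2 * g)) powr s\<bar> \<le> C * h ^ (2 * m))"
proof -
  obtain a C where C: "C \<ge> 0" and tay: "\<And>w. \<bar>w\<bar> \<le> 1/2 \<Longrightarrow> \<bar>(1 - w) powr s - (\<Sum>k<2*m. a k * w ^ k)\<bar> \<le> C * \<bar>w\<bar> ^ (2*m)"
    using one_minus_powr_taylor[of "2*m" s] m by auto
  define M where "M = B * (2 * real m + (real m)\<^sup>2)"
  have M: "M > 0" using m B unfolding M_def by (intro mult_pos_pos add_pos_pos) auto
  define c where "c = min 1 (1 / (2 * M))"
  have c: "0 < c" "c \<le> 1" "c * M \<le> 1/2"
    using M by (auto simp: c_def min_def field_simps)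
  let ?I = "{- int m..int m}"
  define w where "w = (\<lambda>b g (k::int). 2 * of_int k * b + (of_int k)\<^sup>2 * g :: real)"
  have wb: "\<bar>w b g k\<bar> \<le> M * h" if "0 \<le> h" "h \<le> c" "\<bar>b\<bar> \<le> B * h" "\<bar>g\<bar> \<le> B * h\<^sup>2" "k \<in> ?I" for h b g k
  proof -
    have k: "\<bar>of_int k :: real\<bar> \<le> real m" using that(5) by auto
    have "\<bar>g\<bar> \<le> B * h" using that(1,2,4) c(2) B
      by (smt (verit) mult_left_le mult_left_mono power2_eq_square)
    have "\<bar>w b g k\<bar> \<le> 2 * real m * (B * h) + (real m)\<^sup>2 * (B * h)"
    proof -
      have 1: "\<bar>2 * of_int k * b\<bar> \<le> 2 * real m * (B * h)"
        unfolding abs_mult using k that by (intro mult_mono) auto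
      have "(of_int k :: real)\<^sup>2 \<le> (real m)\<^sup>2"
        using k by (intro abs_le_square_iff[THEN iffD1]) auto
      then have 2: "\<bar>(of_int k)\<^sup>2 * g\<bar> \<le> (real m)\<^sup>2 * (B * h)"
        unfolding abs_mult using \<open>\<bar>g\<bar> \<le> B * h\<close> by (intro mult_mono) auto
      show ?thesis unfolding w_def using 1 2 by linarith
    qed
    then show ?thesis by (simp add: M_def algebra_simps)
  qed
  \<comment> \<open>The \<open>k\<close>-th Taylor term: binomially expanded, only moments of order at least \<open>2 m\<close> survive in it.\<close>
  define S where "S = (\<lambda>b g k. \<Sum>j\<in>?I. dcoef m j * w b g j ^ k)"
  define A where "A = (\<lambda>i. \<bar>\<Sum>j\<in>?I. dcoef m j * of_int j ^ i\<bar>)"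
  define K where "K = (\<lambda>k. \<Sum>j\<le>k. real (k choose j) * (2 * B) ^ j * B ^ (k - j) * A (j + 2 * (k - j)))"
  have Sb: "\<bar>S b g k\<bar> \<le> K k * h ^ (2*m)" if "0 \<le> h" "h \<le> c" "\<bar>b\<bar> \<le> B * h" "\<bar>g\<bar> \<le> B * h\<^sup>2" for h b g k
  proof -
    have "S b g k = (\<Sum>i\<in>?I. dcoef m i * (\<Sum>j\<le>k. real (k choose j) * (2 * of_int i * b) ^ j * ((of_int i)\<^sup>2 * g) ^ (k - j)))"
      unfolding S_def w_def by (subst binomial_ring) simp
    also have "\<dots> = (\<Sum>j\<le>k. real (k choose j) * (2 * b) ^ j * g ^ (k - j) * (\<Sum>i\<in>?I. dcoef m i * of_int i ^ (j + 2 * (k - j))))"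
      unfolding sum_distrib_left
      by (subst sum.swap, intro sum.cong refl)
         (unfold power_mult_distrib power_add power_mult, simp only: mult_ac)
    finally have eq: "S b g k = (\<Sum>j\<le>k. real (k choose j) * (2 * b) ^ j * g ^ (k - j) * (\<Sum>i\<in>?I. dcoef m i * of_int i ^ (j + 2 * (k - j))))" .
    show ?thesis
      unfolding K_def sum_distrib_right eq
    proof (rule order_trans[OF sum_abs], rule sum_mono)
      fix j assume "j \<in> {..k}"
      let ?i = "j + 2 * (k - j)"
      show "\<bar>real (k choose j) * (2 * b) ^ j * g ^ (k - j) * (\<Sum>i\<in>?I. dcoef m i * of_int i ^ ?i)\<bar>
        \<le> real (k choose j) * (2 * B) ^ j * B ^ (k - j) * A ?i * h ^ (2*m)"
      proof (cases "?i < 2 * m")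
        case True
        have "(\<Sum>i\<in>?I. dcoef m i * of_int i ^ ?i) = 0" using dcoef_moment[OF True] .
        then show ?thesis using that B by (simp add: A_def)
      next
        case False
        have h1: "h \<le> 1" using that c by simp
        have "\<bar>b\<bar> ^ j \<le> (B * h) ^ j" "\<bar>g\<bar> ^ (k - j) \<le> (B * h\<^sup>2) ^ (k - j)"
          using that by (auto intro!: power_mono)
        then have "real (k choose j) * (2 ^ j * \<bar>b\<bar> ^ j) * \<bar>g\<bar> ^ (k - j) * A ?i
           \<le> real (k choose j) * (2 ^ j * (B * h) ^ j) * (B * h\<^sup>2) ^ (k - j) * A ?i"
          using that B by (intro mult_right_mono[OF mult_mono[OF mult_left_mono[OF mult_left_mono]]]) (auto simp: A_def)
        also have "\<dots> = real (k choose j) * (2 * B) ^ j * B ^ (k - j) * A ?i * h ^ ?i"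
          unfolding power_mult_distrib power_add power_mult by (simp only: mult_ac)
        also have "\<dots> \<le> real (k choose j) * (2 * B) ^ j * B ^ (k - j) * A ?i * h ^ (2*m)"
          using False that h1 B by (intro mult_left_mono[OF power_decreasing]) (auto simp: A_def)
        finally show ?thesis by (simp add: abs_mult power_mult_distrib power_abs A_def)
      qed
    qed
  qed
  define CC where "CC = (\<Sum>k<2*m. \<bar>a k\<bar> * K k) + (\<Sum>j\<in>?I. \<bar>dcoef m j\<bar>) * C * M ^ (2*m)"
  have K0: "K k \<ge> 0" for k unfolding K_def A_def using B by (intro sum_nonneg mult_nonneg_nonneg) auto
  have CC0: "CC \<ge> 0" unfolding CC_def using K0 C M by (intro add_nonneg_nonneg mult_nonneg_nonneg sum_nonneg) auto
  have main: "\<bar>\<Sum>k\<in>?I. dcoef m k * (1 - w b g k) powr s\<bar> \<le> CC * h ^ (2 * m)"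
    if H: "0 \<le> h" "h \<le> c" "\<bar>b\<bar> \<le> B * h" "\<bar>g\<bar> \<le> B * h\<^sup>2" for h b g
  proof -
    define R where "R = (\<lambda>i. (1 - w b g i) powr s - (\<Sum>k<2*m. a k * w b g i ^ k))"
    have R: "\<bar>R i\<bar> \<le> C * (M * h) ^ (2*m)" if i: "i \<in> ?I" for i
    proof -
      have w1: "\<bar>w b g i\<bar> \<le> M * h" using wb[OF H i] .
      have "M * h \<le> M * c" using H M by (intro mult_left_mono) auto
      then have "\<bar>w b g i\<bar> \<le> 1/2" using c w1 by (simp add: mult.commute)
      then have "\<bar>R i\<bar> \<le> C * \<bar>w b g i\<bar> ^ (2*m)" unfolding R_def by (rule tay)
      also have "\<dots> \<le> C * (M * h) ^ (2*m)" using w1 C by (intro mult_left_mono power_mono) auto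
      finally show ?thesis .
    qed
    have "(\<Sum>k\<in>?I. dcoef m k * (1 - w b g k) powr s) = (\<Sum>i\<in>?I. dcoef m i * R i) + (\<Sum>i\<in>?I. dcoef m i * (\<Sum>k<2*m. a k * w b g i ^ k))"
      by (simp add: R_def sum.distrib[symmetric] algebra_simps)
    also have "(\<Sum>i\<in>?I. dcoef m i * (\<Sum>k<2*m. a k * w b g i ^ k)) = (\<Sum>k<2*m. a k * S b g k)"
      unfolding S_def sum_distrib_left by (subst sum.swap) (simp add: mult_ac)
    finally have eq: "(\<Sum>k\<in>?I. dcoef m k * (1 - w b g k) powr s) = (\<Sum>i\<in>?I. dcoef m i * R i) + (\<Sum>k<2*m. a k * S b g k)" .
    have "\<bar>\<Sum>k\<in>?I. dcoef m k * (1 - w b g k) powr s\<bar>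
       \<le> (\<Sum>i\<in>?I. \<bar>dcoef m i\<bar> * (C * (M * h) ^ (2*m))) + (\<Sum>k<2*m. \<bar>a k\<bar> * (K k * h ^ (2*m)))"
      unfolding eq using R Sb[OF H]
      by (intro order_trans[OF abs_triangle_ineq] add_mono order_trans[OF sum_abs] sum_mono)
         (auto simp: abs_mult intro!: mult_left_mono)
    also have "\<dots> = CC * h ^ (2*m)"
      by (simp add: CC_def distrib_right distrib_left sum_distrib_right sum_distrib_left power_mult_distrib mult_ac)
    finally show ?thesis .
  qed
  show ?thesis
    using c CC0 main unfolding w_def by (intro exI[of _ c] exI[of _ CC]) simp
qed

section \<open>The symbol of the difference integral\<close>

text \<open>
  The value of \<open>\<integral> x powr (-s-1) * (\<Sum>i\<in>I. b i * exp (- l i * x))\<close> over the positive half line when enough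
  moments of \<open>b\<close> vanish. At an integer \<open>s\<close> the pole of \<open>Gamma (-s)\<close> meets a vanishing moment, and the
  limit is the logarithmic expression.
\<close>

definition exp_sum_value :: "real \<Rightarrow> 'i set \<Rightarrow> ('i \<Rightarrow> real) \<Rightarrow> ('i \<Rightarrow> real) \<Rightarrow> real" where
  "exp_sum_value s I b l = (if s \<in> \<nat>
     then (-1) ^ (nat \<lfloor>s\<rfloor> + 1) / fact (nat \<lfloor>s\<rfloor>) * (\<Sum>i\<in>I. b i * l i powr s * ln (l i))
     else Gamma (- s) * (\<Sum>i\<in>I. b i * l i powr s))"

lemma has_bochner_integral_lebesgue_iff:
  fixes f :: "'a::euclidean_space \<Rightarrow> 'b::{banach, second_countable_topology}"
  assumes "f \<in> borel_measurable borel"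
  shows "has_bochner_integral lebesgue f I \<longleftrightarrow> has_bochner_integral lborel f I"
  using assms by (simp add: has_bochner_integral_iff integrable_completion integral_completion)

lemma has_bochner_integral_scaled_Gamma:
  fixes p l :: real
  assumes p: "p > 0" and l: "l > 0"
  shows "has_bochner_integral lborel (\<lambda>x. indicator {0<..} x * (x powr (p - 1) * exp (- l * x))) (Gamma p * l powr (- p))"
proof (rule has_bochner_integral_nn_integral)
  have "(\<integral>\<^sup>+ x. ennreal (indicator {0<..} x * (x powr (p - 1) * exp (- l * x))) \<partial>lborel)
     = (\<integral>\<^sup>+ x. ennreal (l powr (1 - p)) * ennreal (indicator {0..} (l * x) * (l * x) powr (p - 1) / exp (l * x)) \<partial>lborel)"
    using l by (intro nn_integral_cong)
      (auto simp: ennreal_mult[symmetric] powr_mult exp_minus field_simps powr_diff powr_minus zero_le_mult_iff split: split_indicator)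
  also have "\<dots> = ennreal (l powr (1 - p)) * (\<integral>\<^sup>+ x. ennreal (indicator {0..} (l * x) * (l * x) powr (p - 1) / exp (l * x)) \<partial>lborel)"
    by (intro nn_integral_cmult) measurable
  also have "(\<integral>\<^sup>+ x. ennreal (indicator {0..} x * x powr (p - 1) / exp x) \<partial>lborel)
      = ennreal l * (\<integral>\<^sup>+ x. ennreal (indicator {0..} (l * x) * (l * x) powr (p - 1) / exp (l * x)) \<partial>lborel)"
    using l by (subst nn_integral_real_affine[where c=l and t=0]) auto
  then have "(\<integral>\<^sup>+ x. ennreal (indicator {0..} (l * x) * (l * x) powr (p - 1) / exp (l * x)) \<partial>lborel)
     = ennreal (1 / l) * (\<integral>\<^sup>+ x. ennreal (indicator {0..} x * x powr (p - 1) / exp x) \<partial>lborel)"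
    using l by (simp add: mult.assoc[symmetric] ennreal_mult[symmetric])
  also have "(\<integral>\<^sup>+ x. ennreal (indicator {0..} x * x powr (p - 1) / exp x) \<partial>lborel) = Gamma p"
    using Gamma_conv_nn_integral_real[OF p] by simp
  also have "ennreal (l powr (1 - p)) * (ennreal (1 / l) * ennreal (Gamma p)) = ennreal (Gamma p * l powr (- p))"
    using l p by (simp add: ennreal_mult[symmetric] Gamma_real_pos powr_diff powr_minus field_simps)
  finally show "(\<integral>\<^sup>+ x. ennreal (indicator {0<..} x * (x powr (p - 1) * exp (- l * x))) \<partial>lborel) = ennreal (Gamma p * l powr (- p))" .
qed (use p in \<open>auto simp: Gamma_real_pos less_imp_le intro!: AE_I2\<close>)

lemma has_bochner_integral_inverse_Gamma:
  fixes p l :: real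
  assumes p: "p > 0" and l: "l > 0"
  shows "has_bochner_integral lborel (\<lambda>x. indicator {0<..} x * (x powr (- p - 1) * exp (- l / x))) (Gamma p * l powr (- p))"
proof -
  define f where "f = (\<lambda>x::real. x powr (p - 1) * exp (- l * x))"
  have *: "has_bochner_integral lebesgue (\<lambda>x. indicator {0<..} x * f x) (Gamma p * l powr (- p))"
    using has_bochner_integral_scaled_Gamma[OF assms] unfolding f_def
    by (subst has_bochner_integral_lebesgue_iff) auto
  have img: "inverse ` {0<..} = {(0::real)<..}"
    by (auto simp: image_iff intro!: bexI[of _ "inverse _"])
  have "(\<lambda>x. \<bar>- inverse (x\<^sup>2)\<bar> * f (inverse x)) absolutely_integrable_on {0<..} \<and>
     integral {0<..} (\<lambda>x. \<bar>- inverse (x\<^sup>2)\<bar> * f (inverse x)) = Gamma p * l powr (- p)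
     \<longleftrightarrow> f absolutely_integrable_on (inverse ` {0<..}) \<and> integral (inverse ` {0<..}) f = Gamma p * l powr (- p)"
    by (rule has_absolute_integral_change_of_variables_1')
       (auto intro!: derivative_eq_intros inj_onI simp: power2_eq_square)
  moreover have "f absolutely_integrable_on {0<..}"
    using * by (auto simp: set_integrable_def has_bochner_integral_iff)
  moreover have "integral {0<..} f = Gamma p * l powr (- p)"
    using * by (subst set_lebesgue_integral_eq_integral(2)[symmetric])
       (auto simp: set_integrable_def set_lebesgue_integral_def has_bochner_integral_iff)
  ultimately have A: "(\<lambda>x. \<bar>- inverse (x\<^sup>2)\<bar> * f (inverse x)) absolutely_integrable_on {0<..}"
     and B: "integral {0<..} (\<lambda>x. \<bar>- inverse (x\<^sup>2)\<bar> * f (inverse x)) = Gamma p * l powr (- p)"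
    unfolding img by auto
  have eq: "indicator {0<..} x *\<^sub>R (\<bar>- inverse (x\<^sup>2)\<bar> * f (inverse x)) = indicator {0<..} x * (x powr (- p - 1) * exp (- l / x))" for x :: real
  proof (cases "x > 0")
    case True
    have "inverse (x\<^sup>2) = x powr (-2)" using True by (simp add: powr_minus powr_numeral)
    moreover have "inverse x powr (p - 1) = x powr (1 - p)"
      using True by (simp add: powr_minus[symmetric] inverse_powr)
    ultimately have "\<bar>- inverse (x\<^sup>2)\<bar> * f (inverse x) = x powr (-2) * x powr (1 - p) * exp (- l / x)"
      using True by (simp add: f_def divide_inverse)
    also have "x powr (-2) * x powr (1 - p) = x powr (- p - 1)"
      unfolding powr_add[symmetric] by (rule arg_cong[where f="(powr) x"]) simp
    finally show ?thesis by simp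
  qed auto
  have "has_bochner_integral lebesgue (\<lambda>x. indicator {0<..} x * (x powr (- p - 1) * exp (- l / x))) (Gamma p * l powr (- p))"
    using A B set_lebesgue_integral_eq_integral(2)[OF A]
    unfolding set_integrable_def set_lebesgue_integral_def eq by (simp add: has_bochner_integral_iff)
  then show ?thesis by (subst (asm) has_bochner_integral_lebesgue_iff) auto
qed

text \<open>
  Write the difference quotient as \<open>\<integral> exp (- u x) du\<close> over \<open>{a..b}\<close> and exchange the integrals.
\<close>

lemma frullani_aux:
  fixes a b :: real
  assumes a: "0 < a" and ab: "a \<le> b"
  shows "has_bochner_integral lborel (\<lambda>x. indicator {0<..} x * ((exp (- a * x) - exp (- b * x)) / x)) (ln b - ln a)"
proof (rule has_bochner_integral_nn_integral)
  have inner1: "(\<integral>\<^sup>+ u. indicator {a..b} u * ennreal (indicator {0<..} x * exp (- u * x)) \<partial>lborel)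
     = ennreal (indicator {0<..} x * ((exp (- a * x) - exp (- b * x)) / x))" for x :: real
  proof (cases "x > 0")
    case True
    have "(\<integral>\<^sup>+ u. ennreal (exp (- u * x)) * indicator {a..b} u \<partial>lborel) = ennreal (- exp (- b * x) / x - (- exp (- a * x) / x))"
      using True ab by (intro nn_integral_FTC_Icc) (auto intro!: derivative_eq_intros)
    then show ?thesis using True by (simp add: mult.commute diff_divide_distrib)
  qed simp
  have inner2: "(\<integral>\<^sup>+ x. indicator {a..b} u * ennreal (indicator {0<..} x * exp (- u * x)) \<partial>lborel)
     = indicator {a..b} u * ennreal (1 / u)" for u :: real
  proof (cases "u \<in> {a..b}")
    case True
    then have "u > 0" using a by auto
    from has_bochner_integral_scaled_Gamma[of 1 u] this
    have "has_bochner_integral lborel (\<lambda>x. indicator {0<..} x * exp (- u * x)) (1 / u)"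
      by (subst has_bochner_integral_cong[of lborel lborel _ "\<lambda>x. indicator {0<..} x * (x powr (1 - 1) * exp (- u * x))" "1/u" "Gamma 1 * u powr (-1)"])
         (auto simp: powr_minus field_simps split: split_indicator)
    then have "(\<integral>\<^sup>+ x. ennreal (indicator {0<..} x * exp (- u * x)) \<partial>lborel) = ennreal (1 / u)"
      by (subst nn_integral_eq_integral) (auto simp: has_bochner_integral_iff)
    then show ?thesis using True by simp
  qed simp
  have "(\<integral>\<^sup>+ x. ennreal (indicator {0<..} x * ((exp (- a * x) - exp (- b * x)) / x)) \<partial>lborel)
      = (\<integral>\<^sup>+ u. \<integral>\<^sup>+ x. indicator {a..b} u * ennreal (indicator {0<..} x * exp (- u * x)) \<partial>lborel \<partial>lborel)"
    unfolding inner1[symmetric] by (rule lborel_pair.Fubini') measurable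
  also have "\<dots> = (\<integral>\<^sup>+ u. ennreal (1 / u) * indicator {a..b} u \<partial>lborel)"
    unfolding inner2 by (simp add: mult.commute)
  also have "\<dots> = ln b - ln a"
    using a ab by (intro nn_integral_FTC_Icc) (auto intro!: derivative_eq_intros)
  finally show "(\<integral>\<^sup>+ x. ennreal (indicator {0<..} x * ((exp (- a * x) - exp (- b * x)) / x)) \<partial>lborel) = ln b - ln a" .
next
  show "AE x in lborel. 0 \<le> indicator {0<..} x * ((exp (- a * x) - exp (- b * x)) / x)"
    using ab by (intro AE_I2) (auto split: split_indicator intro!: divide_nonneg_pos mult_right_mono)
qed (use a ab in auto)

lemma frullani:
  fixes a b :: real
  assumes "0 < a" "0 < b"
  shows "has_bochner_integral lborel (\<lambda>x. indicator {0<..} x * ((exp (- a * x) - exp (- b * x)) / x)) (ln b - ln a)"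
proof (cases "a \<le> b")
  case True
  then show ?thesis using frullani_aux assms by simp
next
  case False
  then have "has_bochner_integral lborel (\<lambda>x. - (indicator {0<..} x * ((exp (- b * x) - exp (- a * x)) / x))) (- (ln a - ln b))"
    using frullani_aux[of b a] assms by (intro has_bochner_integral_minus) auto
  then show ?thesis by (simp add: diff_divide_distrib algebra_simps)
qed

lemma integrable_powr_near_0:
  fixes p :: real
  assumes "p > -1"
  shows "integrable lborel (\<lambda>x::real. indicator {0<..1} x * x powr p)"
proof -
  have "(\<lambda>x. x powr p) absolutely_integrable_on {0..1}"
    using has_integral_powr_from_0[of p 1] assms
    by (intro nonnegative_absolutely_integrable_1) (auto simp: has_integral_integrable)
  then have "integrable lborel (\<lambda>x::real. indicator {0..1} x * x powr p)"
    unfolding set_integrable_def by (subst (asm) integrable_completion) auto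
  then show ?thesis
    by (rule Bochner_Integration.integrable_bound) (auto split: split_indicator)
qed

lemma integrable_powr_near_infinity:
  fixes q :: real
  assumes "q < -1"
  shows "integrable lborel (\<lambda>x::real. indicator {1..} x * x powr q)"
proof -
  have "(\<integral>\<^sup>+x. ennreal (x powr q) * indicator {1..} x \<partial>lborel) = ennreal (0 - 1 powr (q + 1) / (q + 1))"
  proof (rule nn_integral_FTC_atLeast[where F="\<lambda>x. x powr (q + 1) / (q + 1)"])
    show "((\<lambda>x. x powr (q + 1) / (q + 1)) \<longlongrightarrow> 0) at_top"
      using assms by (intro tendsto_divide_zero tendsto_neg_powr filterlim_ident) auto
  qed (use assms in \<open>auto intro!: derivative_eq_intros\<close>)
  then show ?thesis
    by (intro integrableI_bounded) (auto simp: ennreal_mult mult.commute ennreal_indicator)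
qed

text \<open>
  The vanishing moments remove the Taylor terms of order below \<open>N\<close> at 0; at infinity each
  exponential is at most 1.
\<close>

lemma exp_sum_bound:
  fixes b l :: "'i \<Rightarrow> real"
  assumes fin: "finite I" and l: "\<And>i. i \<in> I \<Longrightarrow> l i \<ge> 0"
    and mom: "\<And>j. j < N \<Longrightarrow> (\<Sum>i\<in>I. b i * l i ^ j) = 0"
  shows "\<exists>C\<ge>0. \<forall>x\<ge>0. \<bar>\<Sum>i\<in>I. b i * exp (- l i * x)\<bar> \<le> C * x ^ N \<and> \<bar>\<Sum>i\<in>I. b i * exp (- l i * x)\<bar> \<le> C"
proof -
  define C where "C = (\<Sum>i\<in>I. \<bar>b i\<bar> * (1 + l i ^ N * exp (l i)))"
  have C1: "(\<Sum>i\<in>I. \<bar>b i\<bar>) \<le> C"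
    unfolding C_def using l by (intro sum_mono) (auto simp: algebra_simps)
  have C2: "(\<Sum>i\<in>I. \<bar>b i\<bar> * (l i ^ N * exp (l i))) \<le> C"
    unfolding C_def using l by (intro sum_mono) (auto simp: algebra_simps)
  have bd: "\<bar>\<Sum>i\<in>I. b i * exp (- l i * x)\<bar> \<le> (\<Sum>i\<in>I. \<bar>b i\<bar>)" if x: "x \<ge> 0" for x
  proof (rule order_trans[OF sum_abs], rule sum_mono)
    fix i assume "i \<in> I"
    then have "exp (- l i * x) \<le> 1" using l x by (simp add: mult_nonneg_nonneg)
    then show "\<bar>b i * exp (- l i * x)\<bar> \<le> \<bar>b i\<bar>"
      by (simp add: abs_mult mult_left_le)
  qed
  have bd2: "\<bar>\<Sum>i\<in>I. b i * exp (- l i * x)\<bar> \<le> C * x ^ N" if x: "x \<ge> 0" for x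
  proof (cases "x \<le> 1")
    case True
    have "\<exists>R. exp (- l i * x) = (\<Sum>j<N. (- l i * x) ^ j / fact j) + R \<and> (i \<in> I \<longrightarrow> \<bar>R\<bar> \<le> l i ^ N * exp (l i) * x ^ N)" for i
    proof -
      obtain t where t: "\<bar>t\<bar> \<le> \<bar>- l i * x\<bar>" "exp (- l i * x) = (\<Sum>j<N. (- l i * x) ^ j / fact j) + (exp t / fact N) * (- l i * x) ^ N"
        using Maclaurin_exp_le[of "- l i * x" N] by (elim exE conjE)
      have "\<bar>(exp t / fact N) * (- l i * x) ^ N\<bar> \<le> l i ^ N * exp (l i) * x ^ N" if i: "i \<in> I"
      proof -
        have "\<bar>- l i * x\<bar> = l i * x" using l[OF i] x by (simp add: abs_mult)
        also have "\<dots> \<le> l i" using l[OF i] True by (simp add: mult_left_le)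
        finally have "\<bar>t\<bar> \<le> l i" using t(1) by simp
        then have "exp t / fact N \<le> exp (l i) / 1"
          by (intro frac_le) (auto simp: fact_ge_1)
        moreover have "\<bar>(- l i * x) ^ N\<bar> = (l i * x) ^ N" using l[OF i] x by (simp add: power_abs abs_mult)
        ultimately have "\<bar>(exp t / fact N) * (- l i * x) ^ N\<bar> \<le> exp (l i) * (l i * x) ^ N"
          using l[OF i] x mult_right_mono[of "exp t / fact N" "exp (l i)" "(l i * x) ^ N"]
          unfolding abs_mult by simp
        then show ?thesis by (simp add: power_mult_distrib mult_ac)
      qed
      then show ?thesis using t(2) by (intro exI[of _ "(exp t / fact N) * (- l i * x) ^ N"]) auto
    qed
    then obtain R where R: "\<And>i. exp (- l i * x) = (\<Sum>j<N. (- l i * x) ^ j / fact j) + R i"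
      and Rb: "\<And>i. i \<in> I \<Longrightarrow> \<bar>R i\<bar> \<le> l i ^ N * exp (l i) * x ^ N" by metis
    have "(\<Sum>i\<in>I. b i * exp (- l i * x)) = (\<Sum>i\<in>I. b i * (\<Sum>j<N. (- l i * x) ^ j / fact j)) + (\<Sum>i\<in>I. b i * R i)"
      unfolding R by (simp add: distrib_left sum.distrib)
    also have "(\<Sum>i\<in>I. b i * (\<Sum>j<N. (- l i * x) ^ j / fact j)) = (\<Sum>j<N. (- x) ^ j / fact j * (\<Sum>i\<in>I. b i * l i ^ j))"
      unfolding sum_distrib_left
      by (subst sum.swap, intro sum.cong refl) (simp add: power_mult_distrib[symmetric] mult_ac)
    also have "\<dots> = 0" using mom by (intro sum.neutral) auto
    finally have "\<bar>\<Sum>i\<in>I. b i * exp (- l i * x)\<bar> \<le> (\<Sum>i\<in>I. \<bar>b i * R i\<bar>)" by (simp add: sum_abs)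
    also have "\<dots> \<le> (\<Sum>i\<in>I. \<bar>b i\<bar> * (l i ^ N * exp (l i)) * x ^ N)"
      using Rb by (intro sum_mono) (auto simp: abs_mult mult.assoc intro!: mult_left_mono)
    also have "\<dots> \<le> C * x ^ N"
      using C2 x by (simp add: sum_distrib_right[symmetric] mult_right_mono)
    finally show ?thesis .
  next
    case False
    have "\<bar>\<Sum>i\<in>I. b i * exp (- l i * x)\<bar> \<le> C" using bd[OF x] C1 by simp
    also have "\<dots> \<le> C * x ^ N"
    proof -
      have "0 \<le> (\<Sum>i\<in>I. \<bar>b i\<bar>)" by (simp add: sum_nonneg)
      with C1 have "C \<ge> 0" by linarith
      then show ?thesis using mult_left_mono[of 1 "x ^ N" C] one_le_power[of x N] False by simp
    qed
    finally show ?thesis .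
  qed
  have "0 \<le> (\<Sum>i\<in>I. \<bar>b i\<bar>)" by (simp add: sum_nonneg)
  with C1 have "C \<ge> 0" by linarith
  then show ?thesis using bd bd2 C1 by (intro exI[of _ C]) (auto intro: order_trans)
qed

text \<open>
  The counterpart, for the closed form, of one integration by parts.
\<close>

lemma exp_sum_value_rec:
  assumes s: "s > 0" and l: "\<And>i. i \<in> I \<Longrightarrow> l i \<ge> 0"
  shows "exp_sum_value s I b l = exp_sum_value (s - 1) I (\<lambda>i. - l i * b i) l / s"
proof -
  have pw: "l i * l i powr (s - 1) = l i powr s" if "i \<in> I" for i
    using powr_mult_base[OF l[OF that], of "s - 1"] by simp
  show ?thesis
  proof (cases "s \<in> \<nat>")
    case True
    then obtain j where j: "s = real (Suc j)" using s by (metis Nats_cases gr0_implies_Suc of_nat_0_less_iff)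
    have "s - 1 = real j" using j by simp
    then have 1: "exp_sum_value (s - 1) I (\<lambda>i. - l i * b i) l = (-1) ^ (j + 1) / fact j * (\<Sum>i\<in>I. - l i * b i * l i powr (s - 1) * ln (l i))"
      by (simp add: exp_sum_value_def)
    have 2: "exp_sum_value s I b l = (-1) ^ (Suc j + 1) / fact (Suc j) * (\<Sum>i\<in>I. b i * l i powr s * ln (l i))"
      using j by (simp add: exp_sum_value_def del: of_nat_Suc)
    have 3: "(\<Sum>i\<in>I. - l i * b i * l i powr (s - 1) * ln (l i)) = - (\<Sum>i\<in>I. b i * l i powr s * ln (l i))"
      unfolding sum_negf[symmetric] using pw by (intro sum.cong) (auto simp: algebra_simps)
    show ?thesis unfolding 1 2 3 using j by (simp add: field_simps)
  next
    case False
    then have F: "s - 1 \<notin> \<nat>" using Nats_1 Nats_add[of "s - 1" 1] by auto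
    have "- s \<notin> \<int>\<^sub>\<le>\<^sub>0" using False by (auto elim!: nonpos_Ints_cases') 
    then have "Gamma (- s + 1) = - s * Gamma (- s)" by (rule Gamma_plus1)
    then have G: "Gamma (1 - s) = - s * Gamma (- s)" by (simp add: add.commute)
    have 3: "(\<Sum>i\<in>I. - l i * b i * l i powr (s - 1)) = - (\<Sum>i\<in>I. b i * l i powr s)"
      unfolding sum_negf[symmetric] using pw by (intro sum.cong) (auto simp: algebra_simps)
    show ?thesis using False F s 3 G by (simp add: exp_sum_value_def)
  qed
qed

text \<open>
  One integration by parts lowers \<open>s\<close> by 1 and replaces \<open>b i\<close> by \<open>- l i * b i\<close>, which shifts the moments
  and uses up one of them. The recursion ends in Gamma integrals for \<open>s < 0\<close> and in Frullani integrals
  for \<open>s = 0\<close>; there a constant term would diverge, which is what the last hypothesis excludes.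
\<close>

lemma exp_sum_integral:
  fixes b l :: "'i \<Rightarrow> real"
  assumes "finite I" "\<And>i. i \<in> I \<Longrightarrow> l i \<ge> 0" "s > -1" "s < real N"
    and "\<And>j. j < N \<Longrightarrow> (\<Sum>i\<in>I. b i * l i ^ j) = 0"
    and "\<And>i. s \<le> 0 \<Longrightarrow> i \<in> I \<Longrightarrow> l i = 0 \<Longrightarrow> b i = 0"
  shows "has_bochner_integral lborel (\<lambda>x. indicator {0<..} x * (x powr (- s - 1) * (\<Sum>i\<in>I. b i * exp (- l i * x)))) (exp_sum_value s I b l)"
  using assms
proof (induction N arbitrary: s b)
  case 0
  then show ?case
  proof -
    have s: "s < 0" using 0 by simp
    have "has_bochner_integral lborel (\<lambda>x. \<Sum>i\<in>I. b i * (indicator {0<..} x * (x powr (- s - 1) * exp (- l i * x)))) (\<Sum>i\<in>I. b i * (Gamma (-s) * l i powr s))"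
    proof (rule has_bochner_integral_sum)
      fix i assume i: "i \<in> I"
      show "has_bochner_integral lborel (\<lambda>x. b i * (indicator {0<..} x * (x powr (- s - 1) * exp (- l i * x)))) (b i * (Gamma (-s) * l i powr s))"
      proof (cases "b i = 0")
        case False
        then have "l i > 0" using 0(2,6) i s by force
        then show ?thesis using has_bochner_integral_scaled_Gamma[of "-s" "l i"] s
          by (intro has_bochner_integral_mult_right) auto
      qed (simp add: has_bochner_integral_zero)
    qed
    moreover have "s \<notin> \<nat>" using s by (auto elim!: Nats_cases)
    ultimately show ?thesis by (simp add: exp_sum_value_def sum_distrib_left mult_ac)
  qed
next
  case (Suc N)
  consider "s < 0" | "s = 0" | "s > 0" by linarith
  then show ?case
  proof cases
    case 1
    have "has_bochner_integral lborel (\<lambda>x. \<Sum>i\<in>I. b i * (indicator {0<..} x * (x powr (- s - 1) * exp (- l i * x)))) (\<Sum>i\<in>I. b i * (Gamma (-s) * l i powr s))"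
    proof (rule has_bochner_integral_sum)
      fix i assume i: "i \<in> I"
      show "has_bochner_integral lborel (\<lambda>x. b i * (indicator {0<..} x * (x powr (- s - 1) * exp (- l i * x)))) (b i * (Gamma (-s) * l i powr s))"
      proof (cases "b i = 0")
        case False
        then have "l i > 0" using Suc.prems(2,6) i 1 by force
        then show ?thesis using has_bochner_integral_scaled_Gamma[of "-s" "l i"] 1
          by (intro has_bochner_integral_mult_right) auto
      qed (simp add: has_bochner_integral_zero)
    qed
    moreover have "s \<notin> \<nat>" using 1 by (auto elim!: Nats_cases)
    ultimately show ?thesis by (simp add: exp_sum_value_def sum_distrib_left mult_ac)
  next
    case 2
    have b0: "(\<Sum>i\<in>I. b i) = 0" using Suc.prems(5)[of 0] by simp
    have "has_bochner_integral lborel (\<lambda>x. \<Sum>i\<in>I. b i * (indicator {0<..} x * ((exp (- l i * x) - exp (- 1 * x)) / x))) (\<Sum>i\<in>I. b i * (ln 1 - ln (l i)))"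
    proof (rule has_bochner_integral_sum)
      fix i assume i: "i \<in> I"
      show "has_bochner_integral lborel (\<lambda>x. b i * (indicator {0<..} x * ((exp (- l i * x) - exp (- 1 * x)) / x))) (b i * (ln 1 - ln (l i)))"
      proof (cases "b i = 0")
        case False
        then have "l i > 0" using Suc.prems(2,6) i 2 by force
        then show ?thesis using frullani[of "l i" 1]
          by (intro has_bochner_integral_mult_right) auto
      qed (simp add: has_bochner_integral_zero)
    qed
    moreover have "(\<Sum>i\<in>I. b i * (indicator {0<..} x * ((exp (- l i * x) - exp (- 1 * x)) / x)))
      = indicator {0<..} x * (x powr (- s - 1) * (\<Sum>i\<in>I. b i * exp (- l i * x)))" for x :: real
    proof (cases "x > 0")
      case True
      have "(\<Sum>i\<in>I. b i * ((exp (- l i * x) - exp (- 1 * x)) / x)) = (\<Sum>i\<in>I. b i * exp (- l i * x)) / x - (\<Sum>i\<in>I. b i) * exp (- x) / x"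
        by (simp add: sum_divide_distrib sum_distrib_right sum_subtractf[symmetric] algebra_simps diff_divide_distrib)
      then show ?thesis using True 2 b0 by (simp add: powr_minus field_simps)
    qed simp
    moreover have "(\<Sum>i\<in>I. b i * (ln 1 - ln (l i))) = exp_sum_value s I b l"
    proof -
      have "b i * ln (l i) = b i * l i powr s * ln (l i)" if "i \<in> I" for i
        using Suc.prems(6)[of i] that 2 by (cases "l i = 0") auto
      then have "(\<Sum>i\<in>I. b i * ln (l i)) = (\<Sum>i\<in>I. b i * l i powr s * ln (l i))"
        by (intro sum.cong) auto
      then show ?thesis using 2 by (simp add: exp_sum_value_def sum_negf)
    qed
    ultimately show ?thesis by simp
  next
    case 3
    define G where "G = (\<lambda>x. \<Sum>i\<in>I. b i * exp (- l i * x))"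
    define G' where "G' = (\<lambda>x. \<Sum>i\<in>I. (- l i * b i) * exp (- l i * x))"
    have G': "DERIV G x :> G' x" for x
      unfolding G_def G'_def by (auto intro!: derivative_eq_intros sum.cong simp: mult_ac)
    have IH: "has_bochner_integral lborel (\<lambda>x. indicator {0<..} x * (x powr (- (s - 1) - 1) * G' x)) (exp_sum_value (s - 1) I (\<lambda>i. - l i * b i) l)"
      unfolding G'_def
    proof (rule Suc.IH)
      fix j assume "j < N"
      then have "(\<Sum>i\<in>I. b i * l i ^ (Suc j)) = 0" by (intro Suc.prems(5)) auto
      then show "(\<Sum>i\<in>I. - l i * b i * l i ^ j) = 0"
        by (simp add: sum_negf mult_ac)
    qed (use Suc.prems 3 in auto)
    have "\<exists>C\<ge>0. \<forall>x\<ge>0. \<bar>G x\<bar> \<le> C * x ^ Suc N \<and> \<bar>G x\<bar> \<le> C"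
      unfolding G_def by (rule exp_sum_bound[OF Suc.prems(1,2,5)])
    then obtain C where C: "C \<ge> 0" and CN: "\<And>x. x \<ge> 0 \<Longrightarrow> \<bar>G x\<bar> \<le> C * x ^ Suc N" and C0: "\<And>x. x \<ge> 0 \<Longrightarrow> \<bar>G x\<bar> \<le> C"
      by auto
    have [measurable]: "G \<in> borel_measurable borel" "G' \<in> borel_measurable borel"
      unfolding G_def G'_def by measurable
    have int: "integrable lborel (\<lambda>x. indicator {0<..} x * (x powr (- s - 1) * G x))"
    proof (rule Bochner_Integration.integrable_bound)
      show "integrable lborel (\<lambda>x. C * (indicator {0<..1} x * x powr (real (Suc N) - s - 1)) + C * (indicator {1..} x * x powr (- s - 1)))"
        using 3 Suc.prems(4) by (intro Bochner_Integration.integrable_add integrable_mult_right integrable_powr_near_0 integrable_powr_near_infinity) auto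
      show "AE x in lborel. norm (indicator {0<..} x * (x powr (- s - 1) * G x))
        \<le> norm (C * (indicator {0<..1} x * x powr (real (Suc N) - s - 1)) + C * (indicator {1..} x * x powr (- s - 1)))"
      proof (intro AE_I2)
        fix x :: real
        show "norm (indicator {0<..} x * (x powr (- s - 1) * G x))
          \<le> norm (C * (indicator {0<..1} x * x powr (real (Suc N) - s - 1)) + C * (indicator {1..} x * x powr (- s - 1)))"
        proof (cases "x \<le> 0")
          case False
          show ?thesis
          proof (cases "x < 1")
            case True
            have "\<bar>G x\<bar> * x powr (- s - 1) \<le> (C * x ^ Suc N) * x powr (- s - 1)"
              using CN[of x] False by (intro mult_right_mono) auto
            also have "\<dots> = C * x powr (real (Suc N) - s - 1)"
              using False by (simp add: powr_realpow[symmetric] powr_add[symmetric] algebra_simps del: power_Suc)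
            finally show ?thesis using False True C by (simp add: abs_mult mult.commute)
          next
            case x1: False
            have "\<bar>G x\<bar> * x powr (- s - 1) \<le> C * x powr (- s - 1)"
              using C0[of x] False by (intro mult_right_mono) auto
            then show ?thesis using False x1 C by (cases "x = 1") (auto simp: abs_mult mult.commute)
          qed
        qed auto
      qed
    qed measurable
    define F where "F = (\<lambda>x. - (x powr (- s) * G x) / s)"
    let ?f = "\<lambda>x. x powr (- s - 1) * G x - x powr (- s) * G' x / s"
    have IH': "integrable lborel (\<lambda>x. indicator {0<..} x * (x powr (- s) * G' x))"
      "(\<integral>x. indicator {0<..} x * (x powr (- s) * G' x) \<partial>lborel) = exp_sum_value (s - 1) I (\<lambda>i. - l i * b i) l"
      using IH by (auto simp: has_bochner_integral_iff)
    have fint: "integrable lborel (\<lambda>x. indicator {0<..} x *\<^sub>R ?f x)"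
      using Bochner_Integration.integrable_diff[OF int integrable_divide[OF IH'(1), of s]]
      by (simp add: algebra_simps)
    have "(LBINT x=0..\<infinity>. ?f x) = 0 - 0"
    proof (rule interval_integral_FTC_integrable)
      show "(F has_vector_derivative ?f x) (at x)" if "0 < ereal x" for x
        unfolding has_real_derivative_iff_has_vector_derivative[symmetric] F_def using that 3
        by (auto intro!: derivative_eq_intros G' simp: field_simps)
      show "isCont ?f x" if "0 < ereal x" for x
      proof -
        have "isCont G x" using G'[of x] by (rule DERIV_isCont)
        moreover have "isCont G' x" unfolding G'_def by (intro continuous_intros)
        ultimately show ?thesis using that 3 by (intro continuous_intros) auto
      qed
      show "set_integrable lborel (einterval 0 \<infinity>) ?f"
        using fint by (simp add: set_integrable_def einterval_def greaterThan_def)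
      have "(F \<longlongrightarrow> 0) (at_right 0)"
      proof (rule Lim_null_comparison)
        show "\<forall>\<^sub>F x in at_right 0. norm (F x) \<le> C / s * x powr (real (Suc N) - s)"
          using eventually_at_right_less[of "0::real"]
        proof eventually_elim
          case (elim x)
          have "\<bar>G x\<bar> * x powr (- s) \<le> (C * x ^ Suc N) * x powr (- s)"
            using CN[of x] elim by (intro mult_right_mono) auto
          also have "\<dots> = C * x powr (real (Suc N) - s)"
            using elim by (simp add: powr_realpow[symmetric] powr_add[symmetric] algebra_simps del: power_Suc)
          finally show ?case using 3 by (simp add: F_def abs_mult divide_right_mono mult.commute)
        qed
        show "((\<lambda>x. C / s * x powr (real (Suc N) - s)) \<longlongrightarrow> 0) (at_right 0)"
          using Suc.prems(4)
          by (intro tendsto_mult_right_zero tendsto_eq_rhs[OF tendsto_powr'[OF tendsto_ident_at tendsto_const]])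
             (auto simp: eventually_at_filter intro!: always_eventually)
      qed
      then show "((F \<circ> real_of_ereal) \<longlongrightarrow> 0) (at_right 0)"
        by (simp add: zero_ereal_def ereal_tendsto_simps)
      have "(F \<longlongrightarrow> 0) at_top"
      proof (rule Lim_null_comparison)
        show "\<forall>\<^sub>F x in at_top. norm (F x) \<le> C / s * x powr (- s)"
          using eventually_ge_at_top[of "0::real"]
        proof eventually_elim
          case (elim x)
          have "\<bar>G x\<bar> * x powr (- s) \<le> C * x powr (- s)"
            using C0[of x] elim by (intro mult_right_mono) auto
          then show ?case using 3 by (simp add: F_def abs_mult divide_right_mono mult.commute)
        qed
        show "((\<lambda>x. C / s * x powr (- s)) \<longlongrightarrow> 0) at_top"
          using 3 by (intro tendsto_mult_right_zero tendsto_neg_powr filterlim_ident) auto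
      qed
      then show "((F \<circ> real_of_ereal) \<longlongrightarrow> 0) (at_left \<infinity>)"
        by (simp add: ereal_tendsto_simps)
    qed (use fint in auto)
    then have "(\<integral>x. indicator {0<..} x *\<^sub>R ?f x \<partial>lborel) = 0"
      by (simp add: interval_lebesgue_integral_def set_lebesgue_integral_def einterval_def greaterThan_def)
    also have "(\<integral>x. indicator {0<..} x *\<^sub>R ?f x \<partial>lborel) =
      (\<integral>x. indicator {0<..} x * (x powr (- s - 1) * G x) - indicator {0<..} x * (x powr (- s) * G' x) / s \<partial>lborel)"
      by (intro Bochner_Integration.integral_cong) (auto simp: algebra_simps)
    also have "\<dots> = (\<integral>x. indicator {0<..} x * (x powr (- s - 1) * G x) \<partial>lborel) - exp_sum_value (s - 1) I (\<lambda>i. - l i * b i) l / s"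
      using int IH' by (subst Bochner_Integration.integral_diff) auto
    finally have "(\<integral>x. indicator {0<..} x * (x powr (- s - 1) * G x) \<partial>lborel) = exp_sum_value s I b l"
      using exp_sum_value_rec[OF 3 Suc.prems(2), of I "\<lambda>i. i" b] by simp
    then show ?thesis using int by (simp add: has_bochner_integral_iff G_def)
  qed
qed

lemma lborel_prod_Basis:
  fixes f :: "'a::euclidean_space \<Rightarrow> real \<Rightarrow> complex"
  assumes "\<And>b. b \<in> Basis \<Longrightarrow> integrable lborel (f b)"
  shows "has_bochner_integral lborel (\<lambda>x::'a. \<Prod>b\<in>Basis. f b (x \<bullet> b)) (\<Prod>b\<in>Basis. \<integral>x. f b x \<partial>lborel)"
proof -
  interpret product_sigma_finite "\<lambda>_::'a. lborel :: real measure" ..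
  have [measurable]: "f b \<in> borel_measurable borel" if "b \<in> Basis" for b
    using borel_measurable_integrable[OF assms[OF that]] by simp
  have meas: "(\<lambda>x::'a. \<Prod>b\<in>Basis. f b (x \<bullet> b)) \<in> borel_measurable borel"
    by measurable
  have eq: "(\<Prod>b\<in>Basis. f b ((\<Sum>b\<in>Basis. y b *\<^sub>R b) \<bullet> b)) = (\<Prod>b\<in>Basis. f b (y b))" for y :: "'a \<Rightarrow> real"
    by (intro prod.cong) auto
  have "integrable (\<Pi>\<^sub>M b\<in>(Basis::'a set). lborel) (\<lambda>y. \<Prod>b\<in>Basis. f b (y b))"
    using assms by (intro product_integrable_prod) auto
  moreover have "(\<integral>y. (\<Prod>b\<in>Basis. f b (y b)) \<partial>(\<Pi>\<^sub>M b\<in>(Basis::'a set). lborel)) = (\<Prod>b\<in>Basis. \<integral>x. f b x \<partial>lborel)"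
    using assms by (intro product_integral_prod) auto
  ultimately show ?thesis
    unfolding has_bochner_integral_iff
    by (subst (1 2) lborel_eq) (simp add: integrable_distr_eq integral_distr meas eq)
qed

lemma gaussian_fourier_real:
  fixes t x :: real
  assumes t: "t > 0"
  shows "has_bochner_integral lborel (\<lambda>y. of_real (exp (- t * y\<^sup>2)) * iexp (y * x)) (of_real (sqrt (pi / t) * exp (- x\<^sup>2 / (4 * t))))"
proof -
  define c where "c = sqrt (2 * t)"
  have c: "c > 0" "c\<^sup>2 = 2 * t" using t by (auto simp: c_def)
  define g where "g = (\<lambda>y. std_normal_density y *\<^sub>R iexp (x / c * y))"
  have "integrable lborel std_normal_density" by simp
  then have gi: "integrable lborel g"
    unfolding g_def by (rule Bochner_Integration.integrable_bound) auto
  have "integral\<^sup>L lborel g = char std_normal_distribution (x / c)"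
    unfolding char_def g_def by (subst integral_density) auto
  also have "\<dots> = of_real (exp (- x\<^sup>2 / (4 * t)))"
    using c by (simp add: char_std_normal_distribution power_divide)
  finally have "has_bochner_integral lborel g (of_real (exp (- x\<^sup>2 / (4 * t))))"
    using gi by (simp add: has_bochner_integral_iff)
  then have "has_bochner_integral lborel (\<lambda>y. g (0 + c * y)) (of_real (exp (- x\<^sup>2 / (4 * t))) /\<^sub>R \<bar>c\<bar>)"
    using c by (subst (asm) lborel_has_bochner_integral_real_affine_iff[of c _ _ 0]) auto
  then have "has_bochner_integral lborel (\<lambda>y. of_real (sqrt (2 * pi)) * g (0 + c * y)) (of_real (sqrt (2 * pi)) * (of_real (exp (- x\<^sup>2 / (4 * t))) /\<^sub>R \<bar>c\<bar>))"
    by (rule has_bochner_integral_mult_right)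
  moreover have "of_real (sqrt (2 * pi)) * g (0 + c * y) = of_real (exp (- t * y\<^sup>2)) * iexp (y * x)" for y
    using c by (simp add: g_def std_normal_density_def power_mult_distrib scaleR_conv_of_real mult_ac)
  moreover have "of_real (sqrt (2 * pi)) * (complex_of_real (exp (- x\<^sup>2 / (4 * t))) /\<^sub>R \<bar>c\<bar>) = of_real (sqrt (pi / t) * exp (- x\<^sup>2 / (4 * t)))"
  proof -
    have "sqrt (2 * pi) / c = sqrt (pi / t)" unfolding c_def by (simp add: real_sqrt_divide[symmetric])
    then show ?thesis using c by (simp add: scaleR_conv_of_real field_simps)
  qed
  ultimately show ?thesis by simp
qed

lemma gaussian_fourier:
  fixes x :: "'a::euclidean_space" and t :: real
  assumes t: "t > 0"
  shows "has_bochner_integral lborel (\<lambda>y. of_real (exp (- t * (norm y)\<^sup>2)) * iexp (x \<bullet> y))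
     (of_real ((pi / t) powr (real DIM('a) / 2) * exp (- (norm x)\<^sup>2 / (4 * t))))"
proof -
  let ?f = "\<lambda>b y. of_real (exp (- t * y\<^sup>2)) * iexp (y * (x \<bullet> b))"
  have norm2: "(norm z)\<^sup>2 = (\<Sum>b\<in>Basis. (z \<bullet> b)\<^sup>2)" for z :: 'a
    unfolding dot_square_norm[symmetric] by (subst euclidean_inner) (simp add: power2_eq_square)
  have "has_bochner_integral lborel (\<lambda>y::'a. \<Prod>b\<in>Basis. ?f b (y \<bullet> b)) (\<Prod>b\<in>Basis. \<integral>y. ?f b y \<partial>lborel)"
    using gaussian_fourier_real[OF t] by (intro lborel_prod_Basis) (auto simp: has_bochner_integral_iff)
  moreover have "(\<Prod>b\<in>Basis. ?f b (y \<bullet> b)) = of_real (exp (- t * (norm y)\<^sup>2)) * iexp (x \<bullet> y)" for y :: 'a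
  proof -
    have "(\<Prod>b\<in>Basis. ?f b (y \<bullet> b)) = of_real (exp (\<Sum>b\<in>Basis. - t * (y \<bullet> b)\<^sup>2)) * exp (\<Sum>b\<in>Basis. \<i> * of_real ((y \<bullet> b) * (x \<bullet> b)))"
      by (simp add: prod.distrib exp_sum)
    also have "(\<Sum>b\<in>Basis. \<i> * of_real ((y \<bullet> b) * (x \<bullet> b))) = \<i> * of_real (x \<bullet> y)"
      by (simp add: euclidean_inner[of x y] sum_distrib_left mult_ac)
    also have "(\<Sum>b\<in>Basis. - t * (y \<bullet> b)\<^sup>2) = - t * (norm y)\<^sup>2"
      by (simp add: norm2 sum_distrib_left)
    finally show ?thesis .
  qed
  moreover have "(\<Prod>b\<in>Basis. \<integral>y. ?f b y \<partial>lborel) = of_real ((pi / t) powr (real DIM('a) / 2) * exp (- (norm x)\<^sup>2 / (4 * t)))"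
  proof -
    have "(\<integral>y. ?f b y \<partial>lborel) = of_real (sqrt (pi / t) * exp (- (x \<bullet> b)\<^sup>2 / (4 * t)))" for b
      using gaussian_fourier_real[OF t, of "x \<bullet> b"] by (simp add: has_bochner_integral_iff)
    then have "(\<Prod>b\<in>Basis. \<integral>y. ?f b y \<partial>lborel) = of_real (\<Prod>b\<in>(Basis::'a set). sqrt (pi / t) * exp (- (x \<bullet> b)\<^sup>2 / (4 * t)))"
      by simp
    also have "(\<Prod>b\<in>(Basis::'a set). sqrt (pi / t) * exp (- (x \<bullet> b)\<^sup>2 / (4 * t))) = sqrt (pi / t) ^ DIM('a) * exp (\<Sum>b\<in>Basis. - (x \<bullet> b)\<^sup>2 / (4 * t))"
      by (simp add: prod.distrib exp_sum)
    also have "sqrt (pi / t) ^ DIM('a) = (pi / t) powr (real DIM('a) / 2)"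
      using t by (simp add: powr_realpow[symmetric] powr_half_sqrt[symmetric] powr_powr)
    also have "(\<Sum>b\<in>Basis. - (x \<bullet> b)\<^sup>2 / (4 * t)) = - (norm x)\<^sup>2 / (4 * t)"
      by (simp add: norm2 sum_divide_distrib sum_negf)
    finally show ?thesis .
  qed
  ultimately show ?thesis by simp
qed

lemma dcoef_cos: "(\<Sum>k\<in>{- int m..int m}. dcoef m k * cos (of_int k * t)) = (2 - 2 * cos t) ^ m"
proof -
  have "(2 - 2 * cos t) ^ m = Re (\<Sum>k\<in>{- int m..int m}. of_real (dcoef m k) * exp (\<i> * of_real (of_int k * t)))"
    unfolding dcoef_fourier by simp
  also have "\<dots> = (\<Sum>k\<in>{- int m..int m}. dcoef m k * cos (of_int k * t))"
    unfolding Re_sum by (intro sum.cong refl) (simp add: Re_exp)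
  finally show ?thesis by simp
qed

text \<open>
  The power of \<open>2 - 2 cos\<close> is a sum of cosines, each of which has an explicit Gaussian integral.
\<close>

lemma gaussian_difference_symbol:
  fixes x :: "'a::euclidean_space" and t :: real
  assumes t: "t > 0"
  shows "has_bochner_integral lborel (\<lambda>y. exp (- t * (norm y)\<^sup>2) * (2 - 2 * cos (x \<bullet> y)) ^ m)
     ((pi / t) powr (real DIM('a) / 2) * (\<Sum>k\<in>{- int m..int m}. dcoef m k * exp (- ((of_int k)\<^sup>2 * (norm x)\<^sup>2) * (1 / (4 * t)))))"
proof -
  have "has_bochner_integral lborel (\<lambda>y. exp (- t * (norm y)\<^sup>2) * cos (z \<bullet> y)) ((pi / t) powr (real DIM('a) / 2) * exp (- (norm z)\<^sup>2 / (4 * t)))" for z :: 'a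
    using has_bochner_integral_Re[OF gaussian_fourier[OF t, of z]] by (simp add: Re_exp)
  then have "has_bochner_integral lborel (\<lambda>y. \<Sum>k\<in>{- int m..int m}. dcoef m k * (exp (- t * (norm y)\<^sup>2) * cos ((of_int k *\<^sub>R x) \<bullet> y)))
     (\<Sum>k\<in>{- int m..int m}. dcoef m k * ((pi / t) powr (real DIM('a) / 2) * exp (- (norm (of_int k *\<^sub>R x))\<^sup>2 / (4 * t))))"
    by (intro has_bochner_integral_sum has_bochner_integral_mult_right)
  moreover have "(\<Sum>k\<in>{- int m..int m}. dcoef m k * (exp (- t * (norm y)\<^sup>2) * cos ((of_int k *\<^sub>R x) \<bullet> y))) = exp (- t * (norm y)\<^sup>2) * (2 - 2 * cos (x \<bullet> y)) ^ m" for y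
    unfolding dcoef_cos[symmetric] by (simp add: sum_distrib_left mult_ac)
  ultimately show ?thesis by (simp add: sum_distrib_left mult_ac power_mult_distrib)
qed

text \<open>
  The constant that appears when the kernel \<open>norm y powr - (n + 2 s)\<close> is written as a superposition of
  Gaussians; it links the two branches of \<open>frac_const\<close>.
\<close>

definition symbol_sum :: "nat \<Rightarrow> real \<Rightarrow> real" where
  "symbol_sum m s = exp_sum_value s {- int m..int m} (dcoef m) (\<lambda>k. (of_int k)\<^sup>2)"

text \<open>
  At integer \<open>s\<close> scaling produces an extra term with \<open>ln r\<close>, which the vanishing moment of order \<open>2 s\<close>
  removes.
\<close>

lemma exp_sum_value_dcoef_scale:
  fixes r :: real
  assumes r: "r > 0" and s: "s > 0" "s < real m"
  shows "exp_sum_value s {- int m..int m} (dcoef m) (\<lambda>k. (of_int k)\<^sup>2 * r\<^sup>2) = r powr (2 * s) * symbol_sum m s"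
proof -
  have rp: "(r\<^sup>2) powr s = r powr (2 * s)"
  proof -
    have "r\<^sup>2 = r powr 2" using r by simp
    then show ?thesis by (simp only: powr_powr)
  qed
  have split: "((of_int k)\<^sup>2 * r\<^sup>2) powr s = r powr (2 * s) * (of_int k)\<^sup>2 powr s" for k :: int
    using r rp by (simp add: powr_mult)
  show ?thesis
  proof (cases "s \<in> \<nat>")
    case True
    then obtain j where j: "s = real j" by (auto elim: Nats_cases)
    have z: "(\<Sum>k\<in>{- int m..int m}. dcoef m k * (of_int k)\<^sup>2 powr s) = 0"
    proof -
      have "(of_int k :: real)\<^sup>2 powr s = of_int k ^ (2 * j)" for k :: int
        using j s by (cases "k = 0") (auto simp: powr_realpow power_mult)
      then show ?thesis using dcoef_moment[of "2*j" m] j s by simp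
    qed
    have "(\<Sum>k\<in>{- int m..int m}. dcoef m k * ((of_int k)\<^sup>2 * r\<^sup>2) powr s * ln ((of_int k)\<^sup>2 * r\<^sup>2))
      = (\<Sum>k\<in>{- int m..int m}. r powr (2 * s) * (dcoef m k * (of_int k)\<^sup>2 powr s * ln ((of_int k)\<^sup>2))
           + r powr (2 * s) * ln (r\<^sup>2) * (dcoef m k * (of_int k)\<^sup>2 powr s))"
    proof (intro sum.cong refl)
      fix k :: int
      show "dcoef m k * ((of_int k)\<^sup>2 * r\<^sup>2) powr s * ln ((of_int k)\<^sup>2 * r\<^sup>2) = r powr (2 * s) * (dcoef m k * (of_int k)\<^sup>2 powr s * ln ((of_int k)\<^sup>2))
           + r powr (2 * s) * ln (r\<^sup>2) * (dcoef m k * (of_int k)\<^sup>2 powr s)"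
        unfolding split using r by (cases "k = 0") (simp_all add: ln_mult algebra_simps)
    qed
    also have "\<dots> = r powr (2 * s) * (\<Sum>k\<in>{- int m..int m}. dcoef m k * (of_int k)\<^sup>2 powr s * ln ((of_int k)\<^sup>2))"
      by (simp add: sum.distrib sum_distrib_left[symmetric] z)
    finally show ?thesis using True by (simp add: exp_sum_value_def symbol_sum_def)
  next
    case False
    then show ?thesis
      unfolding exp_sum_value_def symbol_sum_def split by (simp add: sum_distrib_left mult_ac)
  qed
qed

lemma exp_sum_dcoef_integral:
  fixes r :: real
  assumes r: "r > 0" and s: "s > 0" "s < real m"
  shows "has_bochner_integral lborel (\<lambda>x. indicator {0<..} x * (x powr (- s - 1) * (\<Sum>k\<in>{- int m..int m}. dcoef m k * exp (- ((of_int k)\<^sup>2 * r\<^sup>2) * x)))) (r powr (2 * s) * symbol_sum m s)"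
  unfolding exp_sum_value_dcoef_scale[OF assms, symmetric]
proof (rule exp_sum_integral[where N=m])
  fix j assume "j < m"
  then show "(\<Sum>k\<in>{- int m..int m}. dcoef m k * ((of_int k)\<^sup>2 * r\<^sup>2) ^ j) = 0"
    using dcoef_moment[of "2*j" m] by (simp add: power_mult_distrib power_mult[symmetric] sum_distrib_right[symmetric] mult.assoc[symmetric])
qed (use assms in auto)

lemma sum_symmetric_int:
  fixes f :: "int \<Rightarrow> real"
  assumes "f 0 = 0" "\<And>k. f (- k) = f k"
  shows "(\<Sum>k\<in>{- int m..int m}. f k) = 2 * (\<Sum>k=1..m. f (int k))"
proof (induction m)
  case (Suc m)
  have "{- int (Suc m)..int (Suc m)} = insert (- int (Suc m)) (insert (int (Suc m)) {- int m..int m})" by auto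
  then have "(\<Sum>k\<in>{- int (Suc m)..int (Suc m)}. f k) = f (- int (Suc m)) + (f (int (Suc m)) + (\<Sum>k\<in>{- int m..int m}. f k))"
    by simp
  then show ?case using Suc assms(2)[of "int (Suc m)"] by simp
qed (simp add: assms)

lemma dcoef_minus: "dcoef m (- k) = dcoef m k" if "\<bar>k\<bar> \<le> int m"
proof -
  have 1: "(-1::real) powi (-k) = (-1) powi k" by (simp add: power_int_minus_one_minus)
  have "nat (int m + k) = 2 * m - nat (int m - k)" "nat (int m - k) \<le> 2 * m" using that by auto
  then have "(2 * m) choose nat (int m + k) = (2 * m) choose nat (int m - k)" using binomial_symmetric by metis
  then show ?thesis unfolding dcoef_def 1 by simp
qed

text \<open>
  Both branches of \<open>frac_const\<close> contain the inverse of a multiple of \<open>symbol_sum\<close>. The case distinction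
  records the convention \<open>inverse 0 = 0\<close> until \<open>symbol_sum\<close> is known to be positive.
\<close>

lemma frac_const_times_symbol_sum_or_0:
  assumes s: "s > 0" "s < real m" 
  shows "frac_const n m s * symbol_sum m s = (if symbol_sum m s = 0 then 0 else 2 * (4 powr s * Gamma (real n / 2 + s) / pi powr (real n / 2)))"
proof -
  have sq: "(of_int k :: real)\<^sup>2 powr s = \<bar>of_int k\<bar> powr (2 * s)" for k :: int
  proof -
    have "(of_int k :: real)\<^sup>2 = \<bar>of_int k\<bar> powr 2" by simp
    then show ?thesis by (simp only: powr_powr)
  qed
  show ?thesis
proof (cases "s \<in> \<nat>")
  case False
  define S where "S = (\<Sum>k=1..m. (-1) ^ k * real ((2 * m) choose (m - k)) * real k powr (2 * s))"
  have "(\<Sum>k\<in>{- int m..int m}. dcoef m k * (of_int k)\<^sup>2 powr s) = (\<Sum>k\<in>{- int m..int m}. (if \<bar>k\<bar> \<le> int m then dcoef m k else 0) * (of_int k)\<^sup>2 powr s)"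
    by (intro sum.cong) auto
  also have "\<dots> = 2 * (\<Sum>k=1..m. (if \<bar>int k\<bar> \<le> int m then dcoef m (int k) else 0) * (of_int (int k))\<^sup>2 powr s)"
    by (rule sum_symmetric_int) (auto simp: dcoef_minus)
  also have "\<dots> = 2 * S"
    unfolding S_def using s by (intro arg_cong[where f="\<lambda>x. 2 * x"] sum.cong refl) (auto simp: dcoef_def sq[of "int _", simplified] nat_diff_distrib')
  finally have "symbol_sum m s = Gamma (- s) * (2 * S)" using False by (simp add: symbol_sum_def exp_sum_value_def)
  then show ?thesis using False unfolding frac_const_def S_def[symmetric]
    by (auto simp: field_simps)
next
  case True
  then obtain j where j: "s = real j" by (auto elim: Nats_cases)
  define S where "S = (\<Sum>k=2..m. (-1) powi (int k - \<lfloor>s\<rfloor> + 1) * real ((2 * m) choose (m - k)) * real k powr (2 * s) * ln (real k))"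
  have "(\<Sum>k\<in>{- int m..int m}. dcoef m k * (of_int k)\<^sup>2 powr s * ln ((of_int k)\<^sup>2)) = (\<Sum>k\<in>{- int m..int m}. (if \<bar>k\<bar> \<le> int m then dcoef m k else 0) * (of_int k)\<^sup>2 powr s * ln ((of_int k)\<^sup>2))"
    by (intro sum.cong) auto
  also have "\<dots> = 2 * (\<Sum>k=1..m. (if \<bar>int k\<bar> \<le> int m then dcoef m (int k) else 0) * (of_int (int k))\<^sup>2 powr s * ln ((of_int (int k))\<^sup>2))"
    by (rule sum_symmetric_int) (auto simp: dcoef_minus)
  also have "(\<Sum>k=1..m. (if \<bar>int k\<bar> \<le> int m then dcoef m (int k) else 0) * (of_int (int k))\<^sup>2 powr s * ln ((of_int (int k))\<^sup>2))
    = (\<Sum>k=2..m. (if \<bar>int k\<bar> \<le> int m then dcoef m (int k) else 0) * (of_int (int k))\<^sup>2 powr s * ln ((of_int (int k))\<^sup>2))"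
  proof (rule sum.mono_neutral_right)
    show "\<forall>k\<in>{1..m} - {2..m}. (if \<bar>int k\<bar> \<le> int m then dcoef m (int k) else 0) * (of_int (int k))\<^sup>2 powr s * ln ((of_int (int k))\<^sup>2) = 0"
    proof
      fix k assume "k \<in> {1..m} - {2..m}"
      then have "k = 1" by auto
      then show "(if \<bar>int k\<bar> \<le> int m then dcoef m (int k) else 0) * (of_int (int k))\<^sup>2 powr s * ln ((of_int (int k))\<^sup>2) = 0" by simp
    qed
  qed auto
  also have "\<dots> = 2 * (-1) ^ (j + 1) * S"
    unfolding S_def sum_distrib_left
  proof (intro sum.cong refl)
    fix k assume k: "k \<in> {2..m}"
    have "ln ((real k)\<^sup>2) = 2 * ln (real k)" using k by (simp add: ln_realpow)
    moreover have "(-1) powi (int k - \<lfloor>s\<rfloor> + 1) = (-1::real) ^ k * (-1) ^ (j + 1)"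
      by (cases "even j") (simp_all add: j power_int_add power_int_diff power_int_minus_one_minus)
    ultimately show "(if \<bar>int k\<bar> \<le> int m then dcoef m (int k) else 0) * (of_int (int k))\<^sup>2 powr s * ln ((of_int (int k))\<^sup>2)
      = 2 * (-1) ^ (j + 1) * ((-1) powi (int k - \<lfloor>s\<rfloor> + 1) * real ((2 * m) choose (m - k)) * real k powr (2 * s) * ln (real k))"
      using k sq[of "int k"] by (cases "even j") (simp_all add: dcoef_def nat_diff_distrib')
  qed
  finally have ss: "symbol_sum m s = 4 / fact j * S"
    using True by (simp add: symbol_sum_def exp_sum_value_def j)
  have c: "frac_const n m s = 4 powr s * Gamma (real n / 2 + s) * fact j / (2 * pi powr (real n / 2)) * inverse S"
    using True unfolding frac_const_def S_def[symmetric] by (simp add: j)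
  show ?thesis unfolding ss c by (simp add: field_simps)
qed
qed

lemma has_bochner_integral_ge_0:
  fixes f :: "'b \<Rightarrow> real"
  assumes "has_bochner_integral M f x" "\<And>y. f y \<ge> 0"
  shows "x \<ge> 0"
  using assms integral_nonneg_AE[of f M] by (auto simp: has_bochner_integral_iff)

text \<open>
  The exponential sum is, up to a positive factor, a Gaussian average of \<open>(2 - 2 cos) ^ m\<close>, hence
  nonnegative, and it tends to a binomial coefficient at infinity, hence is not zero almost everywhere.
\<close>

lemma symbol_sum_pos:
  assumes s: "s > 0" "s < real m"
  shows "symbol_sum m s > 0"
proof -
  define G where "G = (\<lambda>x. \<Sum>k\<in>{- int m..int m}. dcoef m k * exp (- ((of_int k)\<^sup>2 * 1\<^sup>2) * x))"
  define f where "f = (\<lambda>x. indicator {0<..} x * (x powr (- s - 1) * G x))"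
  have hbi: "has_bochner_integral lborel f (symbol_sum m s)"
    using exp_sum_dcoef_integral[of 1 s m] s unfolding f_def G_def by simp
  have G0: "G x \<ge> 0" if x: "x > 0" for x
  proof -
    define t where "t = 1 / (4 * x)"
    have t: "t > 0" "1 / (4 * t) = x" using x by (auto simp: t_def)
    have "has_bochner_integral lborel (\<lambda>y. exp (- t * (norm y)\<^sup>2) * (2 - 2 * cos ((1::real) \<bullet> y)) ^ m)
     ((pi / t) powr (real DIM(real) / 2) * G x)"
      using gaussian_difference_symbol[OF t(1), of "1::real" m] unfolding t(2) G_def by simp
    then have "0 \<le> (pi / t) powr (real DIM(real) / 2) * G x"
      by (rule has_bochner_integral_ge_0) (auto intro!: mult_nonneg_nonneg zero_le_power)
    then show ?thesis using t x by (simp add: zero_le_mult_iff)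
  qed
  then have f0: "f x \<ge> 0" for x by (auto simp: f_def split: split_indicator)
  have nonneg: "symbol_sum m s \<ge> 0"
    using has_bochner_integral_ge_0[OF hbi] f0 by simp
  have "symbol_sum m s \<noteq> 0"
  proof
    assume "symbol_sum m s = 0"
    then have "AE x in lborel. f x = 0"
      using hbi f0 integral_nonneg_eq_0_iff_AE[of lborel f] by (simp add: has_bochner_integral_iff)
    \<comment> \<open>Only the term \<open>k = 0\<close> survives at infinity.\<close>
    have "((\<lambda>x. dcoef m k * exp (- ((of_int k)\<^sup>2 * 1\<^sup>2) * x)) \<longlongrightarrow> (if k = 0 then dcoef m 0 else 0)) at_top" for k :: int
    proof (cases "k = 0")
      case False
      then have "((\<lambda>x::real. exp (- ((of_int k)\<^sup>2 * 1\<^sup>2) * x)) \<longlongrightarrow> 0) at_top"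
        by (intro filterlim_compose[OF exp_at_bot] filterlim_tendsto_neg_mult_at_bot[OF tendsto_const] filterlim_ident) auto
      then show ?thesis using False tendsto_mult_right_zero by auto
    qed simp
    then have "(G \<longlongrightarrow> (\<Sum>k\<in>{- int m..int m}. if k = 0 then dcoef m 0 else 0)) at_top"
      unfolding G_def by (intro tendsto_sum)
    also have "(\<Sum>k\<in>{- int m..int m}. if k = 0 then dcoef m 0 else 0) = real ((2*m) choose m)"
      by (simp add: dcoef_def)
    finally have "\<forall>\<^sub>F x in at_top. G x > 0"
      by (rule order_tendstoD) auto
    then obtain R where R: "\<And>x. x \<ge> R \<Longrightarrow> G x > 0" by (auto simp: eventually_at_top_linorder)
    define R' where "R' = max R 1"
    have "AE x in lborel. x \<notin> {R'..R' + 1}"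
      using \<open>AE x in lborel. f x = 0\<close>
    proof eventually_elim
      case (elim x)
      then show ?case using R[of x] by (auto simp: f_def R'_def)
    qed
    then have "emeasure lborel {R'..R' + 1} = 0"
      by (subst (asm) AE_iff_null_sets[symmetric]) auto
    then show False by simp
  qed
  then show ?thesis using nonneg by simp
qed

lemma frac_const_times_symbol_sum:
  assumes s: "s > 0" "s < real m" 
  shows "frac_const n m s * symbol_sum m s = 2 * (4 powr s * Gamma (real n / 2 + s) / pi powr (real n / 2))"
  using frac_const_times_symbol_sum_or_0[OF assms] symbol_sum_pos[OF assms] by simp

lemma frac_const_pos:
  assumes s: "s > 0" "s < real m" 
  shows "frac_const n m s > 0"
proof -
  have "frac_const n m s * symbol_sum m s > 0"
    unfolding frac_const_times_symbol_sum[OF assms] using s by (intro mult_pos_pos divide_pos_pos Gamma_real_pos) auto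
  then show ?thesis using symbol_sum_pos[OF assms] by (simp add: zero_less_mult_iff)
qed

text \<open>
  Subordination: \<open>norm y powr (- 2 p)\<close> is a Gamma-type superposition of the Gaussians
  \<open>exp (- (norm y)\<^sup>2 / (4 \<sigma>))\<close>. All terms are nonnegative, so the integrals over \<open>y\<close> and \<open>\<sigma>\<close> may be
  exchanged, the inner one is Gaussian, and the outer one is \<open>exp_sum_integral\<close>. The constant in the
  definition of the fractional Laplacian is exactly the one that normalises the symbol.
\<close>

theorem fractional_symbol:
  fixes \<xi> :: "'a::euclidean_space"
  assumes s: "s > 0" "s < real m" 
  shows "(\<integral>\<^sup>+ y. ennreal ((2 - 2 * cos (\<xi> \<bullet> y)) ^ m / norm y powr (real DIM('a) + 2 * s)) \<partial>lborel)
    = ennreal (2 / frac_const DIM('a) m s * norm \<xi> powr (2 * s))"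
proof (cases "\<xi> = 0")
  case True
  then show ?thesis using s by (cases m) auto
next
  case False
  define n where "n = DIM('a)"
  define p where "p = real n / 2 + s"
  have p: "p > 0" using s by (simp add: p_def)
  define r where "r = norm \<xi>"
  have r: "r > 0" using False by (simp add: r_def)
  define W where "W = (\<lambda>y. (2 - 2 * cos (\<xi> \<bullet> y)) ^ m)"
  have W0: "W y \<ge> 0" for y by (simp add: W_def zero_le_power)
  have [measurable]: "W \<in> borel_measurable borel" unfolding W_def by measurable
  define h where "h = (\<lambda>\<sigma> (y::'a). ennreal (indicator {0<..} \<sigma> * (\<sigma> powr (- p - 1) * exp (- ((norm y)\<^sup>2 / 4) / \<sigma>))) * ennreal (W y))"
  have K: "(\<integral>\<^sup>+ \<sigma>. h \<sigma> y \<partial>lborel) = ennreal (Gamma p * 4 powr p) * ennreal (W y / norm y powr (real n + 2 * s))" if y: "y \<noteq> 0" for y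
  proof -
    have "(\<integral>\<^sup>+ \<sigma>. h \<sigma> y \<partial>lborel) = (\<integral>\<^sup>+ \<sigma>. ennreal (indicator {0<..} \<sigma> * (\<sigma> powr (- p - 1) * exp (- ((norm y)\<^sup>2 / 4) / \<sigma>))) \<partial>lborel) * ennreal (W y)"
      unfolding h_def by (rule nn_integral_multc) measurable
    also have "(\<integral>\<^sup>+ \<sigma>. ennreal (indicator {0<..} \<sigma> * (\<sigma> powr (- p - 1) * exp (- ((norm y)\<^sup>2 / 4) / \<sigma>))) \<partial>lborel) = ennreal (Gamma p * ((norm y)\<^sup>2 / 4) powr (- p))"
      using has_bochner_integral_inverse_Gamma[OF p, of "(norm y)\<^sup>2 / 4"] y
      by (subst nn_integral_eq_integral) (auto simp: has_bochner_integral_iff)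
    also have "((norm y)\<^sup>2 / 4) powr (- p) = 4 powr p / norm y powr (real n + 2 * s)"
    proof -
      have "(norm y)\<^sup>2 = norm y powr 2" by simp
      then have "(norm y)\<^sup>2 powr p = norm y powr (2 * p)" by (simp only: powr_powr)
      also have "2 * p = real n + 2 * s" by (simp add: p_def)
      finally show ?thesis by (simp add: powr_minus powr_divide)
    qed
    finally show ?thesis using p W0 by (simp add: ennreal_mult[symmetric] Gamma_real_pos less_imp_le)
  qed
  define R where "R = (\<lambda>\<sigma>. indicator {0<..} \<sigma> * (\<sigma> powr (- s - 1) * (\<Sum>k\<in>{- int m..int m}. dcoef m k * exp (- ((of_int k)\<^sup>2 * r\<^sup>2) * \<sigma>))))"
  have [measurable]: "R \<in> borel_measurable borel" unfolding R_def by measurable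
  have L: "(\<integral>\<^sup>+ y. h \<sigma> y \<partial>lborel) = ennreal ((4 * pi) powr (real n / 2)) * ennreal (R \<sigma>)"
    and R0: "R \<sigma> \<ge> 0" for \<sigma>
  proof -
    let ?G = "\<Sum>k\<in>{- int m..int m}. dcoef m k * exp (- ((of_int k)\<^sup>2 * r\<^sup>2) * \<sigma>)"
    have *: "(\<integral>\<^sup>+ y. h \<sigma> y \<partial>lborel) = ennreal ((4 * pi) powr (real n / 2)) * ennreal (R \<sigma>) \<and> R \<sigma> \<ge> 0"
    proof (cases "\<sigma> > 0")
      case True
      define t where "t = 1 / (4 * \<sigma>)"
      have t: "t > 0" "1 / (4 * t) = \<sigma>" "pi / t = 4 * pi * \<sigma>" using True by (auto simp: t_def)
      have hb: "has_bochner_integral lborel (\<lambda>y. exp (- t * (norm y)\<^sup>2) * W y) ((4 * pi * \<sigma>) powr (real n / 2) * ?G)"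
        using gaussian_difference_symbol[OF t(1), of \<xi> m] unfolding t(2,3) W_def n_def r_def .
      have G0: "(4 * pi * \<sigma>) powr (real n / 2) * ?G \<ge> 0"
        using hb by (rule has_bochner_integral_ge_0) (auto intro!: mult_nonneg_nonneg W0)
      then have G0': "?G \<ge> 0" using True by (simp add: zero_le_mult_iff)
      have "(\<integral>\<^sup>+ y. h \<sigma> y \<partial>lborel) = (\<integral>\<^sup>+ y. ennreal (\<sigma> powr (- p - 1)) * ennreal (exp (- t * (norm y)\<^sup>2) * W y) \<partial>lborel)"
        unfolding h_def using True W0 by (intro nn_integral_cong) (simp add: ennreal_mult[symmetric] t_def field_simps)
      also have "\<dots> = ennreal (\<sigma> powr (- p - 1)) * (\<integral>\<^sup>+ y. ennreal (exp (- t * (norm y)\<^sup>2) * W y) \<partial>lborel)"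
        by (rule nn_integral_cmult) measurable
      also have "(\<integral>\<^sup>+ y. ennreal (exp (- t * (norm y)\<^sup>2) * W y) \<partial>lborel) = ennreal ((4 * pi * \<sigma>) powr (real n / 2) * ?G)"
        using hb W0 by (subst nn_integral_eq_integral) (auto simp: has_bochner_integral_iff)
      also have "ennreal (\<sigma> powr (- p - 1)) * \<dots> = ennreal (\<sigma> powr (- p - 1) * ((4 * pi * \<sigma>) powr (real n / 2) * ?G))"
        using G0 by (simp add: ennreal_mult)
      also have "\<sigma> powr (- p - 1) * ((4 * pi * \<sigma>) powr (real n / 2) * ?G) = (4 * pi) powr (real n / 2) * ((\<sigma> powr (- p - 1) * \<sigma> powr (real n / 2)) * ?G)"
        using True by (simp add: powr_mult)
      also have "\<sigma> powr (- p - 1) * \<sigma> powr (real n / 2) = \<sigma> powr (- s - 1)"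
        unfolding powr_add[symmetric] by (simp add: p_def)
      finally show ?thesis using True G0' by (simp add: ennreal_mult R_def)
    qed (simp add: h_def R_def)
    show "(\<integral>\<^sup>+ y. h \<sigma> y \<partial>lborel) = ennreal ((4 * pi) powr (real n / 2)) * ennreal (R \<sigma>)" "R \<sigma> \<ge> 0"
      using * by auto
  qed
  have hm[measurable]: "case_prod h \<in> borel_measurable (borel \<Otimes>\<^sub>M borel)"
    unfolding h_def by measurable
  have "ennreal (Gamma p * 4 powr p) * (\<integral>\<^sup>+ y. ennreal (W y / norm y powr (real n + 2 * s)) \<partial>lborel)
    = (\<integral>\<^sup>+ y. ennreal (Gamma p * 4 powr p) * ennreal (W y / norm y powr (real n + 2 * s)) \<partial>lborel)"
    by (rule nn_integral_cmult[symmetric]) measurable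
  also have "\<dots> = (\<integral>\<^sup>+ y. \<integral>\<^sup>+ \<sigma>. h \<sigma> y \<partial>lborel \<partial>lborel)"
    using AE_lborel_singleton[of "0::'a"] by (intro nn_integral_cong_AE) (auto simp: K)
  also have "\<dots> = (\<integral>\<^sup>+ \<sigma>. \<integral>\<^sup>+ y. h \<sigma> y \<partial>lborel \<partial>lborel)"
    by (rule lborel_pair.Fubini') (simp add: hm)
  also have "\<dots> = ennreal ((4 * pi) powr (real n / 2)) * (\<integral>\<^sup>+ \<sigma>. ennreal (R \<sigma>) \<partial>lborel)"
    unfolding L by (rule nn_integral_cmult) measurable
  also have "(\<integral>\<^sup>+ \<sigma>. ennreal (R \<sigma>) \<partial>lborel) = ennreal (r powr (2 * s) * symbol_sum m s)"
    using exp_sum_dcoef_integral[OF r s] R0 unfolding R_def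
    by (subst nn_integral_eq_integral) (auto simp: has_bochner_integral_iff)
  finally have "ennreal (Gamma p * 4 powr p) * (\<integral>\<^sup>+ y. ennreal (W y / norm y powr (real n + 2 * s)) \<partial>lborel)
     = ennreal ((4 * pi) powr (real n / 2)) * ennreal (r powr (2 * s) * symbol_sum m s)" .
  then have "ennreal (1 / (Gamma p * 4 powr p)) * (ennreal (Gamma p * 4 powr p) * (\<integral>\<^sup>+ y. ennreal (W y / norm y powr (real n + 2 * s)) \<partial>lborel))
     = ennreal (1 / (Gamma p * 4 powr p)) * (ennreal ((4 * pi) powr (real n / 2)) * ennreal (r powr (2 * s) * symbol_sum m s))" by simp
  then have "(\<integral>\<^sup>+ y. ennreal (W y / norm y powr (real n + 2 * s)) \<partial>lborel) 
     = ennreal (1 / (Gamma p * 4 powr p) * ((4 * pi) powr (real n / 2) * (r powr (2 * s) * symbol_sum m s)))"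
    using Gamma_real_pos[OF p] symbol_sum_pos[OF s]
    by (simp add: mult.assoc[symmetric] ennreal_mult[symmetric])
  also have "1 / (Gamma p * 4 powr p) * ((4 * pi) powr (real n / 2) * (r powr (2 * s) * symbol_sum m s)) = 2 / frac_const n m s * r powr (2 * s)"
  proof -
    have g: "Gamma p > 0" by (rule Gamma_real_pos[OF p])
    have "4 powr p = 4 powr (real n / 2) * 4 powr s" by (simp add: p_def powr_add)
    moreover have "(4 * pi) powr (real n / 2) = 4 powr (real n / 2) * pi powr (real n / 2)" by (simp add: powr_mult)
    ultimately have eq: "1 / (Gamma p * 4 powr p) * ((4 * pi) powr (real n / 2) * (r powr (2 * s) * symbol_sum m s))
       = pi powr (real n / 2) / (Gamma p * 4 powr s) * symbol_sum m s * r powr (2 * s)"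
      by simp
    have ss: "symbol_sum m s = 2 * (4 powr s * Gamma p / pi powr (real n / 2)) / frac_const n m s"
      using frac_const_times_symbol_sum[OF s, of n] frac_const_pos[OF s, of n] unfolding p_def by (simp add: field_simps)
    show ?thesis by (subst eq, subst ss) (use g in simp)
  qed
  finally show ?thesis unfolding W_def n_def r_def .
qed

section \<open>The Fourier transform on integrable functions\<close>

lemma nn_integral_lborel_affine:
  fixes f :: "'a::euclidean_space \<Rightarrow> ennreal"
  assumes [measurable]: "f \<in> borel_measurable borel" and c: "c \<noteq> 0"
  shows "(\<integral>\<^sup>+x. f x \<partial>lborel) = ennreal (\<bar>c\<bar> ^ DIM('a)) * (\<integral>\<^sup>+x. f (t + c *\<^sub>R x) \<partial>lborel)"
  by (subst lborel_affine[OF c, of t]) (simp add: nn_integral_density nn_integral_distr nn_integral_cmult)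

lemma integrable_lborel_affine:
  fixes f :: "'a::euclidean_space \<Rightarrow> 'b::{banach, second_countable_topology}"
  assumes f: "integrable lborel f" and c: "c \<noteq> 0"
  shows "integrable lborel (\<lambda>x. f (t + c *\<^sub>R x))"
proof -
  have [measurable]: "f \<in> borel_measurable borel" using borel_measurable_integrable[OF f] by simp
  have "ennreal (\<bar>c\<bar> ^ DIM('a)) * (\<integral>\<^sup>+x. ennreal (norm (f (t + c *\<^sub>R x))) \<partial>lborel) < \<infinity>"
    using f nn_integral_lborel_affine[of "\<lambda>x. ennreal (norm (f x))" c t] c unfolding integrable_iff_bounded by simp
  then show ?thesis using c unfolding integrable_iff_bounded by (auto simp: ennreal_mult_less_top)
qed

lemma lborel_integral_affine:
  fixes f :: "'a::euclidean_space \<Rightarrow> 'b::{banach, second_countable_topology}"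
  assumes f: "integrable lborel f" and c: "c \<noteq> 0"
  shows "(\<integral>x. f x \<partial>lborel) = \<bar>c\<bar> ^ DIM('a) *\<^sub>R (\<integral>x. f (t + c *\<^sub>R x) \<partial>lborel)"
proof -
  have [measurable]: "f \<in> borel_measurable borel" using borel_measurable_integrable[OF f] by simp
  show ?thesis using integrable_lborel_affine[OF assms, of t]
    by (subst lborel_affine[OF c, of t]) (simp add: integral_density integral_distr)
qed

text \<open>
  The Fourier integral in the normalisation of \<open>fourier_ball\<close>, without truncation.
\<close>

definition FT :: "('a::euclidean_space \<Rightarrow> real) \<Rightarrow> 'a \<Rightarrow> complex" where
  "FT f \<xi> = of_real ((2 * pi) powr (- real DIM('a) / 2)) * (\<integral>x. exp (- \<i> * of_real (x \<bullet> \<xi>)) * of_real (f x) \<partial>lborel)"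

lemma norm_exp_ii_neg [simp]: "norm (exp (- (\<i> * complex_of_real t))) = 1"
  using norm_exp_i_times[of "-t"] by simp

lemma FT_integrand_integrable:
  fixes f :: "'a::euclidean_space \<Rightarrow> real"
  assumes "integrable lborel f"
  shows "integrable lborel (\<lambda>x. exp (- \<i> * of_real (x \<bullet> \<xi>)) * complex_of_real (f x))"
proof -
  have [measurable]: "f \<in> borel_measurable borel" using borel_measurable_integrable[OF assms] by simp
  show ?thesis
    by (rule Bochner_Integration.integrable_bound[OF assms]) (auto simp: norm_mult)
qed

lemma FT_norm_le:
  fixes f :: "'a::euclidean_space \<Rightarrow> real"
  shows "norm (FT f \<xi>) \<le> (2 * pi) powr (- real DIM('a) / 2) * (\<integral>x. \<bar>f x\<bar> \<partial>lborel)"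
proof -
  have "norm (\<integral>x. exp (- \<i> * of_real (x \<bullet> \<xi>)) * complex_of_real (f x) \<partial>lborel) \<le> (\<integral>x. norm (exp (- \<i> * of_real (x \<bullet> \<xi>)) * complex_of_real (f x)) \<partial>lborel)"
    by (rule integral_norm_bound)
  also have "\<dots> = (\<integral>x. \<bar>f x\<bar> \<partial>lborel)" by (simp add: norm_mult)
  finally show ?thesis unfolding FT_def norm_mult by (simp add: mult_left_mono)
qed

lemma continuous_FT:
  fixes f :: "'a::euclidean_space \<Rightarrow> real"
  assumes "integrable lborel f"
  shows "isCont (FT f) \<xi>"
  unfolding continuous_at_sequentially
proof (intro allI impI)
  fix X assume X: "X \<longlonglongrightarrow> \<xi>"
  have [measurable]: "f \<in> borel_measurable borel" using borel_measurable_integrable[OF assms] by simp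
  have "(\<lambda>k. \<integral>x. exp (- \<i> * of_real (x \<bullet> X k)) * complex_of_real (f x) \<partial>lborel) \<longlonglongrightarrow> (\<integral>x. exp (- \<i> * of_real (x \<bullet> \<xi>)) * complex_of_real (f x) \<partial>lborel)"
  proof (rule integral_dominated_convergence[where w="\<lambda>x. \<bar>f x\<bar>"])
    show "AE x in lborel. (\<lambda>k. exp (- \<i> * of_real (x \<bullet> X k)) * complex_of_real (f x)) \<longlonglongrightarrow> exp (- \<i> * of_real (x \<bullet> \<xi>)) * complex_of_real (f x)"
      using X by (intro AE_I2 tendsto_intros)
  qed (use assms in \<open>auto simp: norm_mult\<close>)
  then show "(FT f \<circ> X) \<longlonglongrightarrow> FT f \<xi>"
    unfolding FT_def o_def by (intro tendsto_mult tendsto_const)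
qed

lemma FT_measurable [measurable]:
  fixes f :: "'a::euclidean_space \<Rightarrow> real"
  assumes [measurable]: "f \<in> borel_measurable borel"
  shows "FT f \<in> borel_measurable borel"
proof -
  have "FT f \<in> borel_measurable lborel" unfolding FT_def by measurable
  then show ?thesis by simp
qed

lemma FT_diff:
  fixes f g :: "'a::euclidean_space \<Rightarrow> real"
  assumes "integrable lborel f" "integrable lborel g"
  shows "FT (\<lambda>x. f x - g x) \<xi> = FT f \<xi> - FT g \<xi>"
  unfolding FT_def using FT_integrand_integrable[OF assms(1), of \<xi>] FT_integrand_integrable[OF assms(2), of \<xi>]
  by (simp add: right_diff_distrib)

lemma FT_cmult:
  fixes f :: "'a::euclidean_space \<Rightarrow> real"
  shows "FT (\<lambda>x. c * f x) \<xi> = of_real c * FT f \<xi>"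
proof -
  have "(\<integral>x. exp (- \<i> * of_real (x \<bullet> \<xi>)) * of_real (c * f x) \<partial>lborel) = (\<integral>x. of_real c * (exp (- \<i> * of_real (x \<bullet> \<xi>)) * of_real (f x)) \<partial>lborel)"
    by (simp add: mult_ac)
  then show ?thesis unfolding FT_def by simp
qed

lemma FT_sum:
  fixes f :: "'i \<Rightarrow> 'a::euclidean_space \<Rightarrow> real"
  assumes "\<And>i. i \<in> I \<Longrightarrow> integrable lborel (f i)"
  shows "FT (\<lambda>x. \<Sum>i\<in>I. f i x) \<xi> = (\<Sum>i\<in>I. FT (f i) \<xi>)"
proof -
  have "(\<integral>x. exp (- \<i> * of_real (x \<bullet> \<xi>)) * of_real (\<Sum>i\<in>I. f i x) \<partial>lborel) = (\<integral>x. (\<Sum>i\<in>I. exp (- \<i> * of_real (x \<bullet> \<xi>)) * of_real (f i x)) \<partial>lborel)"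
    by (simp add: sum_distrib_left)
  also have "\<dots> = (\<Sum>i\<in>I. \<integral>x. exp (- \<i> * of_real (x \<bullet> \<xi>)) * of_real (f i x) \<partial>lborel)"
    using assms by (intro Bochner_Integration.integral_sum FT_integrand_integrable)
  finally show ?thesis unfolding FT_def by (simp add: sum_distrib_left)
qed

lemma FT_affine:
  fixes f :: "'a::euclidean_space \<Rightarrow> real"
  assumes f: "integrable lborel f" and c: "c \<noteq> 0"
  shows "FT (\<lambda>x. f (a + c *\<^sub>R x)) \<xi> = of_real (1 / \<bar>c\<bar> ^ DIM('a)) * exp (\<i> * of_real (a \<bullet> (\<xi> /\<^sub>R c))) * FT f (\<xi> /\<^sub>R c)"
proof -
  let ?g = "\<lambda>x. exp (- \<i> * of_real (x \<bullet> (\<xi> /\<^sub>R c))) * complex_of_real (f x)"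
  have "(\<integral>x. ?g x \<partial>lborel) = \<bar>c\<bar> ^ DIM('a) *\<^sub>R (\<integral>x. ?g (a + c *\<^sub>R x) \<partial>lborel)"
    by (rule lborel_integral_affine[OF FT_integrand_integrable[OF f] c])
  also have "(\<lambda>x. ?g (a + c *\<^sub>R x)) = (\<lambda>x. exp (- \<i> * of_real (a \<bullet> (\<xi> /\<^sub>R c))) * (exp (- \<i> * of_real (x \<bullet> \<xi>)) * of_real (f (a + c *\<^sub>R x))))"
  proof
    fix x
    have "(a + c *\<^sub>R x) \<bullet> (\<xi> /\<^sub>R c) = a \<bullet> (\<xi> /\<^sub>R c) + x \<bullet> \<xi>"
      using c by (simp add: inner_add_left distrib_left)
    then have "- \<i> * of_real ((a + c *\<^sub>R x) \<bullet> (\<xi> /\<^sub>R c)) = - \<i> * of_real (a \<bullet> (\<xi> /\<^sub>R c)) + - \<i> * of_real (x \<bullet> \<xi>)"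
      by (simp only: of_real_add distrib_left)
    then show "?g (a + c *\<^sub>R x) = exp (- \<i> * of_real (a \<bullet> (\<xi> /\<^sub>R c))) * (exp (- \<i> * of_real (x \<bullet> \<xi>)) * of_real (f (a + c *\<^sub>R x)))"
      by (simp only: exp_add mult.assoc)
  qed
  finally have eq: "(\<integral>x. ?g x \<partial>lborel) = \<bar>c\<bar> ^ DIM('a) *\<^sub>R (exp (- \<i> * of_real (a \<bullet> (\<xi> /\<^sub>R c))) * (\<integral>x. exp (- \<i> * of_real (x \<bullet> \<xi>)) * of_real (f (a + c *\<^sub>R x)) \<partial>lborel))"
    by simp
  have e: "exp (\<i> * of_real (a \<bullet> (\<xi> /\<^sub>R c))) * exp (- \<i> * of_real (a \<bullet> (\<xi> /\<^sub>R c))) = 1"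
    by (simp add: exp_add[symmetric])
  have "of_real (1 / \<bar>c\<bar> ^ DIM('a)) * exp (\<i> * of_real (a \<bullet> (\<xi> /\<^sub>R c))) * (\<integral>x. ?g x \<partial>lborel)
    = (exp (\<i> * of_real (a \<bullet> (\<xi> /\<^sub>R c))) * exp (- \<i> * of_real (a \<bullet> (\<xi> /\<^sub>R c)))) * (\<integral>x. exp (- \<i> * of_real (x \<bullet> \<xi>)) * of_real (f (a + c *\<^sub>R x)) \<partial>lborel)"
    unfolding eq using c by (simp add: scaleR_conv_of_real)
  then show ?thesis unfolding FT_def e by (simp add: mult_ac)
qed

lemma integrable_pair_bounded_kernel:
  fixes f :: "'a::euclidean_space \<Rightarrow> complex" and g :: "'b::euclidean_space \<Rightarrow> complex"
  assumes f: "integrable lborel f" and g: "integrable lborel g"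
    and k[measurable]: "(\<lambda>(x, y). k x y) \<in> borel_measurable (borel \<Otimes>\<^sub>M borel)" and kb: "\<And>x y. norm (k x y) \<le> C"
  shows "integrable (lborel \<Otimes>\<^sub>M lborel) (\<lambda>(x, y). f x * g y * k x y :: complex)"
proof -
  have [measurable]: "f \<in> borel_measurable borel" "g \<in> borel_measurable borel"
    using borel_measurable_integrable[OF f] borel_measurable_integrable[OF g] by simp_all
  have C: "C \<ge> 0" using kb[of undefined undefined] norm_ge_zero order_trans by blast
  have "integrable (lborel \<Otimes>\<^sub>M lborel) (\<lambda>(x, y). f x * g y)"
  proof (rule lborel_pair.Fubini_integrable)
    show "integrable lborel (\<lambda>x. \<integral>y. norm (case (x, y) of (x, y) \<Rightarrow> f x * g y) \<partial>lborel)"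
      using f by (simp add: norm_mult)
    show "AE x in lborel. integrable lborel (\<lambda>y. case (x, y) of (x, y) \<Rightarrow> f x * g y)"
      using g by simp
  qed measurable
  then have "integrable (lborel \<Otimes>\<^sub>M lborel) (\<lambda>p. C *\<^sub>R (case p of (x, y) \<Rightarrow> f x * g y))"
    by (rule integrable_scaleR_right)
  then show ?thesis
  proof (rule Bochner_Integration.integrable_bound)
    show "AE p in lborel \<Otimes>\<^sub>M lborel. norm (case p of (x, y) \<Rightarrow> f x * g y * k x y) \<le> norm (C *\<^sub>R (case p of (x, y) \<Rightarrow> f x * g y))"
      using kb C by (auto intro!: AE_I2 simp: norm_mult mult.commute mult_right_mono)
  qed measurable
qed

lemma Fubini_bounded_kernel:
  fixes f :: "'a::euclidean_space \<Rightarrow> complex" and g :: "'b::euclidean_space \<Rightarrow> complex"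
  assumes f: "integrable lborel f" and g: "integrable lborel g"
    and k: "(\<lambda>(x, y). k x y) \<in> borel_measurable (borel \<Otimes>\<^sub>M borel)" and kb: "\<And>x y. norm (k x y) \<le> C"
  shows "(\<integral>x. f x * (\<integral>y. g y * k x y \<partial>lborel) \<partial>lborel) = (\<integral>y. g y * (\<integral>x. f x * k x y \<partial>lborel) \<partial>lborel)"
proof -
  have "(\<integral>y. (\<integral>x. f x * g y * k x y \<partial>lborel) \<partial>lborel) = (\<integral>x. (\<integral>y. f x * g y * k x y \<partial>lborel) \<partial>lborel)"
    using lborel_pair.Fubini_integral[OF integrable_pair_bounded_kernel[OF assms]] by simp
  moreover have "(\<integral>x. f x * g y * k x y \<partial>lborel) = g y * (\<integral>x. f x * k x y \<partial>lborel)" for y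
    by (subst integral_mult_right_zero[symmetric]) (simp add: mult_ac)
  moreover have "(\<integral>y. f x * g y * k x y \<partial>lborel) = f x * (\<integral>y. g y * k x y \<partial>lborel)" for x
    by (subst integral_mult_right_zero[symmetric]) (simp add: mult_ac)
  ultimately show ?thesis by simp
qed

text \<open>
  The multiplication formula: Fubini for two integrable functions and a bounded kernel.
\<close>

lemma FT_multiplication:
  fixes f :: "'a::euclidean_space \<Rightarrow> real" and K :: "'a \<Rightarrow> complex"
  assumes f: "integrable lborel f" and K: "integrable lborel K"
  shows "(\<integral>\<xi>. K \<xi> * FT f \<xi> \<partial>lborel) = of_real ((2 * pi) powr (- real DIM('a) / 2)) * (\<integral>x. of_real (f x) * (\<integral>\<xi>. K \<xi> * exp (- \<i> * of_real (x \<bullet> \<xi>)) \<partial>lborel) \<partial>lborel)"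
    and "(\<integral>\<xi>. K \<xi> * cnj (FT f \<xi>) \<partial>lborel) = of_real ((2 * pi) powr (- real DIM('a) / 2)) * (\<integral>x. of_real (f x) * (\<integral>\<xi>. K \<xi> * exp (\<i> * of_real (x \<bullet> \<xi>)) \<partial>lborel) \<partial>lborel)"
proof -
  define c where "c = complex_of_real ((2 * pi) powr (- real DIM('a) / 2))"
  have f': "integrable lborel (\<lambda>x. complex_of_real (f x))" using f by simp
  have "(\<integral>\<xi>. K \<xi> * FT f \<xi> \<partial>lborel) = (\<integral>\<xi>. c * (K \<xi> * (\<integral>x. of_real (f x) * exp (- \<i> * of_real (x \<bullet> \<xi>)) \<partial>lborel)) \<partial>lborel)"
    unfolding FT_def c_def[symmetric] by (simp only: mult.left_commute mult.commute[of "exp _"])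
  also have "\<dots> = c * (\<integral>\<xi>. K \<xi> * (\<integral>x. of_real (f x) * exp (- \<i> * of_real (x \<bullet> \<xi>)) \<partial>lborel) \<partial>lborel)"
    by (rule integral_mult_right_zero)
  also have "(\<integral>\<xi>. K \<xi> * (\<integral>x. of_real (f x) * exp (- \<i> * of_real (x \<bullet> \<xi>)) \<partial>lborel) \<partial>lborel)
     = (\<integral>x. of_real (f x) * (\<integral>\<xi>. K \<xi> * exp (- \<i> * of_real (x \<bullet> \<xi>)) \<partial>lborel) \<partial>lborel)"
    by (rule Fubini_bounded_kernel[OF K f', where C=1]) simp_all
  finally show "(\<integral>\<xi>. K \<xi> * FT f \<xi> \<partial>lborel) = of_real ((2 * pi) powr (- real DIM('a) / 2)) * (\<integral>x. of_real (f x) * (\<integral>\<xi>. K \<xi> * exp (- \<i> * of_real (x \<bullet> \<xi>)) \<partial>lborel) \<partial>lborel)"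
    unfolding c_def .
  have cn: "cnj (FT f \<xi>) = c * (\<integral>x. of_real (f x) * exp (\<i> * of_real (x \<bullet> \<xi>)) \<partial>lborel)" for \<xi>
  proof -
    have "cnj (\<integral>x. exp (- \<i> * of_real (x \<bullet> \<xi>)) * of_real (f x) \<partial>lborel) = (\<integral>x. cnj (exp (- \<i> * of_real (x \<bullet> \<xi>)) * of_real (f x)) \<partial>lborel)"
      by (rule Bochner_Integration.integral_cnj[symmetric])
    also have "\<dots> = (\<integral>x. of_real (f x) * exp (\<i> * of_real (x \<bullet> \<xi>)) \<partial>lborel)"
      by (intro Bochner_Integration.integral_cong refl) (simp add: exp_cnj mult.commute)
    finally show ?thesis by (simp add: FT_def c_def)
  qed
  have "(\<integral>\<xi>. K \<xi> * cnj (FT f \<xi>) \<partial>lborel) = (\<integral>\<xi>. c * (K \<xi> * (\<integral>x. of_real (f x) * exp (\<i> * of_real (x \<bullet> \<xi>)) \<partial>lborel)) \<partial>lborel)"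
    unfolding cn by (simp only: mult.left_commute)
  also have "\<dots> = c * (\<integral>\<xi>. K \<xi> * (\<integral>x. of_real (f x) * exp (\<i> * of_real (x \<bullet> \<xi>)) \<partial>lborel) \<partial>lborel)"
    by (rule integral_mult_right_zero)
  also have "(\<integral>\<xi>. K \<xi> * (\<integral>x. of_real (f x) * exp (\<i> * of_real (x \<bullet> \<xi>)) \<partial>lborel) \<partial>lborel)
     = (\<integral>x. of_real (f x) * (\<integral>\<xi>. K \<xi> * exp (\<i> * of_real (x \<bullet> \<xi>)) \<partial>lborel) \<partial>lborel)"
    by (rule Fubini_bounded_kernel[OF K f', where C=1]) simp_all
  finally show "(\<integral>\<xi>. K \<xi> * cnj (FT f \<xi>) \<partial>lborel) = of_real ((2 * pi) powr (- real DIM('a) / 2)) * (\<integral>x. of_real (f x) * (\<integral>\<xi>. K \<xi> * exp (\<i> * of_real (x \<bullet> \<xi>)) \<partial>lborel) \<partial>lborel)"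
    unfolding c_def .
qed

text \<open>
  The heat kernel, which is the inverse Fourier transform of \<open>exp (- t * (norm \<xi>)\<^sup>2)\<close> up to normalisation.
\<close>

definition heat :: "real \<Rightarrow> 'a::euclidean_space \<Rightarrow> real" where
  "heat t z = (4 * pi * t) powr (- real DIM('a) / 2) * exp (- (norm z)\<^sup>2 / (4 * t))"

lemma heat_nonneg: "heat t z \<ge> 0" by (simp add: heat_def)

lemma heat_measurable [measurable]: "heat t \<in> borel_measurable borel"
  unfolding heat_def by measurable

lemma heat_integral:
  assumes t: "t > 0"
  shows "has_bochner_integral lborel (heat t :: 'a::euclidean_space \<Rightarrow> real) 1"
proof -
  define q where "q = 1 / (4 * t)"
  have q: "q > 0" "pi / q = 4 * pi * t" using t by (auto simp: q_def)
  have "has_bochner_integral lborel (\<lambda>y::'a. exp (- q * (norm y)\<^sup>2)) ((4 * pi * t) powr (real DIM('a) / 2))"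
    using has_bochner_integral_Re[OF gaussian_fourier[OF q(1), of "0::'a"]] q(2) by simp
  then have "has_bochner_integral lborel (\<lambda>y::'a. (4 * pi * t) powr (- real DIM('a) / 2) * exp (- q * (norm y)\<^sup>2)) ((4 * pi * t) powr (- real DIM('a) / 2) * (4 * pi * t) powr (real DIM('a) / 2))"
    by (rule has_bochner_integral_mult_right)
  moreover have "(4 * pi * t) powr (- real DIM('a) / 2) * (4 * pi * t) powr (real DIM('a) / 2) = 1"
    using t by (simp add: powr_add[symmetric])
  ultimately show ?thesis by (simp add: heat_def[abs_def] q_def)
qed

lemma heat_convolution_norm: 
  assumes t: "t > 0"
  shows "has_bochner_integral lborel (\<lambda>y::'a::euclidean_space. heat t (x - y)) 1"
    and "has_bochner_integral lborel (\<lambda>y::'a::euclidean_space. heat t (y - x)) 1"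
proof -
  have h: "integrable lborel (heat t :: 'a \<Rightarrow> real)" "integral\<^sup>L lborel (heat t :: 'a \<Rightarrow> real) = 1"
    using heat_integral[OF t] by (auto simp: has_bochner_integral_iff)
  show "has_bochner_integral lborel (\<lambda>y::'a::euclidean_space. heat t (x - y)) 1"
    using integrable_lborel_affine[OF h(1), of "-1" x] lborel_integral_affine[OF h(1), of "-1" x] h(2)
    by (simp add: has_bochner_integral_iff)
  show "has_bochner_integral lborel (\<lambda>y::'a::euclidean_space. heat t (y - x)) 1"
    using integrable_lborel_affine[OF h(1), of 1 "-x"] lborel_integral_affine[OF h(1), of 1 "-x"] h(2)
    by (simp add: has_bochner_integral_iff)
qed

text \<open>
  A Gaussian factor in frequency makes every integral absolutely convergent, and turns the pairing of
  two transforms into a convolution with the heat kernel.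
\<close>

lemma FT_gauss_pairing:
  fixes f g :: "'a::euclidean_space \<Rightarrow> real"
  assumes f: "integrable lborel f" and g: "integrable lborel g" and t: "t > 0"
  shows "(\<integral>\<xi>. of_real (exp (- t * (norm \<xi>)\<^sup>2)) * FT f \<xi> * cnj (FT g \<xi>) \<partial>lborel)
    = of_real (\<integral>y. g y * (\<integral>x. f x * heat t (x - y) \<partial>lborel) \<partial>lborel)"
proof -
  define c where "c = (2 * pi) powr (- real DIM('a) / 2)"
  have [measurable]: "f \<in> borel_measurable borel" "g \<in> borel_measurable borel"
    using borel_measurable_integrable[OF f] borel_measurable_integrable[OF g] by simp_all
  have G: "integrable lborel (\<lambda>\<xi>::'a. complex_of_real (exp (- t * (norm \<xi>)\<^sup>2)))"
    using gaussian_fourier[OF t, of "0::'a"] by (simp add: has_bochner_integral_iff)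
  have K: "integrable lborel (\<lambda>\<xi>::'a. complex_of_real (exp (- t * (norm \<xi>)\<^sup>2)) * h \<xi>)"
    if h: "h \<in> borel_measurable borel" "\<And>\<xi>. norm (h \<xi>) \<le> C" for h :: "'a \<Rightarrow> complex" and C
  proof (rule Bochner_Integration.integrable_bound)
    show "integrable lborel (\<lambda>\<xi>::'a. C *\<^sub>R complex_of_real (exp (- t * (norm \<xi>)\<^sup>2)))"
      using G by (rule integrable_scaleR_right)
    show "AE \<xi> in lborel. norm (complex_of_real (exp (- t * (norm \<xi>)\<^sup>2)) * h \<xi>) \<le> norm (C *\<^sub>R complex_of_real (exp (- t * (norm \<xi>)\<^sup>2)))"
    proof (intro AE_I2)
      fix \<xi> :: 'a
      have "C \<ge> 0" using h(2)[of \<xi>] norm_ge_zero order_trans by blast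
      then show "norm (complex_of_real (exp (- t * (norm \<xi>)\<^sup>2)) * h \<xi>) \<le> norm (C *\<^sub>R complex_of_real (exp (- t * (norm \<xi>)\<^sup>2)))"
        using h(2)[of \<xi>] by (simp add: norm_mult mult.commute[of C] mult_left_mono)
    qed
  qed (use h(1) in measurable)
  have inner: "(\<integral>\<xi>. (of_real (exp (- t * (norm \<xi>)\<^sup>2)) * exp (\<i> * of_real (y \<bullet> \<xi>))) * exp (- \<i> * of_real (x \<bullet> \<xi>)) \<partial>lborel)
      = of_real (1 / c\<^sup>2 * heat t (x - y))" for x y :: 'a
  proof -
    have "(\<integral>\<xi>. (of_real (exp (- t * (norm \<xi>)\<^sup>2)) * exp (\<i> * of_real (y \<bullet> \<xi>))) * exp (- \<i> * of_real (x \<bullet> \<xi>)) \<partial>lborel)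
        = (\<integral>\<xi>. of_real (exp (- t * (norm \<xi>)\<^sup>2)) * iexp ((y - x) \<bullet> \<xi>) \<partial>lborel)"
    proof (rule Bochner_Integration.integral_cong[OF refl])
      fix \<xi> :: 'a
      have "exp (\<i> * of_real (y \<bullet> \<xi>)) * exp (- \<i> * of_real (x \<bullet> \<xi>)) = iexp ((y - x) \<bullet> \<xi>)"
        unfolding exp_add[symmetric] inner_diff_left of_real_diff
        by (rule arg_cong[where f=exp]) (simp add: algebra_simps)
      then show "of_real (exp (- t * (norm \<xi>)\<^sup>2)) * exp (\<i> * of_real (y \<bullet> \<xi>)) * exp (- \<i> * of_real (x \<bullet> \<xi>)) = of_real (exp (- t * (norm \<xi>)\<^sup>2)) * iexp ((y - x) \<bullet> \<xi>)"
        by (simp only: mult.assoc)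
    qed
    also have "\<dots> = of_real ((pi / t) powr (real DIM('a) / 2) * exp (- (norm (y - x))\<^sup>2 / (4 * t)))"
      using gaussian_fourier[OF t, of "y - x"] by (simp add: has_bochner_integral_iff)
    also have "(pi / t) powr (real DIM('a) / 2) = 1 / c\<^sup>2 * (4 * pi * t) powr (- real DIM('a) / 2)"
    proof -
        define X where "X = (4 * pi * t) powr (real DIM('a) / 2)"
        define Y where "Y = (pi / t) powr (real DIM('a) / 2)"
        have pos: "X > 0" "Y > 0" using t by (auto simp: X_def Y_def)
        have "(4 * pi * t) * (pi / t) = (2 * pi) powr 2" using t by (simp add: power2_eq_square)
        then have "X * Y = ((2 * pi) powr 2) powr (real DIM('a) / 2)"
          unfolding X_def Y_def using t by (subst powr_mult[symmetric]) auto
        also have "\<dots> = (2 * pi) powr (real DIM('a))" by (simp only: powr_powr) simp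
        finally have XY: "(2 * pi) powr (real DIM('a)) = X * Y" by simp
        have "c\<^sup>2 = (2 * pi) powr (- real DIM('a))"
          by (simp add: c_def power2_eq_square powr_add[symmetric])
        then have "c\<^sup>2 = 1 / (X * Y)" using XY by (simp add: powr_minus inverse_eq_divide)
        then have "Y = 1 / c\<^sup>2 * (1 / X)" using pos by simp
        then show ?thesis unfolding X_def Y_def using t by (simp add: powr_minus inverse_eq_divide)
    qed
    finally show ?thesis by (simp add: heat_def norm_minus_commute)
  qed
  have c0: "c > 0" by (simp add: c_def)
  define J where "J = (\<lambda>y. \<integral>x. f x * heat t (x - y) \<partial>lborel)"
  have inner2: "(\<integral>\<xi>. of_real (exp (- t * (norm \<xi>)\<^sup>2)) * FT f \<xi> * exp (\<i> * of_real (y \<bullet> \<xi>)) \<partial>lborel) = of_real (1 / c * J y)" for y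
  proof -
    have "(\<integral>\<xi>. of_real (exp (- t * (norm \<xi>)\<^sup>2)) * FT f \<xi> * exp (\<i> * of_real (y \<bullet> \<xi>)) \<partial>lborel)
      = (\<integral>\<xi>. (of_real (exp (- t * (norm \<xi>)\<^sup>2)) * exp (\<i> * of_real (y \<bullet> \<xi>))) * FT f \<xi> \<partial>lborel)"
      by (simp only: mult.assoc mult.commute[of "FT f _"])
    also have "\<dots> = of_real c * (\<integral>x. of_real (f x) * (\<integral>\<xi>. (of_real (exp (- t * (norm \<xi>)\<^sup>2)) * exp (\<i> * of_real (y \<bullet> \<xi>))) * exp (- \<i> * of_real (x \<bullet> \<xi>)) \<partial>lborel) \<partial>lborel)"
      unfolding c_def by (rule FT_multiplication(1)[OF f K[where C=1]]) auto
    also have "\<dots> = of_real c * (\<integral>x. complex_of_real (1 / c\<^sup>2 * (f x * heat t (x - y))) \<partial>lborel)"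
      unfolding inner of_real_mult[symmetric] by (simp only: mult.left_commute)
    also have "\<dots> = of_real (c * (1 / c\<^sup>2 * J y))"
      unfolding J_def integral_complex_of_real integral_mult_right_zero by (simp only: of_real_mult)
    also have "c * (1 / c\<^sup>2 * J y) = 1 / c * J y" using c0 by (simp add: power2_eq_square)
    finally show ?thesis .
  qed
  have "(\<integral>\<xi>. of_real (exp (- t * (norm \<xi>)\<^sup>2)) * FT f \<xi> * cnj (FT g \<xi>) \<partial>lborel)
    = of_real c * (\<integral>y. of_real (g y) * (\<integral>\<xi>. of_real (exp (- t * (norm \<xi>)\<^sup>2)) * FT f \<xi> * exp (\<i> * of_real (y \<bullet> \<xi>)) \<partial>lborel) \<partial>lborel)"
    unfolding c_def by (rule FT_multiplication(2)[OF g K]) (use f FT_norm_le[of f] in auto)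
  also have "\<dots> = of_real c * (\<integral>y. complex_of_real (1 / c * (g y * J y)) \<partial>lborel)"
    unfolding inner2 of_real_mult[symmetric] by (simp only: mult.left_commute)
  also have "\<dots> = of_real (c * (1 / c * (\<integral>y. g y * J y \<partial>lborel)))"
    unfolding integral_complex_of_real integral_mult_right_zero by (simp only: of_real_mult)
  also have "c * (1 / c * (\<integral>y. g y * J y \<partial>lborel)) = (\<integral>y. g y * J y \<partial>lborel)" using c0 by simp
  finally show ?thesis unfolding J_def .
qed

lemma borel_measurable_cnj [measurable]:
  assumes "f \<in> borel_measurable M"
  shows "(\<lambda>x. cnj (f x)) \<in> borel_measurable M"
  using borel_measurable_continuous_on[OF continuous_on_cnj[OF continuous_on_id] assms] by simp

lemma ennreal_norm_integral_le:
  fixes f :: "'a \<Rightarrow> 'b::{banach, second_countable_topology}"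
  shows "ennreal (norm (integral\<^sup>L M f)) \<le> (\<integral>\<^sup>+x. ennreal (norm (f x)) \<partial>M)"
proof (cases "integrable M f")
  case True
  then show ?thesis by (rule integral_norm_bound_ennreal)
next
  case False
  then show ?thesis by (simp add: not_integrable_integral_eq)
qed

text \<open>
  Schur's test: \<open>\<bar>g x * g y\<bar> \<le> (g x)\<^sup>2 / 2 + (g y)\<^sup>2 / 2\<close>, and the heat kernel has mass 1 in either variable.
\<close>

lemma heat_quadratic_form_le:
  fixes g :: "'a::euclidean_space \<Rightarrow> real"
  assumes [measurable]: "g \<in> borel_measurable borel" and t: "t > 0"
  shows "ennreal \<bar>\<integral>y. g y * (\<integral>x. g x * heat t (x - y) \<partial>lborel) \<partial>lborel\<bar> \<le> (\<integral>\<^sup>+x. ennreal ((g x)\<^sup>2) \<partial>lborel)"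
proof -
  have h1: "(\<integral>\<^sup>+x. ennreal (heat t (x - y)) \<partial>lborel) = 1" for y :: 'a
    using heat_convolution_norm(2)[OF t, of y] heat_nonneg[of t]
    by (subst nn_integral_eq_integral) (auto simp: has_bochner_integral_iff)
  have h2: "(\<integral>\<^sup>+y. ennreal (heat t (x - y)) \<partial>lborel) = 1" for x :: 'a
    using heat_convolution_norm(1)[OF t, of x] heat_nonneg[of t]
    by (subst nn_integral_eq_integral) (auto simp: has_bochner_integral_iff)
  have amgm: "\<bar>g y\<bar> * \<bar>g x\<bar> \<le> (g x)\<^sup>2 / 2 + (g y)\<^sup>2 / 2" for x y
  proof -
    have "2 * (\<bar>g y\<bar> * \<bar>g x\<bar>) \<le> (g x)\<^sup>2 + (g y)\<^sup>2"
      using sum_squares_bound[of "\<bar>g x\<bar>" "\<bar>g y\<bar>"] by (simp add: mult_ac)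
    then show ?thesis by linarith
  qed
  have "ennreal \<bar>\<integral>y. g y * (\<integral>x. g x * heat t (x - y) \<partial>lborel) \<partial>lborel\<bar> \<le> (\<integral>\<^sup>+y. ennreal (norm (g y * (\<integral>x. g x * heat t (x - y) \<partial>lborel))) \<partial>lborel)"
    using ennreal_norm_integral_le[of lborel "\<lambda>y. g y * (\<integral>x. g x * heat t (x - y) \<partial>lborel)"] by simp
  also have "\<dots> \<le> (\<integral>\<^sup>+y. (\<integral>\<^sup>+x. ennreal ((g x)\<^sup>2 / 2) * ennreal (heat t (x - y)) + ennreal ((g y)\<^sup>2 / 2) * ennreal (heat t (x - y)) \<partial>lborel) \<partial>lborel)"
  proof (rule nn_integral_mono)
    fix y :: 'a
    have "ennreal (norm (g y * (\<integral>x. g x * heat t (x - y) \<partial>lborel))) = ennreal \<bar>g y\<bar> * ennreal (norm (\<integral>x. g x * heat t (x - y) \<partial>lborel))"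
      by (simp add: abs_mult ennreal_mult)
    also have "\<dots> \<le> ennreal \<bar>g y\<bar> * (\<integral>\<^sup>+x. ennreal (norm (g x * heat t (x - y))) \<partial>lborel)"
      by (intro mult_left_mono ennreal_norm_integral_le) simp
    also have "\<dots> = (\<integral>\<^sup>+x. ennreal \<bar>g y\<bar> * ennreal (norm (g x * heat t (x - y))) \<partial>lborel)"
      by (rule nn_integral_cmult[symmetric]) measurable
    also have "\<dots> \<le> (\<integral>\<^sup>+x. ennreal ((g x)\<^sup>2 / 2) * ennreal (heat t (x - y)) + ennreal ((g y)\<^sup>2 / 2) * ennreal (heat t (x - y)) \<partial>lborel)"
    proof (rule nn_integral_mono)
      fix x :: 'a
      have "\<bar>g y\<bar> * norm (g x * heat t (x - y)) = (\<bar>g y\<bar> * \<bar>g x\<bar>) * heat t (x - y)"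
        using heat_nonneg[of t "x - y"] by (simp add: abs_mult)
      also have "\<dots> \<le> ((g x)\<^sup>2 / 2 + (g y)\<^sup>2 / 2) * heat t (x - y)"
        using amgm heat_nonneg by (rule mult_right_mono)
      finally have "ennreal (\<bar>g y\<bar> * norm (g x * heat t (x - y))) \<le> ennreal ((g x)\<^sup>2 / 2 * heat t (x - y) + (g y)\<^sup>2 / 2 * heat t (x - y))"
        by (intro ennreal_leI) (simp add: distrib_right)
      moreover have "ennreal ((g x)\<^sup>2 / 2 * heat t (x - y) + (g y)\<^sup>2 / 2 * heat t (x - y)) = ennreal ((g x)\<^sup>2 / 2) * ennreal (heat t (x - y)) + ennreal ((g y)\<^sup>2 / 2) * ennreal (heat t (x - y))"
        using heat_nonneg[of t "x - y"] by (subst ennreal_plus, simp, simp, subst (1 2) ennreal_mult) auto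
      moreover have "ennreal (\<bar>g y\<bar> * norm (g x * heat t (x - y))) = ennreal \<bar>g y\<bar> * ennreal (norm (g x * heat t (x - y)))"
        by (rule ennreal_mult) auto
      ultimately show "ennreal \<bar>g y\<bar> * ennreal (norm (g x * heat t (x - y))) \<le> ennreal ((g x)\<^sup>2 / 2) * ennreal (heat t (x - y)) + ennreal ((g y)\<^sup>2 / 2) * ennreal (heat t (x - y))"
        by (simp only:)
    qed
    finally show "ennreal (norm (g y * (\<integral>x. g x * heat t (x - y) \<partial>lborel))) \<le> (\<integral>\<^sup>+x. ennreal ((g x)\<^sup>2 / 2) * ennreal (heat t (x - y)) + ennreal ((g y)\<^sup>2 / 2) * ennreal (heat t (x - y)) \<partial>lborel)" .
  qed
  also have "\<dots> = (\<integral>\<^sup>+y. (\<integral>\<^sup>+x. ennreal ((g x)\<^sup>2 / 2) * ennreal (heat t (x - y)) \<partial>lborel) + ennreal ((g y)\<^sup>2 / 2) \<partial>lborel)"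
    by (intro nn_integral_cong) (simp add: nn_integral_add nn_integral_cmult h1)
  also have "\<dots> = (\<integral>\<^sup>+y. (\<integral>\<^sup>+x. ennreal ((g x)\<^sup>2 / 2) * ennreal (heat t (x - y)) \<partial>lborel) \<partial>lborel) + (\<integral>\<^sup>+y. ennreal ((g y)\<^sup>2 / 2) \<partial>lborel)"
    by (rule nn_integral_add) measurable
  also have "(\<integral>\<^sup>+y. (\<integral>\<^sup>+x. ennreal ((g x)\<^sup>2 / 2) * ennreal (heat t (x - y)) \<partial>lborel) \<partial>lborel)
     = (\<integral>\<^sup>+x. (\<integral>\<^sup>+y. ennreal ((g x)\<^sup>2 / 2) * ennreal (heat t (x - y)) \<partial>lborel) \<partial>lborel)"
    by (rule lborel_pair.Fubini') measurable
  also have "\<dots> = (\<integral>\<^sup>+x. ennreal ((g x)\<^sup>2 / 2) \<partial>lborel)"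
    by (simp add: nn_integral_cmult h2)
  also have "\<dots> + \<dots> = (\<integral>\<^sup>+x. ennreal ((g x)\<^sup>2 / 2) + ennreal ((g x)\<^sup>2 / 2) \<partial>lborel)"
    by (rule nn_integral_add[symmetric]) measurable
  also have "\<dots> = (\<integral>\<^sup>+x. ennreal ((g x)\<^sup>2) \<partial>lborel)"
    by (intro nn_integral_cong) (simp add: ennreal_plus[symmetric] del: ennreal_plus)
  finally show ?thesis .
qed

text \<open>
  Damp by a Gaussian, where the integral is a heat quadratic form bounded by \<open>\<integral> g\<^sup>2\<close>, and remove the
  damping by Fatou's lemma.
\<close>

theorem FT_bessel:
  fixes g :: "'a::euclidean_space \<Rightarrow> real"
  assumes g: "integrable lborel g" and g2: "integrable lborel (\<lambda>x. (g x)\<^sup>2)"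
  shows "integrable lborel (\<lambda>\<xi>. (norm (FT g \<xi>))\<^sup>2)"
proof -
  have [measurable]: "g \<in> borel_measurable borel"
    using borel_measurable_integrable[OF g] by simp
  define T where "T = (\<lambda>k::nat. 1 / real (Suc k))"
  have T: "T k > 0" for k by (simp add: T_def)
  have Tlim: "T \<longlonglongrightarrow> 0"
    unfolding T_def using LIMSEQ_inverse_real_of_nat by (simp add: inverse_eq_divide)
  have bd: "norm (FT g \<xi>) \<le> (2 * pi) powr (- real DIM('a) / 2) * (\<integral>x. \<bar>g x\<bar> \<partial>lborel)" for \<xi>
    by (rule FT_norm_le)
  have step: "(\<integral>\<^sup>+\<xi>. ennreal (exp (- T k * (norm \<xi>)\<^sup>2) * (norm (FT g \<xi>))\<^sup>2) \<partial>lborel) \<le> (\<integral>\<^sup>+x. ennreal ((g x)\<^sup>2) \<partial>lborel)" for k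
  proof -
    let ?f = "\<lambda>\<xi>. exp (- T k * (norm \<xi>)\<^sup>2) * (norm (FT g \<xi>))\<^sup>2"
    have G: "integrable lborel (\<lambda>\<xi>::'a. exp (- T k * (norm \<xi>)\<^sup>2))"
      using has_bochner_integral_Re[OF gaussian_fourier[OF T[of k], of "0::'a"]] by (simp add: has_bochner_integral_iff)
    define B where "B = ((2 * pi) powr (- real DIM('a) / 2) * (\<integral>x. \<bar>g x\<bar> \<partial>lborel))\<^sup>2"
    have fi: "integrable lborel ?f"
    proof (rule Bochner_Integration.integrable_bound)
      show "integrable lborel (\<lambda>\<xi>::'a. B * exp (- T k * (norm \<xi>)\<^sup>2))" using G by (rule integrable_mult_right)
      show "AE \<xi> in lborel. norm (?f \<xi>) \<le> norm (B * exp (- T k * (norm \<xi>)\<^sup>2))"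
      proof (intro AE_I2)
        fix \<xi> :: 'a
        have "(norm (FT g \<xi>))\<^sup>2 \<le> B" unfolding B_def using bd[of \<xi>] by (intro power_mono) auto
        then show "norm (?f \<xi>) \<le> norm (B * exp (- T k * (norm \<xi>)\<^sup>2))"
          by (simp add: abs_mult mult.commute mult_right_mono)
      qed
    qed measurable
    have "complex_of_real (\<integral>\<xi>. ?f \<xi> \<partial>lborel) = (\<integral>\<xi>. of_real (exp (- T k * (norm \<xi>)\<^sup>2)) * FT g \<xi> * cnj (FT g \<xi>) \<partial>lborel)"
      unfolding integral_complex_of_real[symmetric]
      by (intro Bochner_Integration.integral_cong refl) (simp only: complex_norm_square of_real_mult mult.assoc)
    also have "\<dots> = of_real (\<integral>y. g y * (\<integral>x. g x * heat (T k) (x - y) \<partial>lborel) \<partial>lborel)"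
      by (rule FT_gauss_pairing[OF g g T])
    finally have "(\<integral>\<xi>. ?f \<xi> \<partial>lborel) = (\<integral>y. g y * (\<integral>x. g x * heat (T k) (x - y) \<partial>lborel) \<partial>lborel)"
      by (simp only: of_real_eq_iff)
    then have "ennreal (\<integral>\<xi>. ?f \<xi> \<partial>lborel) \<le> (\<integral>\<^sup>+x. ennreal ((g x)\<^sup>2) \<partial>lborel)"
      using heat_quadratic_form_le[OF _ T[of k], of g] by (simp add: order_trans[OF ennreal_leI[OF abs_ge_self]])
    then show ?thesis using fi by (subst nn_integral_eq_integral) auto
  qed
  have "(\<integral>\<^sup>+\<xi>. ennreal ((norm (FT g \<xi>))\<^sup>2) \<partial>lborel) = (\<integral>\<^sup>+\<xi>. liminf (\<lambda>k. ennreal (exp (- T k * (norm \<xi>)\<^sup>2) * (norm (FT g \<xi>))\<^sup>2)) \<partial>lborel)"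
  proof (intro nn_integral_cong)
    fix \<xi> :: 'a
    have "(\<lambda>k. exp (- T k * (norm \<xi>)\<^sup>2) * (norm (FT g \<xi>))\<^sup>2) \<longlonglongrightarrow> exp (- 0 * (norm \<xi>)\<^sup>2) * (norm (FT g \<xi>))\<^sup>2"
      by (intro tendsto_intros Tlim)
    then have "(\<lambda>k. ennreal (exp (- T k * (norm \<xi>)\<^sup>2) * (norm (FT g \<xi>))\<^sup>2)) \<longlonglongrightarrow> ennreal ((norm (FT g \<xi>))\<^sup>2)"
      by (intro tendsto_ennrealI) simp
    then show "ennreal ((norm (FT g \<xi>))\<^sup>2) = liminf (\<lambda>k. ennreal (exp (- T k * (norm \<xi>)\<^sup>2) * (norm (FT g \<xi>))\<^sup>2))"
      by (rule lim_imp_Liminf[symmetric, rotated]) simp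
  qed
  also have "\<dots> \<le> liminf (\<lambda>k. \<integral>\<^sup>+\<xi>. ennreal (exp (- T k * (norm \<xi>)\<^sup>2) * (norm (FT g \<xi>))\<^sup>2) \<partial>lborel)"
    by (rule nn_integral_liminf) measurable
  also have "\<dots> \<le> (\<integral>\<^sup>+x. ennreal ((g x)\<^sup>2) \<partial>lborel)"
    using step by (intro Liminf_le) auto
  also have "\<dots> < \<infinity>" using g2 unfolding integrable_iff_bounded by simp
  finally show ?thesis by (intro integrableI_bounded) auto
qed

text \<open>
  In the variable \<open>z = (x - y) / sqrt t\<close> the small-time limit becomes dominated convergence.
\<close>

lemma heat_rescale:
  fixes f :: "'a::euclidean_space \<Rightarrow> real"
  assumes t: "t > 0" and f[measurable]: "f \<in> borel_measurable borel" and bd: "\<And>x. \<bar>f x\<bar> \<le> M"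
  shows "(\<integral>x. f x * heat t (x - y) \<partial>lborel) = (\<integral>z. f (y + sqrt t *\<^sub>R z) * heat 1 z \<partial>lborel)"
    and "integrable lborel (\<lambda>x. f x * heat t (x - y))"
proof -
  have hi: "integrable lborel (\<lambda>x. heat t (x - y))"
    using heat_convolution_norm(2)[OF t, of y] by (simp add: has_bochner_integral_iff)
  show int: "integrable lborel (\<lambda>x. f x * heat t (x - y))"
  proof (rule Bochner_Integration.integrable_bound)
    show "integrable lborel (\<lambda>x. M * heat t (x - y))" using hi by (rule integrable_mult_right)
    show "AE x in lborel. norm (f x * heat t (x - y)) \<le> norm (M * heat t (x - y))"
      using bd by (intro AE_I2) (auto simp: abs_mult intro!: mult_right_mono order_trans[OF bd abs_ge_self])
  qed measurable
  have sc: "sqrt t ^ DIM('a) * heat t (sqrt t *\<^sub>R z) = heat 1 z" for z :: 'a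
  proof -
    have "sqrt t ^ DIM('a) = t powr (real DIM('a) / 2)"
      using t by (simp add: powr_realpow[symmetric] powr_half_sqrt[symmetric] powr_powr)
    moreover have "(4 * pi * t) powr (- real DIM('a) / 2) = (4 * pi) powr (- real DIM('a) / 2) * t powr (- real DIM('a) / 2)"
      using t by (simp add: powr_mult)
    moreover have "t powr (real DIM('a) / 2) * t powr (- real DIM('a) / 2) = 1"
      using t by (simp add: powr_add[symmetric])
    ultimately show ?thesis using t by (simp add: heat_def power_mult_distrib mult.commute mult.left_commute)
  qed
  have "(\<integral>x. f x * heat t (x - y) \<partial>lborel) = \<bar>sqrt t\<bar> ^ DIM('a) *\<^sub>R (\<integral>z. f (y + sqrt t *\<^sub>R z) * heat t ((y + sqrt t *\<^sub>R z) - y) \<partial>lborel)"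
    using t by (intro lborel_integral_affine[OF int]) auto
  also have "\<dots> = (\<integral>z. sqrt t ^ DIM('a) * (f (y + sqrt t *\<^sub>R z) * heat t (sqrt t *\<^sub>R z)) \<partial>lborel)"
    using t by simp
  also have "\<dots> = (\<integral>z. f (y + sqrt t *\<^sub>R z) * heat 1 z \<partial>lborel)"
    unfolding sc[symmetric] by (simp only: mult.left_commute)
  finally show "(\<integral>x. f x * heat t (x - y) \<partial>lborel) = (\<integral>z. f (y + sqrt t *\<^sub>R z) * heat 1 z \<partial>lborel)" .
qed

lemma integrable_mult_L2:
  fixes f g :: "'a \<Rightarrow> complex"
  assumes [measurable]: "f \<in> borel_measurable M" "g \<in> borel_measurable M"
    and f: "integrable M (\<lambda>x. (norm (f x))\<^sup>2)" and g: "integrable M (\<lambda>x. (norm (g x))\<^sup>2)"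
  shows "integrable M (\<lambda>x. f x * g x)"
proof (rule Bochner_Integration.integrable_bound)
  show "integrable M (\<lambda>x. (norm (f x))\<^sup>2 + (norm (g x))\<^sup>2)" using f g by (rule Bochner_Integration.integrable_add)
  have "norm (f x * g x) \<le> (norm (f x))\<^sup>2 + (norm (g x))\<^sup>2" for x
    using sum_squares_bound[of "norm (f x)" "norm (g x)"] mult_nonneg_nonneg[OF norm_ge_zero norm_ge_zero, of "f x" "g x"]
    unfolding norm_mult by linarith
  then show "AE x in M. norm (f x * g x) \<le> norm ((norm (f x))\<^sup>2 + (norm (g x))\<^sup>2)"
    by (intro AE_I2) simp
qed measurable

text \<open>
  Let the Gaussian damping tend to 1 in \<open>FT_gauss_pairing\<close>: on the frequency side by integrability of the
  product, on the space side because heat averages of a bounded continuous function converge pointwise.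
\<close>

theorem parseval:
  fixes u \<phi> :: "'a::euclidean_space \<Rightarrow> real"
  assumes u: "integrable lborel u" and ucont: "continuous_on UNIV u" and ub: "\<And>x. \<bar>u x\<bar> \<le> M"
    and \<phi>: "integrable lborel \<phi>" and \<phi>2: "integrable lborel (\<lambda>x. (\<phi> x)\<^sup>2)"
  shows "has_bochner_integral lborel (\<lambda>\<xi>. FT u \<xi> * cnj (FT \<phi> \<xi>)) (of_real (\<integral>x. u x * \<phi> x \<partial>lborel))"
proof -
  have [measurable]: "u \<in> borel_measurable borel" "\<phi> \<in> borel_measurable borel"
    using borel_measurable_integrable[OF u] borel_measurable_integrable[OF \<phi>] by simp_all
  have u2: "integrable lborel (\<lambda>x. (u x)\<^sup>2)"
  proof (rule Bochner_Integration.integrable_bound)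
    show "integrable lborel (\<lambda>x. M * u x)" using u by (rule integrable_mult_right)
    have "(u x)\<^sup>2 \<le> \<bar>M * u x\<bar>" for x
      using ub[of x] mult_mono[of "\<bar>u x\<bar>" "\<bar>M\<bar>" "\<bar>u x\<bar>" "\<bar>u x\<bar>"] by (simp add: abs_mult power2_eq_square abs_mult_self_eq)
    then show "AE x in lborel. norm ((u x)\<^sup>2) \<le> norm (M * u x)" by simp
  qed measurable
  have int: "integrable lborel (\<lambda>\<xi>. FT u \<xi> * cnj (FT \<phi> \<xi>))"
    using FT_bessel[OF u u2] FT_bessel[OF \<phi> \<phi>2] by (intro integrable_mult_L2) auto
  define T where "T = (\<lambda>k::nat. 1 / real (Suc k))"
  have T: "T k > 0" for k by (simp add: T_def)
  have Tlim: "T \<longlonglongrightarrow> 0"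
    unfolding T_def using LIMSEQ_inverse_real_of_nat by (simp add: inverse_eq_divide)
  have L: "(\<lambda>k. \<integral>\<xi>. of_real (exp (- T k * (norm \<xi>)\<^sup>2)) * FT u \<xi> * cnj (FT \<phi> \<xi>) \<partial>lborel) \<longlonglongrightarrow> (\<integral>\<xi>. FT u \<xi> * cnj (FT \<phi> \<xi>) \<partial>lborel)"
  proof (rule integral_dominated_convergence[where w="\<lambda>\<xi>. norm (FT u \<xi> * cnj (FT \<phi> \<xi>))"])
    show "AE \<xi> in lborel. (\<lambda>k. of_real (exp (- T k * (norm \<xi>)\<^sup>2)) * FT u \<xi> * cnj (FT \<phi> \<xi>)) \<longlonglongrightarrow> FT u \<xi> * cnj (FT \<phi> \<xi>)"
    proof (intro AE_I2)
      fix \<xi> :: 'a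
      have "(\<lambda>k. of_real (exp (- T k * (norm \<xi>)\<^sup>2)) * FT u \<xi> * cnj (FT \<phi> \<xi>)) \<longlonglongrightarrow> of_real (exp (- 0 * (norm \<xi>)\<^sup>2)) * FT u \<xi> * cnj (FT \<phi> \<xi>)"
        by (intro tendsto_intros Tlim)
      then show "(\<lambda>k. of_real (exp (- T k * (norm \<xi>)\<^sup>2)) * FT u \<xi> * cnj (FT \<phi> \<xi>)) \<longlonglongrightarrow> FT u \<xi> * cnj (FT \<phi> \<xi>)"
        by simp
    qed
    show "AE \<xi> in lborel. norm (of_real (exp (- T k * (norm \<xi>)\<^sup>2)) * FT u \<xi> * cnj (FT \<phi> \<xi>)) \<le> norm (FT u \<xi> * cnj (FT \<phi> \<xi>))" for k
      using T[of k] by (intro AE_I2) (simp add: norm_mult mult.assoc mult_left_le_one_le)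
  qed (use int in auto)
  have R: "(\<lambda>k. \<integral>y. \<phi> y * (\<integral>x. u x * heat (T k) (x - y) \<partial>lborel) \<partial>lborel) \<longlonglongrightarrow> (\<integral>y. \<phi> y * u y \<partial>lborel)"
  proof (rule integral_dominated_convergence[where w="\<lambda>y. M * \<bar>\<phi> y\<bar>"])
    have h1: "integrable lborel (heat 1 :: 'a \<Rightarrow> real)" "integral\<^sup>L lborel (heat 1 :: 'a \<Rightarrow> real) = 1"
      using heat_integral[of 1, where 'a='a] by (auto simp: has_bochner_integral_iff)
    have conv: "(\<lambda>k. \<integral>x. u x * heat (T k) (x - y) \<partial>lborel) \<longlonglongrightarrow> u y" for y
    proof -
      have "(\<lambda>k. \<integral>z. u (y + sqrt (T k) *\<^sub>R z) * heat 1 z \<partial>lborel) \<longlonglongrightarrow> (\<integral>z. u y * heat 1 (z::'a) \<partial>lborel)"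
      proof (rule integral_dominated_convergence[where w="\<lambda>z::'a. M * heat 1 z"])
        show "AE z in lborel. (\<lambda>k. u (y + sqrt (T k) *\<^sub>R z) * heat 1 z) \<longlonglongrightarrow> u y * heat 1 z"
        proof (intro AE_I2 tendsto_mult tendsto_const)
          fix z :: 'a
          have "isCont u y" using ucont by (simp add: continuous_on_eq_continuous_at)
          moreover have "(\<lambda>k. y + sqrt (T k) *\<^sub>R z) \<longlonglongrightarrow> y + sqrt 0 *\<^sub>R z"
            by (intro tendsto_intros Tlim)
          ultimately show "(\<lambda>k. u (y + sqrt (T k) *\<^sub>R z)) \<longlonglongrightarrow> u y"
            using isCont_tendsto_compose[of y u "\<lambda>k. y + sqrt (T k) *\<^sub>R z" sequentially] by simp
        qed
        show "integrable lborel (\<lambda>z::'a. M * heat 1 z)" using h1 by simp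
        show "AE z in lborel. norm (u (y + sqrt (T k) *\<^sub>R z) * heat 1 z) \<le> M * heat 1 z" for k
          using ub heat_nonneg[of 1] by (intro AE_I2) (auto simp: abs_mult heat_nonneg intro!: mult_right_mono)
      qed measurable
      then show ?thesis using h1 heat_rescale(1)[OF T, of u M] ub by simp
    qed
    then show "AE y in lborel. (\<lambda>k. \<phi> y * (\<integral>x. u x * heat (T k) (x - y) \<partial>lborel)) \<longlonglongrightarrow> \<phi> y * u y"
      by (intro AE_I2 tendsto_mult tendsto_const)
    show "integrable lborel (\<lambda>y. M * \<bar>\<phi> y\<bar>)" using \<phi> by simp
    show "AE y in lborel. norm (\<phi> y * (\<integral>x. u x * heat (T k) (x - y) \<partial>lborel)) \<le> M * \<bar>\<phi> y\<bar>" for k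
    proof (intro AE_I2)
      fix y :: 'a
      have hi: "integrable lborel (\<lambda>x. heat (T k) (x - y))" "(\<integral>x. heat (T k) (x - y) \<partial>lborel) = 1"
        using heat_convolution_norm(2)[OF T[of k], of y] by (auto simp: has_bochner_integral_iff)
      have "norm (\<integral>x. u x * heat (T k) (x - y) \<partial>lborel) \<le> (\<integral>x. norm (u x * heat (T k) (x - y)) \<partial>lborel)"
        by (rule integral_norm_bound)
      also have "\<dots> \<le> (\<integral>x. M * heat (T k) (x - y) \<partial>lborel)"
      proof (rule integral_mono)
        show "integrable lborel (\<lambda>x. norm (u x * heat (T k) (x - y)))"
          by (rule integrable_norm, rule heat_rescale(2)[OF T _ ub]) simp
        show "integrable lborel (\<lambda>x. M * heat (T k) (x - y))" using hi by simp
        show "norm (u x * heat (T k) (x - y)) \<le> M * heat (T k) (x - y)" for x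
          using ub[of x] by (simp add: abs_mult heat_nonneg mult_right_mono)
      qed
      also have "\<dots> = M" using hi by simp
      finally have "\<bar>\<integral>x. u x * heat (T k) (x - y) \<partial>lborel\<bar> * \<bar>\<phi> y\<bar> \<le> M * \<bar>\<phi> y\<bar>"
        by (intro mult_right_mono) auto
      then show "norm (\<phi> y * (\<integral>x. u x * heat (T k) (x - y) \<partial>lborel)) \<le> M * \<bar>\<phi> y\<bar>"
        by (simp add: abs_mult mult.commute)
    qed
  qed measurable
  have "(\<lambda>k. complex_of_real (\<integral>y. \<phi> y * (\<integral>x. u x * heat (T k) (x - y) \<partial>lborel) \<partial>lborel)) \<longlonglongrightarrow> of_real (\<integral>y. \<phi> y * u y \<partial>lborel)"
    using R by (rule tendsto_of_real)
  then have "(\<lambda>k. \<integral>\<xi>. of_real (exp (- T k * (norm \<xi>)\<^sup>2)) * FT u \<xi> * cnj (FT \<phi> \<xi>) \<partial>lborel) \<longlonglongrightarrow> of_real (\<integral>y. \<phi> y * u y \<partial>lborel)"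
    unfolding FT_gauss_pairing[OF u \<phi> T] .
  from LIMSEQ_unique[OF L this] show ?thesis using int by (simp add: has_bochner_integral_iff mult.commute)
qed

text \<open>
  The positive and the negative part of \<open>f\<close> are densities of two finite measures that agree on boxes.
\<close>

lemma AE_zero_if_box_integrals_zero:
  fixes f :: "'a::euclidean_space \<Rightarrow> real"
  assumes f: "integrable lborel f" and z: "\<And>a b. (\<integral>x. indicator (box a b) x * f x \<partial>lborel) = 0"
  shows "AE x in lborel. f x = 0"
proof -
  have [measurable]: "f \<in> borel_measurable borel" using borel_measurable_integrable[OF f] by simp
  let ?P = "density lborel (\<lambda>x. ennreal (max 0 (f x)))" and ?N = "density lborel (\<lambda>x. ennreal (max 0 (- f x)))"
  have fp: "integrable lborel (\<lambda>x. indicator A x * max 0 (f x))" "integrable lborel (\<lambda>x. indicator A x * max 0 (- f x))"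
    if [measurable]: "A \<in> sets borel" for A
    by (rule Bochner_Integration.integrable_bound[OF f], (auto intro!: AE_I2 split: split_indicator)[2])+
  have em: "emeasure ?P A = ennreal (\<integral>x. indicator A x * max 0 (f x) \<partial>lborel)" "emeasure ?N A = ennreal (\<integral>x. indicator A x * max 0 (- f x) \<partial>lborel)"
    if A[measurable]: "A \<in> sets borel" for A
  proof -
    show "emeasure ?P A = ennreal (\<integral>x. indicator A x * max 0 (f x) \<partial>lborel)"
      using fp(1)[OF A] by (subst nn_integral_eq_integral[symmetric]) (auto simp: emeasure_density ennreal_mult'' ennreal_indicator mult.commute intro!: nn_integral_cong)
    show "emeasure ?N A = ennreal (\<integral>x. indicator A x * max 0 (- f x) \<partial>lborel)"
      using fp(2)[OF A] by (subst nn_integral_eq_integral[symmetric]) (auto simp: emeasure_density ennreal_mult'' ennreal_indicator mult.commute intro!: nn_integral_cong)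
  qed
  have "?P = ?N"
  proof (rule measure_eqI_generator_eq)
    let ?E = "range (\<lambda>(a, b). box a b::'a set)"
    show "Int_stable ?E" by (auto simp: Int_stable_def box_Int_box)
    show "?E \<subseteq> Pow UNIV" "sets ?P = sigma_sets UNIV ?E" "sets ?N = sigma_sets UNIV ?E"
      by (simp_all add: borel_eq_box)
    let ?A = "\<lambda>n::nat. box (- (real n *\<^sub>R One)) (real n *\<^sub>R One) :: 'a set"
    show "range ?A \<subseteq> ?E" "(\<Union>i. ?A i) = UNIV" unfolding UN_box_eq_UNIV by auto
    show "emeasure ?P (?A i) \<noteq> \<infinity>" for i by (subst em(1)) auto
    show "emeasure ?P X = emeasure ?N X" if XE: "X \<in> ?E" for X
    proof -
      obtain a b where X: "X = box a b" using XE by auto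
      have "(\<integral>x. indicator X x * max 0 (f x) \<partial>lborel) - (\<integral>x. indicator X x * max 0 (- f x) \<partial>lborel) = (\<integral>x. indicator X x * max 0 (f x) - indicator X x * max 0 (- f x) \<partial>lborel)"
        using fp[of X] X by (intro Bochner_Integration.integral_diff[symmetric]) auto
      also have "\<dots> = (\<integral>x. indicator (box a b) x * f x \<partial>lborel)"
        unfolding X by (intro Bochner_Integration.integral_cong refl) (auto split: split_indicator)
      finally have eq: "(\<integral>x. indicator X x * max 0 (f x) \<partial>lborel) = (\<integral>x. indicator X x * max 0 (- f x) \<partial>lborel)"
        using z[of a b] by simp
      have "X \<in> sets borel" using X by simp
      then show ?thesis by (simp only: em eq)
    qed
  qed
  then have "AE x in lborel. ennreal (max 0 (f x)) = ennreal (max 0 (- f x))"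
    by (subst sigma_finite_measure.density_unique_iff[OF sigma_finite_lborel, symmetric]) auto
  then show ?thesis
    by eventually_elim (auto simp: max_def split: if_splits)
qed

text \<open>
  Parseval makes \<open>\<phi>\<close> orthogonal to every integrable bounded continuous function, in particular to continuous
  functions that increase to the indicator of a box.
\<close>

theorem FT_injective:
  fixes \<phi> :: "'a::euclidean_space \<Rightarrow> real"
  assumes \<phi>: "integrable lborel \<phi>" and \<phi>2: "integrable lborel (\<lambda>x. (\<phi> x)\<^sup>2)" and z: "AE \<xi> in lborel. FT \<phi> \<xi> = 0"
  shows "AE x in lborel. \<phi> x = 0"
proof (rule AE_zero_if_box_integrals_zero[OF \<phi>])
  fix a b :: 'a
  have [measurable]: "\<phi> \<in> borel_measurable borel" using borel_measurable_integrable[OF \<phi>] by simp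
  \<comment> \<open>Continuous functions that vanish outside the box and increase to its indicator.\<close>
  define u where "u = (\<lambda>k::nat. \<lambda>x. min 1 (real k * infdist x (- box a b)))"
  have ne: "- box a b \<noteq> {}"
  proof
    assume "- box a b = {}"
    then have "- (- box a b) = UNIV" by (simp only: Compl_empty_eq)
    then have "box a b = UNIV" by (simp only: double_complement)
    then show False using bounded_box[of a b] not_bounded_UNIV by metis
  qed
  have ub: "\<bar>u k x\<bar> \<le> 1" and u0: "u k x \<ge> 0" for k x by (auto simp: u_def infdist_nonneg min_def)
  have ucont: "continuous_on UNIV (u k)" for k
    unfolding u_def by (intro continuous_intros)
  have um[measurable]: "u k \<in> borel_measurable borel" for k
    using ucont by (rule borel_measurable_continuous_onI)
  have uout: "u k x = 0" if "x \<notin> box a b" for k x using that by (simp add: u_def)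
  have uint: "integrable lborel (u k)" for k
  proof (rule Bochner_Integration.integrable_bound)
    show "integrable lborel (indicator (box a b) :: 'a \<Rightarrow> real)"
      by (intro integrable_real_indicator) (auto simp: emeasure_lborel_box_eq)
    show "AE x in lborel. norm (u k x) \<le> norm (indicator (box a b) x :: real)"
      using ub uout by (intro AE_I2) (auto split: split_indicator)
  qed measurable
  have z0: "(\<integral>x. u k x * \<phi> x \<partial>lborel) = 0" for k
  proof -
    have "(\<integral>\<xi>. FT (u k) \<xi> * cnj (FT \<phi> \<xi>) \<partial>lborel) = of_real (\<integral>x. u k x * \<phi> x \<partial>lborel)"
      using parseval[OF uint ucont ub \<phi> \<phi>2] by (simp add: has_bochner_integral_iff)
    moreover have "(\<integral>\<xi>. FT (u k) \<xi> * cnj (FT \<phi> \<xi>) \<partial>lborel) = 0"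
      using z by (intro integral_eq_zero_AE) auto
    ultimately show ?thesis by simp
  qed
  have "(\<lambda>k. \<integral>x. u k x * \<phi> x \<partial>lborel) \<longlonglongrightarrow> (\<integral>x. indicator (box a b) x * \<phi> x \<partial>lborel)"
  proof (rule integral_dominated_convergence[where w="\<lambda>x. \<bar>\<phi> x\<bar>"])
    show "AE x in lborel. (\<lambda>k. u k x * \<phi> x) \<longlonglongrightarrow> indicator (box a b) x * \<phi> x"
    proof (intro AE_I2 tendsto_mult tendsto_const)
      fix x
      show "(\<lambda>k. u k x) \<longlonglongrightarrow> indicator (box a b) x"
      proof (cases "x \<in> box a b")
        case True
        have "infdist x (- box a b) \<noteq> 0"
        proof
          assume "infdist x (- box a b) = 0"
          then have "x \<in> - box a b" using ne in_closed_iff_infdist_zero[of "- box a b" x] by (simp add: closed_def open_box)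
          then show False using True by simp
        qed
        then have d: "infdist x (- box a b) > 0" using infdist_nonneg[of x "- box a b"] by simp
        obtain K :: nat where K: "1 / infdist x (- box a b) < real K" using reals_Archimedean2 by blast
        have "u k x = 1" if "k \<ge> K" for k
        proof -
          have "1 < real K * infdist x (- box a b)" using K d by (simp add: field_simps)
          also have "\<dots> \<le> real k * infdist x (- box a b)" using that d by (intro mult_right_mono) auto
          finally show ?thesis by (simp add: u_def)
        qed
        then have "\<forall>\<^sub>F k in sequentially. u k x = 1" by (auto simp: eventually_sequentially)
        then show ?thesis using True by (simp add: tendsto_eventually)
      qed (simp add: uout)
    qed
    show "AE x in lborel. norm (u k x * \<phi> x) \<le> \<bar>\<phi> x\<bar>" for k
      using ub[of k] by (intro AE_I2) (simp add: abs_mult mult_left_le_one_le)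
  qed (use \<phi> in auto)
  then show "(\<integral>x. indicator (box a b) x * \<phi> x \<partial>lborel) = 0"
    unfolding z0 by (simp add: LIMSEQ_const_iff)
qed

lemma FT_central_diff:
  fixes u :: "'a::euclidean_space \<Rightarrow> real"
  assumes u: "integrable lborel u"
  shows "FT (\<lambda>x. central_diff m u x y) \<xi> = of_real ((2 - 2 * cos (\<xi> \<bullet> y)) ^ m) * FT u \<xi>"
    and "integrable lborel (\<lambda>x. central_diff m u x y)"
proof -
  have int: "integrable lborel (\<lambda>x. u (x + of_int k *\<^sub>R y))" for k
    using integrable_lborel_affine[OF u, of 1 "of_int k *\<^sub>R y"] by (simp add: add.commute)
  have F: "FT (\<lambda>x. u (x + of_int k *\<^sub>R y)) \<xi> = exp (\<i> * of_real (of_int k * (\<xi> \<bullet> y))) * FT u \<xi>" for k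
    using FT_affine[OF u, of 1 "of_int k *\<^sub>R y" \<xi>] by (simp add: add.commute inner_commute)
  show "integrable lborel (\<lambda>x. central_diff m u x y)"
    unfolding central_diff_eq using int by (intro Bochner_Integration.integrable_sum integrable_mult_right)
  have "FT (\<lambda>x. central_diff m u x y) \<xi> = (\<Sum>k\<in>{- int m..int m}. FT (\<lambda>x. dcoef m k * u (x + of_int k *\<^sub>R y)) \<xi>)"
    unfolding central_diff_eq using int by (intro FT_sum integrable_mult_right)
  also have "\<dots> = (\<Sum>k\<in>{- int m..int m}. of_real (dcoef m k) * exp (\<i> * of_real (of_int k * (\<xi> \<bullet> y)))) * FT u \<xi>"
    unfolding FT_cmult F sum_distrib_right by (simp only: mult.assoc)
  also have "\<dots> = of_real ((2 - 2 * cos (\<xi> \<bullet> y)) ^ m) * FT u \<xi>"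
    unfolding dcoef_fourier ..
  finally show "FT (\<lambda>x. central_diff m u x y) \<xi> = of_real ((2 - 2 * cos (\<xi> \<bullet> y)) ^ m) * FT u \<xi>" .
qed

lemma central_diff_continuous:
  fixes u :: "'a::euclidean_space \<Rightarrow> real"
  assumes "continuous_on UNIV u"
  shows "continuous_on UNIV (\<lambda>x. central_diff m u x y)"
  unfolding central_diff_eq
  by (intro continuous_intros continuous_on_compose2[OF assms]) auto

lemma central_diff_bounded:
  fixes u :: "'a::euclidean_space \<Rightarrow> real"
  assumes "\<And>x. \<bar>u x\<bar> \<le> M"
  shows "\<bar>central_diff m u x y\<bar> \<le> (\<Sum>k\<in>{- int m..int m}. \<bar>dcoef m k\<bar>) * M"
  unfolding central_diff_eq sum_distrib_right
  using assms by (intro order_trans[OF sum_abs] sum_mono) (auto simp: abs_mult intro!: mult_left_mono)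

lemma central_diff_measurable [measurable]:
  fixes u :: "'a::euclidean_space \<Rightarrow> real"
  assumes [measurable]: "u \<in> borel_measurable borel"
  shows "(\<lambda>(x, y). central_diff m u x y) \<in> borel_measurable (borel \<Otimes>\<^sub>M borel)"
  unfolding central_diff_eq by measurable

text \<open>
  Parseval with a central difference in place of \<open>u\<close>: the difference acts on the Fourier side as
  multiplication by \<open>(2 - 2 cos (\<xi> \<bullet> y)) ^ m\<close>.
\<close>

lemma parseval_central_diff:
  fixes u \<phi> :: "'a::euclidean_space \<Rightarrow> real"
  assumes u: "integrable lborel u" and ucont: "continuous_on UNIV u" and ub: "\<And>x. \<bar>u x\<bar> \<le> M"
    and \<phi>: "integrable lborel \<phi>" and \<phi>2: "integrable lborel (\<lambda>x. (\<phi> x)\<^sup>2)"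
  shows "has_bochner_integral lborel (\<lambda>\<xi>. of_real ((2 - 2 * cos (\<xi> \<bullet> y)) ^ m) * FT u \<xi> * cnj (FT \<phi> \<xi>)) (of_real (\<integral>x. central_diff m u x y * \<phi> x \<partial>lborel))"
  using parseval[OF FT_central_diff(2)[OF u] central_diff_continuous[OF ucont] central_diff_bounded[of u M, OF ub] \<phi> \<phi>2, of m y]
  unfolding FT_central_diff(1)[OF u] .

section \<open>Polar coordinates over an annulus\<close>

text \<open>
  An annulus of directions plays the part of the sphere in polar coordinates, so that Lebesgue measure
  suffices. The ratio \<open>exp 1\<close> of its radii makes \<open>\<integral> d\<rho> / \<rho>\<close> over the scales \<open>\<rho>\<close> that move a given point into it
  equal to 1.
\<close>

definition annulus :: "'a::euclidean_space set" where
  "annulus = {z. 1 \<le> norm z \<and> norm z < exp 1}"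

text \<open>
  The Jacobian of \<open>(z, \<rho>) \<mapsto> \<rho> z\<close> at fixed \<open>\<rho>\<close> is \<open>\<rho> ^ n\<close>, and one factor is divided out by \<open>d\<rho> / \<rho>\<close>.
\<close>

definition polar_weight :: "'a::euclidean_space \<times> real \<Rightarrow> real" where
  "polar_weight = (\<lambda>(z, \<rho>). indicator annulus z * (indicator {0<..} \<rho> * \<rho> ^ (DIM('a) - 1)))"

lemma annulus_measurable [measurable]: "annulus \<in> sets borel"
  unfolding annulus_def by measurable

lemma cball_ball_measurable [measurable]:
  "cball (x::'a::euclidean_space) r \<in> sets borel" "- ball x r \<in> sets borel"
  by (auto intro: borel_closed)

lemma polar_weight_measurable [measurable]: "(polar_weight :: 'a::euclidean_space \<times> real \<Rightarrow> real) \<in> borel_measurable (borel \<Otimes>\<^sub>M borel)"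
  unfolding polar_weight_def by measurable

lemma polar_weight_nonneg: "polar_weight p \<ge> 0"
  by (auto simp: polar_weight_def split: prod.splits split_indicator)

lemma annulus_scaling:
  fixes y :: "'a::euclidean_space"
  assumes "y \<noteq> 0"
  shows "(\<integral>\<^sup>+\<rho>. ennreal (indicator {0<..} \<rho> * (indicator annulus (y /\<^sub>R \<rho>) / \<rho>)) \<partial>lborel) = 1"
proof -
  define a where "a = norm y / exp 1"
  have a: "0 < a" "a \<le> norm y" "ln a = ln (norm y) - 1"
    using assms by (auto simp: a_def ln_div divide_le_eq mult_le_cancel_left1)
  have "(\<integral>\<^sup>+\<rho>. ennreal (indicator {0<..} \<rho> * (indicator annulus (y /\<^sub>R \<rho>) / \<rho>)) \<partial>lborel) = (\<integral>\<^sup>+\<rho>. ennreal (1 / \<rho>) * indicator {a..norm y} \<rho> \<partial>lborel)"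
    using AE_lborel_singleton[of a]
  proof (intro nn_integral_cong_AE, eventually_elim)
    case (elim \<rho>)
    show ?case
    proof (cases "\<rho> > 0")
      case True
      have "y /\<^sub>R \<rho> \<in> annulus \<longleftrightarrow> \<rho> \<le> norm y \<and> norm y < exp 1 * \<rho>"
        using True by (simp add: annulus_def divide_inverse[symmetric] mult.commute[of "inverse \<rho>"] pos_le_divide_eq pos_divide_less_eq)
      also have "\<dots> \<longleftrightarrow> \<rho> \<in> {a..norm y}"
        using True elim by (auto simp: a_def field_simps)
      finally show ?thesis using True by (auto split: split_indicator)
    next
      case False
      then show ?thesis using a by auto
    qed
  qed
  also have "\<dots> = ennreal (ln (norm y) - ln a)"
    using a by (intro nn_integral_FTC_Icc) (auto intro!: derivative_eq_intros)
  finally show ?thesis using a by simp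
qed

text \<open>
  Insert the factor 1 of \<open>annulus_scaling\<close>, exchange the integrals and substitute \<open>y = \<rho> z\<close>.
\<close>

lemma nn_integral_polar:
  fixes F :: "'a::euclidean_space \<Rightarrow> ennreal"
  assumes [measurable]: "F \<in> borel_measurable borel"
  shows "(\<integral>\<^sup>+y. F y \<partial>lborel) = (\<integral>\<^sup>+z. (\<integral>\<^sup>+\<rho>. ennreal (polar_weight (z, \<rho>)) * F (\<rho> *\<^sub>R z) \<partial>lborel) \<partial>lborel)"
proof -
  let ?k = "\<lambda>(y::'a) \<rho>. ennreal (indicator {0<..} \<rho> * (indicator annulus (y /\<^sub>R \<rho>) / \<rho>))"
  have "(\<integral>\<^sup>+y. F y \<partial>lborel) = (\<integral>\<^sup>+y. F y * (\<integral>\<^sup>+\<rho>. ?k y \<rho> \<partial>lborel) \<partial>lborel)"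
  proof (rule nn_integral_cong_AE)
    show "AE y in lborel. F y = F y * (\<integral>\<^sup>+\<rho>. ?k y \<rho> \<partial>lborel)"
      using AE_lborel_singleton[of "0::'a"] by eventually_elim (subst annulus_scaling, simp_all del: times_divide_eq_right)
  qed
  also have "\<dots> = (\<integral>\<^sup>+y. (\<integral>\<^sup>+\<rho>. F y * ?k y \<rho> \<partial>lborel) \<partial>lborel)"
    by (intro nn_integral_cong nn_integral_cmult[symmetric]) measurable
  also have "\<dots> = (\<integral>\<^sup>+\<rho>. (\<integral>\<^sup>+y. F y * ?k y \<rho> \<partial>lborel) \<partial>lborel)"
    by (rule lborel_pair.Fubini'[symmetric]) measurable
  also have "\<dots> = (\<integral>\<^sup>+\<rho>. (\<integral>\<^sup>+z. ennreal (polar_weight (z, \<rho>)) * F (\<rho> *\<^sub>R z) \<partial>lborel) \<partial>lborel)"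
  proof (rule nn_integral_cong)
    fix \<rho> :: real
    show "(\<integral>\<^sup>+y. F y * ?k y \<rho> \<partial>lborel) = (\<integral>\<^sup>+z. ennreal (polar_weight (z, \<rho>)) * F (\<rho> *\<^sub>R z) \<partial>lborel)"
    proof (cases "\<rho> > 0")
      case True
      have "(\<integral>\<^sup>+y. F y * ?k y \<rho> \<partial>lborel) = ennreal (\<bar>\<rho>\<bar> ^ DIM('a)) * (\<integral>\<^sup>+z. F (0 + \<rho> *\<^sub>R z) * ?k (0 + \<rho> *\<^sub>R z) \<rho> \<partial>lborel)"
        using True by (intro nn_integral_lborel_affine) auto
      also have "\<dots> = (\<integral>\<^sup>+z. ennreal (\<bar>\<rho>\<bar> ^ DIM('a)) * (F (0 + \<rho> *\<^sub>R z) * ?k (0 + \<rho> *\<^sub>R z) \<rho>) \<partial>lborel)"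
        by (rule nn_integral_cmult[symmetric]) measurable
      also have "\<dots> = (\<integral>\<^sup>+z. ennreal (polar_weight (z, \<rho>)) * F (\<rho> *\<^sub>R z) \<partial>lborel)"
      proof (intro nn_integral_cong)
        fix z :: 'a
        obtain d where d: "DIM('a) = Suc d" using DIM_positive[where 'a='a] gr0_implies_Suc by blast
        have "ennreal (\<bar>\<rho>\<bar> ^ DIM('a)) * ennreal (indicator annulus z / \<rho>) = ennreal (indicator annulus z * \<rho> ^ d)"
          using True by (subst ennreal_mult[symmetric]) (auto simp: d)
        then show "ennreal (\<bar>\<rho>\<bar> ^ DIM('a)) * (F (0 + \<rho> *\<^sub>R z) * ?k (0 + \<rho> *\<^sub>R z) \<rho>) = ennreal (polar_weight (z, \<rho>)) * F (\<rho> *\<^sub>R z)"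
          using True by (simp add: polar_weight_def d mult_ac)
      qed
      finally show ?thesis .
    qed (simp add: polar_weight_def)
  qed
  also have "\<dots> = (\<integral>\<^sup>+z. (\<integral>\<^sup>+\<rho>. ennreal (polar_weight (z, \<rho>)) * F (\<rho> *\<^sub>R z) \<partial>lborel) \<partial>lborel)"
    by (rule lborel_pair.Fubini') measurable
  finally show ?thesis .
qed

text \<open>
  Polar coordinates as an image measure, from which the version for signed integrands follows.
\<close>

lemma lborel_polar:
  "distr (density (lborel \<Otimes>\<^sub>M lborel) (\<lambda>p. ennreal (polar_weight p))) borel (\<lambda>(z::'a::euclidean_space, \<rho>). \<rho> *\<^sub>R z) = lborel"
  (is "?M = _")
proof (rule measure_eqI)
  show "sets ?M = sets lborel" by simp
  fix A assume "A \<in> sets ?M"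
  then have [measurable]: "A \<in> sets borel" by simp
  have "emeasure lborel A = (\<integral>\<^sup>+y. indicator A y \<partial>lborel)" by simp
  also have "\<dots> = (\<integral>\<^sup>+z. (\<integral>\<^sup>+\<rho>. ennreal (polar_weight (z, \<rho>)) * indicator A (\<rho> *\<^sub>R z) \<partial>lborel) \<partial>lborel)"
    by (rule nn_integral_polar) measurable
  also have "\<dots> = (\<integral>\<^sup>+p. ennreal (polar_weight p) * indicator A (case p of (z, \<rho>) \<Rightarrow> \<rho> *\<^sub>R z) \<partial>(lborel \<Otimes>\<^sub>M lborel))"
  proof -
    have "(\<lambda>p::'a \<times> real. ennreal (polar_weight p) * indicator A (case p of (z, \<rho>) \<Rightarrow> \<rho> *\<^sub>R z)) \<in> borel_measurable (lborel \<Otimes>\<^sub>M lborel)"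
      by measurable
    from lborel.nn_integral_fst[OF this] show ?thesis by simp
  qed
  also have "\<dots> = (\<integral>\<^sup>+p. indicator A (case p of (z, \<rho>) \<Rightarrow> \<rho> *\<^sub>R z) \<partial>(density (lborel \<Otimes>\<^sub>M lborel) (\<lambda>p. ennreal (polar_weight p))))"
    by (subst nn_integral_density) measurable
  also have "\<dots> = (\<integral>\<^sup>+y. indicator A y \<partial>?M)"
    by (subst nn_integral_distr) measurable
  also have "\<dots> = emeasure ?M A" by simp
  finally show "emeasure ?M A = emeasure lborel A" by simp
qed

lemma integral_polar:
  fixes F :: "'a::euclidean_space \<Rightarrow> real"
  assumes F: "integrable lborel F"
  shows "(\<integral>y. F y \<partial>lborel) = (\<integral>z. (\<integral>\<rho>. polar_weight (z, \<rho>) * F (\<rho> *\<^sub>R z) \<partial>lborel) \<partial>lborel)"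
proof -
  have [measurable]: "F \<in> borel_measurable borel" using borel_measurable_integrable[OF F] by simp
  let ?D = "density (lborel \<Otimes>\<^sub>M lborel) (\<lambda>p::'a \<times> real. ennreal (polar_weight p))"
  let ?s = "\<lambda>(z::'a, \<rho>). \<rho> *\<^sub>R z"
  have "integrable (distr ?D borel ?s) F" unfolding lborel_polar by (rule F)
  then have "integrable ?D (\<lambda>p. F (?s p))"
    by (subst (asm) integrable_distr_eq) measurable
  then have int: "integrable (lborel \<Otimes>\<^sub>M lborel) (\<lambda>p. polar_weight p *\<^sub>R F (?s p))"
    by (subst (asm) integrable_density) (auto simp: polar_weight_nonneg)
  have "(\<integral>y. F y \<partial>lborel) = (\<integral>y. F y \<partial>(distr ?D borel ?s))" unfolding lborel_polar ..
  also have "\<dots> = (\<integral>p. F (?s p) \<partial>?D)" by (rule integral_distr) measurable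
  also have "\<dots> = (\<integral>p. polar_weight p *\<^sub>R F (?s p) \<partial>(lborel \<Otimes>\<^sub>M lborel))"
    by (rule integral_density) (auto simp: polar_weight_nonneg)
  also have "\<dots> = (\<integral>z. (\<integral>\<rho>. polar_weight (z, \<rho>) *\<^sub>R F (?s (z, \<rho>)) \<partial>lborel) \<partial>lborel)"
    by (rule lborel_pair.integral_fst'[symmetric]) (rule int)
  finally show ?thesis by simp
qed

lemma emeasure_annulus: "emeasure lborel (annulus :: 'a::euclidean_space set) < \<infinity>"
proof -
  have "bounded (annulus :: 'a set)" unfolding bounded_iff annulus_def by (auto intro!: exI[of _ "exp 1"])
  then show ?thesis by (rule emeasure_bounded_finite)
qed

lemma nn_integral_polar_finite:
  fixes F :: "'a::euclidean_space \<Rightarrow> ennreal"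
  assumes [measurable]: "F \<in> borel_measurable borel" and C: "C < \<infinity>"
    and bd: "\<And>z. z \<in> annulus \<Longrightarrow> (\<integral>\<^sup>+\<rho>. ennreal (indicator {0<..} \<rho> * \<rho> ^ (DIM('a) - 1)) * F (\<rho> *\<^sub>R z) \<partial>lborel) \<le> C"
  shows "(\<integral>\<^sup>+y. F y \<partial>lborel) < \<infinity>"
proof -
  have "(\<integral>\<^sup>+y. F y \<partial>lborel) = (\<integral>\<^sup>+z. (\<integral>\<^sup>+\<rho>. ennreal (polar_weight (z, \<rho>)) * F (\<rho> *\<^sub>R z) \<partial>lborel) \<partial>lborel)"
    by (rule nn_integral_polar) measurable
  also have "\<dots> \<le> (\<integral>\<^sup>+z. C * indicator (annulus :: 'a set) z \<partial>lborel)"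
  proof (rule nn_integral_mono)
    fix z :: 'a
    show "(\<integral>\<^sup>+\<rho>. ennreal (polar_weight (z, \<rho>)) * F (\<rho> *\<^sub>R z) \<partial>lborel) \<le> C * indicator annulus z"
      using bd[of z] by (cases "z \<in> annulus") (simp_all add: polar_weight_def)
  qed
  also have "\<dots> = C * emeasure lborel (annulus :: 'a set)" by (simp add: nn_integral_cmult_indicator)
  also have "\<dots> < \<infinity>" using C emeasure_annulus[where 'a='a] by (simp add: ennreal_mult_less_top)
  finally show ?thesis .
qed

lemma powr_annulus_le:
  assumes "z \<in> annulus"
  shows "norm z powr a \<le> exp \<bar>a\<bar>"
proof -
  have z: "1 \<le> norm z" "norm z < exp 1" using assms by (auto simp: annulus_def)
  have "norm z powr a \<le> norm z powr \<bar>a\<bar>" using z by (intro powr_mono) auto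
  also have "\<dots> \<le> exp 1 powr \<bar>a\<bar>" using z by (intro powr_mono2) auto
  finally show ?thesis by (simp add: powr_def)
qed

lemma power_DIM_powr:
  assumes "\<rho> > 0"
  shows "\<rho> ^ (DIM('a::euclidean_space) - 1) = \<rho> powr (real DIM('a) - 1)"
  using assms DIM_positive[where 'a='a] by (simp add: powr_realpow[symmetric] of_nat_diff)

lemma integrable_norm_powr_near_0:
  assumes p: "p > 0"
  shows "integrable lborel (\<lambda>y::'a::euclidean_space. indicator (cball 0 1) y * norm y powr (p - real DIM('a)))"
proof (rule integrableI_bounded)
  let ?c = "exp \<bar>p - real DIM('a)\<bar>"
  have fin: "ennreal ?c * (\<integral>\<^sup>+\<rho>. ennreal (indicator {0<..1} \<rho> * \<rho> powr (p - 1)) \<partial>lborel) < \<infinity>"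
    using integrable_powr_near_0[of "p - 1"] p by (auto simp: integrable_iff_bounded ennreal_mult_less_top)
  have "(\<integral>\<^sup>+y. ennreal (indicator (cball 0 1) y * norm y powr (p - real DIM('a))) \<partial>(lborel :: 'a measure)) < \<infinity>"
  proof (rule nn_integral_polar_finite[OF _ fin])
    fix z :: 'a assume z: "z \<in> annulus"
    then have z1: "1 \<le> norm z" by (auto simp: annulus_def)
    have "(\<integral>\<^sup>+\<rho>. ennreal (indicator {0<..} \<rho> * \<rho> ^ (DIM('a) - 1)) * ennreal (indicator (cball 0 1) (\<rho> *\<^sub>R z) * norm (\<rho> *\<^sub>R z) powr (p - real DIM('a))) \<partial>lborel)
      \<le> (\<integral>\<^sup>+\<rho>. ennreal ?c * ennreal (indicator {0<..1} \<rho> * \<rho> powr (p - 1)) \<partial>lborel)"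
    proof (rule nn_integral_mono)
      fix \<rho> :: real
      show "ennreal (indicator {0<..} \<rho> * \<rho> ^ (DIM('a) - 1)) * ennreal (indicator (cball 0 1) (\<rho> *\<^sub>R z) * norm (\<rho> *\<^sub>R z) powr (p - real DIM('a)))
         \<le> ennreal ?c * ennreal (indicator {0<..1} \<rho> * \<rho> powr (p - 1))"
      proof (cases "\<rho> > 0 \<and> \<rho> * norm z \<le> 1")
        case True
        then have "\<rho> \<le> 1" using z1 by (smt (verit) mult_left_le mult_le_cancel_left1)
        have "\<rho> ^ (DIM('a) - 1) * norm (\<rho> *\<^sub>R z) powr (p - real DIM('a)) = (\<rho> powr (real DIM('a) - 1) * \<rho> powr (p - real DIM('a))) * norm z powr (p - real DIM('a))"
          using True power_DIM_powr[of \<rho>, where 'a='a] by (simp add: powr_mult)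
        also have "\<rho> powr (real DIM('a) - 1) * \<rho> powr (p - real DIM('a)) = \<rho> powr (p - 1)"
          by (simp add: powr_add[symmetric])
        also have "\<rho> powr (p - 1) * norm z powr (p - real DIM('a)) \<le> \<rho> powr (p - 1) * ?c"
          using powr_annulus_le[OF z] by (intro mult_left_mono) auto
        finally have "ennreal (\<rho> ^ (DIM('a) - 1) * norm (\<rho> *\<^sub>R z) powr (p - real DIM('a))) \<le> ennreal (?c * \<rho> powr (p - 1))"
          by (intro ennreal_leI) (simp add: mult.commute)
        then show ?thesis using True \<open>\<rho> \<le> 1\<close> by (simp add: ennreal_mult)
      next
        case False
        then show ?thesis by (auto split: split_indicator)
      qed
    qed
    also have "\<dots> = ennreal ?c * (\<integral>\<^sup>+\<rho>. ennreal (indicator {0<..1} \<rho> * \<rho> powr (p - 1)) \<partial>lborel)"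
      by (rule nn_integral_cmult) measurable
    finally show "(\<integral>\<^sup>+\<rho>. ennreal (indicator {0<..} \<rho> * \<rho> ^ (DIM('a) - 1)) * ennreal (indicator (cball 0 1) (\<rho> *\<^sub>R z) * norm (\<rho> *\<^sub>R z) powr (p - real DIM('a))) \<partial>lborel)
      \<le> ennreal ?c * (\<integral>\<^sup>+\<rho>. ennreal (indicator {0<..1} \<rho> * \<rho> powr (p - 1)) \<partial>lborel)" .
  qed measurable
  then show "(\<integral>\<^sup>+y. ennreal (norm (indicator (cball 0 1) y * norm y powr (p - real DIM('a)))) \<partial>(lborel :: 'a measure)) < \<infinity>"
    by simp
qed measurable

lemma integrable_norm_powr_near_infinity:
  assumes q: "q > 0"
  shows "integrable lborel (\<lambda>y::'a::euclidean_space. indicator (- ball 0 1) y * norm y powr (- q - real DIM('a)))"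
proof (rule integrableI_bounded)
  let ?c = "exp \<bar>- q - real DIM('a)\<bar>"
  define e where "e = 1 / exp (1::real)"
  have e: "e > 0" by (simp add: e_def)
  let ?g = "\<lambda>\<rho>. indicator {e..} \<rho> * \<rho> powr (- q - 1)"
  have "integrable lborel (\<lambda>x. e powr (- q - 1) * (indicator {1..} (0 + (1 / e) * x) * (0 + (1 / e) * x) powr (- q - 1)))"
    using integrable_powr_near_infinity[of "- q - 1"] q e
    by (intro integrable_mult_right lborel_integrable_real_affine) auto
  moreover have "e powr (- q - 1) * (indicator {1..} (0 + (1 / e) * x) * (0 + (1 / e) * x) powr (- q - 1)) = ?g x" for x
  proof (cases "e \<le> x")
    case True
    then have "e powr (- q - 1) * (x / e) powr (- q - 1) = x powr (- q - 1)"
      using e by (subst powr_mult[symmetric]) auto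
    then show ?thesis using True e by (simp add: indicator_def)
  next
    case False
    then show ?thesis using e by (simp add: indicator_def)
  qed
  ultimately have "integrable lborel ?g" by (simp only:)
  then have fin: "ennreal ?c * (\<integral>\<^sup>+\<rho>. ennreal (?g \<rho>) \<partial>lborel) < \<infinity>"
    by (auto simp: integrable_iff_bounded ennreal_mult_less_top)
  have "(\<integral>\<^sup>+y. ennreal (indicator (- ball 0 1) y * norm y powr (- q - real DIM('a))) \<partial>(lborel :: 'a measure)) < \<infinity>"
  proof (rule nn_integral_polar_finite[OF _ fin])
    fix z :: 'a assume z: "z \<in> annulus"
    then have z1: "1 \<le> norm z" "norm z < exp 1" by (auto simp: annulus_def)
    have "(\<integral>\<^sup>+\<rho>. ennreal (indicator {0<..} \<rho> * \<rho> ^ (DIM('a) - 1)) * ennreal (indicator (- ball 0 1) (\<rho> *\<^sub>R z) * norm (\<rho> *\<^sub>R z) powr (- q - real DIM('a))) \<partial>lborel)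
      \<le> (\<integral>\<^sup>+\<rho>. ennreal ?c * ennreal (?g \<rho>) \<partial>lborel)"
    proof (rule nn_integral_mono)
      fix \<rho> :: real
      show "ennreal (indicator {0<..} \<rho> * \<rho> ^ (DIM('a) - 1)) * ennreal (indicator (- ball 0 1) (\<rho> *\<^sub>R z) * norm (\<rho> *\<^sub>R z) powr (- q - real DIM('a)))
         \<le> ennreal ?c * ennreal (?g \<rho>)"
      proof (cases "\<rho> > 0 \<and> \<rho> * norm z \<ge> 1")
        case True
        have "1 \<le> \<rho> * norm z" using True by simp
        also have "\<dots> \<le> \<rho> * exp 1" using True z1 by (intro mult_left_mono) auto
        finally have "\<rho> \<ge> e" by (simp add: e_def field_simps)
        have "\<rho> ^ (DIM('a) - 1) * norm (\<rho> *\<^sub>R z) powr (- q - real DIM('a)) = (\<rho> powr (real DIM('a) - 1) * \<rho> powr (- q - real DIM('a))) * norm z powr (- q - real DIM('a))"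
          using True power_DIM_powr[of \<rho>, where 'a='a] by (simp add: powr_mult)
        also have "\<rho> powr (real DIM('a) - 1) * \<rho> powr (- q - real DIM('a)) = \<rho> powr (- q - 1)"
          unfolding powr_add[symmetric] by (rule arg_cong[where f="(powr) \<rho>"]) simp
        also have "\<rho> powr (- q - 1) * norm z powr (- q - real DIM('a)) \<le> \<rho> powr (- q - 1) * ?c"
          using powr_annulus_le[OF z] by (intro mult_left_mono) auto
        finally have "ennreal (\<rho> ^ (DIM('a) - 1) * norm (\<rho> *\<^sub>R z) powr (- q - real DIM('a))) \<le> ennreal (?c * \<rho> powr (- q - 1))"
          by (intro ennreal_leI) (simp add: mult.commute)
        then show ?thesis using True \<open>\<rho> \<ge> e\<close> by (simp add: ennreal_mult)
      next
        case False
        then show ?thesis by (auto split: split_indicator)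
      qed
    qed
    also have "\<dots> = ennreal ?c * (\<integral>\<^sup>+\<rho>. ennreal (?g \<rho>) \<partial>lborel)"
      by (rule nn_integral_cmult) measurable
    finally show "(\<integral>\<^sup>+\<rho>. ennreal (indicator {0<..} \<rho> * \<rho> ^ (DIM('a) - 1)) * ennreal (indicator (- ball 0 1) (\<rho> *\<^sub>R z) * norm (\<rho> *\<^sub>R z) powr (- q - real DIM('a))) \<partial>lborel)
      \<le> ennreal ?c * (\<integral>\<^sup>+\<rho>. ennreal (?g \<rho>) \<partial>lborel)" .
  qed measurable
  then show "(\<integral>\<^sup>+y. ennreal (norm (indicator (- ball 0 1) y * norm y powr (- q - real DIM('a)))) \<partial>(lborel :: 'a measure)) < \<infinity>"
    by simp
qed measurable

text \<open>
  A difference of order \<open>norm y powr a\<close> near 0 that stays bounded is integrable against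
  \<open>norm y powr - (n + q)\<close> when \<open>0 < q < a\<close>.
\<close>

lemma integrable_truncated_kernel:
  assumes "0 < q" "q < a"
  shows "integrable lborel (\<lambda>y::'a::euclidean_space. min 1 (norm y powr a) / norm y powr (real DIM('a) + q))"
proof (rule Bochner_Integration.integrable_bound)
  show "integrable lborel (\<lambda>y::'a. indicator (cball 0 1) y * norm y powr ((a - q) - real DIM('a)) + indicator (- ball 0 1) y * norm y powr (- q - real DIM('a)))"
    using assms by (intro Bochner_Integration.integrable_add integrable_norm_powr_near_0 integrable_norm_powr_near_infinity) auto
  show "AE y in lborel. norm (min 1 (norm y powr a) / norm y powr (real DIM('a) + q)) \<le>
    norm (indicator (cball 0 1) y * norm (y::'a) powr ((a - q) - real DIM('a)) + indicator (- ball 0 1) y * norm y powr (- q - real DIM('a)))"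
  proof (intro AE_I2)
    fix y :: 'a
    show "norm (min 1 (norm y powr a) / norm y powr (real DIM('a) + q)) \<le>
    norm (indicator (cball 0 1) y * norm (y::'a) powr ((a - q) - real DIM('a)) + indicator (- ball 0 1) y * norm y powr (- q - real DIM('a)))"
    proof (cases "norm y \<le> 1")
      case True
      have "min 1 (norm y powr a) / norm y powr (real DIM('a) + q) \<le> norm y powr a / norm y powr (real DIM('a) + q)"
        by (intro divide_right_mono) auto
      also have "\<dots> = norm y powr ((a - q) - real DIM('a))"
        by (simp add: powr_diff[symmetric] algebra_simps)
      finally show ?thesis using True by (auto simp: min_def split: split_indicator)
    next
      case False
      have "min 1 (norm y powr a) / norm y powr (real DIM('a) + q) \<le> 1 / norm y powr (real DIM('a) + q)"
        by (intro divide_right_mono) auto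
      also have "\<dots> = norm y powr (- q - real DIM('a))"
        by (simp add: powr_minus[symmetric] inverse_eq_divide[symmetric] algebra_simps)
      finally show ?thesis using False by (auto simp: min_def split: split_indicator)
    qed
  qed
qed measurable

section \<open>Powers of a quadratic form and their differences\<close>

text \<open>
  Forms are given by a linear map instead of a matrix, so that the real line and \<open>real ^ 'n\<close> are covered
  by the same lemmas.
\<close>

definition qf :: "('a::euclidean_space \<Rightarrow> 'a) \<Rightarrow> 'a \<Rightarrow> real" where
  "qf T x = T x \<bullet> x"

definition power_profile :: "('a::euclidean_space \<Rightarrow> 'a) \<Rightarrow> real \<Rightarrow> 'a \<Rightarrow> real" where
  "power_profile T s x = (max 0 (1 - qf T x)) powr s"

locale quadratic_form =
  fixes T :: "'a::euclidean_space \<Rightarrow> 'a"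
  assumes lin: "linear T" and sym: "T x \<bullet> y = x \<bullet> T y" and pos: "x \<noteq> 0 \<Longrightarrow> T x \<bullet> x > 0"
begin

lemma qf_add: "qf T (x + t *\<^sub>R y) = qf T x + 2 * t * (T x \<bullet> y) + t\<^sup>2 * qf T y"
proof -
  have "T (x + t *\<^sub>R y) = T x + t *\<^sub>R T y" using lin by (simp add: linear_add linear_scale)
  moreover have "T y \<bullet> x = T x \<bullet> y" using sym[of x y] by (simp add: inner_commute)
  ultimately show ?thesis by (simp add: qf_def inner_add_left inner_add_right power2_eq_square algebra_simps)
qed

lemma qf_scale: "qf T (t *\<^sub>R y) = t\<^sup>2 * qf T y"
  using lin by (simp add: qf_def linear_scale power2_eq_square)

lemma qf_nonneg: "qf T x \<ge> 0"
  using pos[of x] lin by (cases "x = 0") (auto simp: qf_def linear_0)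

lemma qf_pos: "x \<noteq> 0 \<Longrightarrow> qf T x > 0"
  using pos by (simp add: qf_def)

lemma continuous_qf: "continuous_on S (qf T)"
  unfolding qf_def by (intro continuous_intros linear_continuous_on linear_conv_bounded_linear[THEN iffD1] lin)

lemma qf_measurable [measurable]: "qf T \<in> borel_measurable borel"
  using continuous_qf by (rule borel_measurable_continuous_onI)

lemma qf_lower: "\<exists>b>0. \<forall>x. b * (norm x)\<^sup>2 \<le> qf T x"
proof -
  obtain e :: 'a where e: "e \<in> Basis" using nonempty_Basis by blast
  have "\<exists>x\<in>sphere 0 1. \<forall>y\<in>sphere 0 1. qf T x \<le> qf T y"
    using e continuous_qf by (intro continuous_attains_inf) auto
  then obtain x0 where x0: "norm x0 = 1" "\<And>y. norm y = 1 \<Longrightarrow> qf T x0 \<le> qf T y" by auto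
  have "qf T x0 > 0" using x0(1) by (intro qf_pos) auto
  moreover have "qf T x0 * (norm x)\<^sup>2 \<le> qf T x" for x
  proof (cases "x = 0")
    case False
    have "qf T x0 \<le> qf T ((1 / norm x) *\<^sub>R x)" using False by (intro x0(2)) simp
    then show ?thesis unfolding qf_scale using False by (simp add: field_simps power2_eq_square)
  qed (simp add: qf_nonneg)
  ultimately show ?thesis by blast
qed

lemma qf_bounds: "\<exists>K>0. (\<forall>x y. qf T x \<le> 1 \<longrightarrow> \<bar>T x \<bullet> y\<bar> \<le> K * norm y) \<and> (\<forall>y. qf T y \<le> K * (norm y)\<^sup>2) \<and> (\<forall>x. qf T x \<le> 1 \<longrightarrow> norm x \<le> K)"
proof -
  obtain b where b: "b > 0" "\<And>x. b * (norm x)\<^sup>2 \<le> qf T x" using qf_lower by blast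
  obtain B where B: "B > 0" "\<And>x. norm (T x) \<le> B * norm x" using linear_bounded_pos[OF lin] by blast
  define R where "R = sqrt (1 / b)"
  have R: "norm x \<le> R" if "qf T x \<le> 1" for x
  proof -
    have "(norm x)\<^sup>2 \<le> 1 / b" using b(2)[of x] that b(1) by (simp add: field_simps)
    then show ?thesis unfolding R_def by (rule real_le_rsqrt)
  qed
  have R0: "R > 0" using b by (simp add: R_def)
  define K where "K = max (B * R) (max B R)"
  have 1: "\<bar>T x \<bullet> y\<bar> \<le> K * norm y" if "qf T x \<le> 1" for x y
  proof -
    have "\<bar>T x \<bullet> y\<bar> \<le> norm (T x) * norm y" by (rule Cauchy_Schwarz_ineq2)
    also have "\<dots> \<le> (B * R) * norm y"
      using B R[OF that] by (intro mult_right_mono order_trans[OF B(2)]) auto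
    also have "\<dots> \<le> K * norm y" by (intro mult_right_mono) (auto simp: K_def)
    finally show ?thesis .
  qed
  have 2: "qf T y \<le> K * (norm y)\<^sup>2" for y
  proof -
    have "qf T y \<le> norm (T y) * norm y" unfolding qf_def by (rule norm_cauchy_schwarz)
    also have "\<dots> \<le> (B * norm y) * norm y" using B by (intro mult_right_mono) auto
    also have "\<dots> = B * (norm y)\<^sup>2" by (simp add: power2_eq_square)
    also have "\<dots> \<le> K * (norm y)\<^sup>2" by (intro mult_right_mono) (auto simp: K_def)
    finally show ?thesis .
  qed
  have 3: "norm x \<le> K" if "qf T x \<le> 1" for x using R[OF that] by (simp add: K_def)
  have "K > 0" using B R0 by (simp add: K_def)
  then show ?thesis using 1 2 3 by (intro exI[of _ K]) auto
qed

lemma power_profile_nonneg: "power_profile T s x \<ge> 0" by (simp add: power_profile_def)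

lemma power_profile_le_1: "s > 0 \<Longrightarrow> \<bar>power_profile T s x\<bar> \<le> 1"
  using qf_nonneg[of x] by (auto simp: power_profile_def intro!: powr_le1)

lemma power_profile_outside: "qf T x \<ge> 1 \<Longrightarrow> power_profile T s x = 0"
  by (simp add: power_profile_def max_def)

lemma power_profile_inside: "qf T x < 1 \<Longrightarrow> power_profile T s x = (1 - qf T x) powr s"
  by (simp add: power_profile_def max_def)

lemma continuous_power_profile: "s > 0 \<Longrightarrow> continuous_on UNIV (power_profile T s)"
  unfolding power_profile_def by (intro continuous_on_powr' continuous_intros continuous_qf) auto

lemma power_profile_measurable [measurable]: "power_profile T s \<in> borel_measurable borel"
  unfolding power_profile_def by measurable

lemma bounded_sublevel: "bounded {x. qf T x \<le> 1}"
proof -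
  obtain K where "\<forall>x. qf T x \<le> 1 \<longrightarrow> norm x \<le> K" using qf_bounds by blast
  then show ?thesis by (auto simp: bounded_iff)
qed

lemma integrable_sublevel:
  fixes f :: "'a \<Rightarrow> real"
  assumes [measurable]: "f \<in> borel_measurable borel" and "\<And>x. \<bar>f x\<bar> \<le> C" "\<And>x. qf T x > 1 \<Longrightarrow> f x = 0"
  shows "integrable lborel f"
proof (rule Bochner_Integration.integrable_bound)
  have "emeasure lborel {x. qf T x \<le> 1} < \<infinity>" using emeasure_bounded_finite[OF bounded_sublevel] .
  then show "integrable lborel (\<lambda>x. C * indicator {x. qf T x \<le> 1} x)"
    by (intro integrable_mult_right integrable_real_indicator) auto
  have "C \<ge> 0" using assms(2)[of 0] by (rule order_trans[rotated]) simp
  then show "AE x in lborel. norm (f x) \<le> norm (C * indicator {x. qf T x \<le> 1} x)"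
    using assms(2,3) by (intro AE_I2) (auto split: split_indicator)
qed measurable

lemma power_profile_integrable: 
  assumes "s > 0"
  shows "integrable lborel (power_profile T s)" "integrable lborel (\<lambda>x. (power_profile T s x)\<^sup>2)"
proof -
  show "integrable lborel (power_profile T s)"
    using power_profile_le_1[OF assms] by (intro integrable_sublevel[where C=1]) (auto simp: power_profile_outside)
  have "\<bar>(power_profile T s x)\<^sup>2\<bar> \<le> 1" for x
    using power_profile_le_1[OF assms, of x] by (simp add: abs_square_le_1)
  then show "integrable lborel (\<lambda>x. (power_profile T s x)\<^sup>2)"
    by (intro integrable_sublevel[where C=1]) (auto simp: power_profile_outside)
qed

text \<open>
  At a point of depth \<open>d = 1 - qf T x\<close> the profile is \<open>d powr s\<close> times a function of \<open>y / d\<close>, to which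
  \<open>difference_of_quadratic_powr_bound\<close> applies as long as \<open>norm y\<close> is a small multiple of \<open>d\<close>.
\<close>

lemma central_diff_near:
  assumes m: "m > 0"
  shows "\<exists>c C. 0 < c \<and> c \<le> 1 \<and> C \<ge> 0 \<and> (\<forall>x y. qf T x < 1 \<longrightarrow> norm y \<le> c * (1 - qf T x) \<longrightarrow>
     \<bar>central_diff m (power_profile T s) x y\<bar> \<le> C * (norm y / (1 - qf T x)) ^ (2 * m) * (1 - qf T x) powr s)"
proof -
  obtain K where K: "K > 0" and K1: "\<And>x y. qf T x \<le> 1 \<Longrightarrow> \<bar>T x \<bullet> y\<bar> \<le> K * norm y" and K2: "\<And>y. qf T y \<le> K * (norm y)\<^sup>2"
    using qf_bounds by blast
  obtain c C where c: "0 < c" "c \<le> 1" and C: "C \<ge> 0"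
    and main: "\<And>h b g. 0 \<le> h \<Longrightarrow> h \<le> c \<Longrightarrow> \<bar>b\<bar> \<le> K * h \<Longrightarrow> \<bar>g\<bar> \<le> K * h\<^sup>2 \<Longrightarrow>
     \<bar>\<Sum>k\<in>{- int m..int m}. dcoef m k * (1 - (2 * of_int k * b + (of_int k)\<^sup>2 * g)) powr s\<bar> \<le> C * h ^ (2 * m)"
    using difference_of_quadratic_powr_bound[OF m K, of s] by auto
  define M where "M = K * (2 * real m + (real m)\<^sup>2)"
  have M: "M > 0" unfolding M_def using K m by (intro mult_pos_pos add_pos_pos) auto
  \<comment> \<open>The bound \<open>1 / M\<close> keeps all points \<open>x + k y\<close> inside the closed ellipsoid.\<close>
  define c' where "c' = min c (1 / M)"
  have c': "0 < c'" "c' \<le> c" "c' * M \<le> 1" using c M by (auto simp: c'_def min_def field_simps)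
  have "\<bar>central_diff m (power_profile T s) x y\<bar> \<le> C * (norm y / (1 - qf T x)) ^ (2 * m) * (1 - qf T x) powr s"
    if x: "qf T x < 1" and y: "norm y \<le> c' * (1 - qf T x)" for x y
  proof -
    define d where "d = 1 - qf T x"
    have d: "0 < d" "d \<le> 1" using x qf_nonneg[of x] by (auto simp: d_def)
    define h b g where "h = norm y / d" and "b = (T x \<bullet> y) / d" and "g = qf T y / d"
    have h: "0 \<le> h" "h \<le> c'" using y d by (auto simp: h_def d_def[symmetric] field_simps)
    have b: "\<bar>b\<bar> \<le> K * h"
      using K1[of x y] x d by (simp add: b_def h_def abs_divide divide_right_mono)
    have "qf T y / d \<le> K * (norm y)\<^sup>2 / d" using K2[of y] d by (intro divide_right_mono) auto
    also have "\<dots> \<le> K * (norm y)\<^sup>2 / d\<^sup>2"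
      using d K by (intro divide_left_mono) (auto simp: power2_eq_square mult_left_le)
    finally have g: "\<bar>g\<bar> \<le> K * h\<^sup>2"
      using d qf_nonneg[of y] by (simp add: g_def h_def power_divide)
    have w: "2 * of_int k * b + (of_int k)\<^sup>2 * g \<le> 1" if k: "k \<in> {- int m..int m}" for k
    proof -
      have ka: "\<bar>of_int k :: real\<bar> \<le> real m" using k by auto
      have "2 * of_int k * b \<le> 2 * \<bar>of_int k\<bar> * \<bar>b\<bar>"
        by (metis abs_ge_self abs_mult abs_numeral)
      also have "\<dots> \<le> 2 * real m * (K * h)" using ka b h K by (intro mult_mono) auto
      finally have 1: "2 * of_int k * b \<le> 2 * real m * (K * h)" .
      have "(of_int k :: real)\<^sup>2 \<le> (real m)\<^sup>2" using ka by (intro abs_le_square_iff[THEN iffD1]) auto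
      moreover have "h\<^sup>2 \<le> h" using h c' c by (simp add: power2_eq_square mult_left_le)
      then have "\<bar>g\<bar> \<le> K * h" using g K by (smt (verit) mult_left_mono)
      then have "g \<le> K * h" by simp
      ultimately have 2: "(of_int k)\<^sup>2 * g \<le> (real m)\<^sup>2 * (K * h)"
        using d qf_nonneg[of y] by (intro mult_mono) (auto simp: g_def)
      have "2 * real m * (K * h) + (real m)\<^sup>2 * (K * h) = M * h" by (simp add: M_def algebra_simps)
      also have "\<dots> \<le> M * c'" using h M by (intro mult_left_mono) auto
      also have "\<dots> \<le> 1" using c' by (simp add: mult.commute)
      finally show ?thesis using 1 2 by simp
    qed
    have "power_profile T s (x + of_int k *\<^sub>R y) = d powr s * (1 - (2 * of_int k * b + (of_int k)\<^sup>2 * g)) powr s"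
      if k: "k \<in> {- int m..int m}" for k
    proof -
      have "1 - qf T (x + of_int k *\<^sub>R y) = d * (1 - (2 * of_int k * b + (of_int k)\<^sup>2 * g))"
        unfolding qf_add using d(1) by (simp add: b_def g_def field_simps) (simp add: d_def)
      moreover have "0 \<le> d * (1 - (2 * of_int k * b + (of_int k)\<^sup>2 * g))" using w[OF k] d by simp
      ultimately have "max 0 (1 - qf T (x + of_int k *\<^sub>R y)) = d * (1 - (2 * of_int k * b + (of_int k)\<^sup>2 * g))" by simp
      then show ?thesis unfolding power_profile_def using w[OF k] d by (simp add: powr_mult)
    qed
    then have "central_diff m (power_profile T s) x y = (\<Sum>k\<in>{- int m..int m}. d powr s * (dcoef m k * (1 - (2 * of_int k * b + (of_int k)\<^sup>2 * g)) powr s))"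
      unfolding central_diff_eq by (intro sum.cong refl) simp
    then have eq: "central_diff m (power_profile T s) x y = d powr s * (\<Sum>k\<in>{- int m..int m}. dcoef m k * (1 - (2 * of_int k * b + (of_int k)\<^sup>2 * g)) powr s)"
      by (simp only: sum_distrib_left)
    have "\<bar>central_diff m (power_profile T s) x y\<bar> \<le> d powr s * (C * h ^ (2 * m))"
      unfolding eq abs_mult using main[of h b g] h b g c' by (auto intro!: mult_left_mono)
    then show ?thesis unfolding h_def d_def by (simp add: mult_ac)
  qed
  then show ?thesis using c c' C by (intro exI[of _ c'] exI[of _ C]) auto
qed

lemma central_diff_power_profile_bounded:
  assumes "s > 0"
  shows "\<bar>central_diff m (power_profile T s) x y\<bar> \<le> (\<Sum>k\<in>{- int m..int m}. \<bar>dcoef m k\<bar>)"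
  using central_diff_bounded[of "power_profile T s" 1 m x y, OF power_profile_le_1[OF assms]] by simp

text \<open>
  Away from the boundary the difference is of order \<open>norm y powr (2 m)\<close>, which beats the singularity of
  the kernel.
\<close>

lemma central_diff_compact:
  assumes s: "s > 0" and m: "m > 0" and d0: "0 < d0" "d0 \<le> 1"
  shows "\<exists>C\<ge>0. \<forall>x y. qf T x \<le> 1 - d0 \<longrightarrow> \<bar>central_diff m (power_profile T s) x y\<bar> \<le> C * min 1 (norm y powr (2 * real m))"
proof -
  obtain c C where c: "0 < c" "c \<le> 1" and C: "C \<ge> 0"
    and near: "\<And>x y. qf T x < 1 \<Longrightarrow> norm y \<le> c * (1 - qf T x) \<Longrightarrow>
     \<bar>central_diff m (power_profile T s) x y\<bar> \<le> C * (norm y / (1 - qf T x)) ^ (2 * m) * (1 - qf T x) powr s"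
    using central_diff_near[OF m, of s] by auto
  define S where "S = (\<Sum>k\<in>{- int m..int m}. \<bar>dcoef m k\<bar>)"
  have S: "S \<ge> 0" by (simp add: S_def sum_nonneg)
  have Sb: "\<bar>central_diff m (power_profile T s) x y\<bar> \<le> S" for x y
    unfolding S_def by (rule central_diff_power_profile_bounded[OF s])
  define C' where "C' = S + (C / d0 ^ (2 * m) + S / (c * d0) ^ (2 * m))"
  have parts: "C / d0 ^ (2 * m) \<ge> 0" "S / (c * d0) ^ (2 * m) \<ge> 0" using C S c d0 by auto
  have bound: "\<bar>central_diff m (power_profile T s) x y\<bar> \<le> C' * min 1 (norm y powr (2 * real m))" if x: "qf T x \<le> 1 - d0" for x y
  proof -
    define d where "d = 1 - qf T x"
    have d: "d0 \<le> d" "d \<le> 1" using x qf_nonneg[of x] by (auto simp: d_def)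
    have pw: "norm y powr (2 * real m) = norm y ^ (2 * m)"
      using m by (cases "y = 0") (simp_all add: powr_realpow[symmetric])
    have "\<bar>central_diff m (power_profile T s) x y\<bar> \<le> (C / d0 ^ (2 * m) + S / (c * d0) ^ (2 * m)) * norm y ^ (2 * m)"
    proof (cases "norm y \<le> c * d")
      case True
      have "\<bar>central_diff m (power_profile T s) x y\<bar> \<le> C * (norm y / d) ^ (2 * m) * d powr s"
        using near[of x y] True d d0 by (simp add: d_def)
      also have "\<dots> \<le> C * (norm y / d0) ^ (2 * m) * 1"
        using C d d0 s by (intro mult_mono power_mono divide_left_mono powr_le1) auto
      also have "\<dots> = C / d0 ^ (2 * m) * norm y ^ (2 * m)" by (simp add: power_divide)
      also have "\<dots> \<le> (C / d0 ^ (2 * m) + S / (c * d0) ^ (2 * m)) * norm y ^ (2 * m)"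
        using parts by (intro mult_right_mono) auto
      finally show ?thesis .
    next
      case False
      have "c * d0 \<le> norm y" using False c d mult_left_mono[of d0 d c] by linarith
      then have "(c * d0) ^ (2 * m) \<le> norm y ^ (2 * m)" using c d0 by (intro power_mono) auto
      then have "S \<le> S / (c * d0) ^ (2 * m) * norm y ^ (2 * m)"
        using S c d0 mult_left_mono[of "(c * d0) ^ (2 * m)" "norm y ^ (2 * m)" S] by (simp add: field_simps)
      also have "\<dots> \<le> (C / d0 ^ (2 * m) + S / (c * d0) ^ (2 * m)) * norm y ^ (2 * m)"
        using parts by (intro mult_right_mono) auto
      finally show ?thesis using Sb[of x y] by simp
    qed
    also have "\<dots> \<le> C' * norm y ^ (2 * m)" using S by (intro mult_right_mono) (auto simp: C'_def)
    finally have 1: "\<bar>central_diff m (power_profile T s) x y\<bar> \<le> C' * norm y powr (2 * real m)" unfolding pw .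
    have 2: "\<bar>central_diff m (power_profile T s) x y\<bar> \<le> C'" using Sb[of x y] parts unfolding C'_def by linarith
    show ?thesis using 1 2 by (simp add: min_def)
  qed
  have "C' \<ge> 0" using S parts by (simp add: C'_def)
  then show ?thesis using bound by (intro exI[of _ C']) simp
qed

text \<open>
  Up to the boundary the difference alone is only of order \<open>norm y powr s\<close>, but the profile contributes
  another \<open>s\<close> where this happens, since there \<open>1 - qf T x\<close> is at most a multiple of \<open>norm y\<close>. Giving away a
  factor \<open>(1 - qf T x) powr (-1/2)\<close>, which is still integrable over the ellipsoid, gains the extra
  \<open>norm y powr (1/2)\<close> needed for integrability in \<open>y\<close>.
\<close>

lemma central_diff_weighted:
  assumes s: "s > 0" and m: "real m \<ge> s + 1"
  shows "\<exists>C\<ge>0. \<forall>x y. qf T x < 1 \<longrightarrow> norm y \<le> 1 \<longrightarrow>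
    \<bar>central_diff m (power_profile T s) x y\<bar> * power_profile T s x \<le> C * (norm y powr (2 * s + 1/2) * (1 - qf T x) powr (-1/2))"
proof -
  have m0: "m > 0" using s m by (cases m) auto
  obtain K where K: "K > 0" and K1: "\<And>x y. qf T x \<le> 1 \<Longrightarrow> \<bar>T x \<bullet> y\<bar> \<le> K * norm y"
    using qf_bounds by blast
  obtain c C where c: "0 < c" "c \<le> 1" and C: "C \<ge> 0"
    and near: "\<And>x y. qf T x < 1 \<Longrightarrow> norm y \<le> c * (1 - qf T x) \<Longrightarrow>
     \<bar>central_diff m (power_profile T s) x y\<bar> \<le> C * (norm y / (1 - qf T x)) ^ (2 * m) * (1 - qf T x) powr s"
    using central_diff_near[OF m0, of s] by auto
  define S where "S = (\<Sum>k\<in>{- int m..int m}. \<bar>dcoef m k\<bar>)"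
  have S: "S \<ge> 0" by (simp add: S_def sum_nonneg)
  define P where "P = 1 / c + 2 * real m * K"
  have P: "P > 0" unfolding P_def using c K by (intro add_pos_nonneg) auto
  define C2 where "C2 = S * P powr s * (1 / c) powr s * (1 / c) powr (1/2)"
  have C2: "C2 \<ge> 0" using S by (simp add: C2_def)
  have bound: "\<bar>central_diff m (power_profile T s) x y\<bar> * power_profile T s x \<le> (C + C2) * (norm y powr (2 * s + 1/2) * (1 - qf T x) powr (-1/2))"
    if x: "qf T x < 1" for x y
  proof (cases "y = 0")
    case True
    have "central_diff m (power_profile T s) x 0 = power_profile T s x * (\<Sum>k\<in>{- int m..int m}. dcoef m k * of_int k ^ 0)"
      unfolding central_diff_eq by (simp add: sum_distrib_left mult.commute)
    then show ?thesis using True dcoef_moment[of 0 m] m0 s by simp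
  next
    case False
    define d where "d = 1 - qf T x"
    define r where "r = norm y"
    have d: "0 < d" "d \<le> 1" using x qf_nonneg[of x] by (auto simp: d_def)
    have r: "r > 0" using False by (simp add: r_def)
    have ux: "power_profile T s x = d powr s" using x by (simp add: power_profile_inside d_def)
    have "\<bar>central_diff m (power_profile T s) x y\<bar> * power_profile T s x \<le> (C + C2) * (r powr (2 * s + 1/2) * d powr (-1/2))"
    proof (cases "r \<le> c * d")
      case True
      have rd: "r / d \<le> 1" 
      proof -
        have "c * d \<le> 1 * d" using c d by (intro mult_right_mono) auto
        then have "r \<le> d" using True by simp
        then show ?thesis using d by (simp add: divide_le_eq)
      qed
      have "\<bar>central_diff m (power_profile T s) x y\<bar> * power_profile T s x \<le> (C * (r / d) ^ (2 * m) * d powr s) * d powr s"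
        unfolding ux using near[of x y] True x by (intro mult_right_mono) (auto simp: d_def r_def)
      also have "(r / d) ^ (2 * m) = (r / d) powr (2 * real m)" using r d by (simp add: powr_realpow[symmetric])
      also have "C * (r / d) powr (2 * real m) * d powr s * d powr s \<le> C * (r / d) powr (2 * s + 1/2) * d powr s * d powr s"
        using rd r d m C by (intro mult_right_mono mult_left_mono powr_mono') auto
      also have "\<dots> = C * (r powr (2 * s + 1/2) * (d powr (- (2 * s + 1/2)) * d powr s * d powr s))"
        using r d by (simp add: powr_divide powr_minus field_simps)
      also have "d powr (- (2 * s + 1/2)) * d powr s * d powr s = d powr (-1/2)"
        unfolding powr_add[symmetric] by (rule arg_cong[where f="(powr) d"]) simp
      also have "C * (r powr (2 * s + 1/2) * d powr (-1/2)) \<le> (C + C2) * (r powr (2 * s + 1/2) * d powr (-1/2))"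
        using C2 by (intro mult_right_mono) auto
      finally show ?thesis .
    next
      case rc: False
      have dr: "d \<le> (1 / c) * r" using rc c by (simp add: field_simps)
      have uk: "\<bar>power_profile T s (x + of_int k *\<^sub>R y)\<bar> \<le> P powr s * r powr s" if k: "k \<in> {- int m..int m}" for k
      proof -
        have ka: "\<bar>of_int k :: real\<bar> \<le> real m" using k by auto
        have "- (2 * of_int k * (T x \<bullet> y)) \<le> \<bar>2 * of_int k * (T x \<bullet> y)\<bar>" by simp
        moreover have "\<bar>2 * of_int k * (T x \<bullet> y)\<bar> \<le> 2 * real m * (K * r)"
          unfolding abs_mult r_def using ka K1[of x y] x by (intro mult_mono) auto
        ultimately have "1 - qf T (x + of_int k *\<^sub>R y) \<le> d + 2 * real m * (K * r)"
        proof -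
          have "(of_int k)\<^sup>2 * qf T y \<ge> 0" using qf_nonneg[of y] by simp
          moreover have "- (2 * of_int k * (T x \<bullet> y)) \<le> 2 * real m * (K * r)"
            by (rule order_trans) fact+
          ultimately show ?thesis unfolding qf_add d_def by linarith
        qed
        also have "\<dots> \<le> P * r" using dr by (simp add: P_def algebra_simps)
        finally have "max 0 (1 - qf T (x + of_int k *\<^sub>R y)) \<le> P * r" using P r by simp
        then have "power_profile T s (x + of_int k *\<^sub>R y) \<le> (P * r) powr s"
          unfolding power_profile_def using s by (intro powr_mono2) auto
        then show ?thesis using P r by (simp add: powr_mult power_profile_nonneg)
      qed
      have "\<bar>central_diff m (power_profile T s) x y\<bar> \<le> (\<Sum>k\<in>{- int m..int m}. \<bar>dcoef m k\<bar> * (P powr s * r powr s))"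
        unfolding central_diff_eq using uk
        by (intro order_trans[OF sum_abs] sum_mono) (auto simp: abs_mult intro!: mult_left_mono)
      also have "\<dots> = S * (P powr s * r powr s)" by (simp add: S_def sum_distrib_right)
      finally have 1: "\<bar>central_diff m (power_profile T s) x y\<bar> \<le> S * (P powr s * r powr s)" .
      have 2: "d powr s \<le> (1 / c) powr s * r powr s"
        using dr d c r s by (subst powr_mult[symmetric]) (auto intro!: powr_mono2)
      have "1 = d powr (1/2) * d powr (-1/2)" using d by (simp add: powr_add[symmetric])
      also have "\<dots> \<le> ((1 / c) powr (1/2) * r powr (1/2)) * d powr (-1/2)"
        using dr d c r by (subst powr_mult[symmetric]) (auto intro!: mult_right_mono powr_mono2)
      finally have 3: "1 \<le> ((1 / c) powr (1/2) * r powr (1/2)) * d powr (-1/2)" .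
      have "\<bar>central_diff m (power_profile T s) x y\<bar> * power_profile T s x \<le> (S * (P powr s * r powr s)) * ((1 / c) powr s * r powr s) * 1"
        unfolding ux using 1 2 S by (simp, intro mult_mono) auto
      also have "\<dots> \<le> (S * (P powr s * r powr s)) * ((1 / c) powr s * r powr s) * (((1 / c) powr (1/2) * r powr (1/2)) * d powr (-1/2))"
        using 3 S by (intro mult_left_mono) auto
      also have "\<dots> = C2 * ((r powr s * r powr s * r powr (1/2)) * d powr (-1/2))"
        by (simp add: C2_def mult_ac)
      also have "r powr s * r powr s * r powr (1/2) = r powr (2 * s + 1/2)"
        unfolding powr_add[symmetric] by (rule arg_cong[where f="(powr) r"]) simp
      also have "C2 * (r powr (2 * s + 1/2) * d powr (-1/2)) \<le> (C + C2) * (r powr (2 * s + 1/2) * d powr (-1/2))"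
        using C by (intro mult_right_mono) auto
      finally show ?thesis .
    qed
    then show ?thesis by (simp add: r_def d_def)
  qed
  then show ?thesis using C C2 by (intro exI[of _ "C + C2"]) auto
qed

text \<open>
  On a ray in direction \<open>z\<close>, with \<open>q\<^sup>2 = qf T z\<close>, the weight is \<open>((1 - q \<rho>) (1 + q \<rho>)) powr (-1/2)\<close>, which is integrable
  uniformly in \<open>z\<close> from the annulus.
\<close>

lemma integrable_distance_weight:
  "integrable lborel (\<lambda>x. indicator {x. qf T x < 1} x * (1 - qf T x) powr (-1/2))"
proof (rule integrableI_bounded)
  obtain b where b: "b > 0" "\<And>x. b * (norm x)\<^sup>2 \<le> qf T x" using qf_lower by blast
  define q0 where "q0 = sqrt b"
  have q0: "q0 > 0" using b by (simp add: q0_def)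
  define G where "G = (\<integral>\<^sup>+t. ennreal (indicator {0<..1} t * t powr (-1/2)) \<partial>lborel)"
  have G: "G < \<infinity>" unfolding G_def using integrable_powr_near_0[of "-1/2"] by (simp add: integrable_iff_bounded)
  let ?c = "(1 / q0) ^ (DIM('a) - 1)"
  have fin: "ennreal ?c * (ennreal (1 / q0) * G) < \<infinity>" using G by (simp add: ennreal_mult_less_top)
  have "(\<integral>\<^sup>+x. ennreal (indicator {x. qf T x < 1} x * (1 - qf T x) powr (-1/2)) \<partial>lborel) < \<infinity>"
  proof (rule nn_integral_polar_finite[OF _ fin])
    fix z :: 'a assume z: "z \<in> annulus"
    then have z1: "norm z \<ge> 1" by (auto simp: annulus_def)
    define q where "q = sqrt (qf T z)"
    have "b * 1 \<le> b * (norm z)\<^sup>2" using b z1 by (intro mult_left_mono) auto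
    then have "b \<le> qf T z" using b(2)[of z] by simp
    then have q: "q \<ge> q0" "q > 0" "q\<^sup>2 = qf T z" using q0 b by (auto simp: q_def q0_def)
    have "(\<integral>\<^sup>+\<rho>. ennreal (indicator {0<..} \<rho> * \<rho> ^ (DIM('a) - 1)) * ennreal (indicator {x. qf T x < 1} (\<rho> *\<^sub>R z) * (1 - qf T (\<rho> *\<^sub>R z)) powr (-1/2)) \<partial>lborel)
       \<le> (\<integral>\<^sup>+\<rho>. ennreal ?c * ennreal (indicator {0<..1} (1 + (- q) * \<rho>) * (1 + (- q) * \<rho>) powr (-1/2)) \<partial>lborel)"
    proof (rule nn_integral_mono)
      fix \<rho> :: real
      have eq: "1 - qf T (\<rho> *\<^sub>R z) = (1 - q * \<rho>) * (1 + q * \<rho>)"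
        unfolding qf_scale q(3)[symmetric] by (simp add: algebra_simps power2_eq_square)
      show "ennreal (indicator {0<..} \<rho> * \<rho> ^ (DIM('a) - 1)) * ennreal (indicator {x. qf T x < 1} (\<rho> *\<^sub>R z) * (1 - qf T (\<rho> *\<^sub>R z)) powr (-1/2))
         \<le> ennreal ?c * ennreal (indicator {0<..1} (1 + (- q) * \<rho>) * (1 + (- q) * \<rho>) powr (-1/2))"
      proof (cases "\<rho> > 0 \<and> qf T (\<rho> *\<^sub>R z) < 1")
        case True
        have pr: "1 + q * \<rho> > 1" using True q by simp
        have "0 < (1 - q * \<rho>) * (1 + q * \<rho>)" using True eq by simp
        then have p1: "1 - q * \<rho> > 0" using pr by (simp add: zero_less_mult_iff)
        have "\<rho> \<le> 1 / q0"
        proof -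
          have "q0 * \<rho> \<le> q * \<rho>" using q True by (intro mult_right_mono) auto
          then have "q0 * \<rho> \<le> 1" using p1 by simp
          then show ?thesis using q0 by (simp add: field_simps)
        qed
        then have A: "\<rho> ^ (DIM('a) - 1) \<le> ?c" using True by (intro power_mono) auto
        have B: "(1 - qf T (\<rho> *\<^sub>R z)) powr (-1/2) \<le> (1 - q * \<rho>) powr (-1/2)"
          unfolding eq using p1 pr by (intro powr_mono2') (auto simp: mult_le_cancel_left1)
        have "\<rho> ^ (DIM('a) - 1) * (1 - qf T (\<rho> *\<^sub>R z)) powr (-1/2) \<le> ?c * (1 - q * \<rho>) powr (-1/2)"
          using A B q0 by (intro mult_mono) auto
        then have "ennreal (\<rho> ^ (DIM('a) - 1) * (1 - qf T (\<rho> *\<^sub>R z)) powr (-1/2)) \<le> ennreal (?c * (1 - q * \<rho>) powr (-1/2))"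
          by (rule ennreal_leI)
        then show ?thesis using True p1 q q0 by (simp add: ennreal_mult)
      next
        case False
        then show ?thesis by (auto split: split_indicator)
      qed
    qed
    also have "\<dots> = ennreal ?c * (\<integral>\<^sup>+\<rho>. ennreal (indicator {0<..1} (1 + (- q) * \<rho>) * (1 + (- q) * \<rho>) powr (-1/2)) \<partial>lborel)"
      by (rule nn_integral_cmult) measurable
    also have "(\<integral>\<^sup>+\<rho>. ennreal (indicator {0<..1} (1 + (- q) * \<rho>) * (1 + (- q) * \<rho>) powr (-1/2)) \<partial>lborel) = ennreal (1 / q) * G"
    proof -
      have "G = ennreal \<bar>- q\<bar> * (\<integral>\<^sup>+\<rho>. ennreal (indicator {0<..1} (1 + (- q) * \<rho>) * (1 + (- q) * \<rho>) powr (-1/2)) \<partial>lborel)"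
        unfolding G_def using q by (intro nn_integral_real_affine) auto
      then have "ennreal (1 / q) * G = (ennreal (1 / q) * ennreal q) * (\<integral>\<^sup>+\<rho>. ennreal (indicator {0<..1} (1 + (- q) * \<rho>) * (1 + (- q) * \<rho>) powr (-1/2)) \<partial>lborel)"
        using q by (simp add: mult.assoc)
      also have "ennreal (1 / q) * ennreal q = 1" using q by (simp add: ennreal_mult[symmetric])
      finally show ?thesis by simp
    qed
    also have "ennreal ?c * (ennreal (1 / q) * G) \<le> ennreal ?c * (ennreal (1 / q0) * G)"
      using q q0 by (intro mult_left_mono mult_right_mono ennreal_leI divide_left_mono) auto
    finally show "(\<integral>\<^sup>+\<rho>. ennreal (indicator {0<..} \<rho> * \<rho> ^ (DIM('a) - 1)) * ennreal (indicator {x. qf T x < 1} (\<rho> *\<^sub>R z) * (1 - qf T (\<rho> *\<^sub>R z)) powr (-1/2)) \<partial>lborel)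
       \<le> ennreal ?c * (ennreal (1 / q0) * G)" .
  qed measurable
  then show "(\<integral>\<^sup>+x. ennreal (norm (indicator {x. qf T x < 1} x * (1 - qf T x) powr (-1/2))) \<partial>lborel) < \<infinity>"
    by simp
qed measurable

end

section \<open>Finite energy, and the energy pairing with interior test functions\<close>

lemma has_bochner_integral_symbol:
  fixes \<xi> :: "'a::euclidean_space"
  assumes s: "s > 0" "s < real m"
  shows "has_bochner_integral lborel (\<lambda>y. (2 - 2 * cos (\<xi> \<bullet> y)) ^ m / norm y powr (real DIM('a) + 2 * s)) (2 / frac_const DIM('a) m s * norm \<xi> powr (2 * s))"
proof (rule has_bochner_integral_nn_integral)
  show "AE y in lborel. 0 \<le> (2 - 2 * cos (\<xi> \<bullet> y)) ^ m / norm y powr (real DIM('a) + 2 * s)"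
    by (intro AE_I2 divide_nonneg_nonneg zero_le_power) auto
  show "0 \<le> 2 / frac_const DIM('a) m s * norm \<xi> powr (2 * s)"
    using frac_const_pos[OF s, of "DIM('a)"] by simp
qed (auto simp: fractional_symbol[OF s])

lemma integrable_product:
  fixes f :: "'a::euclidean_space \<Rightarrow> real" and g :: "'b::euclidean_space \<Rightarrow> real"
  assumes f: "integrable lborel f" and g: "integrable lborel g"
  shows "integrable (lborel \<Otimes>\<^sub>M lborel) (\<lambda>(x, y). f x * g y)"
proof -
  have [measurable]: "f \<in> borel_measurable borel" "g \<in> borel_measurable borel"
    using borel_measurable_integrable[OF f] borel_measurable_integrable[OF g] by simp_all
  show ?thesis
  proof (rule lborel_pair.Fubini_integrable)
    show "integrable lborel (\<lambda>x. \<integral>y. norm (case (x, y) of (x, y) \<Rightarrow> f x * g y) \<partial>lborel)"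
      using f by (simp add: abs_mult)
    show "AE x in lborel. integrable lborel (\<lambda>y. case (x, y) of (x, y) \<Rightarrow> f x * g y)"
      using g by simp
  qed measurable
qed

lemma (in quadratic_form) central_diff_pairing_bounded:
  assumes s: "s > 0"
  shows "\<exists>C\<ge>0. \<forall>y. \<bar>\<integral>x. central_diff m (power_profile T s) x y * power_profile T s x \<partial>lborel\<bar> \<le> C"
proof -
  define S where "S = (\<Sum>k\<in>{- int m..int m}. \<bar>dcoef m k\<bar>)"
  have S: "S \<ge> 0" by (simp add: S_def sum_nonneg)
  have "\<bar>\<integral>x. central_diff m (power_profile T s) x y * power_profile T s x \<partial>lborel\<bar> \<le> S * (\<integral>x. power_profile T s x \<partial>lborel)" for y
  proof -
    have "norm (\<integral>x. central_diff m (power_profile T s) x y * power_profile T s x \<partial>lborel) \<le> (\<integral>x. S * power_profile T s x \<partial>lborel)"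
    proof (rule Bochner_Integration.integral_norm_bound_integral)
      show i: "integrable lborel (\<lambda>x. S * power_profile T s x)" using power_profile_integrable[OF s] by simp
      have b: "norm (central_diff m (power_profile T s) x y * power_profile T s x) \<le> S * power_profile T s x" for x
        using central_diff_power_profile_bounded[OF s, of m x y] power_profile_nonneg[of s x]
        by (simp add: abs_mult S_def mult_right_mono)
      show "norm (central_diff m (power_profile T s) x y * power_profile T s x) \<le> S * power_profile T s x" for x by (rule b)
      show "integrable lborel (\<lambda>x. central_diff m (power_profile T s) x y * power_profile T s x)"
        using i
      proof (rule Bochner_Integration.integrable_bound)
        show "AE x in lborel. norm (central_diff m (power_profile T s) x y * power_profile T s x) \<le> norm (S * power_profile T s x)"
          using b by (intro AE_I2 order_trans[OF b]) simp
      qed measurable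
    qed
    then show ?thesis by simp
  qed
  moreover have "S * (\<integral>x. power_profile T s x \<partial>lborel) \<ge> 0"
    using S by (intro mult_nonneg_nonneg integral_nonneg_AE) (auto simp: power_profile_nonneg)
  ultimately show ?thesis by blast
qed

text \<open>
  The energy is, up to a constant, the integral over \<open>y\<close> of \<open>\<integral> (central_diff m u x y) * u x dx\<close> against the
  kernel, by Parseval in \<open>x\<close> and \<open>fractional_symbol\<close> in \<open>y\<close>. Everything on the frequency side is nonnegative, so no
  prior integrability is needed, and the weighted bound on differences makes the result finite.
\<close>

theorem (in quadratic_form) power_profile_energy:
  assumes s: "s > 0"
  shows "integrable lborel (\<lambda>\<xi>. norm \<xi> powr (2 * s) * (norm (FT (power_profile T s) \<xi>))\<^sup>2)"
proof -
  \<comment> \<open>Any order works for the energy; the weighted bound asks for \<open>m \<ge> s + 1\<close>.\<close>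
  define m where "m = nat \<lceil>s\<rceil> + 1"
  have m: "real m \<ge> s + 1" "s < real m" by (auto simp: m_def) linarith+
  let ?u = "power_profile T s"
  define n where "n = DIM('a)"
  define c where "c = frac_const n m s"
  have c: "c > 0" unfolding c_def by (rule frac_const_pos[OF s m(2)])
  define J where "J = (\<lambda>y. \<integral>x. central_diff m ?u x y * ?u x \<partial>lborel)"
  obtain C1 where C1: "C1 \<ge> 0" "\<And>y. \<bar>J y\<bar> \<le> C1" using central_diff_pairing_bounded[OF s, of m] unfolding J_def by auto
  obtain C2 where C2: "C2 \<ge> 0" and w: "\<And>x y. qf T x < 1 \<Longrightarrow> norm y \<le> 1 \<Longrightarrow>
    \<bar>central_diff m ?u x y\<bar> * ?u x \<le> C2 * (norm y powr (2 * s + 1/2) * (1 - qf T x) powr (-1/2))"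
    using central_diff_weighted[OF s m(1)] by auto
  let ?w = "\<lambda>x. indicator {x. qf T x < 1} x * (1 - qf T x) powr (-1/2)"
  define I where "I = (\<integral>x. ?w x \<partial>lborel)"
  have I: "I \<ge> 0" unfolding I_def by (intro integral_nonneg_AE AE_I2) auto
  have J1: "\<bar>J y\<bar> \<le> (C2 * I) * norm y powr (2 * s + 1/2)" if y: "norm y \<le> 1" for y
  proof -
    have iw: "integrable lborel (\<lambda>x. C2 * norm y powr (2 * s + 1/2) * ?w x)"
      by (intro integrable_mult_right integrable_distance_weight)
    have b: "norm (central_diff m ?u x y * ?u x) \<le> C2 * norm y powr (2 * s + 1/2) * ?w x" for x
    proof (cases "qf T x < 1")
      case True
      then show ?thesis using w[OF True y] power_profile_nonneg[of s x] by (simp add: abs_mult mult.assoc)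
    next
      case False
      then show ?thesis using power_profile_outside[of x s] C2 by simp
    qed
    have "norm (J y) \<le> (\<integral>x. C2 * norm y powr (2 * s + 1/2) * ?w x \<partial>lborel)"
      unfolding J_def
    proof (rule Bochner_Integration.integral_norm_bound_integral)
      show "integrable lborel (\<lambda>x. central_diff m ?u x y * ?u x)"
        using iw
      proof (rule Bochner_Integration.integrable_bound)
        show "AE x in lborel. norm (central_diff m ?u x y * ?u x) \<le> norm (C2 * norm y powr (2 * s + 1/2) * ?w x)"
          by (intro AE_I2 order_trans[OF b]) simp
      qed measurable
    qed (use iw b in auto)
    also have "\<dots> = C2 * norm y powr (2 * s + 1/2) * I"
      unfolding I_def by (rule integral_mult_right_zero)
    finally show ?thesis by (simp add: mult_ac)
  qed
  define C3 where "C3 = max C1 (C2 * I)"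
  have J3: "\<bar>J y\<bar> \<le> C3 * min 1 (norm y powr (2 * s + 1/2))" for y
  proof (cases "norm y \<le> 1")
    case True
    have p1: "norm y powr (2 * s + 1/2) \<le> 1" using True s by (intro powr_le1) auto
    have "\<bar>J y\<bar> \<le> (C2 * I) * norm y powr (2 * s + 1/2)" by (rule J1[OF True])
    also have "\<dots> \<le> C3 * norm y powr (2 * s + 1/2)" by (intro mult_right_mono) (auto simp: C3_def)
    finally show ?thesis using p1 by (simp add: min_def)
  next
    case False
    then have "norm y powr (2 * s + 1/2) \<ge> 1" using s by (intro ge_one_powr_ge_zero) auto
    then show ?thesis using C1(2)[of y] by (simp add: min_def C3_def)
  qed
  define W where "W = (\<lambda>\<xi> (y::'a). (2 - 2 * cos (\<xi> \<bullet> y)) ^ m / norm y powr (real n + 2 * s))"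
  have W0: "W \<xi> y \<ge> 0" for \<xi> y by (auto simp: W_def intro!: divide_nonneg_nonneg)
  have Wm[measurable]: "(\<lambda>(\<xi>, y). W \<xi> y) \<in> borel_measurable (borel \<Otimes>\<^sub>M borel)" unfolding W_def by measurable
  have Wint: "(\<integral>\<^sup>+y. ennreal (W \<xi> y) \<partial>lborel) = ennreal (2 / c * norm \<xi> powr (2 * s))" for \<xi>
    using fractional_symbol[OF s m(2), of \<xi>] unfolding W_def c_def n_def .
  define A where "A = (\<lambda>\<xi>. (norm (FT ?u \<xi>))\<^sup>2)"
  have A0: "A \<xi> \<ge> 0" for \<xi> by (simp add: A_def)
  have [measurable]: "A \<in> borel_measurable borel" unfolding A_def by measurable
  have inner: "(\<integral>\<^sup>+\<xi>. ennreal (A \<xi>) * ennreal (W \<xi> y) \<partial>lborel) = ennreal (J y / norm y powr (real n + 2 * s))" for y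
  proof -
    have hb: "has_bochner_integral lborel (\<lambda>\<xi>. of_real ((2 - 2 * cos (\<xi> \<bullet> y)) ^ m) * FT ?u \<xi> * cnj (FT ?u \<xi>)) (of_real (J y))"
      unfolding J_def by (rule parseval_central_diff[OF power_profile_integrable(1)[OF s] continuous_power_profile[OF s] power_profile_le_1[OF s] power_profile_integrable[OF s]])
    have eq: "of_real ((2 - 2 * cos (\<xi> \<bullet> y)) ^ m) * FT ?u \<xi> * cnj (FT ?u \<xi>) = of_real ((2 - 2 * cos (\<xi> \<bullet> y)) ^ m * A \<xi>)" for \<xi>
      unfolding A_def by (simp only: complex_norm_square of_real_mult mult.assoc)
    have "has_bochner_integral lborel (\<lambda>\<xi>. (2 - 2 * cos (\<xi> \<bullet> y)) ^ m * A \<xi>) (J y)"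
      using has_bochner_integral_Re[OF hb[unfolded eq]] by (simp only: Re_complex_of_real)
    then have "has_bochner_integral lborel (\<lambda>\<xi>. (2 - 2 * cos (\<xi> \<bullet> y)) ^ m * A \<xi> / norm y powr (real n + 2 * s)) (J y / norm y powr (real n + 2 * s))"
      by (rule has_bochner_integral_divide_zero)
    moreover have "(2 - 2 * cos (\<xi> \<bullet> y)) ^ m * A \<xi> / norm y powr (real n + 2 * s) = A \<xi> * W \<xi> y" for \<xi>
      by (simp add: W_def)
    ultimately have "has_bochner_integral lborel (\<lambda>\<xi>. A \<xi> * W \<xi> y) (J y / norm y powr (real n + 2 * s))"
      by simp
    then have "(\<integral>\<^sup>+\<xi>. ennreal (A \<xi> * W \<xi> y) \<partial>lborel) = ennreal (J y / norm y powr (real n + 2 * s))"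
      using A0 W0 by (subst nn_integral_eq_integral) (auto simp: has_bochner_integral_iff)
    then show ?thesis using A0 W0 by (simp add: ennreal_mult)
  qed
  have "(\<integral>\<^sup>+\<xi>. ennreal (2 / c * (norm \<xi> powr (2 * s) * A \<xi>)) \<partial>lborel) = (\<integral>\<^sup>+\<xi>. (\<integral>\<^sup>+y. ennreal (A \<xi>) * ennreal (W \<xi> y) \<partial>lborel) \<partial>lborel)"
  proof (rule nn_integral_cong)
    fix \<xi> :: 'a
    have "(\<integral>\<^sup>+y. ennreal (A \<xi>) * ennreal (W \<xi> y) \<partial>lborel) = ennreal (A \<xi>) * (\<integral>\<^sup>+y. ennreal (W \<xi> y) \<partial>lborel)"
      by (rule nn_integral_cmult) measurable
    also have "\<dots> = ennreal (A \<xi> * (2 / c * norm \<xi> powr (2 * s)))"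
      unfolding Wint using A0 c by (subst ennreal_mult) auto
    also have "A \<xi> * (2 / c * norm \<xi> powr (2 * s)) = 2 / c * (norm \<xi> powr (2 * s) * A \<xi>)" by simp
    finally show "ennreal (2 / c * (norm \<xi> powr (2 * s) * A \<xi>)) = (\<integral>\<^sup>+y. ennreal (A \<xi>) * ennreal (W \<xi> y) \<partial>lborel)" by simp
  qed
  also have "\<dots> = (\<integral>\<^sup>+y. (\<integral>\<^sup>+\<xi>. ennreal (A \<xi>) * ennreal (W \<xi> y) \<partial>lborel) \<partial>lborel)"
    by (rule lborel_pair.Fubini'[symmetric]) measurable
  also have "\<dots> \<le> (\<integral>\<^sup>+y. ennreal (C3 * (min 1 (norm y powr (2 * s + 1/2)) / norm y powr (real n + 2 * s))) \<partial>(lborel :: 'a measure))"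
  proof (rule nn_integral_mono)
    fix y :: 'a
    have "J y / norm y powr (real n + 2 * s) \<le> C3 * (min 1 (norm y powr (2 * s + 1/2)) / norm y powr (real n + 2 * s))"
      using J3[of y] by (simp add: divide_right_mono)
    then show "(\<integral>\<^sup>+\<xi>. ennreal (A \<xi>) * ennreal (W \<xi> y) \<partial>lborel) \<le> ennreal (C3 * (min 1 (norm y powr (2 * s + 1/2)) / norm y powr (real n + 2 * s)))"
      unfolding inner by (rule ennreal_leI)
  qed
  also have "\<dots> < \<infinity>"
  proof -
    have "integrable lborel (\<lambda>y::'a. C3 * (min 1 (norm y powr (2 * s + 1/2)) / norm y powr (real n + 2 * s)))"
      unfolding n_def using s by (intro integrable_mult_right integrable_truncated_kernel) auto
    moreover have "C3 \<ge> 0" using C1 by (simp add: C3_def)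
    ultimately show ?thesis unfolding integrable_iff_bounded by simp
  qed
  finally have "integrable lborel (\<lambda>\<xi>. 2 / c * (norm \<xi> powr (2 * s) * A \<xi>))"
    using A0 c by (intro integrableI_bounded) auto
  then have "integrable lborel (\<lambda>\<xi>. c / 2 * (2 / c * (norm \<xi> powr (2 * s) * A \<xi>)))"
    by (rule integrable_mult_right)
  then show ?thesis using c unfolding A_def by simp
qed

lemma integrable_weighted_pairing:
  fixes f g :: "'a::euclidean_space \<Rightarrow> complex"
  assumes [measurable]: "f \<in> borel_measurable lborel" "g \<in> borel_measurable lborel"
    and f: "integrable lborel (\<lambda>\<xi>. norm \<xi> powr (2 * s) * (norm (f \<xi>))\<^sup>2)"
    and g: "integrable lborel (\<lambda>\<xi>. norm \<xi> powr (2 * s) * (norm (g \<xi>))\<^sup>2)"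
  shows "integrable lborel (\<lambda>\<xi>. of_real (norm \<xi> powr (2 * s)) * f \<xi> * cnj (g \<xi>))"
proof -
  have sq: "(norm \<xi> powr s)\<^sup>2 = norm \<xi> powr (2 * s)" for \<xi> :: 'a
    by (simp add: power2_eq_square powr_add[symmetric])
  have "integrable lborel (\<lambda>\<xi>. (of_real (norm \<xi> powr s) * f \<xi>) * (of_real (norm \<xi> powr s) * cnj (g \<xi>)))"
    using f g by (intro integrable_mult_L2) (auto simp: norm_mult power_mult_distrib sq)
  moreover have "(of_real (norm \<xi> powr s) * f \<xi>) * (of_real (norm \<xi> powr s) * cnj (g \<xi>)) = of_real (norm \<xi> powr (2 * s)) * f \<xi> * cnj (g \<xi>)" for \<xi>
    unfolding sq[symmetric] by (simp add: power2_eq_square mult_ac)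
  ultimately show ?thesis by simp
qed

text \<open>
  The fractional Laplacian of order \<open>s\<close> without its normalising constant.
\<close>

definition difference_integral :: "nat \<Rightarrow> real \<Rightarrow> ('a::euclidean_space \<Rightarrow> real) \<Rightarrow> 'a \<Rightarrow> real" where
  "difference_integral m s u x = (\<integral>y. central_diff m u x y / norm y powr (real DIM('a) + 2 * s) \<partial>lborel)"

lemma (in quadratic_form) integrand_bound:
  assumes s: "s > 0" "s < real m" and d0: "0 < d0" "d0 \<le> 1"
  shows "\<exists>k. integrable lborel k \<and> (\<forall>x y. qf T x \<le> 1 - d0 \<longrightarrow> \<bar>central_diff m (power_profile T s) x y / norm y powr (real DIM('a) + 2 * s)\<bar> \<le> k y)"
proof -
  have m: "m > 0" using s by (cases m) auto
  obtain C where C: "C \<ge> 0" "\<And>x y. qf T x \<le> 1 - d0 \<Longrightarrow> \<bar>central_diff m (power_profile T s) x y\<bar> \<le> C * min 1 (norm y powr (2 * real m))"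
    using central_diff_compact[OF s(1) m d0] by auto
  have "integrable lborel (\<lambda>y::'a. C * (min 1 (norm y powr (2 * real m)) / norm y powr (real DIM('a) + 2 * s)))"
    using s by (intro integrable_mult_right integrable_truncated_kernel) auto
  moreover have "\<bar>central_diff m (power_profile T s) x y / norm y powr (real DIM('a) + 2 * s)\<bar> \<le> C * (min 1 (norm y powr (2 * real m)) / norm y powr (real DIM('a) + 2 * s))"
    if "qf T x \<le> 1 - d0" for x y
    using C(2)[OF that, of y] by (simp add: abs_divide divide_right_mono)
  ultimately show ?thesis by (intro exI[of _ "\<lambda>y. C * (min 1 (norm y powr (2 * real m)) / norm y powr (real DIM('a) + 2 * s))"]) auto
qed

lemma (in quadratic_form) integrable_integrand:
  assumes s: "s > 0" "s < real m" and x: "qf T x < 1"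
  shows "integrable lborel (\<lambda>y. central_diff m (power_profile T s) x y / norm y powr (real DIM('a) + 2 * s))"
proof -
  have "0 < 1 - qf T x" "1 - qf T x \<le> 1" using x qf_nonneg[of x] by auto
  from integrand_bound[OF s this] obtain k where k: "integrable lborel k"
    "\<And>y. \<bar>central_diff m (power_profile T s) x y / norm y powr (real DIM('a) + 2 * s)\<bar> \<le> k y" by auto
  show ?thesis
    using k(1)
  proof (rule Bochner_Integration.integrable_bound)
    show "AE y in lborel. norm (central_diff m (power_profile T s) x y / norm y powr (real DIM('a) + 2 * s)) \<le> norm (k y)"
      using k(2) by (intro AE_I2) (simp add: order_trans[OF _ abs_ge_self])
  qed measurable
qed

lemma (in quadratic_form) isCont_difference_integral:
  assumes s: "s > 0" "s < real m" and x: "qf T x < 1"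
  shows "isCont (difference_integral m s (power_profile T s)) x"
  unfolding continuous_at_sequentially
proof (intro allI impI)
  fix X assume X: "X \<longlonglongrightarrow> x"
  define d0 where "d0 = (1 - qf T x) / 2"
  have d0: "0 < d0" "d0 \<le> 1" "qf T x < 1 - d0" using x qf_nonneg[of x] by (auto simp: d0_def field_simps)
  obtain k where k: "integrable lborel k"
    "\<And>x y. qf T x \<le> 1 - d0 \<Longrightarrow> \<bar>central_diff m (power_profile T s) x y / norm y powr (real DIM('a) + 2 * s)\<bar> \<le> k y"
    using integrand_bound[OF s d0(1,2)] by auto
  have "(\<lambda>i. qf T (X i)) \<longlonglongrightarrow> qf T x"
    using continuous_qf[of UNIV] X by (auto simp: continuous_on_eq_continuous_at intro: isCont_tendsto_compose)
  then have "\<forall>\<^sub>F i in sequentially. qf T (X i) < 1 - d0" using d0(3) by (rule order_tendstoD(2))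
  then obtain N where N: "\<And>i. i \<ge> N \<Longrightarrow> qf T (X i) < 1 - d0" by (auto simp: eventually_sequentially)
  have "(\<lambda>i. \<integral>y. central_diff m (power_profile T s) (X (i + N)) y / norm y powr (real DIM('a) + 2 * s) \<partial>lborel) \<longlonglongrightarrow> (\<integral>y. central_diff m (power_profile T s) x y / norm y powr (real DIM('a) + 2 * s) \<partial>lborel)"
  proof (rule integral_dominated_convergence[where w=k])
    show "AE y in lborel. (\<lambda>i. central_diff m (power_profile T s) (X (i + N)) y / norm y powr (real DIM('a) + 2 * s)) \<longlonglongrightarrow> central_diff m (power_profile T s) x y / norm y powr (real DIM('a) + 2 * s)"
    proof (intro AE_I2)
      fix y :: 'a
      have "isCont (\<lambda>x. central_diff m (power_profile T s) x y) x"
        using central_diff_continuous[OF continuous_power_profile[OF s(1)], of m y] by (simp add: continuous_on_eq_continuous_at)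
      then have "(\<lambda>i. central_diff m (power_profile T s) (X (i + N)) y) \<longlonglongrightarrow> central_diff m (power_profile T s) x y"
        using LIMSEQ_ignore_initial_segment[OF X, of N] by (rule isCont_tendsto_compose)
      then show "(\<lambda>i. central_diff m (power_profile T s) (X (i + N)) y / norm y powr (real DIM('a) + 2 * s)) \<longlonglongrightarrow> central_diff m (power_profile T s) x y / norm y powr (real DIM('a) + 2 * s)"
        unfolding divide_inverse by (rule tendsto_mult_right)
    qed
    show "AE y in lborel. norm (central_diff m (power_profile T s) (X (i + N)) y / norm y powr (real DIM('a) + 2 * s)) \<le> k y" for i
      using k(2)[of "X (i + N)"] N[of "i + N"] by (intro AE_I2) auto
  qed (use k in measurable)
  then have "(\<lambda>i. difference_integral m s (power_profile T s) (X (i + N))) \<longlonglongrightarrow> difference_integral m s (power_profile T s) x"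
    unfolding difference_integral_def .
  then show "(difference_integral m s (power_profile T s) \<circ> X) \<longlonglongrightarrow> difference_integral m s (power_profile T s) x"
    unfolding o_def by (rule LIMSEQ_offset)
qed

text \<open>
  The identity \<open>\<langle>u, \<phi>\<rangle> = \<integral> (-\<Delta>)\<^sup>s u \<phi>\<close>: Parseval in \<open>x\<close> and the symbol in \<open>y\<close>, with one exchange of integrals on either side.
  The support of \<open>\<phi>\<close> stays away from the boundary, where the difference quotients of the profile have an
  integrable majorant in \<open>y\<close>; the exchange in frequency is paid for by the finite energies.
\<close>

theorem (in quadratic_form) energy_pairing:
  assumes s: "s > 0" "s < real m" and d0: "0 < d0" "d0 \<le> 1"
    and \<phi>: "integrable lborel \<phi>" and \<phi>2: "integrable lborel (\<lambda>x. (\<phi> x)\<^sup>2)"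
    and supp: "\<And>x. qf T x > 1 - d0 \<Longrightarrow> \<phi> x = 0"
    and en: "integrable lborel (\<lambda>\<xi>. norm \<xi> powr (2 * s) * (norm (FT \<phi> \<xi>))\<^sup>2)"
  shows "has_bochner_integral lborel (\<lambda>\<xi>. of_real (norm \<xi> powr (2 * s)) * FT (power_profile T s) \<xi> * cnj (FT \<phi> \<xi>))
     (of_real (frac_const DIM('a) m s / 2 * (\<integral>x. \<phi> x * difference_integral m s (power_profile T s) x \<partial>lborel)))"
proof -
  let ?u = "power_profile T s"
  have [measurable]: "\<phi> \<in> borel_measurable borel" using borel_measurable_integrable[OF \<phi>] by simp
  define n where "n = DIM('a)"
  define c where "c = frac_const n m s"
  have c: "c > 0" unfolding c_def by (rule frac_const_pos[OF s])
  define A where "A = (\<lambda>\<xi>. FT ?u \<xi> * cnj (FT \<phi> \<xi>))"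
  have Am[measurable]: "A \<in> borel_measurable borel" unfolding A_def by measurable
  have int: "integrable lborel (\<lambda>\<xi>. of_real (norm \<xi> powr (2 * s)) * A \<xi>)"
    using integrable_weighted_pairing[OF _ _ power_profile_energy[OF s(1)] en] unfolding A_def by (simp add: mult.assoc)
  define W where "W = (\<lambda>\<xi> (y::'a). (2 - 2 * cos (\<xi> \<bullet> y)) ^ m / norm y powr (real n + 2 * s))"
  have W0: "W \<xi> y \<ge> 0" for \<xi> y by (auto simp: W_def intro!: divide_nonneg_nonneg)
  have Wm[measurable]: "(\<lambda>(\<xi>, y). W \<xi> y) \<in> borel_measurable (borel \<Otimes>\<^sub>M borel)" unfolding W_def by measurable
  have Wint: "integrable lborel (W \<xi>)" "(\<integral>y. W \<xi> y \<partial>lborel) = 2 / c * norm \<xi> powr (2 * s)" for \<xi>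
    using has_bochner_integral_symbol[OF s, of \<xi>] unfolding W_def c_def n_def by (auto simp: has_bochner_integral_iff)
  have pair1: "integrable (lborel \<Otimes>\<^sub>M lborel) (\<lambda>(\<xi>, y). of_real (W \<xi> y) * A \<xi>)"
  proof (rule lborel_pair.Fubini_integrable)
    have "integrable lborel (\<lambda>\<xi>. 2 / c * norm (of_real (norm \<xi> powr (2 * s)) * A \<xi>))"
      using int by (intro integrable_mult_right integrable_norm)
    moreover have "(\<integral>y. norm (case (\<xi>, y) of (\<xi>, y) \<Rightarrow> of_real (W \<xi> y) * A \<xi>) \<partial>lborel) = 2 / c * norm (of_real (norm \<xi> powr (2 * s)) * A \<xi>)" for \<xi>
      using W0 Wint(2)[of \<xi>] by (simp add: norm_mult)
    ultimately show "integrable lborel (\<lambda>\<xi>. \<integral>y. norm (case (\<xi>, y) of (\<xi>, y) \<Rightarrow> of_real (W \<xi> y) * A \<xi>) \<partial>lborel)" by simp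
    show "AE \<xi> in lborel. integrable lborel (\<lambda>y. case (\<xi>, y) of (\<xi>, y) \<Rightarrow> of_real (W \<xi> y) * A \<xi>)"
      using Wint(1) by simp
  qed measurable
  define J where "J = (\<lambda>y. \<integral>x. central_diff m ?u x y * \<phi> x \<partial>lborel)"
  have inner: "(\<integral>\<xi>. of_real (W \<xi> y) * A \<xi> \<partial>lborel) = of_real (J y / norm y powr (real n + 2 * s))" for y
  proof -
    have hb: "has_bochner_integral lborel (\<lambda>\<xi>. of_real ((2 - 2 * cos (\<xi> \<bullet> y)) ^ m) * FT ?u \<xi> * cnj (FT \<phi> \<xi>)) (of_real (J y))"
      unfolding J_def by (rule parseval_central_diff[OF power_profile_integrable(1)[OF s(1)] continuous_power_profile[OF s(1)] power_profile_le_1[OF s(1)] \<phi> \<phi>2])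
    have "(\<integral>\<xi>. of_real (W \<xi> y) * A \<xi> \<partial>lborel) = (\<integral>\<xi>. of_real (1 / norm y powr (real n + 2 * s)) * (of_real ((2 - 2 * cos (\<xi> \<bullet> y)) ^ m) * FT ?u \<xi> * cnj (FT \<phi> \<xi>)) \<partial>lborel)"
      unfolding W_def A_def by (intro Bochner_Integration.integral_cong refl) simp
    also have "\<dots> = of_real (1 / norm y powr (real n + 2 * s)) * (\<integral>\<xi>. of_real ((2 - 2 * cos (\<xi> \<bullet> y)) ^ m) * FT ?u \<xi> * cnj (FT \<phi> \<xi>) \<partial>lborel)"
      by (rule integral_mult_right_zero)
    also have "\<dots> = of_real (1 / norm y powr (real n + 2 * s)) * of_real (J y)"
      using hb by (simp only: has_bochner_integral_iff)
    finally show ?thesis by simp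
  qed
  have swap1: "(\<integral>\<xi>. (\<integral>y. of_real (W \<xi> y) * A \<xi> \<partial>lborel) \<partial>lborel) = (\<integral>y. (\<integral>\<xi>. of_real (W \<xi> y) * A \<xi> \<partial>lborel) \<partial>lborel)"
    using lborel_pair.Fubini_integral[OF pair1] by simp
  have lhs: "(\<integral>y. of_real (W \<xi> y) * A \<xi> \<partial>lborel) = of_real (2 / c) * (of_real (norm \<xi> powr (2 * s)) * A \<xi>)" for \<xi>
  proof -
    have "(\<integral>y. of_real (W \<xi> y) * A \<xi> \<partial>lborel) = (\<integral>y. complex_of_real (W \<xi> y) \<partial>lborel) * A \<xi>"
      by (rule integral_mult_left_zero)
    then show ?thesis using Wint(2)[of \<xi>] by (simp add: mult.assoc)
  qed
  obtain k where k: "integrable lborel k"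
    "\<And>x y. qf T x \<le> 1 - d0 \<Longrightarrow> \<bar>central_diff m ?u x y / norm y powr (real n + 2 * s)\<bar> \<le> k y"
    using integrand_bound[OF s d0] unfolding n_def by auto
  have [measurable]: "k \<in> borel_measurable borel" using borel_measurable_integrable[OF k(1)] by simp
  have pair2: "integrable (lborel \<Otimes>\<^sub>M lborel) (\<lambda>(x, y). \<phi> x * (central_diff m ?u x y / norm y powr (real n + 2 * s)))"
    using integrable_product[OF \<phi> k(1)]
  proof (rule Bochner_Integration.integrable_bound)
    have "\<bar>\<phi> x * (central_diff m ?u x y / norm y powr (real n + 2 * s))\<bar> \<le> \<bar>\<phi> x * k y\<bar>" for x y
    proof (cases "qf T x \<le> 1 - d0")
      case True
      then show ?thesis unfolding abs_mult using k(2)[OF True, of y] by (intro mult_left_mono) auto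
    qed (simp add: supp)
    then show "AE p in lborel \<Otimes>\<^sub>M lborel. norm (case p of (x, y) \<Rightarrow> \<phi> x * (central_diff m ?u x y / norm y powr (real n + 2 * s))) \<le> norm (case p of (x, y) \<Rightarrow> \<phi> x * k y)"
      by (intro AE_I2) auto
  qed measurable
  have e: "(\<integral>x. \<phi> x * (central_diff m ?u x y / norm y powr (real n + 2 * s)) \<partial>lborel) = J y / norm y powr (real n + 2 * s)" for y
  proof -
    have "(\<integral>x. \<phi> x * (central_diff m ?u x y / norm y powr (real n + 2 * s)) \<partial>lborel) = (\<integral>x. central_diff m ?u x y * \<phi> x / norm y powr (real n + 2 * s) \<partial>lborel)"
      by (intro Bochner_Integration.integral_cong refl) simp
    then show ?thesis unfolding J_def by (simp only: integral_divide_zero)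
  qed
  have "(\<integral>y. J y / norm y powr (real n + 2 * s) \<partial>lborel) = (\<integral>y. (\<integral>x. \<phi> x * (central_diff m ?u x y / norm y powr (real n + 2 * s)) \<partial>lborel) \<partial>lborel)"
    by (simp only: e)
  also have "\<dots> = (\<integral>x. (\<integral>y. \<phi> x * (central_diff m ?u x y / norm y powr (real n + 2 * s)) \<partial>lborel) \<partial>lborel)"
    using lborel_pair.Fubini_integral[OF pair2] by simp
  also have "\<dots> = (\<integral>x. \<phi> x * difference_integral m s ?u x \<partial>lborel)"
    unfolding difference_integral_def n_def by (intro Bochner_Integration.integral_cong refl integral_mult_right_zero)
  finally have swap2: "(\<integral>y. J y / norm y powr (real n + 2 * s) \<partial>lborel) = (\<integral>x. \<phi> x * difference_integral m s ?u x \<partial>lborel)" .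
  have "of_real (2 / c) * (\<integral>\<xi>. of_real (norm \<xi> powr (2 * s)) * A \<xi> \<partial>lborel) = (\<integral>\<xi>. of_real (2 / c) * (of_real (norm \<xi> powr (2 * s)) * A \<xi>) \<partial>lborel)"
    by (rule integral_mult_right_zero[symmetric])
  also have "\<dots> = (\<integral>y. complex_of_real (J y / norm y powr (real n + 2 * s)) \<partial>lborel)"
    using swap1 unfolding lhs inner .
  also have "\<dots> = of_real (\<integral>x. \<phi> x * difference_integral m s ?u x \<partial>lborel)"
    unfolding integral_complex_of_real swap2 ..
  finally have "of_real (c / 2) * (of_real (2 / c) * (\<integral>\<xi>. of_real (norm \<xi> powr (2 * s)) * A \<xi> \<partial>lborel)) = complex_of_real (c / 2 * (\<integral>x. \<phi> x * difference_integral m s ?u x \<partial>lborel))"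
    by (simp only: of_real_mult)
  moreover have "complex_of_real (c / 2) * of_real (2 / c) = 1" using c by (simp add: of_real_mult[symmetric] del: of_real_mult)
  ultimately have "(\<integral>\<xi>. of_real (norm \<xi> powr (2 * s)) * A \<xi> \<partial>lborel) = complex_of_real (c / 2 * (\<integral>x. \<phi> x * difference_integral m s ?u x \<partial>lborel))"
    by (simp only: mult.assoc[symmetric] mult_1_left)
  then show ?thesis using int unfolding A_def c_def n_def by (simp only: has_bochner_integral_iff mult.assoc)
qed

section \<open>A Cauchy-type integral in the upper half plane\<close>

lemma DERIV_powr_compose:
  fixes g :: "complex \<Rightarrow> complex"
  assumes "(g has_field_derivative D) (at z)" "g z \<notin> \<real>\<^sub>\<le>\<^sub>0"
  shows "((\<lambda>z. g z powr a) has_field_derivative (a * g z powr (a - 1) * D)) (at z)"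
  by (rule DERIV_chain2[of "\<lambda>w. w powr a" _ g z, OF has_field_derivative_powr[OF assms(2)] assms(1)])

text \<open>
  For \<open>\<alpha> = - 2 s - 1\<close> this is, up to a constant, the holomorphic function in the upper half plane whose real
  part tends to \<open>(-\<Delta>)\<^sup>s (1 - t\<^sup>2)\<^sup>s\<^sub>+\<close> on the interval \<open>(-1, 1)\<close>. The factor \<open>-\<i>\<close> moves \<open>z - t\<close> into the right
  half plane, where the principal power is holomorphic.
\<close>

definition half_plane_integral :: "real \<Rightarrow> real \<Rightarrow> complex \<Rightarrow> complex" where
  "half_plane_integral s \<alpha> z = integral {-1..1} (\<lambda>t. of_real ((1 - t\<^sup>2) powr s) * (- \<i> * (z - of_real t)) powr of_real \<alpha>)"

lemma half_plane_nonpos: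
  assumes "Im z > 0"
  shows "- \<i> * (z - of_real t) \<notin> \<real>\<^sub>\<le>\<^sub>0" "Re (- \<i> * (z - of_real t)) > 0" "- \<i> * (z - of_real t) \<noteq> 0"
proof -
  show 1: "Re (- \<i> * (z - of_real t)) > 0" using assms by simp
  then show "- \<i> * (z - of_real t) \<notin> \<real>\<^sub>\<le>\<^sub>0" by (auto simp: complex_nonpos_Reals_iff)
  show "- \<i> * (z - of_real t) \<noteq> 0" using 1 by (metis less_irrefl zero_complex.simps(1))
qed

lemma continuous_weight: "s > 0 \<Longrightarrow> continuous_on {-1..1} (\<lambda>t::real. complex_of_real ((1 - t\<^sup>2) powr s))"
  by (intro continuous_intros continuous_on_powr') (auto simp: abs_square_le_1 abs_le_iff)

lemma half_plane_integral_integrand_continuous: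
  assumes "s > 0" "Im z > 0"
  shows "continuous_on {-1..1} (\<lambda>t. of_real ((1 - t\<^sup>2) powr s) * (- \<i> * (z - of_real t)) powr of_real \<alpha>)"
  using half_plane_nonpos[OF assms(2)] assms(1)
  by (intro continuous_on_mult continuous_weight continuous_on_powr_complex continuous_intros) auto

lemma half_plane_integral_deriv:
  assumes s: "s > 0" and z: "Im z > 0"
  shows "(half_plane_integral s \<alpha> has_field_derivative (- \<i> * of_real \<alpha> * half_plane_integral s (\<alpha> - 1) z)) (at z)"
proof -
  define U where "U = {z. Im z > 0}"
  have U: "convex U" "open U" "z \<in> U" using z by (auto simp: U_def convex_halfspace_Im_gt open_halfspace_Im_gt)
  let ?fx = "\<lambda>z t. of_real ((1 - t\<^sup>2) powr s) * (of_real \<alpha> * (- \<i> * (z - of_real t)) powr (of_real \<alpha> - 1) * (- \<i>))"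
  have "((\<lambda>z. integral (cbox (-1) 1) (\<lambda>t. of_real ((1 - t\<^sup>2) powr s) * (- \<i> * (z - of_real t)) powr of_real \<alpha>)) has_field_derivative integral (cbox (-1) 1) (?fx z)) (at z within U)"
  proof (rule leibniz_rule_field_derivative)
    fix x t assume "x \<in> U" "t \<in> cbox (-1) (1::real)"
    then have x: "Im x > 0" by (simp add: U_def)
    have "((\<lambda>x. (- \<i> * (x - of_real t)) powr of_real \<alpha>) has_field_derivative of_real \<alpha> * (- \<i> * (x - of_real t)) powr (of_real \<alpha> - 1) * (- \<i>)) (at x)"
      by (rule DERIV_powr_compose, (auto intro!: derivative_eq_intros)[1], rule half_plane_nonpos(1)[OF x])
    then have "((\<lambda>x. of_real ((1 - t\<^sup>2) powr s) * (- \<i> * (x - of_real t)) powr of_real \<alpha>) has_field_derivative ?fx x t) (at x)"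
      by (rule DERIV_cmult)
    then show "((\<lambda>x. of_real ((1 - t\<^sup>2) powr s) * (- \<i> * (x - of_real t)) powr of_real \<alpha>) has_field_derivative ?fx x t) (at x within U)"
      by (rule has_field_derivative_at_within)
  next
    fix x assume "x \<in> U"
    then show "(\<lambda>t. of_real ((1 - t\<^sup>2) powr s) * (- \<i> * (x - of_real t)) powr of_real \<alpha>) integrable_on cbox (-1) 1"
      using half_plane_integral_integrand_continuous[OF s, of x \<alpha>] by (intro integrable_continuous) (auto simp: U_def)
  next
    have "continuous_on (U \<times> {-1..1}) (\<lambda>p. complex_of_real ((1 - (snd p)\<^sup>2) powr s))"
      by (rule continuous_on_compose2[OF continuous_weight[OF s]]) (auto intro!: continuous_intros)
    moreover have "continuous_on (U \<times> {-1..1}) (\<lambda>p. (- \<i> * (fst p - of_real (snd p))) powr (of_real \<alpha> - 1))"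
    proof (rule continuous_on_powr_complex)
      show "continuous_on (U \<times> {-1..1}) (\<lambda>p. - \<i> * (fst p - of_real (snd p)))" by (intro continuous_intros)
      show "continuous_on (U \<times> {-1..1::real}) (\<lambda>p. complex_of_real \<alpha> - 1)" by (intro continuous_intros)
      have pos: "Re (- \<i> * (fst p - of_real (snd p))) > 0" if "p \<in> U \<times> {-1..1}" for p :: "complex \<times> real"
        using that half_plane_nonpos(2)[of "fst p" "snd p"] by (auto simp: U_def)
      then show "U \<times> {-1..1} \<subseteq> {p. 0 \<le> Re (- \<i> * (fst p - of_real (snd p))) \<or> Im (- \<i> * (fst p - of_real (snd p))) \<noteq> 0}"
        by (auto intro: less_imp_le)
      show "\<And>p. p \<in> U \<times> {-1..1} \<Longrightarrow> - \<i> * (fst p - of_real (snd p)) = 0 \<Longrightarrow> 0 < Re (complex_of_real \<alpha> - 1)"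
        using pos by force
    qed
    ultimately show "continuous_on (U \<times> cbox (-1) 1) (\<lambda>(x, t). ?fx x t)"
      unfolding split_beta cbox_interval by (intro continuous_on_mult continuous_on_const)
  qed (use U in auto)
  moreover have "integral (cbox (-1) 1) (?fx z) = - \<i> * of_real \<alpha> * half_plane_integral s (\<alpha> - 1) z"
  proof -
    have "integral (cbox (-1) 1) (?fx z) = integral (cbox (-1) 1) (\<lambda>t. (- \<i> * of_real \<alpha>) * (of_real ((1 - t\<^sup>2) powr s) * (- \<i> * (z - of_real t)) powr of_real (\<alpha> - 1)))"
      by (intro Henstock_Kurzweil_Integration.integral_cong) (simp add: mult_ac)
    also have "\<dots> = - \<i> * of_real \<alpha> * half_plane_integral s (\<alpha> - 1) z"
      unfolding half_plane_integral_def cbox_interval by (rule integral_mult_right)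
    finally show ?thesis .
  qed
  ultimately show ?thesis using U unfolding half_plane_integral_def cbox_interval by (simp add: at_within_open[of z U])
qed

text \<open>
  Integrate the derivative of \<open>(1 - t\<^sup>2) powr (s + 1) * w powr (- 2 s - 2)\<close> with \<open>w = - \<i> (z - t)\<close>; the boundary
  terms vanish. The two exponents are matched so that the polynomial in \<open>t\<close> reduces to one in \<open>z\<close>.
\<close>

lemma half_plane_integral_recurrence:
  assumes s: "s > 0" and z: "Im z > 0"
  shows "(z\<^sup>2 - 1) * half_plane_integral s (- 2 * s - 3) z = \<i> * z * half_plane_integral s (- 2 * s - 2) z"
proof -
  let ?w = "\<lambda>t::real. - \<i> * (z - of_real t)"
  let ?F = "\<lambda>t::real. of_real ((1 - t\<^sup>2) powr (s + 1)) * ?w t powr of_real (- 2 * s - 2)"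
  let ?f = "\<lambda>t::real. (2 * of_real s + 2) * \<i> * ((z\<^sup>2 - 1) * (of_real ((1 - t\<^sup>2) powr s) * ?w t powr of_real (- 2 * s - 3)) - \<i> * z * (of_real ((1 - t\<^sup>2) powr s) * ?w t powr of_real (- 2 * s - 2)))"
  have "(?f has_integral (?F 1 - ?F (-1))) {-1..1}"
  proof (rule fundamental_theorem_of_calculus_interior)
    show "continuous_on {-1..1} ?F" using s z by (intro half_plane_integral_integrand_continuous) auto
    fix t :: real assume t: "t \<in> {-1<..<1}"
    have t1: "1 - t\<^sup>2 > 0" using t by (simp add: abs_square_less_1 abs_less_iff)
    have d1: "((\<lambda>t. (1 - t\<^sup>2) powr (s + 1)) has_real_derivative ((s + 1) * (1 - t\<^sup>2) powr s * (- 2 * t))) (at t)"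
      using t1 by (auto intro!: derivative_eq_intros)
    have d2: "((\<lambda>w. (- \<i> * (z - w)) powr of_real (- 2 * s - 2)) has_field_derivative of_real (- 2 * s - 2) * ?w t powr (of_real (- 2 * s - 2) - 1) * \<i>) (at (of_real t))"
      by (rule DERIV_powr_compose, (auto intro!: derivative_eq_intros)[1], rule half_plane_nonpos(1)[OF z])
    have d3: "((\<lambda>t. ?w t powr of_real (- 2 * s - 2)) has_vector_derivative of_real (- 2 * s - 2) * ?w t powr (of_real (- 2 * s - 2) - 1) * \<i>) (at t)"
      using has_vector_derivative_real_field[OF d2] .
    have d4: "((\<lambda>t. complex_of_real ((1 - t\<^sup>2) powr (s + 1))) has_vector_derivative of_real ((s + 1) * (1 - t\<^sup>2) powr s * (- 2 * t))) (at t)"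
      using d1 by (intro has_vector_derivative_of_real) (simp add: has_real_derivative_iff_has_vector_derivative)
    have e1: "(1 - t\<^sup>2) powr (s + 1) = (1 - t\<^sup>2) powr s * (1 - t\<^sup>2)" using t1 by (simp add: powr_add)
    have e2: "?w t powr of_real (- 2 * s - 2) = ?w t powr of_real (- 2 * s - 3) * ?w t"
    proof -
      have "?w t powr (of_real (- 2 * s - 3) + 1) = ?w t powr of_real (- 2 * s - 3) * ?w t powr 1"
        by (rule powr_add)
      moreover have "complex_of_real (- 2 * s - 3) + 1 = of_real (- 2 * s - 2)" by simp
      ultimately show ?thesis using half_plane_nonpos(3)[OF z, of t] by (simp only: powr_one' complex_eq_iff) simp
    qed
    have e3: "complex_of_real (- 2 * s - 2) - 1 = of_real (- 2 * s - 3)" by simp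
    define W where "W = ?w t"
    define X where "X = W powr of_real (- 2 * s - 3)"
    have e2': "W powr of_real (- 2 * s - 2) = X * W" using e2 unfolding W_def X_def .
    have zw: "z = of_real t + \<i> * W" by (simp add: W_def algebra_simps)
    define P where "P = complex_of_real ((1 - t\<^sup>2) powr s)"
    define r where "r = complex_of_real s"
    define \<tau> where "\<tau> = complex_of_real t"
    have "(?F has_vector_derivative (of_real ((1 - t\<^sup>2) powr (s + 1)) * (of_real (- 2 * s - 2) * ?w t powr (of_real (- 2 * s - 2) - 1) * \<i>) + of_real ((s + 1) * (1 - t\<^sup>2) powr s * (- 2 * t)) * ?w t powr of_real (- 2 * s - 2))) (at t)"
      by (rule has_vector_derivative_mult[OF d4 d3])
    moreover have "of_real ((1 - t\<^sup>2) powr (s + 1)) * (of_real (- 2 * s - 2) * ?w t powr (of_real (- 2 * s - 2) - 1) * \<i>) + of_real ((s + 1) * (1 - t\<^sup>2) powr s * (- 2 * t)) * ?w t powr of_real (- 2 * s - 2)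
      = P * (1 - \<tau>\<^sup>2) * ((- 2 * r - 2) * X * \<i>) + (r + 1) * P * (- 2 * \<tau>) * (X * W)"
      unfolding W_def[symmetric] unfolding e1 e2' e3 X_def[symmetric] by (simp add: P_def r_def \<tau>_def)
    moreover have "P * (1 - \<tau>\<^sup>2) * ((- 2 * r - 2) * X * \<i>) + (r + 1) * P * (- 2 * \<tau>) * (X * W) = (2 * r + 2) * \<i> * ((z\<^sup>2 - 1) * (P * X) - \<i> * z * (P * (X * W)))"
    proof -
      have i2: "\<i> * \<i> = -1" by simp
      show ?thesis unfolding zw \<tau>_def[symmetric] using i2 by algebra
    qed
    moreover have "(2 * r + 2) * \<i> * ((z\<^sup>2 - 1) * (P * X) - \<i> * z * (P * (X * W))) = ?f t"
      unfolding W_def[symmetric] unfolding e2' X_def[symmetric] by (simp only: P_def r_def)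
    ultimately show "(?F has_vector_derivative ?f t) (at t)" by (simp only:)
  qed simp
  moreover have "?F 1 = 0" "?F (-1) = 0" using s by simp_all
  ultimately have 0: "(?f has_integral 0) {-1..1}" by (simp only: diff_zero)
  have i1: "(\<lambda>t. of_real ((1 - t\<^sup>2) powr s) * ?w t powr of_real \<alpha>) integrable_on {-1..1}" for \<alpha>
    using half_plane_integral_integrand_continuous[OF s z] by (rule integrable_continuous_interval)
  have h: "((\<lambda>t. of_real ((1 - t\<^sup>2) powr s) * ?w t powr of_real \<alpha>) has_integral half_plane_integral s \<alpha> z) {-1..1}" for \<alpha>
    unfolding half_plane_integral_def by (rule integrable_integral[OF i1])
  have "(?f has_integral (2 * of_real s + 2) * \<i> * ((z\<^sup>2 - 1) * half_plane_integral s (- 2 * s - 3) z - \<i> * z * half_plane_integral s (- 2 * s - 2) z)) {-1..1}"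
    by (intro has_integral_mult_right has_integral_diff h)
  from has_integral_unique[OF this 0]
  have "(2 * of_real s + 2) * \<i> * ((z\<^sup>2 - 1) * half_plane_integral s (- 2 * s - 3) z - \<i> * z * half_plane_integral s (- 2 * s - 2) z) = 0" .
  moreover have "(2 * complex_of_real s + 2) \<noteq> 0"
  proof
    assume "2 * complex_of_real s + 2 = 0"
    then have "Re (2 * complex_of_real s + 2) = 0" by (simp only: zero_complex.simps)
    then show False using s by simp
  qed
  ultimately show ?thesis by simp
qed

lemma one_minus_square_nonpos:
  assumes "Im z > 0"
  shows "1 - z\<^sup>2 \<notin> \<real>\<^sub>\<le>\<^sub>0"
proof
  assume A: "1 - z\<^sup>2 \<in> \<real>\<^sub>\<le>\<^sub>0"
  then have "Im (z\<^sup>2) = 0" "Re (z\<^sup>2) \<ge> 1" by (auto simp: complex_nonpos_Reals_iff)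
  then have "Re z = 0" using assms by (simp add: power2_eq_square)
  then have "Re (z\<^sup>2) \<le> 0" by (simp add: power2_eq_square)
  then show False using \<open>Re (z\<^sup>2) \<ge> 1\<close> by simp
qed

text \<open>
  The recurrence and the derivative formula say that \<open>(1 - z\<^sup>2) powr (s + 1)\<close> times the integral has
  derivative 0. The constant is real because the integral at \<open>z = \<i>\<close> is invariant under conjugation followed
  by \<open>t \<mapsto> - t\<close>.
\<close>

lemma half_plane_integral_closed_form:
  assumes s: "s > 0"
  shows "\<exists>B::real. \<forall>z. Im z > 0 \<longrightarrow> half_plane_integral s (- 2 * s - 2) z = of_real B * (1 - z\<^sup>2) powr of_real (- s - 1)"
proof -
  define U where "U = {z. Im z > 0}"
  have U: "convex U" "open U" by (auto simp: U_def convex_halfspace_Im_gt open_halfspace_Im_gt)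
  define K where "K = half_plane_integral s (- 2 * s - 2)"
  \<comment> \<open>The candidate for a constant function.\<close>
  define M where "M = (\<lambda>z. K z * (1 - z\<^sup>2) powr of_real (s + 1))"
  have "(M has_field_derivative 0) (at z within U)" if "z \<in> U" for z
  proof -
    have z: "Im z > 0" using that by (simp add: U_def)
    have nz: "1 - z\<^sup>2 \<noteq> 0" using one_minus_square_nonpos[OF z] by auto
    have d1: "(K has_field_derivative (- \<i> * of_real (- 2 * s - 2) * half_plane_integral s (- 2 * s - 3) z)) (at z)"
      using half_plane_integral_deriv[OF s z, of "- 2 * s - 2"] unfolding K_def by (simp add: algebra_simps)
    have d2: "((\<lambda>z. (1 - z\<^sup>2) powr of_real (s + 1)) has_field_derivative (of_real (s + 1) * (1 - z\<^sup>2) powr (of_real (s + 1) - 1) * (- 2 * z))) (at z)"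
      by (rule DERIV_powr_compose, (auto intro!: derivative_eq_intros)[1], rule one_minus_square_nonpos[OF z])
    have p: "(1 - z\<^sup>2) powr of_real (s + 1) = (1 - z\<^sup>2) powr of_real s * (1 - z\<^sup>2)"
      using nz by (simp add: powr_add)
    have e: "complex_of_real (s + 1) - 1 = of_real s" by simp
    have rec: "(1 - z\<^sup>2) * half_plane_integral s (- 2 * s - 3) z = - (\<i> * z * K z)"
      using half_plane_integral_recurrence[OF s z] unfolding K_def by (simp add: algebra_simps)
    have "(M has_field_derivative ((- \<i> * of_real (- 2 * s - 2) * half_plane_integral s (- 2 * s - 3) z) * (1 - z\<^sup>2) powr of_real (s + 1) + (of_real (s + 1) * (1 - z\<^sup>2) powr (of_real (s + 1) - 1) * (- 2 * z)) * K z)) (at z)"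
      unfolding M_def by (rule DERIV_mult'[OF d1 d2, THEN DERIV_cong]) (simp add: mult_ac)
    moreover have "(- \<i> * of_real (- 2 * s - 2) * half_plane_integral s (- 2 * s - 3) z) * (1 - z\<^sup>2) powr of_real (s + 1) + (of_real (s + 1) * (1 - z\<^sup>2) powr (of_real (s + 1) - 1) * (- 2 * z)) * K z = 0"
    proof -
      have "(- \<i> * of_real (- 2 * s - 2) * half_plane_integral s (- 2 * s - 3) z) * (1 - z\<^sup>2) powr of_real (s + 1)
         = (\<i> * (2 * of_real s + 2)) * (1 - z\<^sup>2) powr of_real s * ((1 - z\<^sup>2) * half_plane_integral s (- 2 * s - 3) z)"
        unfolding p by (simp add: algebra_simps)
      also have "\<dots> = (2 * of_real s + 2) * (1 - z\<^sup>2) powr of_real s * z * K z"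
        unfolding rec by (simp add: algebra_simps)
      finally show ?thesis unfolding e by (simp add: algebra_simps)
    qed
    ultimately show ?thesis by (simp only: has_field_derivative_at_within)
  qed
  then obtain c where c: "\<And>z. z \<in> U \<Longrightarrow> M z = c"
    using has_field_derivative_zero_constant[OF U(1), of M] by auto
  have K: "K z = c * (1 - z\<^sup>2) powr of_real (- s - 1)" if z: "Im z > 0" for z
  proof -
    have nz: "1 - z\<^sup>2 \<noteq> 0" using one_minus_square_nonpos[OF z] by auto
    have "(1 - z\<^sup>2) powr of_real (s + 1) * (1 - z\<^sup>2) powr of_real (- s - 1) = (1 - z\<^sup>2) powr (of_real (s + 1) + of_real (- s - 1))"
      by (rule powr_add[symmetric])
    also have "\<dots> = 1" using nz by simp
    finally have "K z = M z * (1 - z\<^sup>2) powr of_real (- s - 1)" unfolding M_def by (simp only: mult.assoc mult_1_right)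
    then show ?thesis using c[of z] z by (simp add: U_def)
  qed
  \<comment> \<open>At \<open>z = \<i>\<close> conjugation amounts to reflecting \<open>t\<close>.\<close>
  have cK: "cnj (K \<i>) = K \<i>"
  proof -
    let ?g = "\<lambda>t::real. complex_of_real ((1 - t\<^sup>2) powr s) * (- \<i> * (\<i> - of_real t)) powr of_real (- 2 * s - 2)"
    have "cnj (K \<i>) = integral {-1..1} (\<lambda>t. cnj (?g t))"
      unfolding K_def half_plane_integral_def by (rule Henstock_Kurzweil_Integration.integral_cnj)
    also have "\<dots> = integral {-1..1} (\<lambda>t. ?g (- t))"
    proof (rule Henstock_Kurzweil_Integration.integral_cong)
      fix t :: real
      have "cnj ((- \<i> * (\<i> - of_real t)) powr of_real (- 2 * s - 2)) = cnj (- \<i> * (\<i> - of_real t)) powr cnj (of_real (- 2 * s - 2))"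
        by (rule cnj_powr) simp
      also have "cnj (- \<i> * (\<i> - of_real t)) = - \<i> * (\<i> - of_real (- t))" by (simp add: algebra_simps)
      finally show "cnj (?g t) = ?g (- t)" by simp
    qed
    also have "\<dots> = K \<i>"
      unfolding K_def half_plane_integral_def using Henstock_Kurzweil_Integration.integral_reflect_real[of 1 "-1" ?g] by simp
    finally show ?thesis .
  qed
  have two: "(1 - \<i>\<^sup>2) powr of_real (- s - 1) = complex_of_real (2 powr (- s - 1))"
    using powr_of_real[of 2 "- s - 1"] by simp
  have "K \<i> = c * complex_of_real (2 powr (- s - 1))" using K[of \<i>] unfolding two by simp
  then have "cnj c * complex_of_real (2 powr (- s - 1)) = c * complex_of_real (2 powr (- s - 1))" using cK by simp
  then have "cnj c = c" by simp
  then obtain B where "c = of_real B" by (metis Reals_cases Reals_cnj_iff)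
  then show ?thesis using K unfolding K_def by blast
qed

text \<open>
  The power is real on the positive axis, so the mean value inequality on a vertical segment bounds its
  imaginary part.
\<close>

lemma Im_powr_small:
  assumes d: "\<delta> > 0" and w: "Re w \<ge> \<delta>" and s: "s > 0"
  shows "\<bar>Im (w powr of_real (- s - 1))\<bar> \<le> (s + 1) * \<delta> powr (- s - 2) * \<bar>Im w\<bar>"
proof -
  define S where "S = {w. Re w \<ge> \<delta>}"
  have S: "convex S" by (simp add: S_def convex_halfspace_Re_ge)
  have "norm (w powr of_real (- s - 1) - of_real (Re w) powr of_real (- s - 1)) \<le> (s + 1) * \<delta> powr (- s - 2) * norm (w - of_real (Re w))"
  proof (rule field_differentiable_bound[OF S, where f'="\<lambda>w. of_real (- s - 1) * w powr (of_real (- s - 1) - 1)"])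
    fix v assume v: "v \<in> S"
    then have Rv: "Re v \<ge> \<delta>" by (simp add: S_def)
    then have "v \<notin> \<real>\<^sub>\<le>\<^sub>0" using d by (auto simp: complex_nonpos_Reals_iff)
    then show "((\<lambda>w. w powr of_real (- s - 1)) has_field_derivative of_real (- s - 1) * v powr (of_real (- s - 1) - 1)) (at v within S)"
      by (rule has_field_derivative_at_within[OF has_field_derivative_powr])
    have "norm v \<ge> \<delta>" using Rv complex_Re_le_cmod[of v] by simp
    have "complex_of_real (- s - 1) - 1 = of_real (- s - 2)" by simp
    then have "norm (v powr (of_real (- s - 1) - 1)) = norm v powr (- s - 2)"
      by (simp only: norm_powr_real_powr'[OF Reals_of_real] Re_complex_of_real)
    also have "\<dots> \<le> \<delta> powr (- s - 2)" using \<open>norm v \<ge> \<delta>\<close> d s by (intro powr_mono2') auto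
    finally have le: "norm (v powr (of_real (- s - 1) - 1)) \<le> \<delta> powr (- s - 2)" .
    have n: "norm (complex_of_real (- s - 1)) = s + 1" unfolding norm_of_real using s by simp
    show "norm (of_real (- s - 1) * v powr (of_real (- s - 1) - 1)) \<le> (s + 1) * \<delta> powr (- s - 2)"
      unfolding norm_mult n using le s by (intro mult_left_mono) auto
  qed (use w in \<open>auto simp: S_def\<close>)
  moreover have "norm (w - of_real (Re w)) = \<bar>Im w\<bar>"
    by (simp add: cmod_def)
  moreover have "Im (of_real (Re w) powr of_real (- s - 1) :: complex) = 0"
    using powr_of_real[of "Re w" "- s - 1"] w d by simp
  then have "\<bar>Im (w powr of_real (- s - 1))\<bar> \<le> norm (w powr of_real (- s - 1) - of_real (Re w) powr of_real (- s - 1))"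
    using abs_Im_le_cmod[of "w powr of_real (- s - 1) - of_real (Re w) powr of_real (- s - 1)"] by simp
  ultimately show ?thesis by simp
qed

text \<open>
  The derivative along a horizontal line is \<open>\<i> (2 s + 1) B (1 - z\<^sup>2) powr (- s - 1)\<close> with real \<open>B\<close>. It is purely
  imaginary on the interval \<open>(-1, 1)\<close> itself, so at height \<open>\<epsilon>\<close> its real part is of order \<open>\<epsilon>\<close>. This is the reason
  for the constancy of the fractional Laplacian in dimension one.
\<close>

theorem half_plane_integral_real_part_nearly_constant:
  assumes s: "s > 0" and r: "0 < r" "r < 1"
  shows "\<exists>C. \<forall>\<epsilon> p q. 0 < \<epsilon> \<longrightarrow> \<bar>p\<bar> \<le> r \<longrightarrow> \<bar>q\<bar> \<le> r \<longrightarrow>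
    \<bar>Re (half_plane_integral s (- 2 * s - 1) (Complex p \<epsilon>)) - Re (half_plane_integral s (- 2 * s - 1) (Complex q \<epsilon>))\<bar> \<le> C * \<epsilon>"
proof -
  obtain B where B: "\<And>z. Im z > 0 \<Longrightarrow> half_plane_integral s (- 2 * s - 2) z = of_real B * (1 - z\<^sup>2) powr of_real (- s - 1)"
    using half_plane_integral_closed_form[OF s] by auto
  define \<delta> where "\<delta> = 1 - r\<^sup>2"
  have \<delta>: "\<delta> > 0" using r by (simp add: \<delta>_def abs_square_less_1)
  define C where "C = (2 * s + 1) * (\<bar>B\<bar> * ((s + 1) * \<delta> powr (- s - 2) * 2))"
  have "\<bar>Re (half_plane_integral s (- 2 * s - 1) (Complex p \<epsilon>)) - Re (half_plane_integral s (- 2 * s - 1) (Complex q \<epsilon>))\<bar> \<le> C * 2 * \<epsilon>"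
    if e: "0 < \<epsilon>" and p: "\<bar>p\<bar> \<le> r" and q: "\<bar>q\<bar> \<le> r" for \<epsilon> p q
  proof -
    let ?f = "\<lambda>p. Re (half_plane_integral s (- 2 * s - 1) (Complex p \<epsilon>))"
    have deriv: "(?f has_real_derivative Re (\<i> * of_real (2 * s + 1) * half_plane_integral s (- 2 * s - 2) (Complex p \<epsilon>))) (at p)" for p
    proof -
      have "(half_plane_integral s (- 2 * s - 1) has_field_derivative (- \<i> * of_real (- 2 * s - 1) * half_plane_integral s (- 2 * s - 2) (Complex p \<epsilon>))) (at (Complex p \<epsilon>))"
        using half_plane_integral_deriv[OF s, of "Complex p \<epsilon>" "- 2 * s - 1"] e by (simp add: algebra_simps)
      moreover have "- \<i> * of_real (- 2 * s - 1) = \<i> * complex_of_real (2 * s + 1)" by (simp add: algebra_simps)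
      moreover define D where "D = \<i> * of_real (2 * s + 1) * half_plane_integral s (- 2 * s - 2) (Complex p \<epsilon>)"
      ultimately have d0: "(half_plane_integral s (- 2 * s - 1) has_field_derivative D) (at (Complex p \<epsilon>))" by (simp only:)
      have pt: "Complex p \<epsilon> = \<i> * of_real \<epsilon> + of_real p" for p by (simp add: complex_eq_iff)
      have d: "(half_plane_integral s (- 2 * s - 1) has_field_derivative D) (at (\<i> * of_real \<epsilon> + of_real p))"
        using d0 by (simp only: pt)
      have "((\<lambda>w. half_plane_integral s (- 2 * s - 1) (\<i> * of_real \<epsilon> + w)) has_field_derivative D * 1) (at (of_real p))"
        by (rule DERIV_chain2[of "half_plane_integral s (- 2 * s - 1)" D "\<lambda>w. \<i> * of_real \<epsilon> + w", OF d]) (auto intro!: derivative_eq_intros)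
      then have "((\<lambda>p. half_plane_integral s (- 2 * s - 1) (\<i> * of_real \<epsilon> + of_real p)) has_vector_derivative D * 1) (at p)"
        by (rule has_vector_derivative_real_field)
      then have "((\<lambda>p. Re (half_plane_integral s (- 2 * s - 1) (\<i> * of_real \<epsilon> + of_real p))) has_vector_derivative Re (D * 1)) (at p)"
        by (rule bounded_linear.has_vector_derivative[OF bounded_linear_Re])
      then show ?thesis
        by (simp only: has_real_derivative_iff_has_vector_derivative pt mult_1_right D_def)
    qed
    have bound: "norm (Re (\<i> * of_real (2 * s + 1) * half_plane_integral s (- 2 * s - 2) (Complex p \<epsilon>))) \<le> C * \<epsilon>" if p: "p \<in> {-r..r}" for p
    proof -
      define w where "w = 1 - (Complex p \<epsilon>)\<^sup>2"
      have w: "Re w = 1 - p\<^sup>2 + \<epsilon>\<^sup>2" "Im w = - (2 * p * \<epsilon>)" by (auto simp: w_def power2_eq_square)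
      have "\<bar>p\<bar> \<le> r" using p by auto
      then have "p\<^sup>2 \<le> r\<^sup>2" using r by (intro abs_le_square_iff[THEN iffD1]) auto
      then have "Re w \<ge> \<delta>" unfolding w \<delta>_def using zero_le_power2[of \<epsilon>] by linarith
      then have "\<bar>Im (w powr of_real (- s - 1))\<bar> \<le> (s + 1) * \<delta> powr (- s - 2) * \<bar>Im w\<bar>"
        by (intro Im_powr_small \<delta> s)
      also have "\<bar>Im w\<bar> \<le> 2 * \<epsilon>"
        unfolding w using \<open>\<bar>p\<bar> \<le> r\<close> r e by (simp add: abs_mult mult_left_le_one_le)
      finally have b: "\<bar>Im (w powr of_real (- s - 1))\<bar> \<le> (s + 1) * \<delta> powr (- s - 2) * (2 * \<epsilon>)"
        using s by (simp add: mult_left_mono)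
      have "half_plane_integral s (- 2 * s - 2) (Complex p \<epsilon>) = of_real B * w powr of_real (- s - 1)"
        unfolding w_def using e by (intro B) simp
      then have "Re (\<i> * of_real (2 * s + 1) * half_plane_integral s (- 2 * s - 2) (Complex p \<epsilon>)) = - ((2 * s + 1) * (B * Im (w powr of_real (- s - 1))))"
        by (simp del: of_real_add of_real_mult)
      then have "norm (Re (\<i> * of_real (2 * s + 1) * half_plane_integral s (- 2 * s - 2) (Complex p \<epsilon>))) = (2 * s + 1) * (\<bar>B\<bar> * \<bar>Im (w powr of_real (- s - 1))\<bar>)"
        using s by (simp only: real_norm_def abs_minus_cancel abs_mult)
      also have "\<dots> \<le> (2 * s + 1) * (\<bar>B\<bar> * ((s + 1) * \<delta> powr (- s - 2) * (2 * \<epsilon>)))"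
        using b s by (intro mult_left_mono) auto
      finally show ?thesis by (simp add: C_def mult_ac)
    qed
    have "norm (?f p - ?f q) \<le> C * \<epsilon> * norm (p - q)"
      by (rule field_differentiable_bound[of "{-r..r}", OF _ has_field_derivative_at_within[OF deriv] bound]) (use p q in auto)
    also have "\<dots> \<le> C * \<epsilon> * 2"
      using p q r e s by (intro mult_left_mono) (auto simp: C_def intro!: mult_nonneg_nonneg)
    finally show ?thesis by (simp add: mult_ac)
  qed
  then show ?thesis by (intro exI[of _ "C * 2"]) auto
qed

section \<open>Constancy of the difference integral on an interval\<close>

lemma fourier_has_vector_derivative:
  fixes g :: "real \<Rightarrow> complex"
  assumes g: "integrable lborel g" and xg: "integrable lborel (\<lambda>\<xi>. of_real \<xi> * g \<xi>)"
  shows "((\<lambda>r. \<integral>\<xi>. g \<xi> * iexp (r * \<xi>) \<partial>lborel) has_vector_derivative (\<integral>\<xi>. \<i> * (of_real \<xi> * g \<xi>) * iexp (r * \<xi>) \<partial>lborel)) (at r)"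
proof -
  have [measurable]: "g \<in> borel_measurable borel" using borel_measurable_integrable[OF g] by simp
  define F where "F = (\<lambda>r. \<integral>\<xi>. g \<xi> * iexp (r * \<xi>) \<partial>lborel)"
  define D where "D = (\<integral>\<xi>. \<i> * (of_real \<xi> * g \<xi>) * iexp (r * \<xi>) \<partial>lborel)"
  have Fi: "integrable lborel (\<lambda>\<xi>. g \<xi> * iexp (r * \<xi>))" for r
    by (rule Bochner_Integration.integrable_bound[OF g]) (auto simp: norm_mult)
  have Di: "integrable lborel (\<lambda>\<xi>. \<i> * (of_real \<xi> * g \<xi>) * iexp (r * \<xi>))"
    by (rule Bochner_Integration.integrable_bound[OF xg]) (auto simp: norm_mult)
  have lim: "((\<lambda>h. norm (F (r + h) - F r - h *\<^sub>R D) / norm h) \<longlongrightarrow> 0) (at 0)"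
    unfolding tendsto_at_iff_sequentially
  proof (intro allI impI)
    fix X :: "nat \<Rightarrow> real" assume X: "\<forall>i. X i \<in> UNIV - {0}" "X \<longlonglongrightarrow> 0"
    have X0: "X i \<noteq> 0" for i using X by auto
    let ?q = "\<lambda>i \<xi>. (g \<xi> * iexp (r * \<xi>) * (iexp (X i * \<xi>) - 1 - \<i> * of_real (X i * \<xi>))) / of_real (X i)"
    have qb: "norm (?q i \<xi>) \<le> 2 * norm (of_real \<xi> * g \<xi>)" for i \<xi>
    proof -
      have "norm (iexp (X i * \<xi>) - 1 - \<i> * of_real (X i * \<xi>)) \<le> 2 * \<bar>X i * \<xi>\<bar>"
        using iexp_approx2[of "X i * \<xi>" 1] by (simp add: algebra_simps)
      then have "norm (g \<xi>) * norm (iexp (X i * \<xi>) - 1 - \<i> * of_real (X i * \<xi>)) / \<bar>X i\<bar> \<le> norm (g \<xi>) * (2 * \<bar>X i * \<xi>\<bar>) / \<bar>X i\<bar>"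
        by (intro divide_right_mono mult_left_mono) auto
      also have "\<dots> = 2 * norm (of_real \<xi> * g \<xi>)" using X0[of i] by (simp add: norm_mult abs_mult)
      finally show ?thesis by (simp add: norm_mult norm_divide)
    qed
    have "(\<lambda>i. \<integral>\<xi>. ?q i \<xi> \<partial>lborel) \<longlonglongrightarrow> (\<integral>\<xi>. 0 \<partial>(lborel :: real measure))"
    proof (rule integral_dominated_convergence[where w="\<lambda>\<xi>. 2 * norm (of_real \<xi> * g \<xi>)"])
      show "AE \<xi> in lborel. (\<lambda>i. ?q i \<xi>) \<longlonglongrightarrow> 0"
      proof (intro AE_I2)
        fix \<xi> :: real
        have b: "norm (?q i \<xi>) \<le> norm (g \<xi>) * (\<bar>X i\<bar> * \<xi>\<^sup>2)" for i
        proof -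
          have "norm (iexp (X i * \<xi>) - 1 - \<i> * of_real (X i * \<xi>)) \<le> \<bar>X i * \<xi>\<bar>\<^sup>2 / 2"
            using iexp_approx1[of "X i * \<xi>" 1] by (simp add: algebra_simps power2_eq_square)
          also have "\<dots> \<le> \<bar>X i * \<xi>\<bar>\<^sup>2" by simp
          finally have "norm (g \<xi>) * norm (iexp (X i * \<xi>) - 1 - \<i> * of_real (X i * \<xi>)) / \<bar>X i\<bar> \<le> norm (g \<xi>) * \<bar>X i * \<xi>\<bar>\<^sup>2 / \<bar>X i\<bar>"
            by (intro divide_right_mono mult_left_mono) auto
          also have "\<bar>X i * \<xi>\<bar>\<^sup>2 = \<bar>X i\<bar> * (\<bar>X i\<bar> * \<xi>\<^sup>2)"
            by (simp add: abs_mult power_mult_distrib power2_eq_square)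
          finally show ?thesis using X0[of i] by (simp add: norm_mult norm_divide)
        qed
        have "(\<lambda>i. norm (g \<xi>) * (\<bar>X i\<bar> * \<xi>\<^sup>2)) \<longlonglongrightarrow> norm (g \<xi>) * (\<bar>0\<bar> * \<xi>\<^sup>2)"
          by (intro tendsto_intros X(2))
        then have z: "(\<lambda>i. norm (g \<xi>) * (\<bar>X i\<bar> * \<xi>\<^sup>2)) \<longlonglongrightarrow> 0" by simp
        show "(\<lambda>i. ?q i \<xi>) \<longlonglongrightarrow> 0"
          by (rule Lim_null_comparison[OF always_eventually z]) (use b in blast)
      qed
      show "AE \<xi> in lborel. norm (?q i \<xi>) \<le> 2 * norm (of_real \<xi> * g \<xi>)" for i
        using qb by (intro AE_I2)
      show "integrable lborel (\<lambda>\<xi>. 2 * norm (of_real \<xi> * g \<xi>))"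
        using xg by (intro integrable_mult_right integrable_norm)
    qed measurable
    then have "(\<lambda>i. norm (\<integral>\<xi>. ?q i \<xi> \<partial>lborel)) \<longlonglongrightarrow> 0"
      by (simp add: tendsto_norm_zero)
    moreover have "norm (\<integral>\<xi>. ?q i \<xi> \<partial>lborel) = norm (F (r + X i) - F r - X i *\<^sub>R D) / norm (X i)" for i
    proof -
      have split: "g \<xi> * iexp (r * \<xi>) * (iexp (X i * \<xi>) - 1 - \<i> * of_real (X i * \<xi>))
         = g \<xi> * iexp ((r + X i) * \<xi>) - g \<xi> * iexp (r * \<xi>) - of_real (X i) * (\<i> * (of_real \<xi> * g \<xi>) * iexp (r * \<xi>))" for \<xi>
        by (simp add: algebra_simps exp_add)
      have "(\<integral>\<xi>. ?q i \<xi> \<partial>lborel) = (\<integral>\<xi>. g \<xi> * iexp (r * \<xi>) * (iexp (X i * \<xi>) - 1 - \<i> * of_real (X i * \<xi>)) \<partial>lborel) / of_real (X i)"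
        by (rule integral_divide_zero)
      also have "(\<integral>\<xi>. g \<xi> * iexp (r * \<xi>) * (iexp (X i * \<xi>) - 1 - \<i> * of_real (X i * \<xi>)) \<partial>lborel)
         = (\<integral>\<xi>. g \<xi> * iexp ((r + X i) * \<xi>) - g \<xi> * iexp (r * \<xi>) \<partial>lborel) - (\<integral>\<xi>. of_real (X i) * (\<i> * (of_real \<xi> * g \<xi>) * iexp (r * \<xi>)) \<partial>lborel)"
        unfolding split by (intro Bochner_Integration.integral_diff Bochner_Integration.integrable_diff integrable_mult_right Fi Di)
      also have "(\<integral>\<xi>. of_real (X i) * (\<i> * (of_real \<xi> * g \<xi>) * iexp (r * \<xi>)) \<partial>lborel) = of_real (X i) * D"
        unfolding D_def by (rule integral_mult_right_zero)
      also have "(\<integral>\<xi>. g \<xi> * iexp ((r + X i) * \<xi>) - g \<xi> * iexp (r * \<xi>) \<partial>lborel) = F (r + X i) - F r"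
        unfolding F_def by (intro Bochner_Integration.integral_diff Fi)
      finally show ?thesis by (simp only: norm_divide norm_of_real scaleR_conv_of_real real_norm_def)
    qed
    ultimately show "((\<lambda>h. norm (F (r + h) - F r - h *\<^sub>R D) / norm h) \<circ> X) \<longlonglongrightarrow> 0"
      by (simp add: o_def)
  qed
  show ?thesis
    unfolding has_vector_derivative_def F_def[symmetric] D_def[symmetric] has_derivative_at
    using lim by (auto intro: bounded_linear_scaleR_left)
qed

lemma powr_times_exp_tendsto_0:
  fixes a \<epsilon> :: real
  assumes e: "\<epsilon> > 0"
  shows "((\<lambda>x. x powr a * exp (- \<epsilon> * x)) \<longlongrightarrow> 0) at_top"
proof -
  define N where "N = nat \<lceil>a\<rceil>"
  have N: "a \<le> real N" by (simp add: N_def) linarith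
  have "((\<lambda>x. (\<epsilon> * x) ^ N / exp (\<epsilon> * x)) \<longlongrightarrow> 0) at_top"
    by (rule filterlim_compose[OF tendsto_power_div_exp_0]) (use e in \<open>auto intro!: filterlim_tendsto_pos_mult_at_top[OF tendsto_const] filterlim_ident\<close>)
  then have lim: "((\<lambda>x. (1 / \<epsilon> ^ N) * ((\<epsilon> * x) ^ N / exp (\<epsilon> * x))) \<longlongrightarrow> 0) at_top"
    by (rule tendsto_mult_right_zero)
  show ?thesis
  proof (rule Lim_null_comparison[OF _ lim])
    show "\<forall>\<^sub>F x in at_top. norm (x powr a * exp (- \<epsilon> * x)) \<le> (1 / \<epsilon> ^ N) * ((\<epsilon> * x) ^ N / exp (\<epsilon> * x))"
      using eventually_ge_at_top[of "1::real"]
    proof eventually_elim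
      case (elim x)
      have "x powr a \<le> x powr real N" using elim N by (intro powr_mono) auto
      also have "\<dots> = x ^ N" using elim by (simp add: powr_realpow)
      finally have "x powr a * exp (- \<epsilon> * x) \<le> x ^ N * exp (- \<epsilon> * x)" by (intro mult_right_mono) auto
      also have "\<dots> = (1 / \<epsilon> ^ N) * ((\<epsilon> * x) ^ N / exp (\<epsilon> * x))"
        using e by (simp add: power_mult_distrib exp_minus field_simps)
      finally show ?case by simp
    qed
  qed
qed

text \<open>
  Differentiation under the integral followed by integration by parts gives a linear equation of first order in \<open>r\<close>,
  which makes the integral times \<open>(\<epsilon> - \<i> r) powr (a + 1)\<close> constant; at \<open>r = 0\<close> it is a Gamma integral.
\<close>

lemma laplace_powr:
  fixes a \<epsilon> r :: real
  assumes a: "a > 0" and e: "\<epsilon> > 0"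
  shows "(\<integral>\<xi>. of_real (indicator {0<..} \<xi> * (\<xi> powr a * exp (- \<epsilon> * \<xi>))) * iexp (r * \<xi>) \<partial>lborel)
    = of_real (Gamma (a + 1)) * (of_real \<epsilon> - \<i> * of_real r) powr of_real (- a - 1)"
    and "integrable lborel (\<lambda>\<xi>::real. indicator {0<..} \<xi> * (\<xi> powr a * exp (- \<epsilon> * \<xi>)))"
proof -
  let ?g = "\<lambda>b \<xi>::real. indicator {0<..} \<xi> * (\<xi> powr b * exp (- \<epsilon> * \<xi>))"
  have gi: "integrable lborel (?g b)" "(\<integral>\<xi>. ?g b \<xi> \<partial>lborel) = Gamma (b + 1) * \<epsilon> powr (- (b + 1))" if "b > -1" for b
    using has_bochner_integral_scaled_Gamma[of "b + 1" \<epsilon>] that e by (auto simp: has_bochner_integral_iff)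
  show "integrable lborel (?g a)" using a by (intro gi) simp
  have shift: "\<xi> * ?g b \<xi> = ?g (b + 1) \<xi>" for b \<xi> by (auto simp: powr_add split: split_indicator)
  define F where "F = (\<lambda>r. \<integral>\<xi>. complex_of_real (?g a \<xi>) * iexp (r * \<xi>) \<partial>lborel)"
  define D where "D = (\<lambda>r. \<integral>\<xi>. complex_of_real (?g (a + 1) \<xi>) * iexp (r * \<xi>) \<partial>lborel)"
  have F': "(F has_vector_derivative \<i> * D r) (at r)" for r
  proof -
    have s: "of_real \<xi> * complex_of_real (?g a \<xi>) = of_real (?g (a + 1) \<xi>)" for \<xi>
      unfolding of_real_mult[symmetric] shift ..
    have "(F has_vector_derivative (\<integral>\<xi>. \<i> * (of_real \<xi> * complex_of_real (?g a \<xi>)) * iexp (r * \<xi>) \<partial>lborel)) (at r)"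
      unfolding F_def using gi(1)[of a] gi(1)[of "a + 1"] a
      by (intro fourier_has_vector_derivative) (simp_all only: s complex_of_real_integrable_eq)
    also have "(\<integral>\<xi>. \<i> * (of_real \<xi> * complex_of_real (?g a \<xi>)) * iexp (r * \<xi>) \<partial>lborel) = (\<integral>\<xi>. \<i> * (complex_of_real (?g (a + 1) \<xi>) * iexp (r * \<xi>)) \<partial>lborel)"
      unfolding s by (simp only: mult.assoc)
    also have "\<dots> = \<i> * D r" unfolding D_def by (rule integral_mult_right_zero)
    finally show ?thesis .
  qed
  have parts: "of_real (a + 1) * F r = (of_real \<epsilon> - \<i> * of_real r) * D r" for r
  proof -
    define w where "w = complex_of_real \<epsilon> - \<i> * of_real r"
    have gw: "complex_of_real (?g b \<xi>) * iexp (r * \<xi>) = indicator {0<..} \<xi> *\<^sub>R (of_real (\<xi> powr b) * exp (- w * of_real \<xi>))" for b \<xi>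
    proof -
      have "- w * of_real \<xi> = of_real (- \<epsilon> * \<xi>) + \<i> * of_real (r * \<xi>)" by (simp add: w_def algebra_simps)
      then have "exp (- w * of_real \<xi>) = of_real (exp (- \<epsilon> * \<xi>)) * iexp (r * \<xi>)"
        by (simp only: exp_add exp_of_real)
      then show ?thesis by (simp split: split_indicator)
    qed
    have int: "integrable lborel (\<lambda>\<xi>. complex_of_real (?g b \<xi>) * iexp (r * \<xi>))" if "b > -1" for b
    proof (rule Bochner_Integration.integrable_bound)
      show "integrable lborel (?g b)" using gi(1)[OF that] .
    qed (auto simp: norm_mult)
    let ?F = "\<lambda>\<xi>. of_real (\<xi> powr (a + 1)) * exp (- w * of_real \<xi>)"
    let ?f = "\<lambda>\<xi>. of_real (a + 1) * (of_real (\<xi> powr a) * exp (- w * of_real \<xi>)) - w * (of_real (\<xi> powr (a + 1)) * exp (- w * of_real \<xi>))"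
    have ind: "indicator {0<..} \<xi> *\<^sub>R ?f \<xi> = of_real (a + 1) * (complex_of_real (?g a \<xi>) * iexp (r * \<xi>)) - w * (complex_of_real (?g (a + 1) \<xi>) * iexp (r * \<xi>))" for \<xi>
      unfolding gw by (auto split: split_indicator)
    have fint: "integrable lborel (\<lambda>\<xi>. indicator {0<..} \<xi> *\<^sub>R ?f \<xi>)"
      unfolding ind using a by (intro Bochner_Integration.integrable_diff integrable_mult_right int) auto
    have nF: "norm (?F \<xi>) = \<xi> powr (a + 1) * exp (- \<epsilon> * \<xi>)" for \<xi>
      by (simp add: norm_mult w_def)
    have "(LBINT \<xi>=0..\<infinity>. ?f \<xi>) = 0 - 0"
    proof (rule interval_integral_FTC_integrable)
      fix \<xi> :: real assume "0 < ereal \<xi>"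
      then have x: "\<xi> > 0" by simp
      have d1: "((\<lambda>\<xi>. complex_of_real (\<xi> powr (a + 1))) has_vector_derivative of_real ((a + 1) * \<xi> powr a)) (at \<xi>)"
        using x by (intro has_vector_derivative_of_real) (auto intro!: derivative_eq_intros simp: has_real_derivative_iff_has_vector_derivative[symmetric])
      have "((\<lambda>z. exp (- w * z)) has_field_derivative exp (- w * of_real \<xi>) * (- w)) (at (of_real \<xi>))"
        by (auto intro!: derivative_eq_intros)
      then have d2: "((\<lambda>\<xi>. exp (- w * of_real \<xi>)) has_vector_derivative exp (- w * of_real \<xi>) * (- w)) (at \<xi>)"
        by (rule has_vector_derivative_real_field)
      have "(?F has_vector_derivative (of_real (\<xi> powr (a + 1)) * (exp (- w * of_real \<xi>) * (- w)) + of_real ((a + 1) * \<xi> powr a) * exp (- w * of_real \<xi>))) (at \<xi>)"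
        by (rule has_vector_derivative_mult[OF d1 d2])
      then show "(?F has_vector_derivative ?f \<xi>) (at \<xi>)" by (simp add: algebra_simps)
      show "isCont ?f \<xi>" using x by (intro continuous_intros) auto
    next
      show "set_integrable lborel (einterval 0 \<infinity>) ?f"
        using fint by (simp add: set_integrable_def einterval_def greaterThan_def)
      have "((\<lambda>\<xi>. norm (?F \<xi>)) \<longlongrightarrow> 0 powr (a + 1) * exp (- \<epsilon> * 0)) (at_right 0)"
        unfolding nF using a by (intro tendsto_mult tendsto_powr' tendsto_intros) (auto simp: eventually_at_filter intro!: always_eventually)
      then have "(?F \<longlongrightarrow> 0) (at_right 0)" by (intro tendsto_norm_zero_cancel[where f="?F"]) simp
      then show "((?F \<circ> real_of_ereal) \<longlongrightarrow> 0) (at_right 0)" by (simp add: zero_ereal_def ereal_tendsto_simps)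
      have "(?F \<longlongrightarrow> 0) at_top"
        by (rule tendsto_norm_zero_cancel) (unfold nF, rule powr_times_exp_tendsto_0[OF e])
      then show "((?F \<circ> real_of_ereal) \<longlongrightarrow> 0) (at_left \<infinity>)" by (simp add: ereal_tendsto_simps)
    qed simp
    then have "(\<integral>\<xi>. indicator {0<..} \<xi> *\<^sub>R ?f \<xi> \<partial>lborel) = 0"
      by (simp add: interval_lebesgue_integral_def set_lebesgue_integral_def einterval_def greaterThan_def)
    also have "(\<integral>\<xi>. indicator {0<..} \<xi> *\<^sub>R ?f \<xi> \<partial>lborel) = of_real (a + 1) * F r - w * D r"
      unfolding ind F_def D_def using a
      by (subst Bochner_Integration.integral_diff) (auto intro!: integrable_mult_right int simp only: integral_mult_right_zero)
    finally show ?thesis by (simp add: w_def)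
  qed
  define P where "P = (\<lambda>r::real. (of_real \<epsilon> - \<i> * of_real r) powr complex_of_real (a + 1))"
  have np: "of_real \<epsilon> - \<i> * of_real r \<notin> \<real>\<^sub>\<le>\<^sub>0" "of_real \<epsilon> - \<i> * of_real r \<noteq> 0" for r
    using e by (auto simp: complex_nonpos_Reals_iff complex_eq_iff)
  have P': "(P has_vector_derivative (of_real (a + 1) * (of_real \<epsilon> - \<i> * of_real r) powr (of_real (a + 1) - 1) * (- \<i>))) (at r)" for r
    unfolding P_def
    by (rule has_vector_derivative_real_field[where f="\<lambda>z. (of_real \<epsilon> - \<i> * z) powr complex_of_real (a + 1)"], rule DERIV_powr_compose, (auto intro!: derivative_eq_intros)[1], rule np(1))
  have const: "((\<lambda>r. F r * P r) has_vector_derivative 0) (at r)" for r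
  proof -
    define w where "w = complex_of_real \<epsilon> - \<i> * of_real r"
    define Q where "Q = w powr (of_real (a + 1) - 1)"
    have "w powr (of_real (a + 1) - 1 + 1) = Q * w powr 1" unfolding Q_def by (rule powr_add)
    then have PQ: "P r = Q * w" using np(2)[of r] unfolding P_def w_def by simp
    have "((\<lambda>r. F r * P r) has_vector_derivative (F r * (of_real (a + 1) * Q * (- \<i>)) + \<i> * D r * P r)) (at r)"
      unfolding Q_def w_def by (rule has_vector_derivative_mult[OF F' P'])
    moreover have "F r * (of_real (a + 1) * Q * (- \<i>)) + \<i> * D r * P r = \<i> * Q * (w * D r - of_real (a + 1) * F r)"
      unfolding PQ by (simp add: algebra_simps)
    ultimately show ?thesis using parts[of r] unfolding w_def by simp
  qed
  obtain c where c: "\<And>r. F r * P r = c"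
    using has_vector_derivative_zero_constant[of UNIV "\<lambda>r. F r * P r"] const by (auto simp: has_vector_derivative_at_within)
  have F0: "F 0 = of_real (Gamma (a + 1) * \<epsilon> powr (- (a + 1)))"
    using gi(2)[of a] a unfolding F_def by (simp del: of_real_mult)
  have P0: "P 0 = of_real (\<epsilon> powr (a + 1))"
    using powr_of_real[of \<epsilon> "a + 1"] e unfolding P_def by simp
  have "c = of_real (Gamma (a + 1) * (\<epsilon> powr (- (a + 1)) * \<epsilon> powr (a + 1)))"
    using c[of 0] unfolding F0 P0 by (simp add: mult.assoc)
  also have "\<epsilon> powr (- (a + 1)) * \<epsilon> powr (a + 1) = 1" using e by (simp add: powr_add[symmetric])
  finally have cG: "c = of_real (Gamma (a + 1))" by simp
  have "P r * (of_real \<epsilon> - \<i> * of_real r) powr of_real (- a - 1) = (of_real \<epsilon> - \<i> * of_real r) powr (complex_of_real (a + 1) + of_real (- a - 1))"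
    unfolding P_def by (rule powr_add[symmetric])
  also have "\<dots> = 1" using np(2)[of r] by simp
  finally have "F r = (F r * P r) * (of_real \<epsilon> - \<i> * of_real r) powr of_real (- a - 1)" by (simp only: mult.assoc mult_1_right)
  then have "F r = of_real (Gamma (a + 1)) * (of_real \<epsilon> - \<i> * of_real r) powr of_real (- a - 1)"
    unfolding c cG .
  then show "(\<integral>\<xi>. of_real (?g a \<xi>) * iexp (r * \<xi>) \<partial>lborel) = of_real (Gamma (a + 1)) * (of_real \<epsilon> - \<i> * of_real r) powr of_real (- a - 1)"
    unfolding F_def .
qed

text \<open>
  The two half lines contribute complex conjugate values.
\<close>

lemma even_kernel_fourier:
  fixes a \<epsilon> r :: real
  assumes a: "a > 0" and e: "\<epsilon> > 0"
  shows "(\<integral>\<xi>. of_real (\<bar>\<xi>\<bar> powr a * exp (- \<epsilon> * \<bar>\<xi>\<bar>)) * iexp (r * \<xi>) \<partial>lborel)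
    = of_real (2 * Gamma (a + 1) * Re ((of_real \<epsilon> - \<i> * of_real r) powr of_real (- a - 1)))"
    and "integrable lborel (\<lambda>\<xi>::real. \<bar>\<xi>\<bar> powr a * exp (- \<epsilon> * \<bar>\<xi>\<bar>))"
proof -
  let ?g = "\<lambda>\<xi>::real. indicator {0<..} \<xi> * (\<xi> powr a * exp (- \<epsilon> * \<xi>))"
  have gi: "integrable lborel ?g" by (rule laplace_powr(2)[OF a e])
  have gi': "integrable lborel (\<lambda>\<xi>. ?g (- \<xi>))"
    using lborel_integrable_real_affine[OF gi, of "-1" 0] by simp
  have split: "\<bar>\<xi>\<bar> powr a * exp (- \<epsilon> * \<bar>\<xi>\<bar>) = ?g \<xi> + ?g (- \<xi>)" for \<xi>
    by (auto split: split_indicator)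
  show "integrable lborel (\<lambda>\<xi>::real. \<bar>\<xi>\<bar> powr a * exp (- \<epsilon> * \<bar>\<xi>\<bar>))"
    unfolding split by (intro Bochner_Integration.integrable_add gi gi')
  have mult: "integrable lborel (\<lambda>\<xi>. complex_of_real (f \<xi>) * iexp (r * \<xi>))" if f: "integrable lborel f" for f r
  proof -
    have [measurable]: "f \<in> borel_measurable borel" using borel_measurable_integrable[OF f] by simp
    show ?thesis by (rule Bochner_Integration.integrable_bound[OF f]) (auto simp: norm_mult)
  qed
  define w where "w = complex_of_real \<epsilon> - \<i> * of_real r"
  have "(\<integral>\<xi>. of_real (\<bar>\<xi>\<bar> powr a * exp (- \<epsilon> * \<bar>\<xi>\<bar>)) * iexp (r * \<xi>) \<partial>lborel) = (\<integral>\<xi>. complex_of_real (?g \<xi>) * iexp (r * \<xi>) + complex_of_real (?g (- \<xi>)) * iexp (r * \<xi>) \<partial>lborel)"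
    unfolding split of_real_add distrib_right ..
  also have "\<dots> = (\<integral>\<xi>. complex_of_real (?g \<xi>) * iexp (r * \<xi>) \<partial>lborel) + (\<integral>\<xi>. complex_of_real (?g (- \<xi>)) * iexp (r * \<xi>) \<partial>lborel)"
    by (intro Bochner_Integration.integral_add mult gi gi')
  also have "(\<integral>\<xi>. complex_of_real (?g (- \<xi>)) * iexp (r * \<xi>) \<partial>lborel) = (\<integral>\<xi>. complex_of_real (?g \<xi>) * iexp (- r * \<xi>) \<partial>lborel)"
    by (subst lborel_integral_real_affine[of "-1" _ 0]) simp_all
  also have "(\<integral>\<xi>. complex_of_real (?g \<xi>) * iexp (r * \<xi>) \<partial>lborel) = of_real (Gamma (a + 1)) * w powr of_real (- a - 1)"
    unfolding w_def by (rule laplace_powr(1)[OF a e])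
  also have "(\<integral>\<xi>. complex_of_real (?g \<xi>) * iexp (- r * \<xi>) \<partial>lborel) = of_real (Gamma (a + 1)) * (of_real \<epsilon> - \<i> * of_real (- r)) powr of_real (- a - 1)"
    by (rule laplace_powr(1)[OF a e])
  also have "(of_real \<epsilon> - \<i> * of_real (- r)) powr complex_of_real (- a - 1) = cnj (w powr of_real (- a - 1))"
  proof -
    have "cnj (w powr of_real (- a - 1)) = cnj w powr cnj (of_real (- a - 1))"
      using e by (intro cnj_powr) (simp add: w_def)
    then show ?thesis by (simp add: w_def)
  qed
  also have "of_real (Gamma (a + 1)) * w powr of_real (- a - 1) + of_real (Gamma (a + 1)) * cnj (w powr of_real (- a - 1))
    = of_real (2 * Gamma (a + 1) * Re (w powr of_real (- a - 1)))"
    unfolding distrib_left[symmetric] complex_add_cnj by simp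
  finally show "(\<integral>\<xi>. of_real (\<bar>\<xi>\<bar> powr a * exp (- \<epsilon> * \<bar>\<xi>\<bar>)) * iexp (r * \<xi>) \<partial>lborel)
    = of_real (2 * Gamma (a + 1) * Re ((of_real \<epsilon> - \<i> * of_real r) powr of_real (- a - 1)))"
    unfolding w_def .
qed

interpretation unit_form: quadratic_form "\<lambda>x::real. x"
  by unfold_locales (auto simp: linear_id[unfolded id_def] zero_less_mult_iff)

lemma unit_profile: "power_profile (\<lambda>x::real. x) s t = indicator {-1..1} t * (1 - t\<^sup>2) powr s"
proof (cases "t \<in> {-1..1}")
  case True
  then have "1 - t\<^sup>2 \<ge> 0" by (simp add: abs_square_le_1 abs_le_iff)
  then show ?thesis using True by (simp add: power_profile_def qf_def power2_eq_square max_def)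
next
  case False
  then have "\<bar>t\<bar> > 1" by auto
  then have "1 - t * t < 0" by (metis abs_square_le_1 diff_less_0_iff_less not_less power2_eq_square)
  then show ?thesis using False by (simp add: power_profile_def qf_def max_def)
qed

lemma unit_profile_poisson:
  assumes s: "s > 0" and e: "\<epsilon> > 0"
  shows "(\<integral>t. power_profile (\<lambda>x::real. x) s t * Re ((of_real \<epsilon> - \<i> * of_real (x - t)) powr of_real (- 2 * s - 1)) \<partial>lborel)
    = Re (half_plane_integral s (- 2 * s - 1) (Complex x \<epsilon>))"
proof -
  let ?z = "Complex x \<epsilon>"
  let ?f = "\<lambda>t::real. of_real ((1 - t\<^sup>2) powr s) * (- \<i> * (?z - of_real t)) powr of_real (- 2 * s - 1)"
  have cont: "continuous_on {-1..1} ?f" using s e by (intro half_plane_integral_integrand_continuous) auto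
  have w: "of_real \<epsilon> - \<i> * of_real (x - t) = - \<i> * (?z - of_real t)" for t by (simp add: complex_eq_iff)
  have int: "set_integrable lborel {-1..1} ?f"
    unfolding set_integrable_def by (rule borel_integrable_compact) (use cont in auto)
  have "Re (half_plane_integral s (- 2 * s - 1) ?z) = Re (\<integral>t. indicator {-1..1} t *\<^sub>R ?f t \<partial>lborel)"
    using set_borel_integral_eq_integral(2)[OF int] unfolding half_plane_integral_def set_lebesgue_integral_def by (simp only:)
  also have "\<dots> = (\<integral>t. Re (indicator {-1..1} t *\<^sub>R ?f t) \<partial>lborel)"
    using int unfolding set_integrable_def by (intro integral_Re[symmetric])
  also have "\<dots> = (\<integral>t. power_profile (\<lambda>x::real. x) s t * Re ((of_real \<epsilon> - \<i> * of_real (x - t)) powr of_real (- 2 * s - 1)) \<partial>lborel)"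
    unfolding w by (intro Bochner_Integration.integral_cong refl) (simp add: unit_profile mult.assoc)
  finally show ?thesis by simp
qed

text \<open>
  With the damping \<open>exp (- \<epsilon> * \<bar>\<xi>\<bar>)\<close> the multiplier \<open>\<bar>\<xi>\<bar> powr (2 s)\<close> has an honest kernel, the real part of a
  power of \<open>\<epsilon> - \<i> x\<close>; its convolution with the profile is the real part of \<open>half_plane_integral\<close> at height \<open>\<epsilon>\<close>.
\<close>

lemma regularised_pairing:
  fixes \<phi> :: "real \<Rightarrow> real"
  assumes s: "s > 0" and e: "\<epsilon> > 0" and \<phi>: "integrable lborel \<phi>"
  shows "(\<integral>\<xi>. of_real (\<bar>\<xi>\<bar> powr (2 * s) * exp (- \<epsilon> * \<bar>\<xi>\<bar>)) * FT (power_profile (\<lambda>x. x) s) \<xi> * cnj (FT \<phi> \<xi>) \<partial>lborel)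
    = of_real (((2 * pi) powr (- 1 / 2))\<^sup>2 * (2 * Gamma (2 * s + 1)) * (\<integral>x. \<phi> x * Re (half_plane_integral s (- 2 * s - 1) (Complex x \<epsilon>)) \<partial>lborel))"
proof -
  let ?v = "power_profile (\<lambda>x::real. x) s"
  define c where "c = (2 * pi) powr (- 1 / 2)"
  define G where "G = 2 * Gamma (2 * s + 1)"
  have cD: "(2 * pi) powr (- real DIM(real) / 2) = c" by (simp add: c_def)
  have vi: "integrable lborel ?v" by (rule unit_form.power_profile_integrable[OF s])
  let ?k = "\<lambda>\<xi>::real. \<bar>\<xi>\<bar> powr (2 * s) * exp (- \<epsilon> * \<bar>\<xi>\<bar>)"
  have ki: "integrable lborel ?k" using s by (intro even_kernel_fourier(2) e) simp
  have mult: "integrable lborel (\<lambda>\<xi>. complex_of_real (?k \<xi>) * g \<xi>)"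
    if [measurable]: "g \<in> borel_measurable borel" and b: "\<And>\<xi>. norm (g \<xi>) \<le> C" for g C
  proof (rule Bochner_Integration.integrable_bound)
    show "integrable lborel (\<lambda>\<xi>. C * ?k \<xi>)" using ki by (rule integrable_mult_right)
    show "AE \<xi> in lborel. norm (complex_of_real (?k \<xi>) * g \<xi>) \<le> norm (C * ?k \<xi>)"
    proof (intro AE_I2)
      fix \<xi> :: real
      have "norm (complex_of_real (?k \<xi>) * g \<xi>) = ?k \<xi> * norm (g \<xi>)" by (simp add: norm_mult abs_mult)
      also have "\<dots> \<le> ?k \<xi> * C" using b by (intro mult_left_mono) auto
      also have "\<dots> \<le> norm (C * ?k \<xi>)" by (simp only: mult.commute[of C] real_norm_def abs_ge_self)
      finally show "norm (complex_of_real (?k \<xi>) * g \<xi>) \<le> norm (C * ?k \<xi>)" .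
    qed
  qed measurable
  have FTb: "norm (FT ?v \<xi>) \<le> (2 * pi) powr (- real DIM(real) / 2) * (\<integral>x. \<bar>?v x\<bar> \<partial>lborel)" for \<xi> :: real
    by (rule FT_norm_le)
  have inner: "(\<integral>\<xi>. of_real (?k \<xi>) * FT ?v \<xi> * exp (\<i> * of_real (x \<bullet> \<xi>)) \<partial>lborel) = of_real (c * (G * Re (half_plane_integral s (- 2 * s - 1) (Complex x \<epsilon>))))" for x :: real
  proof -
    have "(\<integral>\<xi>. of_real (?k \<xi>) * FT ?v \<xi> * exp (\<i> * of_real (x \<bullet> \<xi>)) \<partial>lborel) = (\<integral>\<xi>. (of_real (?k \<xi>) * exp (\<i> * of_real (x \<bullet> \<xi>))) * FT ?v \<xi> \<partial>lborel)"
      by (simp only: mult.assoc mult.commute[of "FT ?v _"])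
    also have "\<dots> = of_real c * (\<integral>t. of_real (?v t) * (\<integral>\<xi>. (of_real (?k \<xi>) * exp (\<i> * of_real (x \<bullet> \<xi>))) * exp (- \<i> * of_real (t \<bullet> \<xi>)) \<partial>lborel) \<partial>lborel)"
      unfolding cD[symmetric] by (rule FT_multiplication(1)[OF vi mult[where C=1]]) auto
    also have "\<dots> = of_real c * (\<integral>t. complex_of_real (G * (?v t * Re ((of_real \<epsilon> - \<i> * of_real (x - t)) powr of_real (- 2 * s - 1)))) \<partial>lborel)"
    proof (intro arg_cong[where f="\<lambda>x. of_real c * x"] Bochner_Integration.integral_cong refl)
      fix t :: real
      have "(\<integral>\<xi>. (of_real (?k \<xi>) * exp (\<i> * of_real (x \<bullet> \<xi>))) * exp (- \<i> * of_real (t \<bullet> \<xi>)) \<partial>lborel) = (\<integral>\<xi>. of_real (?k \<xi>) * iexp ((x - t) * \<xi>) \<partial>lborel)"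
      proof (rule Bochner_Integration.integral_cong[OF refl])
        fix \<xi> :: real
        have "exp (\<i> * of_real (x \<bullet> \<xi>)) * exp (- \<i> * of_real (t \<bullet> \<xi>)) = iexp ((x - t) * \<xi>)"
          unfolding exp_add[symmetric] by (rule arg_cong[where f=exp]) (simp add: algebra_simps)
        then show "of_real (?k \<xi>) * exp (\<i> * of_real (x \<bullet> \<xi>)) * exp (- \<i> * of_real (t \<bullet> \<xi>)) = of_real (?k \<xi>) * iexp ((x - t) * \<xi>)"
          by (simp only: mult.assoc)
      qed
      also have "\<dots> = of_real (G * Re ((of_real \<epsilon> - \<i> * of_real (x - t)) powr of_real (- (2 * s) - 1)))"
        unfolding G_def using s by (intro even_kernel_fourier(1) e) simp
      finally show "complex_of_real (?v t) * (\<integral>\<xi>. (of_real (?k \<xi>) * exp (\<i> * of_real (x \<bullet> \<xi>))) * exp (- \<i> * of_real (t \<bullet> \<xi>)) \<partial>lborel)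
         = complex_of_real (G * (?v t * Re ((of_real \<epsilon> - \<i> * of_real (x - t)) powr of_real (- 2 * s - 1))))"
        by (simp only: of_real_mult[symmetric] mult.left_commute mult_minus_left)
    qed
    also have "\<dots> = of_real (c * (G * Re (half_plane_integral s (- 2 * s - 1) (Complex x \<epsilon>))))"
      unfolding integral_complex_of_real integral_mult_right_zero unit_profile_poisson[OF s e] by (simp only: of_real_mult)
    finally show ?thesis .
  qed
  have "(\<integral>\<xi>. of_real (?k \<xi>) * FT ?v \<xi> * cnj (FT \<phi> \<xi>) \<partial>lborel)
    = of_real c * (\<integral>x. of_real (\<phi> x) * (\<integral>\<xi>. of_real (?k \<xi>) * FT ?v \<xi> * exp (\<i> * of_real (x \<bullet> \<xi>)) \<partial>lborel) \<partial>lborel)"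
    unfolding cD[symmetric] by (rule FT_multiplication(2)[OF \<phi> mult[OF _ FTb]]) measurable
  also have "\<dots> = of_real c * (\<integral>x. complex_of_real (c * (G * (\<phi> x * Re (half_plane_integral s (- 2 * s - 1) (Complex x \<epsilon>))))) \<partial>lborel)"
    unfolding inner of_real_mult[symmetric] by (simp only: mult.left_commute)
  also have "\<dots> = of_real (c * (c * (G * (\<integral>x. \<phi> x * Re (half_plane_integral s (- 2 * s - 1) (Complex x \<epsilon>)) \<partial>lborel))))"
    unfolding integral_complex_of_real integral_mult_right_zero by (simp only: of_real_mult)
  finally show ?thesis unfolding c_def[symmetric] G_def[symmetric] by (simp only: power2_eq_square mult.assoc)
qed

lemma (in quadratic_form) power_profile_integral_pos:
  assumes s: "s > 0"
  shows "(\<integral>x. power_profile T s x \<partial>lborel) > 0"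
proof -
  have "(\<integral>x. power_profile T s x \<partial>lborel) \<noteq> 0"
  proof
    assume "(\<integral>x. power_profile T s x \<partial>lborel) = 0"
    then have AE: "AE x in lborel. power_profile T s x = 0"
      using integral_nonneg_eq_0_iff_AE[OF power_profile_integrable(1)[OF s]] by (simp add: power_profile_nonneg)
    have op: "open {x. qf T x < 1}"
      using continuous_qf[of UNIV] by (intro open_Collect_less) (auto intro: continuous_intros)
    have "AE x in lborel. x \<notin> {x. qf T x < 1}"
      using AE
    proof eventually_elim
      case (elim x)
      then show ?case using power_profile_inside[of x s] by (auto simp: powr_eq_0_iff)
    qed
    then have "{x. qf T x < 1} \<in> null_sets lborel"
      by (subst AE_iff_null_sets) (auto simp: op)
    moreover have "(0::'a) \<in> {x. qf T x < 1}" using lin by (simp add: qf_def linear_0)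
    ultimately show False using op by (metis empty_iff negligible_iff_null_sets null_sets_completionI open_not_negligible)
  qed
  moreover have "(\<integral>x. power_profile T s x \<partial>lborel) \<ge> 0" by (intro integral_nonneg_AE) (auto simp: power_profile_nonneg)
  ultimately show ?thesis by simp
qed

lemma interval_form:
  assumes d: "d > 0"
  shows "quadratic_form (\<lambda>x::real. x / d\<^sup>2)"
proof (rule quadratic_form.intro)
  show "linear (\<lambda>x::real. x / d\<^sup>2)" by (intro linearI) (auto simp: add_divide_distrib)
  show "(x / d\<^sup>2) \<bullet> y = x \<bullet> (y / d\<^sup>2)" for x y :: real by simp
  show "0 < (x / d\<^sup>2) \<bullet> x" if "x \<noteq> 0" for x :: real
    using that d by (simp add: zero_less_divide_iff zero_less_mult_iff) linarith
qed

lemma unit_qf: "qf (\<lambda>x::real. x) x = x\<^sup>2"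
  by (simp add: qf_def power2_eq_square)

lemma continuous_half_plane_integral_line:
  assumes "s > 0" "\<epsilon> > 0"
  shows "isCont (\<lambda>x. Re (half_plane_integral s \<alpha> (Complex x \<epsilon>))) x"
proof -
  have "isCont (half_plane_integral s \<alpha>) (Complex x \<epsilon>)" using half_plane_integral_deriv[OF assms(1), of "Complex x \<epsilon>" \<alpha>] assms(2) by (intro DERIV_isCont) auto
  moreover have "isCont (\<lambda>x. Complex x \<epsilon>) x" unfolding Complex_eq by (intro continuous_intros)
  ultimately show ?thesis by (intro isCont_Re isCont_o2[of x "\<lambda>x. Complex x \<epsilon>" "half_plane_integral s \<alpha>"])
qed

text \<open>
  Profiles of shorter intervals serve as test functions, because their energy is already known to be
  finite.
\<close>

lemma shifted_bump_pairing:
  fixes a d r s :: real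
  assumes s: "s > 0" "s < real m" and r: "0 < r" "r < 1" and d: "d > 0" and a: "\<bar>a\<bar> + d \<le> r"
  defines "\<phi> \<equiv> \<lambda>x. power_profile (\<lambda>x. x / d\<^sup>2) s (x - a)"
  shows "has_bochner_integral lborel (\<lambda>\<xi>. of_real (norm \<xi> powr (2 * s)) * FT (power_profile (\<lambda>x. x) s) \<xi> * cnj (FT \<phi> \<xi>))
     (of_real (frac_const 1 m s / 2 * (\<integral>y. power_profile (\<lambda>x. x / d\<^sup>2) s y * difference_integral m s (power_profile (\<lambda>x. x) s) (a + y) \<partial>lborel)))"
    and "integrable lborel \<phi>"
proof -
  interpret q: quadratic_form "\<lambda>x::real. x / d\<^sup>2" using d by (rule interval_form)
  let ?v = "power_profile (\<lambda>x::real. x / d\<^sup>2) s"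
  have vi: "integrable lborel ?v" "integrable lborel (\<lambda>x. (?v x)\<^sup>2)" using q.power_profile_integrable[OF s(1)] by auto
  have \<phi>': "\<phi> = (\<lambda>x. ?v (- a + 1 *\<^sub>R x))" by (simp add: \<phi>_def)
  show \<phi>i: "integrable lborel \<phi>" unfolding \<phi>' by (rule integrable_lborel_affine[OF vi(1)]) simp
  have \<phi>2: "integrable lborel (\<lambda>x. (\<phi> x)\<^sup>2)" unfolding \<phi>' by (rule integrable_lborel_affine[OF vi(2)]) simp
  have F: "norm (FT \<phi> \<xi>) = norm (FT ?v \<xi>)" for \<xi>
    unfolding \<phi>' using FT_affine[OF vi(1), of 1 "- a" \<xi>] by (simp add: norm_mult)
  have en: "integrable lborel (\<lambda>\<xi>. norm \<xi> powr (2 * s) * (norm (FT \<phi> \<xi>))\<^sup>2)"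
    unfolding F by (rule q.power_profile_energy[OF s(1)])
  have r2: "0 < 1 - r\<^sup>2" "1 - r\<^sup>2 \<le> 1" using r by (auto simp: abs_square_less_1)
  have supp: "\<phi> x = 0" if "qf (\<lambda>x. x) x > 1 - (1 - r\<^sup>2)" for x
  proof -
    have "r\<^sup>2 < x\<^sup>2" using that by (simp add: unit_qf)
    then have "\<bar>r\<bar> < \<bar>x\<bar>" using abs_le_square_iff[of x r] by linarith
    then have "d \<le> \<bar>x - a\<bar>" using a r by linarith
    then have "d\<^sup>2 \<le> (x - a)\<^sup>2" using d by (intro abs_le_square_iff[THEN iffD1]) auto
    then have "qf (\<lambda>x. x / d\<^sup>2) (x - a) \<ge> 1" using d by (simp add: qf_def power2_eq_square)
    then show ?thesis unfolding \<phi>_def by (rule q.power_profile_outside)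
  qed
  have "has_bochner_integral lborel (\<lambda>\<xi>. of_real (norm \<xi> powr (2 * s)) * FT (power_profile (\<lambda>x. x) s) \<xi> * cnj (FT \<phi> \<xi>))
     (of_real (frac_const DIM(real) m s / 2 * (\<integral>x. \<phi> x * difference_integral m s (power_profile (\<lambda>x. x) s) x \<partial>lborel)))"
    by (rule unit_form.energy_pairing[OF s r2 \<phi>i \<phi>2 supp en])
  moreover have "(\<integral>x. \<phi> x * difference_integral m s (power_profile (\<lambda>x. x) s) x \<partial>lborel) = (\<integral>y. ?v y * difference_integral m s (power_profile (\<lambda>x. x) s) (a + y) \<partial>lborel)"
    by (subst lborel_integral_real_affine[of 1 _ a]) (simp_all add: \<phi>_def)
  ultimately show "has_bochner_integral lborel (\<lambda>\<xi>. of_real (norm \<xi> powr (2 * s)) * FT (power_profile (\<lambda>x. x) s) \<xi> * cnj (FT \<phi> \<xi>))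
     (of_real (frac_const 1 m s / 2 * (\<integral>y. ?v y * difference_integral m s (power_profile (\<lambda>x. x) s) (a + y) \<partial>lborel)))" by simp
qed

text \<open>
  The regularised pairings with two translates of a bump differ by \<open>O(\<epsilon>)\<close>, as the real part of
  \<open>half_plane_integral\<close> is constant up to \<open>O(\<epsilon>)\<close>. In the limit the pairings themselves agree.
\<close>

lemma bump_averages_equal:
  fixes a b d r s :: real
  assumes s: "s > 0" "s < real m" and r: "0 < r" "r < 1" and d: "d > 0" and a: "\<bar>a\<bar> + d \<le> r" and b: "\<bar>b\<bar> + d \<le> r"
  shows "(\<integral>y. power_profile (\<lambda>x. x / d\<^sup>2) s y * difference_integral m s (power_profile (\<lambda>x. x) s) (a + y) \<partial>lborel)
     = (\<integral>y. power_profile (\<lambda>x. x / d\<^sup>2) s y * difference_integral m s (power_profile (\<lambda>x. x) s) (b + y) \<partial>lborel)"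
proof -
  interpret q: quadratic_form "\<lambda>x::real. x / d\<^sup>2" using d by (rule interval_form)
  let ?v = "power_profile (\<lambda>x::real. x / d\<^sup>2) s"
  let ?u = "power_profile (\<lambda>x::real. x) s"
  have vi: "integrable lborel ?v" using q.power_profile_integrable[OF s(1)] by auto
  have vout: "?v y = 0" if "\<bar>y\<bar> > d" for y
  proof -
    have "d\<^sup>2 \<le> y\<^sup>2" using d that by (intro abs_le_square_iff[THEN iffD1]) auto
    then have "qf (\<lambda>x. x / d\<^sup>2) y \<ge> 1" using d by (simp add: qf_def power2_eq_square)
    then show ?thesis by (rule q.power_profile_outside)
  qed
  define \<phi> where "\<phi> = (\<lambda>a x. ?v (x - a))"
  define I where "I = (\<lambda>a. \<integral>y. ?v y * difference_integral m s ?u (a + y) \<partial>lborel)"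
  define A where "A = (\<lambda>a \<xi>. of_real (norm \<xi> powr (2 * s)) * FT ?u \<xi> * cnj (FT (\<phi> a) \<xi>))"
  define T where "T = (\<lambda>k::nat. 1 / real (Suc k))"
  have T: "T k > 0" for k by (simp add: T_def)
  have Tlim: "T \<longlonglongrightarrow> 0"
    unfolding T_def using LIMSEQ_inverse_real_of_nat by (simp add: inverse_eq_divide)
  define R where "R = (\<lambda>k a. \<integral>\<xi>. of_real (\<bar>\<xi>\<bar> powr (2 * s) * exp (- T k * \<bar>\<xi>\<bar>)) * FT ?u \<xi> * cnj (FT (\<phi> a) \<xi>) \<partial>lborel)"
  have lim: "(\<lambda>k. R k a) \<longlonglongrightarrow> of_real (frac_const 1 m s / 2 * I a)" and \<phi>i: "integrable lborel (\<phi> a)" if a: "\<bar>a\<bar> + d \<le> r" for a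
  proof -
    have hb1: "has_bochner_integral lborel (A a) (of_real (frac_const 1 m s / 2 * I a))"
      using shifted_bump_pairing(1)[OF s r d a] unfolding A_def \<phi>_def I_def .
    show "integrable lborel (\<phi> a)" using shifted_bump_pairing(2)[OF s r d a] unfolding \<phi>_def .
    have Ai: "integrable lborel (A a)" using hb1 by (simp add: has_bochner_integral_iff)
    have [measurable]: "A a \<in> borel_measurable borel" using borel_measurable_integrable[OF Ai] by simp
    have RA: "R k a = (\<integral>\<xi>. of_real (exp (- T k * \<bar>\<xi>\<bar>)) * A a \<xi> \<partial>lborel)" for k
      unfolding R_def A_def by (intro Bochner_Integration.integral_cong refl) (simp add: mult_ac)
    have "(\<lambda>k. \<integral>\<xi>. of_real (exp (- T k * \<bar>\<xi>\<bar>)) * A a \<xi> \<partial>lborel) \<longlonglongrightarrow> (\<integral>\<xi>. A a \<xi> \<partial>lborel)"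
    proof (rule integral_dominated_convergence[where w="\<lambda>\<xi>. norm (A a \<xi>)"])
      show "AE \<xi> in lborel. (\<lambda>k. of_real (exp (- T k * \<bar>\<xi>\<bar>)) * A a \<xi>) \<longlonglongrightarrow> A a \<xi>"
      proof (intro AE_I2)
        fix \<xi> :: real
        have "(\<lambda>k. of_real (exp (- T k * \<bar>\<xi>\<bar>)) * A a \<xi>) \<longlonglongrightarrow> of_real (exp (- 0 * \<bar>\<xi>\<bar>)) * A a \<xi>"
          by (intro tendsto_intros Tlim)
        then show "(\<lambda>k. of_real (exp (- T k * \<bar>\<xi>\<bar>)) * A a \<xi>) \<longlonglongrightarrow> A a \<xi>" by simp
      qed
      show "AE \<xi> in lborel. norm (of_real (exp (- T k * \<bar>\<xi>\<bar>)) * A a \<xi>) \<le> norm (A a \<xi>)" for k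
        using T[of k] by (intro AE_I2) (simp add: norm_mult mult_left_le_one_le)
    qed (use Ai in auto)
    moreover have "(\<integral>\<xi>. A a \<xi> \<partial>lborel) = of_real (frac_const 1 m s / 2 * I a)"
      using hb1 by (simp only: has_bochner_integral_iff)
    ultimately show "(\<lambda>k. R k a) \<longlonglongrightarrow> of_real (frac_const 1 m s / 2 * I a)" unfolding RA by (simp only:)
  qed
  obtain C where C': "\<forall>\<epsilon> p q. 0 < \<epsilon> \<longrightarrow> \<bar>p\<bar> \<le> r \<longrightarrow> \<bar>q\<bar> \<le> r \<longrightarrow>
    \<bar>Re (half_plane_integral s (- 2 * s - 1) (Complex p \<epsilon>)) - Re (half_plane_integral s (- 2 * s - 1) (Complex q \<epsilon>))\<bar> \<le> C * \<epsilon>"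
    using half_plane_integral_real_part_nearly_constant[OF s(1) r] by (elim exE)
  note C = C'[rule_format]
  define c where "c = ((2 * pi) powr (- 1 / 2))\<^sup>2 * (2 * Gamma (2 * s + 1))"
  define h where "h = (\<lambda>k x. Re (half_plane_integral s (- 2 * s - 1) (Complex x (T k))))"
  have hc: "isCont (h k) x" for k x unfolding h_def using s(1) T by (rule continuous_half_plane_integral_line)
  have hint: "integrable lborel (\<lambda>y. ?v y * h k (a + y))" for k a
  proof -
    have "integrable lborel (\<lambda>y. indicator {-d..d} y *\<^sub>R (?v y * h k (a + y)))"
    proof (rule borel_integrable_compact)
      have "continuous_on UNIV (h k)" using hc by (simp add: continuous_on_eq_continuous_at)
      then show "continuous_on {-d..d} (\<lambda>y. ?v y * h k (a + y))"
        by (intro continuous_on_mult continuous_on_subset[OF q.continuous_power_profile[OF s(1)]] continuous_on_compose2[of UNIV "h k" _ "\<lambda>y. a + y"] continuous_intros) auto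
    qed simp
    moreover have "indicator {-d..d} y *\<^sub>R (?v y * h k (a + y)) = ?v y * h k (a + y)" for y
      using vout[of y] by (auto split: split_indicator)
    ultimately show ?thesis by (simp only:)
  qed
  have RR: "R k a = of_real (c * (\<integral>y. ?v y * h k (a + y) \<partial>lborel))" if a: "\<bar>a\<bar> + d \<le> r" for k a
  proof -
    have "R k a = of_real (c * (\<integral>x. \<phi> a x * h k x \<partial>lborel))"
      unfolding R_def c_def h_def by (rule regularised_pairing[OF s(1) T \<phi>i[OF a]])
    also have "(\<integral>x. \<phi> a x * h k x \<partial>lborel) = (\<integral>y. ?v y * h k (a + y) \<partial>lborel)"
      by (subst lborel_integral_real_affine[of 1 _ a]) (simp_all add: \<phi>_def)
    finally show ?thesis .
  qed
  have diff: "norm (R k a - R k b) \<le> \<bar>c\<bar> * (C * T k * (\<integral>y. ?v y \<partial>lborel))" for k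
  proof -
    have "R k a - R k b = of_real (c * (\<integral>y. ?v y * h k (a + y) - ?v y * h k (b + y) \<partial>lborel))"
      unfolding RR[OF a] RR[OF b] Bochner_Integration.integral_diff[OF hint hint] by (simp add: right_diff_distrib)
    then have eq1: "norm (R k a - R k b) = \<bar>c\<bar> * \<bar>\<integral>y. ?v y * h k (a + y) - ?v y * h k (b + y) \<partial>lborel\<bar>"
      by (simp only: norm_of_real abs_mult)
    have le1: "\<bar>\<integral>y. ?v y * h k (a + y) - ?v y * h k (b + y) \<partial>lborel\<bar> \<le> (\<integral>y. C * T k * ?v y \<partial>lborel)"
    proof -
      have "norm (\<integral>y. ?v y * h k (a + y) - ?v y * h k (b + y) \<partial>lborel) \<le> (\<integral>y. C * T k * ?v y \<partial>lborel)"
      proof (rule Bochner_Integration.integral_norm_bound_integral)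
        show "integrable lborel (\<lambda>y. ?v y * h k (a + y) - ?v y * h k (b + y))" by (intro Bochner_Integration.integrable_diff hint)
        show "integrable lborel (\<lambda>y. C * T k * ?v y)" by (intro integrable_mult_right vi)
        fix y :: real
        show "norm (?v y * h k (a + y) - ?v y * h k (b + y)) \<le> C * T k * ?v y"
        proof (cases "\<bar>y\<bar> > d")
          case False
          have "\<bar>h k (a + y) - h k (b + y)\<bar> \<le> C * T k"
            unfolding h_def using False a b by (intro C T) auto
          then have "?v y * \<bar>h k (a + y) - h k (b + y)\<bar> \<le> ?v y * (C * T k)"
            by (intro mult_left_mono q.power_profile_nonneg)
          moreover have "norm (?v y * h k (a + y) - ?v y * h k (b + y)) = ?v y * \<bar>h k (a + y) - h k (b + y)\<bar>"
            unfolding right_diff_distrib[symmetric] real_norm_def abs_mult using q.power_profile_nonneg[of s y] by simp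
          ultimately show ?thesis by (simp only: mult.commute)
        qed (simp add: vout)
      qed
      then show ?thesis by simp
    qed
    have "(\<integral>y. C * T k * ?v y \<partial>lborel) = C * T k * (\<integral>y. ?v y \<partial>lborel)" by (rule integral_mult_right_zero)
    then show ?thesis unfolding eq1 using mult_left_mono[OF le1 abs_ge_zero[of c]] by (simp only:)
  qed
  have "(\<lambda>k. \<bar>c\<bar> * (C * T k * (\<integral>y. ?v y \<partial>lborel))) \<longlonglongrightarrow> \<bar>c\<bar> * (C * 0 * (\<integral>y. ?v y \<partial>lborel))"
    by (intro tendsto_intros Tlim)
  then have z: "(\<lambda>k. \<bar>c\<bar> * (C * T k * (\<integral>y. ?v y \<partial>lborel))) \<longlonglongrightarrow> 0" by simp
  have "\<forall>k. norm (R k a - R k b) \<le> \<bar>c\<bar> * (C * T k * (\<integral>y. ?v y \<partial>lborel))" using diff by (rule allI)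
  then have "(\<lambda>k. R k a - R k b) \<longlonglongrightarrow> 0"
    by (rule Lim_null_comparison[OF always_eventually z])
  moreover have "(\<lambda>k. R k a - R k b) \<longlonglongrightarrow> of_real (frac_const 1 m s / 2 * I a) - of_real (frac_const 1 m s / 2 * I b)"
    by (intro tendsto_diff lim a b)
  ultimately have "complex_of_real (frac_const 1 m s / 2 * I a) - of_real (frac_const 1 m s / 2 * I b) = 0"
    by (rule LIMSEQ_unique[rotated])
  then have "frac_const 1 m s / 2 * I a = frac_const 1 m s / 2 * I b" by (simp only: right_minus_eq of_real_eq_iff)
  then show ?thesis using frac_const_pos[OF s, of 1] unfolding I_def by simp
qed

text \<open>
  By continuity a strict inequality between two values would persist for averages over small bumps.
\<close>

lemma difference_integral_unit_le:
  fixes a b s :: real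
  assumes s: "s > 0" "s < real m" and a: "\<bar>a\<bar> < 1" and b: "\<bar>b\<bar> < 1"
  shows "difference_integral m s (power_profile (\<lambda>x. x) s) a \<le> difference_integral m s (power_profile (\<lambda>x. x) s) b"
proof (rule ccontr)
  let ?L = "difference_integral m s (power_profile (\<lambda>x::real. x) s)"
  assume "\<not> ?L a \<le> ?L b"
  \<comment> \<open>The gap between the two translates; it stays above half of its value at 0 on a small interval.\<close>
  define g where "g = (\<lambda>y. ?L (a + y) - ?L (b + y))"
  define g0 where "g0 = g 0"
  have g0: "g0 > 0" using \<open>\<not> ?L a \<le> ?L b\<close> by (simp add: g0_def g_def)
  have cont: "isCont g 0"
  proof -
    have "isCont ?L (a + 0)" "isCont ?L (b + 0)"
      using a b by (auto intro!: unit_form.isCont_difference_integral[OF s] simp: unit_qf abs_square_less_1)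
    then show ?thesis unfolding g_def
      by (intro continuous_diff isCont_o2[of 0 "\<lambda>y. a + y" ?L] isCont_o2[of 0 "\<lambda>y. b + y" ?L]) auto
  qed
  have "\<exists>\<delta>>0. \<forall>y. y \<noteq> 0 \<and> norm (y - 0) < \<delta> \<longrightarrow> norm (g y - g 0) < g0 / 2"
    using cont[unfolded isCont_def LIM_eq, rule_format, of "g0 / 2"] g0 by simp
  then obtain \<delta> where \<delta>1: "\<delta> > 0" "\<And>y. y \<noteq> 0 \<Longrightarrow> \<bar>y\<bar> < \<delta> \<Longrightarrow> \<bar>g y - g0\<bar> < g0 / 2"
    unfolding g0_def by auto
  have \<delta>: "\<delta> > 0" "\<And>y. \<bar>y\<bar> < \<delta> \<Longrightarrow> \<bar>g y - g0\<bar> < g0 / 2"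
  proof -
    show "\<bar>g y - g0\<bar> < g0 / 2" if "\<bar>y\<bar> < \<delta>" for y
      using \<delta>1(2)[of y] that g0 by (cases "y = 0") (auto simp: g0_def)
  qed (rule \<delta>1(1))
  define M where "M = max \<bar>a\<bar> \<bar>b\<bar>"
  define r where "r = (M + 1) / 2"
  have r: "0 < r" "r < 1" "M < r" using a b by (auto simp: r_def M_def)
  define d where "d = min (\<delta> / 2) (r - M)"
  have d: "d > 0" "d < \<delta>" "d \<le> r - M" using \<delta>(1) r by (auto simp: d_def)
  interpret q: quadratic_form "\<lambda>x::real. x / d\<^sup>2" using d(1) by (rule interval_form)
  let ?v = "power_profile (\<lambda>x::real. x / d\<^sup>2) s"
  have vi: "integrable lborel ?v" using q.power_profile_integrable[OF s(1)] by auto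
  have eq: "(\<integral>y. ?v y * ?L (a + y) \<partial>lborel) = (\<integral>y. ?v y * ?L (b + y) \<partial>lborel)"
    using d by (intro bump_averages_equal[OF s r(1,2) d(1)]) (auto simp: M_def)
  have vout: "?v y = 0" if "\<bar>y\<bar> \<ge> d" for y
  proof -
    have "d\<^sup>2 \<le> y\<^sup>2" using d that by (intro abs_le_square_iff[THEN iffD1]) auto
    then have "qf (\<lambda>x. x / d\<^sup>2) y \<ge> 1" using d by (simp add: qf_def power2_eq_square)
    then show ?thesis by (rule q.power_profile_outside)
  qed
  have Lm[measurable]: "?L \<in> borel_measurable borel"
  proof -
    have "?L \<in> borel_measurable lborel" unfolding difference_integral_def by measurable
    then show ?thesis by simp
  qed
  have Lint: "integrable lborel (\<lambda>y. ?v y * ?L (p + y))" if p: "\<bar>p\<bar> + d \<le> r" for p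
  proof -
    have "continuous_on {-r..r} ?L"
    proof (intro continuous_at_imp_continuous_on ballI unit_form.isCont_difference_integral[OF s])
      fix x assume "x \<in> {-r..r}"
      then have "\<bar>x\<bar> < 1" using r by auto
      then show "qf (\<lambda>x. x) x < 1" by (simp add: unit_qf abs_square_less_1)
    qed
    then have "continuous_on {-d..d} (\<lambda>y. ?L (p + y))"
      using p by (intro continuous_on_compose2[of "{-r..r}" ?L _ "\<lambda>y. p + y"] continuous_intros) auto
    then have "integrable lborel (\<lambda>y. indicator {-d..d} y *\<^sub>R (?v y * ?L (p + y)))"
      by (intro borel_integrable_compact continuous_on_mult continuous_on_subset[OF q.continuous_power_profile[OF s(1)]]) auto
    moreover have "indicator {-d..d} y *\<^sub>R (?v y * ?L (p + y)) = ?v y * ?L (p + y)" for y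
      using vout[of y] by (auto split: split_indicator)
    ultimately show ?thesis by (simp only:)
  qed
  have ia: "integrable lborel (\<lambda>y. ?v y * ?L (a + y))" and ib: "integrable lborel (\<lambda>y. ?v y * ?L (b + y))"
    using d by (auto intro!: Lint simp: M_def)
  have "0 = (\<integral>y. ?v y * ?L (a + y) - ?v y * ?L (b + y) \<partial>lborel)"
    using eq Bochner_Integration.integral_diff[OF ia ib] by simp
  also have "\<dots> \<ge> (\<integral>y. g0 / 2 * ?v y \<partial>lborel)"
  proof (rule integral_mono)
    show "integrable lborel (\<lambda>y. g0 / 2 * ?v y)" by (intro integrable_mult_right vi)
    show "integrable lborel (\<lambda>y. ?v y * ?L (a + y) - ?v y * ?L (b + y))" by (intro Bochner_Integration.integrable_diff ia ib)
    fix y :: real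
    show "g0 / 2 * ?v y \<le> ?v y * ?L (a + y) - ?v y * ?L (b + y)"
    proof (cases "\<bar>y\<bar> \<ge> d")
      case False
      then have "\<bar>g y - g0\<bar> < g0 / 2" using d by (intro \<delta>(2)) auto
      then have "g0 / 2 \<le> g y" by linarith
      then have "g0 / 2 * ?v y \<le> g y * ?v y" by (intro mult_right_mono q.power_profile_nonneg)
      then show ?thesis by (simp add: g_def algebra_simps)
    qed (simp add: vout)
  qed
  finally have "(\<integral>y. g0 / 2 * ?v y \<partial>lborel) \<le> 0" .
  then have le: "(\<integral>y. ?v y \<partial>lborel) \<le> 0" using g0 by (simp add: mult_le_0_iff)
  have "(\<integral>y. ?v y \<partial>lborel) > 0" by (rule q.power_profile_integral_pos[OF s(1)])
  then show False using le by simp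
qed

theorem difference_integral_unit_constant:
  fixes a b s :: real
  assumes "s > 0" "s < real m" "\<bar>a\<bar> < 1" "\<bar>b\<bar> < 1"
  shows "difference_integral m s (power_profile (\<lambda>x. x) s) a = difference_integral m s (power_profile (\<lambda>x. x) s) b"
  using difference_integral_unit_le[OF assms] difference_integral_unit_le[OF assms(1,2,4,3)] by simp

section \<open>Reduction to lines, and the weak equation\<close>

lemma central_diff_even: "central_diff m u x (- y) = central_diff m u x y"
proof -
  have "(\<Sum>k\<in>{- int m..int m}. dcoef m k * u (x + of_int k *\<^sub>R (- y))) = (\<Sum>k\<in>{- int m..int m}. dcoef m k * u (x + of_int k *\<^sub>R y))"
    by (rule sum.reindex_bij_witness[of _ uminus uminus]) (auto simp: dcoef_minus)
  then show ?thesis unfolding central_diff_eq .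
qed

text \<open>
  The difference is even in \<open>t\<close>, so each half line carries half of the constant.
\<close>

lemma half_line_integral:
  fixes \<tau> s :: real
  assumes s: "s > 0" "s < real m" and \<tau>: "\<bar>\<tau>\<bar> < 1"
  shows "(\<integral>t. indicator {0<..} t * (central_diff m (power_profile (\<lambda>x. x) s) \<tau> t / t powr (1 + 2 * s)) \<partial>lborel) = difference_integral m s (power_profile (\<lambda>x::real. x) s) 0 / 2"
proof -
  let ?f = "\<lambda>t. central_diff m (power_profile (\<lambda>x::real. x) s) \<tau> t / norm t powr (real DIM(real) + 2 * s)"
  have i: "integrable lborel ?f"
    using \<tau> by (intro unit_form.integrable_integrand[OF s]) (simp add: unit_qf abs_square_less_1)
  have ind: "integrable lborel (\<lambda>t. indicator {0<..} t * ?f t)"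
    by (rule Bochner_Integration.integrable_bound[OF i]) (auto split: split_indicator)
  have "difference_integral m s (power_profile (\<lambda>x. x) s) \<tau> = (\<integral>t. ?f t \<partial>lborel)" by (simp only: difference_integral_def)
  also have "\<dots> = (\<integral>t. indicator {0<..} t * ?f t + indicator {0<..} (- t) * ?f (- t) \<partial>lborel)"
  proof (rule integral_cong_AE)
    show "AE t in lborel. ?f t = indicator {0<..} t * ?f t + indicator {0<..} (- t) * ?f (- t)"
      using AE_lborel_singleton[of "0::real"] by eventually_elim (auto simp: central_diff_even split: split_indicator)
  qed measurable
  also have "\<dots> = (\<integral>t. indicator {0<..} t * ?f t \<partial>lborel) + (\<integral>t. indicator {0<..} (- t) * ?f (- t) \<partial>lborel)"
    using ind lborel_integrable_real_affine[OF ind, of "-1" 0] by (intro Bochner_Integration.integral_add) simp_all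
  also have "(\<integral>t. indicator {0<..} (- t) * ?f (- t) \<partial>lborel) = (\<integral>t. indicator {0<..} t * ?f t \<partial>lborel)"
    by (subst lborel_integral_real_affine[of "-1" _ 0]) simp_all
  finally have "difference_integral m s (power_profile (\<lambda>x. x) s) \<tau> = 2 * (\<integral>t. indicator {0<..} t * ?f t \<partial>lborel)" by simp
  moreover have "difference_integral m s (power_profile (\<lambda>x. x) s) \<tau> = difference_integral m s (power_profile (\<lambda>x::real. x) s) 0"
    by (rule difference_integral_unit_constant[OF s \<tau>]) simp
  moreover have "(\<integral>t. indicator {0<..} t * ?f t \<partial>lborel) = (\<integral>t. indicator {0<..} t * (central_diff m (power_profile (\<lambda>x. x) s) \<tau> t / t powr (1 + 2 * s)) \<partial>lborel)"
    by (intro Bochner_Integration.integral_cong refl) (simp split: split_indicator)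
  ultimately show ?thesis by simp
qed

context quadratic_form begin

text \<open>
  Completing the square: along any line through a point of the ellipsoid the profile is a multiple of
  \<open>(1 - r\<^sup>2) powr s\<close> in an affine coordinate \<open>r = \<tau> + l t\<close> in which the point lies in \<open>(-1, 1)\<close>. The product
  \<open>D * l\<^sup>2\<close> of the two scale factors does not depend on the point.
\<close>

lemma profile_on_line:
  assumes x: "qf T x < 1" and z: "z \<noteq> 0"
  obtains D \<tau> l where "D > 0" "\<bar>\<tau>\<bar> < 1" "l > 0" "D * l\<^sup>2 = qf T z"
    "\<And>t. power_profile T s (x + t *\<^sub>R z) = D powr s * power_profile (\<lambda>x. x) s (\<tau> + l * t)"
proof -
  define q b where "q = qf T z" and "b = T x \<bullet> z"
  have q: "q > 0" using qf_pos[OF z] by (simp add: q_def)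
  \<comment> \<open>The maximum of \<open>1 - qf T\<close> on the line, found by completing the square in \<open>t\<close>.\<close>
  define D where "D = 1 - qf T x + b\<^sup>2 / q"
  have D: "D > 0" using x q by (simp add: D_def add_pos_nonneg)
  define l where "l = sqrt (q / D)"
  define \<tau> where "\<tau> = b / (D * l)"
  have l: "l > 0" "l\<^sup>2 = q / D" using q D by (auto simp: l_def)
  have tl: "\<tau> * l = b / D" using l(1) by (simp add: \<tau>_def)
  have "\<tau>\<^sup>2 = b\<^sup>2 / (D\<^sup>2 * l\<^sup>2)" by (simp add: \<tau>_def power_divide power_mult_distrib)
  also have "\<dots> = b\<^sup>2 / q / D" unfolding l(2) using D q by (simp add: power2_eq_square)
  finally have t2: "\<tau>\<^sup>2 = b\<^sup>2 / q / D" .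
  have "b\<^sup>2 / q < D" using x by (simp add: D_def)
  then have "\<tau>\<^sup>2 < 1" unfolding t2 pos_divide_less_eq[OF D] by (simp only: mult_1)
  then have \<tau>: "\<bar>\<tau>\<bar> < 1" by (simp add: abs_square_less_1)
  have key: "power_profile T s (x + t *\<^sub>R z) = D powr s * power_profile (\<lambda>x. x) s (\<tau> + l * t)" for t
  proof -
    have "D * (1 - (\<tau> + l * t)\<^sup>2) = D - D * \<tau>\<^sup>2 - 2 * t * (D * (\<tau> * l)) - t\<^sup>2 * (D * l\<^sup>2)"
      by (simp add: power2_eq_square algebra_simps)
    also have "\<dots> = 1 - qf T (x + t *\<^sub>R z)"
      unfolding qf_add t2 tl l(2) using D by (simp add: D_def q_def[symmetric] b_def[symmetric])
    finally have fe: "D * (1 - (\<tau> + l * t)\<^sup>2) = 1 - qf T (x + t *\<^sub>R z)" .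
    have "max 0 (1 - qf T (x + t *\<^sub>R z)) = D * max 0 (1 - (\<tau> + l * t)\<^sup>2)"
      using D unfolding fe[symmetric] max_mult_distrib_left by simp
    then show ?thesis unfolding power_profile_def unit_qf using D by (simp add: powr_mult)
  qed
  show ?thesis by (rule that[OF D \<tau> l(1) _ key]) (use l D in \<open>simp add: q_def\<close>)
qed

text \<open>
  By \<open>profile_on_line\<close> and a substitution, the integral scales by \<open>D powr s * l powr (2 s) = qf T z powr s\<close>: the position of
  \<open>x\<close> has dropped out.
\<close>

lemma radial_integral:
  assumes s: "s > 0" "s < real m" and x: "qf T x < 1" and z: "z \<noteq> 0"
  shows "(\<integral>\<rho>. indicator {0<..} \<rho> * (central_diff m (power_profile T s) x (\<rho> *\<^sub>R z) / \<rho> powr (1 + 2 * s)) \<partial>lborel) = qf T z powr s * (difference_integral m s (power_profile (\<lambda>x::real. x) s) 0 / 2)"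
proof -
  obtain D \<tau> l where D: "D > 0" and \<tau>: "\<bar>\<tau>\<bar> < 1" and l: "l > 0" "D * l\<^sup>2 = qf T z"
    and line: "\<And>t. power_profile T s (x + t *\<^sub>R z) = D powr s * power_profile (\<lambda>x. x) s (\<tau> + l * t)"
    by (rule profile_on_line[OF x z, where s=s]) blast
  let ?v = "power_profile (\<lambda>x::real. x) s"
  have cd: "central_diff m (power_profile T s) x (\<rho> *\<^sub>R z) = D powr s * central_diff m ?v \<tau> (l * \<rho>)" for \<rho>
  proof -
    have "power_profile T s (x + of_int k *\<^sub>R (\<rho> *\<^sub>R z)) = D powr s * ?v (\<tau> + of_int k *\<^sub>R (l * \<rho>))" for k
      using line[of "of_int k * \<rho>"] by (simp add: mult.left_commute)
    then show ?thesis unfolding central_diff_eq by (simp add: sum_distrib_left mult.left_commute)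
  qed
  let ?f = "\<lambda>t. indicator {0<..} t * (central_diff m ?v \<tau> t / t powr (1 + 2 * s))"
  have "difference_integral m s ?v 0 / 2 = (\<integral>t. ?f t \<partial>lborel)" by (rule half_line_integral[OF s \<tau>, symmetric])
  also have "\<dots> = l * (\<integral>\<rho>. ?f (l * \<rho>) \<partial>lborel)"
    using l by (subst lborel_integral_real_affine[of l _ 0]) simp_all
  finally have h: "difference_integral m s ?v 0 / 2 = l * (\<integral>\<rho>. ?f (l * \<rho>) \<partial>lborel)" .
  have pl: "l powr (1 + 2 * s) = l * l powr (2 * s)" using l by (simp add: powr_add)
  have "(\<integral>\<rho>. indicator {0<..} \<rho> * (central_diff m (power_profile T s) x (\<rho> *\<^sub>R z) / \<rho> powr (1 + 2 * s)) \<partial>lborel) = (\<integral>\<rho>. (D powr s * l powr (1 + 2 * s)) * ?f (l * \<rho>) \<partial>lborel)"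
  proof (intro Bochner_Integration.integral_cong refl)
    fix \<rho> :: real
    show "indicator {0<..} \<rho> * (central_diff m (power_profile T s) x (\<rho> *\<^sub>R z) / \<rho> powr (1 + 2 * s)) = (D powr s * l powr (1 + 2 * s)) * ?f (l * \<rho>)"
      unfolding cd using l by (cases "\<rho> > 0") (simp_all add: powr_mult zero_less_mult_iff)
  qed
  also have "\<dots> = (D powr s * l powr (1 + 2 * s)) * (\<integral>\<rho>. ?f (l * \<rho>) \<partial>lborel)"
    by (rule integral_mult_right_zero)
  also have "\<dots> = (D powr s * l powr (2 * s)) * (difference_integral m s ?v 0 / 2)" unfolding h pl by simp
  also have "D powr s * l powr (2 * s) = qf T z powr s"
  proof -
    have "l powr (2 * s) = (l powr 2) powr s" by (simp only: powr_powr)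
    then have "D powr s * l powr (2 * s) = D powr s * (l\<^sup>2) powr s" using l by simp
    also have "\<dots> = (D * l\<^sup>2) powr s" using D by (simp add: powr_mult)
    finally show ?thesis unfolding l(2) .
  qed
  finally show ?thesis .
qed

text \<open>
  Polar coordinates around \<open>x\<close> reduce the integral to \<open>radial_integral\<close> in every direction \<open>z\<close>. The formula on
  the right no longer contains \<open>x\<close>.
\<close>

theorem difference_integral_power_profile:
  assumes s: "s > 0" "s < real m" and x: "qf T x < 1"
  shows "difference_integral m s (power_profile T s) x = (\<integral>z. indicator annulus z * (norm z powr (- real DIM('a) - 2 * s) * (qf T z powr s * (difference_integral m s (power_profile (\<lambda>x::real. x) s) 0 / 2))) \<partial>(lborel :: 'a measure))"
proof -
  let ?F = "\<lambda>y. central_diff m (power_profile T s) x y / norm y powr (real DIM('a) + 2 * s)"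
  have "difference_integral m s (power_profile T s) x = (\<integral>z. (\<integral>\<rho>. polar_weight (z, \<rho>) * ?F (\<rho> *\<^sub>R z) \<partial>lborel) \<partial>lborel)"
    unfolding difference_integral_def by (rule integral_polar[OF integrable_integrand[OF s x]])
  also have "\<dots> = (\<integral>z. indicator annulus z * (norm z powr (- real DIM('a) - 2 * s) * (qf T z powr s * (difference_integral m s (power_profile (\<lambda>x::real. x) s) 0 / 2))) \<partial>(lborel :: 'a measure))"
  proof (rule Bochner_Integration.integral_cong[OF refl])
    fix z :: 'a
    show "(\<integral>\<rho>. polar_weight (z, \<rho>) * ?F (\<rho> *\<^sub>R z) \<partial>lborel) = indicator annulus z * (norm z powr (- real DIM('a) - 2 * s) * (qf T z powr s * (difference_integral m s (power_profile (\<lambda>x::real. x) s) 0 / 2)))"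
    proof (cases "z \<in> annulus")
      case True
      then have z: "z \<noteq> 0" by (auto simp: annulus_def)
      have "(\<integral>\<rho>. polar_weight (z, \<rho>) * ?F (\<rho> *\<^sub>R z) \<partial>lborel) = (\<integral>\<rho>. norm z powr (- real DIM('a) - 2 * s) * (indicator {0<..} \<rho> * (central_diff m (power_profile T s) x (\<rho> *\<^sub>R z) / \<rho> powr (1 + 2 * s))) \<partial>lborel)"
      proof (rule Bochner_Integration.integral_cong[OF refl])
        fix \<rho> :: real
        show "polar_weight (z, \<rho>) * ?F (\<rho> *\<^sub>R z) = norm z powr (- real DIM('a) - 2 * s) * (indicator {0<..} \<rho> * (central_diff m (power_profile T s) x (\<rho> *\<^sub>R z) / \<rho> powr (1 + 2 * s)))"
        proof (cases "\<rho> > 0")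
          case \<rho>: True
          have "\<rho> powr (real DIM('a) + 2 * s) = \<rho> powr (real DIM('a) - 1) * \<rho> powr (1 + 2 * s)"
            unfolding powr_add[symmetric] by (rule arg_cong[where f="(powr) \<rho>"]) simp
          moreover have "\<rho> powr (real DIM('a) - 1) > 0" using \<rho> by simp
          ultimately have a: "\<rho> powr (real DIM('a) - 1) / \<rho> powr (real DIM('a) + 2 * s) = 1 / \<rho> powr (1 + 2 * s)" by simp
          have b: "1 / norm z powr (real DIM('a) + 2 * s) = norm z powr (- real DIM('a) - 2 * s)"
            unfolding powr_minus_divide[symmetric] by (rule arg_cong[where f="(powr) (norm z)"]) simp
          have "polar_weight (z, \<rho>) * ?F (\<rho> *\<^sub>R z) = (\<rho> powr (real DIM('a) - 1) / \<rho> powr (real DIM('a) + 2 * s)) * (1 / norm z powr (real DIM('a) + 2 * s)) * central_diff m (power_profile T s) x (\<rho> *\<^sub>R z)"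
            using True \<rho> power_DIM_powr[OF \<rho>, where 'a='a] by (simp add: polar_weight_def powr_mult)
          then show ?thesis unfolding a b using \<rho> by simp
        qed (simp add: polar_weight_def)
      qed
      also have "\<dots> = norm z powr (- real DIM('a) - 2 * s) * (qf T z powr s * (difference_integral m s (power_profile (\<lambda>x::real. x) s) 0 / 2))"
        unfolding radial_integral[OF s x z, symmetric] by (rule integral_mult_right_zero)
      finally show ?thesis using True by simp
    qed (simp add: polar_weight_def)
  qed
  finally show ?thesis .
qed

corollary difference_integral_constant:
  assumes "s > 0" "s < real m" "qf T x < 1"
  shows "difference_integral m s (power_profile T s) x = difference_integral m s (power_profile T s) 0"
proof -
  have "qf T 0 < 1" using lin by (simp add: qf_def linear_0)
  then show ?thesis using difference_integral_power_profile[OF assms] difference_integral_power_profile[OF assms(1,2), of 0] by simp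
qed

end

lemma fatou_limit:
  fixes h :: "nat \<Rightarrow> 'b \<Rightarrow> real"
  assumes hi: "\<And>k. integrable M (h k)" and h0: "\<And>k x. h k x \<ge> 0" and hh: "integrable M g"
    and lim: "\<And>x. (\<lambda>k. h k x) \<longlonglongrightarrow> g x" and L: "(\<lambda>k. \<integral>x. h k x \<partial>M) \<longlonglongrightarrow> L"
  shows "(\<integral>x. g x \<partial>M) \<le> L"
proof -
  have g0: "g x \<ge> 0" for x by (rule LIMSEQ_le_const[OF lim]) (use h0 in auto)
  have L0: "L \<ge> 0" by (rule LIMSEQ_le_const[OF L]) (use h0 in \<open>auto intro!: integral_nonneg_AE\<close>)
  have [measurable]: "h k \<in> borel_measurable M" for k using hi by (rule borel_measurable_integrable)
  have "ennreal (\<integral>x. g x \<partial>M) = (\<integral>\<^sup>+x. ennreal (g x) \<partial>M)"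
    using hh g0 by (intro nn_integral_eq_integral[symmetric]) auto
  also have "\<dots> = (\<integral>\<^sup>+x. liminf (\<lambda>k. ennreal (h k x)) \<partial>M)"
    using lim by (intro nn_integral_cong lim_imp_Liminf[symmetric] tendsto_ennrealI) auto
  also have "\<dots> \<le> liminf (\<lambda>k. \<integral>\<^sup>+x. ennreal (h k x) \<partial>M)"
    by (rule nn_integral_liminf) measurable
  also have "\<dots> = liminf (\<lambda>k. ennreal (\<integral>x. h k x \<partial>M))"
    using hi h0 by (subst nn_integral_eq_integral) auto
  also have "\<dots> = ennreal L" using L by (intro lim_imp_Liminf tendsto_ennrealI) auto
  finally show ?thesis using L0 by simp
qed

text \<open>
  Pointwise convergence together with convergence of the norms suffices. Fatou's lemma applied to
  \<open>\<bar>F\<bar>\<^sup>2 / 2 + \<bar>H k\<bar>\<^sup>2 / 2 + Re (c F H k) \<ge> 0\<close> gives one inequality for each unimodular \<open>c\<close>; the four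
  values \<open>1, -1, \<i>, - \<i>\<close> of \<open>c\<close> give the equality.
\<close>

lemma L2_pairing_limit:
  fixes F G :: "'b \<Rightarrow> complex" and H :: "nat \<Rightarrow> 'b \<Rightarrow> complex"
  assumes [measurable]: "F \<in> borel_measurable M" "G \<in> borel_measurable M" "\<And>k. H k \<in> borel_measurable M"
    and F: "integrable M (\<lambda>x. (norm (F x))\<^sup>2)" and G: "integrable M (\<lambda>x. (norm (G x))\<^sup>2)" and H: "\<And>k. integrable M (\<lambda>x. (norm (H k x))\<^sup>2)"
    and lim: "\<And>x. (\<lambda>k. H k x) \<longlonglongrightarrow> G x" and nlim: "(\<lambda>k. \<integral>x. (norm (H k x))\<^sup>2 \<partial>M) \<longlonglongrightarrow> (\<integral>x. (norm (G x))\<^sup>2 \<partial>M)"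
    and K: "\<And>k. (\<integral>x. F x * H k x \<partial>M) = K"
  shows "(\<integral>x. F x * G x \<partial>M) = K"
proof -
  have FG: "integrable M (\<lambda>x. F x * G x)" and FH: "\<And>k. integrable M (\<lambda>x. F x * H k x)"
    using F G H by (auto intro: integrable_mult_L2)
  \<comment> \<open>One inequality for each direction \<open>c\<close>.\<close>
  have le: "Re (c * (\<integral>x. F x * G x \<partial>M)) \<le> Re (c * K)" if c: "norm c = 1" for c
  proof -
    let ?h = "\<lambda>k x. ((norm (F x))\<^sup>2 / 2 + (norm (H k x))\<^sup>2 / 2) + Re (c * (F x * H k x))"
    let ?g = "\<lambda>x. ((norm (F x))\<^sup>2 / 2 + (norm (G x))\<^sup>2 / 2) + Re (c * (F x * G x))"
    have iR: "integrable M (\<lambda>x. Re (c * f x))" "(\<integral>x. Re (c * f x) \<partial>M) = Re (c * (\<integral>x. f x \<partial>M))" if "integrable M f" for f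
    proof -
      have cf: "integrable M (\<lambda>x. c * f x)" using that by (rule integrable_mult_right)
      show "integrable M (\<lambda>x. Re (c * f x))" using cf by (rule integrable_Re)
      show "(\<integral>x. Re (c * f x) \<partial>M) = Re (c * (\<integral>x. f x \<partial>M))"
        unfolding integral_Re[OF cf] integral_mult_right_zero ..
    qed
    have "(\<integral>x. ?g x \<partial>M) \<le> ((\<integral>x. (norm (F x))\<^sup>2 \<partial>M) / 2 + (\<integral>x. (norm (G x))\<^sup>2 \<partial>M) / 2) + Re (c * K)"
    proof (rule fatou_limit)
      show "integrable M (?h k)" for k using F H[of k] iR(1)[OF FH[of k]] by (intro Bochner_Integration.integrable_add integrable_divide)
      show "integrable M ?g" using F G iR(1)[OF FG] by (intro Bochner_Integration.integrable_add integrable_divide)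
      show "?h k x \<ge> 0" for k x
      proof -
        have "\<bar>Re (c * (F x * H k x))\<bar> \<le> norm (c * (F x * H k x))" by (rule abs_Re_le_cmod)
        also have "\<dots> = norm (F x) * norm (H k x)" using c by (simp add: norm_mult)
        also have "2 * (norm (F x) * norm (H k x)) \<le> (norm (F x))\<^sup>2 + (norm (H k x))\<^sup>2"
          using sum_squares_bound[of "norm (F x)" "norm (H k x)"] by (simp add: mult.assoc)
        ultimately show ?thesis by linarith
      qed
      show "(\<lambda>k. ?h k x) \<longlonglongrightarrow> ?g x" for x by (intro tendsto_intros lim) auto
      have "(\<integral>x. ?h k x \<partial>M) = ((\<integral>x. (norm (F x))\<^sup>2 \<partial>M) / 2 + (\<integral>x. (norm (H k x))\<^sup>2 \<partial>M) / 2) + Re (c * K)" for k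
      proof -
        have "(\<integral>x. ?h k x \<partial>M) = (\<integral>x. (norm (F x))\<^sup>2 / 2 + (norm (H k x))\<^sup>2 / 2 \<partial>M) + (\<integral>x. Re (c * (F x * H k x)) \<partial>M)"
          using F H[of k] iR(1)[OF FH[of k]] by (intro Bochner_Integration.integral_add Bochner_Integration.integrable_add integrable_divide)
        also have "(\<integral>x. (norm (F x))\<^sup>2 / 2 + (norm (H k x))\<^sup>2 / 2 \<partial>M) = (\<integral>x. (norm (F x))\<^sup>2 / 2 \<partial>M) + (\<integral>x. (norm (H k x))\<^sup>2 / 2 \<partial>M)"
          using F H[of k] by (intro Bochner_Integration.integral_add integrable_divide)
        finally show ?thesis unfolding iR(2)[OF FH[of k]] K by simp
      qed
      then show "(\<lambda>k. \<integral>x. ?h k x \<partial>M) \<longlonglongrightarrow> ((\<integral>x. (norm (F x))\<^sup>2 \<partial>M) / 2 + (\<integral>x. (norm (G x))\<^sup>2 \<partial>M) / 2) + Re (c * K)"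
        by (simp only:) (intro tendsto_intros nlim, auto)
    qed
    moreover have "(\<integral>x. ?g x \<partial>M) = ((\<integral>x. (norm (F x))\<^sup>2 \<partial>M) / 2 + (\<integral>x. (norm (G x))\<^sup>2 \<partial>M) / 2) + Re (c * (\<integral>x. F x * G x \<partial>M))"
    proof -
      have "(\<integral>x. ?g x \<partial>M) = (\<integral>x. (norm (F x))\<^sup>2 / 2 + (norm (G x))\<^sup>2 / 2 \<partial>M) + (\<integral>x. Re (c * (F x * G x)) \<partial>M)"
        using F G iR(1)[OF FG] by (intro Bochner_Integration.integral_add Bochner_Integration.integrable_add integrable_divide)
      also have "(\<integral>x. (norm (F x))\<^sup>2 / 2 + (norm (G x))\<^sup>2 / 2 \<partial>M) = (\<integral>x. (norm (F x))\<^sup>2 / 2 \<partial>M) + (\<integral>x. (norm (G x))\<^sup>2 / 2 \<partial>M)"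
        using F G by (intro Bochner_Integration.integral_add integrable_divide)
      finally show ?thesis unfolding iR(2)[OF FG] by simp
    qed
    ultimately show ?thesis by linarith
  qed
  show ?thesis
    using le[of 1] le[of "-1"] le[of \<i>] le[of "-\<i>"] by (intro complex_eqI) simp_all
qed

text \<open>
  For \<open>\<phi>\<close> supported well inside the ellipsoid this is the energy pairing with a constant Laplacian. A general
  \<open>\<phi>\<close> is approximated by its dilates \<open>\<phi> (x / r)\<close> with \<open>r \<rightarrow> 1\<close>, whose supports are compact in the open ellipsoid. On
  the Fourier side dilation is again a dilation, which converges pointwise with convergent energies.
\<close>

theorem (in quadratic_form) weak_equation:
  fixes \<phi> :: "'a \<Rightarrow> real"
  assumes s: "s > 0" "s < real m"
    and \<phi>: "integrable lborel \<phi>" and \<phi>2: "integrable lborel (\<lambda>x. (\<phi> x)\<^sup>2)"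
    and supp: "\<And>x. qf T x \<ge> 1 \<Longrightarrow> \<phi> x = 0"
    and en: "integrable lborel (\<lambda>\<xi>. norm \<xi> powr (2 * s) * (norm (FT \<phi> \<xi>))\<^sup>2)"
  shows "has_bochner_integral lborel (\<lambda>\<xi>. of_real (norm \<xi> powr (2 * s)) * FT (power_profile T s) \<xi> * cnj (FT \<phi> \<xi>))
     (of_real (frac_const DIM('a) m s / 2 * difference_integral m s (power_profile T s) 0 * (\<integral>x. \<phi> x \<partial>lborel)))"
proof -
  let ?u = "power_profile T s"
  define n where "n = DIM('a)"
  define \<kappa> where "\<kappa> = frac_const DIM('a) m s / 2 * difference_integral m s ?u 0"
  have [measurable]: "\<phi> \<in> borel_measurable borel" using borel_measurable_integrable[OF \<phi>] by simp
  define r where "r = (\<lambda>k::nat. 1 - 1 / real (Suc (Suc k)))"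
  have r: "0 < r k" "r k < 1" for k by (auto simp: r_def)
  have rlim: "r \<longlonglongrightarrow> 1"
  proof -
    have "(\<lambda>k. 1 / real (Suc (Suc k))) \<longlonglongrightarrow> 0"
      using LIMSEQ_Suc[OF LIMSEQ_inverse_real_of_nat] by (simp add: inverse_eq_divide)
    from tendsto_diff[OF tendsto_const[of 1] this] show ?thesis by (simp add: r_def)
  qed
  define G where "G = (\<lambda>\<xi>. norm \<xi> powr (2 * s) * (norm (FT \<phi> \<xi>))\<^sup>2)"
  have Gr: "integrable lborel (\<lambda>\<xi>. norm \<xi> powr (2 * s) * (norm (FT \<phi> (r k *\<^sub>R \<xi>)))\<^sup>2)"
    "(\<integral>\<xi>. norm \<xi> powr (2 * s) * (norm (FT \<phi> (r k *\<^sub>R \<xi>)))\<^sup>2 \<partial>lborel) = (1 / (r k ^ n * r k powr (2 * s))) * (\<integral>\<xi>. G \<xi> \<partial>lborel)" for k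
  proof -
    have e: "norm \<xi> powr (2 * s) * (norm (FT \<phi> (r k *\<^sub>R \<xi>)))\<^sup>2 = (1 / r k powr (2 * s)) * G (0 + r k *\<^sub>R \<xi>)" for \<xi>
      using r(1)[of k] by (simp add: G_def powr_mult)
    have gi: "integrable lborel G" using en unfolding G_def .
    show "integrable lborel (\<lambda>\<xi>. norm \<xi> powr (2 * s) * (norm (FT \<phi> (r k *\<^sub>R \<xi>)))\<^sup>2)"
      unfolding e using r(1)[of k] by (intro integrable_mult_right integrable_lborel_affine[OF gi]) auto
    have "(\<integral>\<xi>. G \<xi> \<partial>lborel) = r k ^ n * (\<integral>\<xi>. G (0 + r k *\<^sub>R \<xi>) \<partial>lborel)"
      using lborel_integral_affine[OF gi, of "r k" 0] r(1)[of k] by (simp add: n_def)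
    then show "(\<integral>\<xi>. norm \<xi> powr (2 * s) * (norm (FT \<phi> (r k *\<^sub>R \<xi>)))\<^sup>2 \<partial>lborel) = (1 / (r k ^ n * r k powr (2 * s))) * (\<integral>\<xi>. G \<xi> \<partial>lborel)"
      unfolding e integral_mult_right_zero using r(1)[of k] by simp
  qed
  \<comment> \<open>The dilate is supported where \<open>qf T x \<le> (r k)\<^sup>2\<close>, so the energy pairing applies to it.\<close>
  have step: "(\<integral>\<xi>. of_real (norm \<xi> powr (2 * s)) * FT ?u \<xi> * cnj (FT \<phi> (r k *\<^sub>R \<xi>)) \<partial>lborel) = of_real (\<kappa> * (\<integral>x. \<phi> x \<partial>lborel))" for k
  proof -
    define \<psi> where "\<psi> = (\<lambda>x. \<phi> (0 + (1 / r k) *\<^sub>R x))"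
    have rk: "1 / r k \<noteq> 0" "r k \<noteq> 0" using r(1)[of k] by auto
    have \<psi>: "integrable lborel \<psi>" "integrable lborel (\<lambda>x. (\<psi> x)\<^sup>2)"
      unfolding \<psi>_def using integrable_lborel_affine[OF \<phi> rk(1), of 0] integrable_lborel_affine[OF \<phi>2 rk(1), of 0] by auto
    have F: "FT \<psi> \<xi> = of_real (r k ^ n) * FT \<phi> (r k *\<^sub>R \<xi>)" for \<xi>
      unfolding \<psi>_def FT_affine[OF \<phi> rk(1)] using r(1)[of k] by (simp add: n_def power_one_over)
    have "0 < 1 - (r k)\<^sup>2" "1 - (r k)\<^sup>2 \<le> 1" using r[of k] by (auto simp: abs_square_less_1)
    moreover have sp: "\<psi> x = 0" if "qf T x > 1 - (1 - (r k)\<^sup>2)" for x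
    proof -
      have "qf T ((1 / r k) *\<^sub>R x) \<ge> 1" unfolding qf_scale using that r(1)[of k] by (simp add: power_divide)
      then show ?thesis unfolding \<psi>_def by (simp add: supp)
    qed
    moreover have "integrable lborel (\<lambda>\<xi>. norm \<xi> powr (2 * s) * (norm (FT \<psi> \<xi>))\<^sup>2)"
    proof -
      have e: "norm \<xi> powr (2 * s) * (norm (FT \<psi> \<xi>))\<^sup>2 = (r k ^ n)\<^sup>2 * (norm \<xi> powr (2 * s) * (norm (FT \<phi> (r k *\<^sub>R \<xi>)))\<^sup>2)" for \<xi>
        using r(1)[of k] by (simp add: F norm_mult norm_power power_mult_distrib mult.left_commute)
      show ?thesis unfolding e by (intro integrable_mult_right Gr(1))
    qed
    ultimately have hb: "has_bochner_integral lborel (\<lambda>\<xi>. of_real (norm \<xi> powr (2 * s)) * FT ?u \<xi> * cnj (FT \<psi> \<xi>))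
      (of_real (frac_const DIM('a) m s / 2 * (\<integral>x. \<psi> x * difference_integral m s ?u x \<partial>lborel)))"
      by (intro energy_pairing[OF s _ _ \<psi>])
    have "\<psi> x * difference_integral m s ?u x = difference_integral m s ?u 0 * \<psi> x" for x
    proof (cases "qf T x < 1")
      case True
      then show ?thesis using difference_integral_constant[OF s True] by simp
    next
      case False
      have "(r k)\<^sup>2 < 1" using r[of k] by (simp add: abs_square_less_1)
      then have "\<psi> x = 0" using False by (intro sp) auto
      then show ?thesis by simp
    qed
    then have "(\<lambda>x. \<psi> x * difference_integral m s ?u x) = (\<lambda>x. difference_integral m s ?u 0 * \<psi> x)" by (rule ext)
    then have i1: "(\<integral>x. \<psi> x * difference_integral m s ?u x \<partial>lborel) = difference_integral m s ?u 0 * (\<integral>x. \<psi> x \<partial>lborel)"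
      by (simp only: integral_mult_right_zero)
    have i2: "(\<integral>x. \<psi> x \<partial>lborel) = r k ^ n * (\<integral>x. \<phi> x \<partial>lborel)"
      using lborel_integral_affine[OF \<phi> rk(1), of 0] r(1)[of k] unfolding \<psi>_def by (simp add: n_def power_one_over)
    have "of_real (r k ^ n) * (\<integral>\<xi>. of_real (norm \<xi> powr (2 * s)) * FT ?u \<xi> * cnj (FT \<phi> (r k *\<^sub>R \<xi>)) \<partial>lborel)
      = (\<integral>\<xi>. of_real (r k ^ n) * (of_real (norm \<xi> powr (2 * s)) * FT ?u \<xi> * cnj (FT \<phi> (r k *\<^sub>R \<xi>))) \<partial>lborel)"
      by (rule integral_mult_right_zero[symmetric])
    also have "\<dots> = (\<integral>\<xi>. of_real (norm \<xi> powr (2 * s)) * FT ?u \<xi> * cnj (FT \<psi> \<xi>) \<partial>lborel)"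
      unfolding F by (intro Bochner_Integration.integral_cong refl) simp
    also have "\<dots> = of_real (r k ^ n) * of_real (\<kappa> * (\<integral>x. \<phi> x \<partial>lborel))"
      using hb unfolding has_bochner_integral_iff i1 i2 \<kappa>_def of_real_mult[symmetric] by (simp only: mult_ac)
    finally show ?thesis using rk(2) by simp
  qed
  have sq: "(norm \<xi> powr s)\<^sup>2 = norm \<xi> powr (2 * s)" for \<xi> :: 'a
    by (simp add: power2_eq_square powr_add[symmetric])
  have fac: "of_real (norm \<xi> powr (2 * s)) * a * b = (of_real (norm \<xi> powr s) * a) * (of_real (norm \<xi> powr s) * b)" for \<xi> :: 'a and a b :: complex
    unfolding sq[symmetric] by (simp add: power2_eq_square mult_ac)
  have nn: "(norm (of_real (norm \<xi> powr s) * cnj z))\<^sup>2 = norm \<xi> powr (2 * s) * (norm z)\<^sup>2" for \<xi> :: 'a and z :: complex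
    by (simp add: norm_mult power_mult_distrib sq)
  have "(\<integral>\<xi>. (of_real (norm \<xi> powr s) * FT ?u \<xi>) * (of_real (norm \<xi> powr s) * cnj (FT \<phi> \<xi>)) \<partial>lborel) = of_real (\<kappa> * (\<integral>x. \<phi> x \<partial>lborel))"
  proof (rule L2_pairing_limit)
    show "integrable lborel (\<lambda>\<xi>. (norm (of_real (norm \<xi> powr s) * FT ?u \<xi>))\<^sup>2)"
      using power_profile_energy[OF s(1)] by (simp add: norm_mult power_mult_distrib sq)
    show "integrable lborel (\<lambda>\<xi>. (norm (of_real (norm \<xi> powr s) * cnj (FT \<phi> \<xi>)))\<^sup>2)"
      using en by (simp add: norm_mult power_mult_distrib sq)
    show "integrable lborel (\<lambda>\<xi>. (norm (of_real (norm \<xi> powr s) * cnj (FT \<phi> (r k *\<^sub>R \<xi>))))\<^sup>2)" for k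
      using Gr(1)[of k] by (simp add: norm_mult power_mult_distrib sq)
    show "(\<lambda>k. of_real (norm \<xi> powr s) * cnj (FT \<phi> (r k *\<^sub>R \<xi>))) \<longlonglongrightarrow> of_real (norm \<xi> powr s) * cnj (FT \<phi> \<xi>)" for \<xi>
    proof -
      have "(\<lambda>k. r k *\<^sub>R \<xi>) \<longlonglongrightarrow> 1 *\<^sub>R \<xi>" by (intro tendsto_intros rlim)
      then have "(\<lambda>k. FT \<phi> (r k *\<^sub>R \<xi>)) \<longlonglongrightarrow> FT \<phi> \<xi>"
        by (intro isCont_tendsto_compose[OF continuous_FT[OF \<phi>]]) simp
      then show ?thesis by (intro tendsto_intros)
    qed
    have "(\<lambda>k. (1 / (r k ^ n * r k powr (2 * s))) * (\<integral>\<xi>. G \<xi> \<partial>lborel)) \<longlonglongrightarrow> (1 / (1 ^ n * 1 powr (2 * s))) * (\<integral>\<xi>. G \<xi> \<partial>lborel)"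
      by (intro tendsto_intros rlim) auto
    then show "(\<lambda>k. \<integral>\<xi>. (norm (of_real (norm \<xi> powr s) * cnj (FT \<phi> (r k *\<^sub>R \<xi>))))\<^sup>2 \<partial>lborel) \<longlonglongrightarrow> (\<integral>\<xi>. (norm (of_real (norm \<xi> powr s) * cnj (FT \<phi> \<xi>)))\<^sup>2 \<partial>lborel)"
      unfolding nn Gr(2) unfolding G_def by simp
    show "(\<integral>\<xi>. (of_real (norm \<xi> powr s) * FT ?u \<xi>) * (of_real (norm \<xi> powr s) * cnj (FT \<phi> (r k *\<^sub>R \<xi>))) \<partial>lborel) = of_real (\<kappa> * (\<integral>x. \<phi> x \<partial>lborel))" for k
      using step[of k] unfolding fac .
  qed measurable
  then have "(\<integral>\<xi>. of_real (norm \<xi> powr (2 * s)) * FT ?u \<xi> * cnj (FT \<phi> \<xi>) \<partial>lborel) = of_real (\<kappa> * (\<integral>x. \<phi> x \<partial>lborel))"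
    unfolding fac[symmetric] .
  moreover have "integrable lborel (\<lambda>\<xi>. of_real (norm \<xi> powr (2 * s)) * FT ?u \<xi> * cnj (FT \<phi> \<xi>))"
    by (rule integrable_weighted_pairing[OF _ _ power_profile_energy[OF s(1)] en]) measurable
  ultimately show ?thesis unfolding \<kappa>_def by (simp only: has_bochner_integral_iff)
qed

section \<open>Sobolev functions supported in a bounded set, and conclusion\<close>

text \<open>
  A representative with the exterior condition valid everywhere and measurable in the Borel sense. A member of
  \<open>sobolev0\<close> is only Lebesgue measurable and vanishes outside the domain only almost everywhere.
\<close>

definition borel_version :: "'a::euclidean_space set \<Rightarrow> ('a \<Rightarrow> real) \<Rightarrow> ('a \<Rightarrow> real) \<Rightarrow> bool" where
  "borel_version \<Omega> \<phi> \<psi> \<longleftrightarrow> \<phi> \<in> borel_measurable lebesgue \<and> \<psi> \<in> borel_measurable borel \<and>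
     (AE x in lebesgue. \<phi> x = \<psi> x) \<and> (\<forall>x. x \<notin> \<Omega> \<longrightarrow> \<psi> x = 0) \<and>
     integrable lborel \<psi> \<and> integrable lborel (\<lambda>x. (\<psi> x)\<^sup>2)"

lemma borel_versionD:
  assumes "borel_version \<Omega> \<phi> \<psi>"
  shows "\<phi> \<in> borel_measurable lebesgue" "\<psi> \<in> borel_measurable borel" "AE x in lebesgue. \<phi> x = \<psi> x"
    "\<And>x. x \<notin> \<Omega> \<Longrightarrow> \<psi> x = 0" "integrable lborel \<psi>" "integrable lborel (\<lambda>x. (\<psi> x)\<^sup>2)"
  using assms unfolding borel_version_def by auto

lemma borel_measurable_lebesgueI:
  fixes f :: "'a::euclidean_space \<Rightarrow> 'b::topological_space"
  assumes "f \<in> borel_measurable borel"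
  shows "f \<in> borel_measurable lebesgue"
  by (rule measurable_completion) (use assms in simp)

lemma borel_version_refl:
  assumes \<psi>: "integrable lborel \<psi>" and "integrable lborel (\<lambda>x. (\<psi> x)\<^sup>2)" "\<And>x. x \<notin> \<Omega> \<Longrightarrow> \<psi> x = 0"
  shows "borel_version \<Omega> \<psi> \<psi>"
  unfolding borel_version_def using assms borel_measurable_integrable[OF \<psi>]
  by (auto intro: borel_measurable_lebesgueI)

text \<open>
  Square integrability on a bounded set implies integrability, since \<open>2 * \<bar>\<psi>\<bar> \<le> 1 + \<psi>\<^sup>2\<close>.
\<close>

lemma ex_borel_version:
  fixes \<phi> :: "'a::euclidean_space \<Rightarrow> real"
  assumes \<Omega>: "bounded \<Omega>" and \<Omega>m[measurable]: "\<Omega> \<in> sets borel" and \<phi>: "\<phi> \<in> L2" and z: "AE x in lebesgue. x \<notin> \<Omega> \<longrightarrow> \<phi> x = 0"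
  shows "\<exists>\<psi>. borel_version \<Omega> \<phi> \<psi>"
proof -
  have \<phi>m: "\<phi> \<in> borel_measurable lebesgue" and \<phi>2: "integrable lebesgue (\<lambda>x. (\<phi> x)\<^sup>2)"
    using \<phi> by (auto simp: L2_def)
  obtain g where gm: "g \<in> borel_measurable lborel" and g: "AE x in lborel. \<phi> x = g x"
    using completion_ex_borel_measurable_real[OF \<phi>m] by (elim bexE)
  have [measurable]: "g \<in> borel_measurable borel" using gm by simp
  define \<psi> where "\<psi> = (\<lambda>x. indicator \<Omega> x * g x)"
  have \<psi>m[measurable]: "\<psi> \<in> borel_measurable borel" unfolding \<psi>_def by measurable
  have out: "x \<notin> \<Omega> \<Longrightarrow> \<psi> x = 0" for x by (simp add: \<psi>_def)
  have eq: "AE x in lebesgue. \<phi> x = \<psi> x"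
    using AE_completion[OF g] z by eventually_elim (auto simp: \<psi>_def split: split_indicator)
  have sq: "integrable lebesgue (\<lambda>x. (\<psi> x)\<^sup>2)"
  proof (rule integrable_cong_AE_imp[OF \<phi>2])
    show "(\<lambda>x. (\<psi> x)\<^sup>2) \<in> borel_measurable lebesgue" by (rule borel_measurable_lebesgueI) measurable
    show "AE x in lebesgue. (\<phi> x)\<^sup>2 = (\<psi> x)\<^sup>2" using eq by eventually_elim simp
  qed
  then have sq': "integrable lborel (\<lambda>x. (\<psi> x)\<^sup>2)" by (subst (asm) integrable_completion) simp_all
  have ind: "integrable lborel (indicator \<Omega> :: 'a \<Rightarrow> real)"
    using emeasure_bounded_finite[OF \<Omega>] by (intro integrable_real_indicator) auto
  have "integrable lborel \<psi>"
  proof (rule Bochner_Integration.integrable_bound)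
    show "integrable lborel (\<lambda>x. indicator \<Omega> x + (\<psi> x)\<^sup>2)" using ind sq' by (rule Bochner_Integration.integrable_add)
    have "norm (\<psi> x) \<le> norm (indicator \<Omega> x + (\<psi> x)\<^sup>2)" for x
    proof (cases "x \<in> \<Omega>")
      case True
      have "2 * \<bar>\<psi> x\<bar> \<le> 1 + (\<psi> x)\<^sup>2" using sum_squares_bound[of 1 "\<bar>\<psi> x\<bar>"] by simp
      moreover have "0 \<le> (\<psi> x)\<^sup>2" by simp
      ultimately have "\<bar>\<psi> x\<bar> \<le> \<bar>1 + (\<psi> x)\<^sup>2\<bar>" using abs_ge_zero[of "\<psi> x"] by linarith
      then show ?thesis using True by simp
    qed (simp add: out)
    then show "AE x in lborel. norm (\<psi> x) \<le> norm (indicator \<Omega> x + (\<psi> x)\<^sup>2)" by simp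
  qed simp
  then have "borel_version \<Omega> \<phi> \<psi>" unfolding borel_version_def using \<phi>m \<psi>m eq out sq' by (intro conjI allI impI)
  then show ?thesis by (rule exI[of _ \<psi>])
qed

text \<open>
  Once the ball contains the support, the Fourier integrals over balls are all equal to \<open>FT \<psi>\<close>, so the
  defining limit forces its value almost everywhere.
\<close>

lemma fourier_L2_eq_FT:
  fixes \<phi> \<psi> :: "'a::euclidean_space \<Rightarrow> real"
  assumes \<Omega>: "bounded \<Omega>" and bv: "borel_version \<Omega> \<phi> \<psi>"
  shows "fourier_L2 \<phi> \<in> borel_measurable lebesgue" "AE \<xi> in lebesgue. fourier_L2 \<phi> \<xi> = FT \<psi> \<xi>"
proof -
  note v = borel_versionD[OF bv]
  have \<phi>m: "\<phi> \<in> borel_measurable lebesgue" by (rule v(1))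
  have [measurable]: "\<psi> \<in> borel_measurable borel" by (rule v(2))
  obtain R0 where R0: "\<Omega> \<subseteq> ball 0 R0" using bounded_subset_ballD[OF \<Omega>, of 0] by auto
  have ball: "fourier_ball R \<phi> \<xi> = FT \<psi> \<xi>" if R: "R \<ge> R0" for R \<xi>
  proof -
    have em: "(\<lambda>x::'a. exp (- \<i> * of_real (x \<bullet> \<xi>))) \<in> borel_measurable lebesgue"
      by (rule borel_measurable_lebesgueI) measurable
    have "(LINT x:ball 0 R|lebesgue. exp (- \<i> * of_real (x \<bullet> \<xi>)) * of_real (\<phi> x)) = (\<integral>x. exp (- \<i> * of_real (x \<bullet> \<xi>)) * of_real (\<psi> x) \<partial>lebesgue)"
      unfolding set_lebesgue_integral_def
    proof (rule integral_cong_AE)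
      have "(\<lambda>x. complex_of_real (\<phi> x)) \<in> borel_measurable lebesgue" using \<phi>m by measurable
      then have "(\<lambda>x. exp (- \<i> * of_real (x \<bullet> \<xi>)) * complex_of_real (\<phi> x)) \<in> borel_measurable lebesgue"
        using em by (intro borel_measurable_times)
      then show "(\<lambda>x. indicat_real (ball 0 R) x *\<^sub>R (exp (- \<i> * of_real (x \<bullet> \<xi>)) * complex_of_real (\<phi> x))) \<in> borel_measurable lebesgue"
        by (intro borel_measurable_scaleR borel_measurable_indicator) auto
      show "(\<lambda>x. exp (- \<i> * of_real (x \<bullet> \<xi>)) * complex_of_real (\<psi> x)) \<in> borel_measurable lebesgue"
        by (rule borel_measurable_lebesgueI) measurable
      show "AE x in lebesgue. indicat_real (ball 0 R) x *\<^sub>R (exp (- \<i> * of_real (x \<bullet> \<xi>)) * complex_of_real (\<phi> x)) = exp (- \<i> * of_real (x \<bullet> \<xi>)) * complex_of_real (\<psi> x)"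
        using v(3)
      proof eventually_elim
        case (elim x)
        show ?case
        proof (cases "x \<in> ball 0 R")
          case False
          then have "x \<notin> \<Omega>" using R0 R by auto
          then show ?thesis using False v(4) by simp
        qed (simp add: elim)
      qed
    qed
    also have "\<dots> = (\<integral>x. exp (- \<i> * of_real (x \<bullet> \<xi>)) * of_real (\<psi> x) \<partial>lborel)"
      by (rule integral_completion) measurable
    finally show ?thesis unfolding fourier_ball_def FT_def by (simp only:)
  qed
  have FTm[measurable]: "FT \<psi> \<in> borel_measurable lebesgue" by (rule borel_measurable_lebesgueI) measurable
  have "integrable lebesgue (\<lambda>\<xi>. (norm (FT \<psi> \<xi>))\<^sup>2)"
    using FT_bessel[OF v(5,6)] by (subst integrable_completion) simp_all
  then have FTL: "FT \<psi> \<in> L2" using FTm by (simp add: L2_def)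
  \<comment> \<open>Beyond \<open>R0\<close> the integrals in the defining limit do not depend on \<open>R\<close>.\<close>
  have const: "eventually (\<lambda>R. (\<integral>\<^sup>+ \<xi>. ennreal ((norm (fourier_ball R \<phi> \<xi> - g \<xi>))\<^sup>2) \<partial>lebesgue) = (\<integral>\<^sup>+ \<xi>. ennreal ((norm (FT \<psi> \<xi> - g \<xi>))\<^sup>2) \<partial>lebesgue)) at_top" for g
    using eventually_ge_at_top[of R0] by eventually_elim (simp only: ball)
  have "is_fourier_L2 \<phi> (FT \<psi>)"
    unfolding is_fourier_L2_def
  proof (intro conjI FTL)
    show "((\<lambda>R. \<integral>\<^sup>+ \<xi>. ennreal ((norm (fourier_ball R \<phi> \<xi> - FT \<psi> \<xi>))\<^sup>2) \<partial>lebesgue) \<longlongrightarrow> 0) at_top"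
      using const[of "FT \<psi>"] by (intro tendsto_eventually) simp
  qed
  then have isF: "is_fourier_L2 \<phi> (fourier_L2 \<phi>)" unfolding fourier_L2_def by (rule someI[of "is_fourier_L2 \<phi>" "FT \<psi>"])
  then show m: "fourier_L2 \<phi> \<in> borel_measurable lebesgue" by (simp add: is_fourier_L2_def L2_def)
  let ?c = "\<integral>\<^sup>+ \<xi>. ennreal ((norm (FT \<psi> \<xi> - fourier_L2 \<phi> \<xi>))\<^sup>2) \<partial>lebesgue"
  have "((\<lambda>R. \<integral>\<^sup>+ \<xi>. ennreal ((norm (fourier_ball R \<phi> \<xi> - fourier_L2 \<phi> \<xi>))\<^sup>2) \<partial>lebesgue) \<longlongrightarrow> 0) at_top"
    using isF by (simp add: is_fourier_L2_def)
  then have "((\<lambda>R::real. ?c) \<longlongrightarrow> 0) at_top"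
    by (rule Lim_transform_eventually[OF _ const])
  then have "?c = 0" by (simp add: tendsto_const_iff)
  moreover have "(\<lambda>\<xi>. ennreal ((norm (FT \<psi> \<xi> - fourier_L2 \<phi> \<xi>))\<^sup>2)) \<in> borel_measurable lebesgue"
    using m by measurable
  ultimately have "AE \<xi> in lebesgue. ennreal ((norm (FT \<psi> \<xi> - fourier_L2 \<phi> \<xi>))\<^sup>2) = 0"
    by (simp only: nn_integral_0_iff_AE)
  then show "AE \<xi> in lebesgue. fourier_L2 \<phi> \<xi> = FT \<psi> \<xi>"
    by eventually_elim (simp add: ennreal_eq_0_iff)
qed

text \<open>
  The inhomogeneous weight of \<open>sobolev\<close> is controlled by the square integrability and the energy.
\<close>

lemma bessel_weight_le:
  fixes t s :: real
  assumes "s > 0" "t \<ge> 0"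
  shows "(1 + t\<^sup>2) powr s \<le> 2 powr s * (1 + t powr (2 * s))"
proof (cases "t \<le> 1")
  case True
  then have "t\<^sup>2 \<le> 1" using assms by (simp add: power_le_one)
  then have "(1 + t\<^sup>2) powr s \<le> 2 powr s" using assms by (intro powr_mono2) auto
  also have "\<dots> \<le> 2 powr s * (1 + t powr (2 * s))" by (simp add: distrib_left)
  finally show ?thesis .
next
  case False
  then have "1 \<le> t\<^sup>2" by (simp add: one_le_power)
  then have "(1 + t\<^sup>2) powr s \<le> (2 * t\<^sup>2) powr s" using assms by (intro powr_mono2) auto
  also have "\<dots> = 2 powr s * (t\<^sup>2) powr s" by (simp add: powr_mult)
  also have "(t\<^sup>2) powr s = t powr (2 * s)"
  proof -
    have "t powr (2 * s) = (t powr 2) powr s" by (simp only: powr_powr)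
    then show ?thesis using assms by simp
  qed
  also have "2 powr s * t powr (2 * s) \<le> 2 powr s * (1 + t powr (2 * s))" by simp
  finally show ?thesis .
qed

lemma sobolev0_borel_version:
  fixes \<phi> :: "'a::euclidean_space \<Rightarrow> real"
  assumes \<Omega>: "bounded \<Omega>" "\<Omega> \<in> sets borel" and s: "s > 0" and \<phi>: "\<phi> \<in> sobolev0 s \<Omega>"
  shows "\<exists>\<psi>. borel_version \<Omega> \<phi> \<psi> \<and> integrable lborel (\<lambda>\<xi>. norm \<xi> powr (2 * s) * (norm (FT \<psi> \<xi>))\<^sup>2)"
proof -
  have L: "\<phi> \<in> L2" and en: "integrable lebesgue (\<lambda>\<xi>. (1 + (norm \<xi>)\<^sup>2) powr s * (norm (fourier_L2 \<phi> \<xi>))\<^sup>2)"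
    and z: "AE x in lebesgue. x \<notin> \<Omega> \<longrightarrow> \<phi> x = 0"
    using \<phi> by (auto simp: sobolev0_def sobolev_def)
  obtain \<psi> where bv: "borel_version \<Omega> \<phi> \<psi>" using ex_borel_version[OF \<Omega> L z] by (elim exE)
  note v = borel_versionD[OF bv]
  have [measurable]: "\<psi> \<in> borel_measurable borel" by (rule v(2))
  have "integrable lebesgue (\<lambda>\<xi>. (1 + (norm \<xi>)\<^sup>2) powr s * (norm (FT \<psi> \<xi>))\<^sup>2)"
  proof (rule integrable_cong_AE_imp[OF en])
    show "(\<lambda>\<xi>. (1 + (norm \<xi>)\<^sup>2) powr s * (norm (FT \<psi> \<xi>))\<^sup>2) \<in> borel_measurable lebesgue"
      by (rule borel_measurable_lebesgueI) measurable
    show "AE \<xi> in lebesgue. (1 + (norm \<xi>)\<^sup>2) powr s * (norm (fourier_L2 \<phi> \<xi>))\<^sup>2 = (1 + (norm \<xi>)\<^sup>2) powr s * (norm (FT \<psi> \<xi>))\<^sup>2"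
      using fourier_L2_eq_FT(2)[OF \<Omega>(1) bv] by eventually_elim simp
  qed
  then have i: "integrable lborel (\<lambda>\<xi>. (1 + (norm \<xi>)\<^sup>2) powr s * (norm (FT \<psi> \<xi>))\<^sup>2)"
    by (subst (asm) integrable_completion) measurable
  have "integrable lborel (\<lambda>\<xi>. norm \<xi> powr (2 * s) * (norm (FT \<psi> \<xi>))\<^sup>2)"
  proof (rule Bochner_Integration.integrable_bound[OF i])
    have "norm \<xi> powr (2 * s) \<le> (1 + (norm \<xi>)\<^sup>2) powr s" for \<xi> :: 'a
    proof -
      have "norm \<xi> powr (2 * s) = (norm \<xi> powr 2) powr s" by (simp only: powr_powr)
      also have "\<dots> = ((norm \<xi>)\<^sup>2) powr s" by simp
      also have "\<dots> \<le> (1 + (norm \<xi>)\<^sup>2) powr s" using s by (intro powr_mono2) auto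
      finally show ?thesis .
    qed
    then show "AE \<xi> in lborel. norm (norm \<xi> powr (2 * s) * (norm (FT \<psi> \<xi>))\<^sup>2) \<le> norm ((1 + (norm \<xi>)\<^sup>2) powr s * (norm (FT \<psi> \<xi>))\<^sup>2)"
      by (intro AE_I2) (simp add: abs_mult mult_right_mono)
  qed measurable
  then show ?thesis by (intro exI[of _ \<psi>] conjI bv)
qed

lemma sobolev0I:
  fixes \<psi> :: "'a::euclidean_space \<Rightarrow> real"
  assumes \<Omega>: "bounded \<Omega>" and s: "s > 0" and bv: "borel_version \<Omega> \<psi> \<psi>"
    and en: "integrable lborel (\<lambda>\<xi>. norm \<xi> powr (2 * s) * (norm (FT \<psi> \<xi>))\<^sup>2)"
  shows "\<psi> \<in> sobolev0 s \<Omega>"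
proof -
  note v = borel_versionD[OF bv]
  have [measurable]: "\<psi> \<in> borel_measurable borel" by (rule v(2))
  have "integrable lebesgue (\<lambda>x. (\<psi> x)\<^sup>2)" using v(6) by (subst integrable_completion) simp_all
  then have L: "\<psi> \<in> L2" using v(1) by (simp add: L2_def)
  have i: "integrable lborel (\<lambda>\<xi>. 2 powr s * ((norm (FT \<psi> \<xi>))\<^sup>2 + norm \<xi> powr (2 * s) * (norm (FT \<psi> \<xi>))\<^sup>2))"
    by (intro integrable_mult_right Bochner_Integration.integrable_add en FT_bessel[OF v(5,6)])
  have "integrable lborel (\<lambda>\<xi>. (1 + (norm \<xi>)\<^sup>2) powr s * (norm (FT \<psi> \<xi>))\<^sup>2)"
  proof (rule Bochner_Integration.integrable_bound[OF i])
    have "(1 + (norm \<xi>)\<^sup>2) powr s * (norm (FT \<psi> \<xi>))\<^sup>2 \<le> 2 powr s * ((norm (FT \<psi> \<xi>))\<^sup>2 + norm \<xi> powr (2 * s) * (norm (FT \<psi> \<xi>))\<^sup>2)" for \<xi>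
      using mult_right_mono[OF bessel_weight_le[OF s norm_ge_zero[of \<xi>]], of "(norm (FT \<psi> \<xi>))\<^sup>2"] by (simp add: algebra_simps)
    then show "AE \<xi> in lborel. norm ((1 + (norm \<xi>)\<^sup>2) powr s * (norm (FT \<psi> \<xi>))\<^sup>2) \<le> norm (2 powr s * ((norm (FT \<psi> \<xi>))\<^sup>2 + norm \<xi> powr (2 * s) * (norm (FT \<psi> \<xi>))\<^sup>2))"
      by (intro AE_I2) (simp add: abs_mult)
  qed measurable
  then have "integrable lebesgue (\<lambda>\<xi>. (1 + (norm \<xi>)\<^sup>2) powr s * (norm (FT \<psi> \<xi>))\<^sup>2)"
    by (subst integrable_completion) measurable
  then have "integrable lebesgue (\<lambda>\<xi>. (1 + (norm \<xi>)\<^sup>2) powr s * (norm (fourier_L2 \<psi> \<xi>))\<^sup>2)"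
  proof (rule integrable_cong_AE_imp)
    have "(\<lambda>\<xi>::'a. (1 + (norm \<xi>)\<^sup>2) powr s) \<in> borel_measurable lebesgue"
      by (rule borel_measurable_lebesgueI) measurable
    then show "(\<lambda>\<xi>. (1 + (norm \<xi>)\<^sup>2) powr s * (norm (fourier_L2 \<psi> \<xi>))\<^sup>2) \<in> borel_measurable lebesgue"
      using fourier_L2_eq_FT(1)[OF \<Omega> bv] by measurable
    show "AE \<xi> in lebesgue. (1 + (norm \<xi>)\<^sup>2) powr s * (norm (FT \<psi> \<xi>))\<^sup>2 = (1 + (norm \<xi>)\<^sup>2) powr s * (norm (fourier_L2 \<psi> \<xi>))\<^sup>2"
      using fourier_L2_eq_FT(2)[OF \<Omega> bv] by eventually_elim simp
  qed
  then show ?thesis using L v(4) by (simp add: sobolev0_def sobolev_def)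
qed

lemma weak_form_borel_version:
  fixes u u' \<phi> \<psi> :: "'a::euclidean_space \<Rightarrow> real"
  assumes \<Omega>: "bounded \<Omega>" and u: "borel_version \<Omega> u u'" and \<phi>: "borel_version \<Omega> \<phi> \<psi>"
  shows "has_bochner_integral lebesgue (\<lambda>\<xi>. of_real (norm \<xi> powr (2 * s)) * fourier_L2 u \<xi> * cnj (fourier_L2 \<phi> \<xi>)) I \<longleftrightarrow>
    has_bochner_integral lborel (\<lambda>\<xi>. of_real (norm \<xi> powr (2 * s)) * FT u' \<xi> * cnj (FT \<psi> \<xi>)) I"
proof -
  have [measurable]: "u' \<in> borel_measurable borel" "\<psi> \<in> borel_measurable borel"
    using borel_versionD(2)[OF u] borel_versionD(2)[OF \<phi>] by auto
  note Fu = fourier_L2_eq_FT[OF \<Omega> u] and F\<phi> = fourier_L2_eq_FT[OF \<Omega> \<phi>]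
  have m: "(\<lambda>\<xi>. of_real (norm \<xi> powr (2 * s)) * FT u' \<xi> * cnj (FT \<psi> \<xi>)) \<in> borel_measurable borel" by measurable
  have "has_bochner_integral lebesgue (\<lambda>\<xi>. of_real (norm \<xi> powr (2 * s)) * fourier_L2 u \<xi> * cnj (fourier_L2 \<phi> \<xi>)) I \<longleftrightarrow>
    has_bochner_integral lebesgue (\<lambda>\<xi>. of_real (norm \<xi> powr (2 * s)) * FT u' \<xi> * cnj (FT \<psi> \<xi>)) I"
  proof (rule has_bochner_integral_cong_AE)
    have "(\<lambda>\<xi>::'a. complex_of_real (norm \<xi> powr (2 * s))) \<in> borel_measurable lebesgue"
      by (rule borel_measurable_lebesgueI) measurable
    moreover have "(\<lambda>\<xi>. cnj (fourier_L2 \<phi> \<xi>)) \<in> borel_measurable lebesgue" using F\<phi>(1) by measurable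
    ultimately show "(\<lambda>\<xi>. of_real (norm \<xi> powr (2 * s)) * fourier_L2 u \<xi> * cnj (fourier_L2 \<phi> \<xi>)) \<in> borel_measurable lebesgue"
      using Fu(1) by (intro borel_measurable_times)
    show "(\<lambda>\<xi>. of_real (norm \<xi> powr (2 * s)) * FT u' \<xi> * cnj (FT \<psi> \<xi>)) \<in> borel_measurable lebesgue"
      using m by (rule borel_measurable_lebesgueI)
    show "AE \<xi> in lebesgue. of_real (norm \<xi> powr (2 * s)) * fourier_L2 u \<xi> * cnj (fourier_L2 \<phi> \<xi>) = of_real (norm \<xi> powr (2 * s)) * FT u' \<xi> * cnj (FT \<psi> \<xi>)"
      using Fu(2) F\<phi>(2) by eventually_elim simp
  qed
  then show ?thesis unfolding has_bochner_integral_lebesgue_iff[OF m] .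
qed

lemma constant_load_borel_version:
  fixes \<phi> \<psi> :: "'a::euclidean_space \<Rightarrow> real"
  assumes [measurable]: "\<Omega> \<in> sets borel" and bv: "borel_version \<Omega> \<phi> \<psi>"
  shows "set_integrable lebesgue \<Omega> (\<lambda>x. \<kappa> * \<phi> x)" "(LINT x:\<Omega>|lebesgue. \<kappa> * \<phi> x) = \<kappa> * (\<integral>x. \<psi> x \<partial>lborel)"
proof -
  note v = borel_versionD[OF bv]
  have \<psi>m[measurable]: "\<psi> \<in> borel_measurable borel" by (rule v(2))
  have hb: "has_bochner_integral lebesgue (\<lambda>x. \<kappa> * \<psi> x) (\<kappa> * (\<integral>x. \<psi> x \<partial>lborel))"
    using v(5) by (subst has_bochner_integral_lebesgue_iff) (auto simp: has_bochner_integral_iff)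
  have "has_bochner_integral lebesgue (\<lambda>x. indicator \<Omega> x *\<^sub>R (\<kappa> * \<phi> x)) (\<kappa> * (\<integral>x. \<psi> x \<partial>lborel)) \<longleftrightarrow> has_bochner_integral lebesgue (\<lambda>x. \<kappa> * \<psi> x) (\<kappa> * (\<integral>x. \<psi> x \<partial>lborel))"
  proof (rule has_bochner_integral_cong_AE)
    show "(\<lambda>x. indicat_real \<Omega> x *\<^sub>R (\<kappa> * \<phi> x)) \<in> borel_measurable lebesgue"
      using v(1) by (intro borel_measurable_scaleR borel_measurable_indicator borel_measurable_times) auto
    show "(\<lambda>x. \<kappa> * \<psi> x) \<in> borel_measurable lebesgue" by (rule borel_measurable_lebesgueI) measurable
    show "AE x in lebesgue. indicat_real \<Omega> x *\<^sub>R (\<kappa> * \<phi> x) = \<kappa> * \<psi> x"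
      using v(3) by eventually_elim (auto simp: v(4) split: split_indicator)
  qed
  with hb have hb2: "has_bochner_integral lebesgue (\<lambda>x. indicator \<Omega> x *\<^sub>R (\<kappa> * \<phi> x)) (\<kappa> * (\<integral>x. \<psi> x \<partial>lborel))" by (simp only:)
  from hb2 show "set_integrable lebesgue \<Omega> (\<lambda>x. \<kappa> * \<phi> x)"
    unfolding set_integrable_def has_bochner_integral_iff by (rule conjunct1)
  from hb2 show "(LINT x:\<Omega>|lebesgue. \<kappa> * \<phi> x) = \<kappa> * (\<integral>x. \<psi> x \<partial>lborel)"
    unfolding set_lebesgue_integral_def has_bochner_integral_iff by (rule conjunct2)
qed

text \<open>
  The weight vanishes at the origin only, so the transform is zero almost everywhere.
\<close>

lemma zero_energy:
  fixes \<psi> :: "'a::euclidean_space \<Rightarrow> real"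
  assumes \<psi>: "integrable lborel \<psi>" and \<psi>2: "integrable lborel (\<lambda>x. (\<psi> x)\<^sup>2)"
    and hb: "has_bochner_integral lborel (\<lambda>\<xi>. of_real (norm \<xi> powr (2 * s)) * FT \<psi> \<xi> * cnj (FT \<psi> \<xi>)) 0"
  shows "AE x in lborel. \<psi> x = 0"
proof -
  have c: "of_real (norm \<xi> powr (2 * s)) * FT \<psi> \<xi> * cnj (FT \<psi> \<xi>) = complex_of_real (norm \<xi> powr (2 * s) * (norm (FT \<psi> \<xi>))\<^sup>2)" for \<xi>
    by (simp only: mult.assoc complex_norm_square[symmetric] of_real_mult of_real_power)
  have hb': "has_bochner_integral lborel (\<lambda>\<xi>. norm \<xi> powr (2 * s) * (norm (FT \<psi> \<xi>))\<^sup>2) 0"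
    using has_bochner_integral_Re[OF hb[unfolded c]] by simp
  then have "integrable lborel (\<lambda>\<xi>. norm \<xi> powr (2 * s) * (norm (FT \<psi> \<xi>))\<^sup>2)"
    and "(\<integral>\<xi>. norm \<xi> powr (2 * s) * (norm (FT \<psi> \<xi>))\<^sup>2 \<partial>lborel) = 0"
    by (simp_all only: has_bochner_integral_iff)
  then have "AE \<xi> in lborel. norm \<xi> powr (2 * s) * (norm (FT \<psi> \<xi>))\<^sup>2 = 0"
    by (subst (asm) integral_nonneg_eq_0_iff_AE) simp_all
  then have "AE \<xi> in lborel. FT \<psi> \<xi> = 0"
    using AE_lborel_singleton[of "0::'a"] by eventually_elim auto
  then show ?thesis by (rule FT_injective[OF \<psi> \<psi>2])
qed

text \<open>
  Test the difference of the two equations with the difference of the solutions, which is itself admissible.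
\<close>

theorem weak_solution_unique:
  fixes u v :: "'a::euclidean_space \<Rightarrow> real"
  assumes \<Omega>: "bounded \<Omega>" "\<Omega> \<in> sets borel" and s: "s > 0"
    and u: "weak_solution s \<Omega> f u" and v: "weak_solution s \<Omega> f v"
  shows "AE x in lebesgue. v x = u x"
proof -
  obtain u' where u': "borel_version \<Omega> u u'" and eu: "integrable lborel (\<lambda>\<xi>. norm \<xi> powr (2 * s) * (norm (FT u' \<xi>))\<^sup>2)"
    using sobolev0_borel_version[OF \<Omega> s, of u] u by (auto simp: weak_solution_def)
  obtain v' where v': "borel_version \<Omega> v v'" and ev: "integrable lborel (\<lambda>\<xi>. norm \<xi> powr (2 * s) * (norm (FT v' \<xi>))\<^sup>2)"
    using sobolev0_borel_version[OF \<Omega> s, of v] v by (auto simp: weak_solution_def)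
  note U = borel_versionD[OF u'] and V = borel_versionD[OF v']
  have [measurable]: "u' \<in> borel_measurable borel" "v' \<in> borel_measurable borel" by (rule U(2) V(2))+
  define w where "w = (\<lambda>x. v' x - u' x)"
  have Fw: "FT w \<xi> = FT v' \<xi> - FT u' \<xi>" for \<xi> unfolding w_def by (rule FT_diff[OF V(5) U(5)])
  have sqle: "(norm (a - b))\<^sup>2 \<le> 2 * (norm a)\<^sup>2 + 2 * (norm b)\<^sup>2" for a b :: "'c::real_normed_vector"
  proof -
    have "(norm (a - b))\<^sup>2 \<le> (norm a + norm b)\<^sup>2" by (intro power_mono norm_triangle_ineq4) auto
    then show ?thesis using sum_squares_bound[of "norm a" "norm b"] by (simp add: power2_sum)
  qed
  have w1: "integrable lborel w" unfolding w_def by (intro Bochner_Integration.integrable_diff U(5) V(5))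
  have w2: "integrable lborel (\<lambda>x. (w x)\<^sup>2)"
  proof (rule Bochner_Integration.integrable_bound)
    show "integrable lborel (\<lambda>x. 2 * (v' x)\<^sup>2 + 2 * (u' x)\<^sup>2)"
      by (intro Bochner_Integration.integrable_add integrable_mult_right U(6) V(6))
    show "AE x in lborel. norm ((w x)\<^sup>2) \<le> norm (2 * (v' x)\<^sup>2 + 2 * (u' x)\<^sup>2)"
      using sqle[of "v' _" "u' _"] by (intro AE_I2) (simp add: w_def)
  qed (simp add: w_def)
  have ew: "integrable lborel (\<lambda>\<xi>. norm \<xi> powr (2 * s) * (norm (FT w \<xi>))\<^sup>2)"
  proof (rule Bochner_Integration.integrable_bound)
    show "integrable lborel (\<lambda>\<xi>. 2 * (norm \<xi> powr (2 * s) * (norm (FT v' \<xi>))\<^sup>2) + 2 * (norm \<xi> powr (2 * s) * (norm (FT u' \<xi>))\<^sup>2))"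
      by (intro Bochner_Integration.integrable_add integrable_mult_right eu ev)
    have "norm \<xi> powr (2 * s) * (norm (FT w \<xi>))\<^sup>2 \<le> 2 * (norm \<xi> powr (2 * s) * (norm (FT v' \<xi>))\<^sup>2) + 2 * (norm \<xi> powr (2 * s) * (norm (FT u' \<xi>))\<^sup>2)" for \<xi>
      using mult_left_mono[OF sqle[of "FT v' \<xi>" "FT u' \<xi>"] powr_ge_zero[of "norm \<xi>" "2 * s"]] unfolding Fw by (simp add: algebra_simps)
    then show "AE \<xi> in lborel. norm (norm \<xi> powr (2 * s) * (norm (FT w \<xi>))\<^sup>2) \<le> norm (2 * (norm \<xi> powr (2 * s) * (norm (FT v' \<xi>))\<^sup>2) + 2 * (norm \<xi> powr (2 * s) * (norm (FT u' \<xi>))\<^sup>2))"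
      by (intro AE_I2) (simp add: abs_mult)
  qed (simp add: w_def)
  have bw: "borel_version \<Omega> w w"
    by (rule borel_version_refl[OF w1 w2]) (simp add: w_def U(4) V(4))
  have wS: "w \<in> sobolev0 s \<Omega>" by (rule sobolev0I[OF \<Omega>(1) s bw ew])
  define I where "I = complex_of_real (LINT x:\<Omega>|lebesgue. f x * w x)"
  have "has_bochner_integral lborel (\<lambda>\<xi>. of_real (norm \<xi> powr (2 * s)) * FT v' \<xi> * cnj (FT w \<xi>)) I"
    unfolding weak_form_borel_version[OF \<Omega>(1) v' bw, symmetric] I_def using v wS by (simp add: weak_solution_def)
  moreover have "has_bochner_integral lborel (\<lambda>\<xi>. of_real (norm \<xi> powr (2 * s)) * FT u' \<xi> * cnj (FT w \<xi>)) I"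
    unfolding weak_form_borel_version[OF \<Omega>(1) u' bw, symmetric] I_def using u wS by (simp add: weak_solution_def)
  ultimately have "has_bochner_integral lborel (\<lambda>\<xi>. of_real (norm \<xi> powr (2 * s)) * FT v' \<xi> * cnj (FT w \<xi>) - of_real (norm \<xi> powr (2 * s)) * FT u' \<xi> * cnj (FT w \<xi>)) (I - I)"
    by (rule has_bochner_integral_diff)
  moreover have "of_real (norm \<xi> powr (2 * s)) * FT v' \<xi> * cnj (FT w \<xi>) - of_real (norm \<xi> powr (2 * s)) * FT u' \<xi> * cnj (FT w \<xi>) = of_real (norm \<xi> powr (2 * s)) * FT w \<xi> * cnj (FT w \<xi>)" for \<xi>
    unfolding Fw by (simp add: algebra_simps)
  ultimately have "has_bochner_integral lborel (\<lambda>\<xi>. of_real (norm \<xi> powr (2 * s)) * FT w \<xi> * cnj (FT w \<xi>)) 0"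
    by (simp only: diff_self)
  then have "AE x in lborel. w x = 0" by (rule zero_energy[OF w1 w2])
  from AE_completion[OF this] V(3) U(3) show ?thesis by eventually_elim (simp add: w_def)
qed

context quadratic_form begin

lemma sublevel_domain: "bounded {x. qf T x < 1}" "{x. qf T x < 1} \<in> sets borel"
proof -
  show "bounded {x. qf T x < 1}" by (rule bounded_subset[OF bounded_sublevel]) auto
  show "{x. qf T x < 1} \<in> sets borel" by measurable
qed

lemma power_profile_borel_version: "s > 0 \<Longrightarrow> borel_version {x. qf T x < 1} (power_profile T s) (power_profile T s)"
  by (rule borel_version_refl) (auto simp: power_profile_integrable intro: power_profile_outside)

text \<open>
  Testing the weak equation with the profile itself expresses the constant as energy divided by \<open>\<integral> u\<close>. The
  quotient is independent of the order \<open>m\<close> of the difference, and the energy is positive.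
\<close>

lemma torsion_constant_pos:
  assumes s: "s > 0" "s < real m"
  shows "frac_const DIM('a) m s / 2 * difference_integral m s (power_profile T s) 0 > 0"
    and "frac_const DIM('a) m s / 2 * difference_integral m s (power_profile T s) 0 = Re (\<integral>\<xi>. of_real (norm \<xi> powr (2 * s)) * FT (power_profile T s) \<xi> * cnj (FT (power_profile T s) \<xi>) \<partial>lborel) / (\<integral>x. power_profile T s x \<partial>lborel)"
proof -
  define \<kappa> where "\<kappa> = frac_const DIM('a) m s / 2 * difference_integral m s (power_profile T s) 0"
  define J where "J = (\<integral>x. power_profile T s x \<partial>lborel)"
  have J: "J > 0" unfolding J_def by (rule power_profile_integral_pos[OF s(1)])
  have hb: "has_bochner_integral lborel (\<lambda>\<xi>. of_real (norm \<xi> powr (2 * s)) * FT (power_profile T s) \<xi> * cnj (FT (power_profile T s) \<xi>)) (of_real (\<kappa> * J))"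
    unfolding \<kappa>_def J_def by (rule weak_equation[OF s power_profile_integrable[OF s(1)] power_profile_outside power_profile_energy[OF s(1)]])
  have eq: "Re (\<integral>\<xi>. of_real (norm \<xi> powr (2 * s)) * FT (power_profile T s) \<xi> * cnj (FT (power_profile T s) \<xi>) \<partial>lborel) = \<kappa> * J"
    using hb unfolding has_bochner_integral_iff by (simp only: Re_complex_of_real)
  have ge: "\<kappa> * J \<ge> 0"
  proof -
    have c: "of_real (norm \<xi> powr (2 * s)) * FT (power_profile T s) \<xi> * cnj (FT (power_profile T s) \<xi>) = complex_of_real (norm \<xi> powr (2 * s) * (norm (FT (power_profile T s) \<xi>))\<^sup>2)" for \<xi>
      by (simp only: mult.assoc complex_norm_square[symmetric] of_real_mult of_real_power)
    show ?thesis unfolding eq[symmetric] c integral_complex_of_real Re_complex_of_real by (rule integral_nonneg_AE) simp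
  qed
  have "\<kappa> \<noteq> 0"
  proof
    assume "\<kappa> = 0"
    then have "AE x in lborel. power_profile T s x = 0"
      using hb by (intro zero_energy[OF power_profile_integrable[OF s(1)]]) simp_all
    then have "J = 0" unfolding J_def by (rule integral_eq_zero_AE)
    then show False using J by simp
  qed
  then show "frac_const DIM('a) m s / 2 * difference_integral m s (power_profile T s) 0 > 0"
    using ge J unfolding \<kappa>_def[symmetric] by (simp add: zero_le_mult_iff)
  show "frac_const DIM('a) m s / 2 * difference_integral m s (power_profile T s) 0 = Re (\<integral>\<xi>. of_real (norm \<xi> powr (2 * s)) * FT (power_profile T s) \<xi> * cnj (FT (power_profile T s) \<xi>) \<partial>lborel) / (\<integral>x. power_profile T s x \<partial>lborel)"
    unfolding eq \<kappa>_def[symmetric] J_def[symmetric] using J by simp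
qed

theorem torsion_function:
  assumes s: "s > 0"
  shows "\<exists>\<kappa>>0. (\<forall>x. qf T x < 1 \<longrightarrow> has_frac_laplacian s (power_profile T s) x \<kappa>) \<and>
    weak_solution s {x. qf T x < 1} (\<lambda>_. \<kappa>) (power_profile T s)"
proof -
  let ?u = "power_profile T s" and ?E = "{x. qf T x < 1}"
  define \<kappa> where "\<kappa> = Re (\<integral>\<xi>. of_real (norm \<xi> powr (2 * s)) * FT ?u \<xi> * cnj (FT ?u \<xi>) \<partial>lborel) / (\<integral>x. ?u x \<partial>lborel)"
  have \<kappa>: "frac_const DIM('a) m s / 2 * difference_integral m s ?u 0 = \<kappa>" if "s < real m" for m
    unfolding \<kappa>_def by (rule torsion_constant_pos(2)[OF s that])
  obtain m where m: "s < real m" using reals_Archimedean2 by auto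
  have pos: "\<kappa> > 0" using torsion_constant_pos(1)[OF s m] unfolding \<kappa>[OF m] .
  have "has_frac_laplacian s ?u x \<kappa>" if x: "qf T x < 1" for x
    unfolding has_frac_laplacian_def
  proof (intro allI impI)
    fix k assume k: "s < real k"
    have i: "integrable lborel (frac_laplacian_integrand k s ?u x)"
      unfolding frac_laplacian_integrand_def by (rule integrable_integrand[OF s k x])
    then have m: "frac_laplacian_integrand k s ?u x \<in> borel_measurable lborel" by (rule borel_measurable_integrable)
    have "(\<integral>y. frac_laplacian_integrand k s ?u x y \<partial>lebesgue) = difference_integral k s ?u x"
      unfolding integral_completion[OF m] unfolding frac_laplacian_integrand_def difference_integral_def ..
    then have "frac_laplacian k s ?u x = \<kappa>"
      unfolding frac_laplacian_def \<kappa>[OF k, symmetric] difference_integral_constant[OF s k x] by (simp only:)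
    then show "integrable lebesgue (frac_laplacian_integrand k s ?u x) \<and> frac_laplacian k s ?u x = \<kappa>"
      using i by (simp add: integrable_completion[OF m])
  qed
  moreover have "weak_solution s ?E (\<lambda>_. \<kappa>) ?u"
    unfolding weak_solution_def
  proof (intro conjI ballI)
    show "?u \<in> sobolev0 s ?E"
      by (rule sobolev0I[OF sublevel_domain(1) s power_profile_borel_version[OF s] power_profile_energy[OF s]])
    fix \<phi> assume \<phi>: "\<phi> \<in> sobolev0 s ?E"
    obtain \<psi> where \<psi>: "borel_version ?E \<phi> \<psi>" and en: "integrable lborel (\<lambda>\<xi>. norm \<xi> powr (2 * s) * (norm (FT \<psi> \<xi>))\<^sup>2)"
      using sobolev0_borel_version[OF sublevel_domain s \<phi>] by (elim exE conjE)
    note v = borel_versionD[OF \<psi>]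
    show "set_integrable lebesgue ?E (\<lambda>x. \<kappa> * \<phi> x)" by (rule constant_load_borel_version(1)[OF sublevel_domain(2) \<psi>])
    have "has_bochner_integral lborel (\<lambda>\<xi>. of_real (norm \<xi> powr (2 * s)) * FT ?u \<xi> * cnj (FT \<psi> \<xi>)) (of_real (\<kappa> * (\<integral>x. \<psi> x \<partial>lborel)))"
      unfolding \<kappa>[OF m, symmetric] by (rule weak_equation[OF s m v(5,6) _ en]) (auto intro: v(4))
    then show "has_bochner_integral lebesgue (\<lambda>\<xi>. of_real (norm \<xi> powr (2 * s)) * fourier_L2 ?u \<xi> * cnj (fourier_L2 \<phi> \<xi>)) (complex_of_real (LINT x:?E|lebesgue. \<kappa> * \<phi> x))"
      unfolding constant_load_borel_version(2)[OF sublevel_domain(2) \<psi>] weak_form_borel_version[OF sublevel_domain(1) power_profile_borel_version[OF s] \<psi>] .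
  qed
  ultimately show ?thesis using pos by (intro exI[of _ \<kappa>] conjI allI impI)
qed

end

theorem theorem1p1:
  fixes A :: "real^'n^'n" and s :: real
  assumes "CARD('n) \<ge> 2"
    and "s > 0"
    and "symmetric_posdef A"
  shows "\<exists>\<kappa>>0.
    (\<forall>x \<in> ellipsoid A. has_frac_laplacian s (ellipsoid_fun s A) x \<kappa>) \<and>
    weak_solution s (ellipsoid A) (\<lambda>_. \<kappa>) (ellipsoid_fun s A) \<and>
    (\<forall>v. weak_solution s (ellipsoid A) (\<lambda>_. \<kappa>) v \<longrightarrow>
       (AE x in lebesgue. v x = ellipsoid_fun s A x))"
proof -
  interpret quadratic_form "\<lambda>x. A *v x"
  proof (rule quadratic_form.intro)
    show "linear ((*v) A)" by (rule matrix_vector_mul_linear)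
    have "transpose A = A" using assms(3) by (simp add: symmetric_posdef_def)
    then show "(A *v x) \<bullet> y = x \<bullet> (A *v y)" for x y
      using dot_lmul_matrix[of x A y] by (simp add: transpose_matrix_vector[symmetric])
    show "x \<noteq> 0 \<Longrightarrow> (A *v x) \<bullet> x > 0" for x using assms(3) by (simp add: symmetric_posdef_def)
  qed
  have E: "ellipsoid A = {x. qf (\<lambda>x. A *v x) x < 1}" by (simp add: ellipsoid_def qf_def)
  have u: "ellipsoid_fun s A = power_profile (\<lambda>x. A *v x) s" by (simp add: fun_eq_iff ellipsoid_fun_def power_profile_def qf_def)
  obtain \<kappa> where \<kappa>: "\<kappa> > 0" "\<forall>x. qf (\<lambda>x. A *v x) x < 1 \<longrightarrow> has_frac_laplacian s (power_profile (\<lambda>x. A *v x) s) x \<kappa>"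
    and w: "weak_solution s {x. qf (\<lambda>x. A *v x) x < 1} (\<lambda>_. \<kappa>) (power_profile (\<lambda>x. A *v x) s)"
    using torsion_function[OF assms(2)] by (elim exE conjE)
  show ?thesis unfolding E u
  proof (intro exI[of _ \<kappa>] conjI ballI allI impI w \<kappa>(1))
    show "has_frac_laplacian s (power_profile (\<lambda>x. A *v x) s) x \<kappa>" if "x \<in> {x. qf (\<lambda>x. A *v x) x < 1}" for x
      using \<kappa>(2) that by simp
    show "AE x in lebesgue. v x = power_profile (\<lambda>x. A *v x) s x" if "weak_solution s {x. qf (\<lambda>x. A *v x) x < 1} (\<lambda>_. \<kappa>) v" for v
      by (rule weak_solution_unique[OF sublevel_domain assms(2) w that])
  qed
qed

end
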